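(* Let $d\ge1$, $g=(g^i)_{i=1,\dots,d}\in(\mathcal C([0,\infty)\times\mathbb T^d))^d$, $u_0\in\mathcal C^2(\mathbb T^d)$; let $(u_t^\varepsilon)_{t\ge0}$ be the averaging process on $\mathbb T_\varepsilon^d$ started from $u_0^\varepsilon=u_0|_{\mathbb T_\varepsilon^d}$ and $(u_t)_{t\ge0}$ the solution to $\partial_tu=\frac12\Delta u$ on $\mathbb T^d$ started from $u_0$. Set $$\varGamma_t^\varepsilon(g)=\sum_{i=1}^d\int_0^t\varepsilon^d\sum_{x\in\mathbb T_\varepsilon^d}\big(\nabla^{\varepsilon,i}u_s^\varepsilon(x)\big)^2g_s^i(x)\,\mathrm ds,$$ $$\varGamma_t(g)=\sum_{i,j=1}^d\Big((1+\mathfrak a)\mathbf 1_{i=j}+\frac{1-\mathfrak a}{d-1}\mathbf 1_{i\neq j}\Big)\int_0^t\int_{\mathbb T^d}\big(\nabla^ju_s(x)\big)^2g_s^i(x)\,\mathrm dx\,\mathrm ds,$$ with $\mathfrak a=\mathfrak a(d)\in(0,1]$ the constant given in the context. Then, for all $t>0$, $$\mathbb E[\varGamma_t^\varepsilon(g)]\xrightarrow{\varepsilon\to0}\varGamma_t(g).$$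
   Context: Torus and process. $\mathbb T^d=(\mathbb R/\mathbb Z)^d$; $\varepsilon\in(0,1)$ with $\varepsilon^{-1}\in\mathbb N$; $\mathbb T_\varepsilon^d=(\varepsilon\mathbb Z/\mathbb Z)^d\subset\mathbb T^d$ is the lattice discretization with mesh $\varepsilon$; $e_1,\dots,e_d$ is the canonical basis. Let $(N_t^{\varepsilon,i}(x))_{t\ge0}$, $x\in\mathbb T_\varepsilon^d$, $i=1,\dots,d$, be i.i.d. Poisson processes of intensity $\varepsilon^{-2}$, with expectation $\mathbb E$. The averaging process $(u_t^\varepsilon)_{t\ge0}\subset\mathbb R^{\mathbb T_\varepsilon^d}$ started from a deterministic $u_0^\varepsilon$ is the càdlàg process which, at each arrival time $t$ of $N^{\varepsilon,i}(x)$, replaces both $u_{t^-}^\varepsilon(x)$ and $u_{t^-}^\varepsilon(x+\varepsilon e_i)$ with $\tfrac12(u_{t^-}^\varepsilon(x)+u_{t^-}^\varepsilon(x+\varepsilon e_i))$, leaves the other values unchanged, and is constant between arrivals. Discrete gradients: $\nabla^{\varepsilon,i}h(x)=\varepsilon^{-1}(h(x+\varepsilon e_i)-h(x))$; $\nabla^j$ is the $j$-th partial derivative on $\mathbb T^d$; $g_s^i(x)=g^i(s,x)$. The constant $\mathfrak a$. $\mathfrak a(1)=1$, and for $d\ge2$ $$\mathfrak a(d)=\frac{1-(d-2)J_d}{1+d\,J_d},\qquad J_d=\int_{\mathbb T^d}\frac{\psi(x^1)\psi(x^2)}{\psi(x^1)+\dots+\psi(x^d)}\,\mathrm dx,\qquad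 \psi(z)=1-\cos(2\pi z).$$ When $d=1$, the term with $\mathbf 1_{i\ne j}$ is absent. *)

theory Defs
  imports "HOL-Probability.Probability"
begin

text \<open>
  Functions on the torus \<open>(\<real>/\<int>)\<^sup>d\<close> are \<open>\<int>\<^sup>d\<close>-periodic functions on \<open>real ^ 'd\<close>, with \<open>d = CARD('d)\<close>;
  points of the torus are represented in the half-open unit cube.
\<close>

definition torus_fun :: "(real ^ 'd::finite \<Rightarrow> real) \<Rightarrow> bool" where
  "torus_fun f \<longleftrightarrow> (\<forall>x i. f (x + axis i 1) = f x)"

definition torus_cell :: "(real ^ 'd::finite) set" where
  "torus_cell = {x. \<forall>i. 0 \<le> x $ i \<and> x $ i < 1}"

definition mesh_sizes :: "real set" where
  "mesh_sizes = {\<epsilon>. 0 < \<epsilon> \<and> \<epsilon> < 1 \<and> 1 / \<epsilon> \<in> \<nat>}"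

definition torus_lattice :: "real \<Rightarrow> (real ^ 'd::finite) set" where
  "torus_lattice \<epsilon> = {x \<in> torus_cell. \<forall>i. \<exists>k::int. x $ i = \<epsilon> * of_int k}"

text \<open>The neighbour \<open>x + \<epsilon> e\<^sub>i\<close>, computed modulo \<open>\<int>\<^sup>d\<close>.\<close>

definition torus_shift :: "real \<Rightarrow> 'd::finite \<Rightarrow> real ^ 'd \<Rightarrow> real ^ 'd" where
  "torus_shift \<epsilon> i x = (\<chi> j. frac ((x + \<epsilon> *\<^sub>R axis i 1) $ j))"

definition disc_grad :: "real \<Rightarrow> 'd::finite \<Rightarrow> (real ^ 'd \<Rightarrow> real) \<Rightarrow> real ^ 'd \<Rightarrow> real" where
  "disc_grad \<epsilon> i h x = (h (torus_shift \<epsilon> i x) - h x) / \<epsilon>"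

definition partial_deriv :: "'d::finite \<Rightarrow> (real ^ 'd \<Rightarrow> real) \<Rightarrow> real ^ 'd \<Rightarrow> real" where
  "partial_deriv j f x = deriv (\<lambda>s. f (x + s *\<^sub>R axis j 1)) 0"

definition C1_fun :: "(real ^ 'd::finite \<Rightarrow> real) \<Rightarrow> bool" where
  "C1_fun f \<longleftrightarrow> (\<forall>x. f differentiable (at x)) \<and> (\<forall>j. continuous_on UNIV (partial_deriv j f))"

definition C2_fun :: "(real ^ 'd::finite \<Rightarrow> real) \<Rightarrow> bool" where
  "C2_fun f \<longleftrightarrow> C1_fun f \<and> (\<forall>j. C1_fun (partial_deriv j f))"

definition laplacian :: "(real ^ 'd::finite \<Rightarrow> real) \<Rightarrow> real ^ 'd \<Rightarrow> real" where
  "laplacian f x = (\<Sum>j\<in>UNIV. partial_deriv j (partial_deriv j f) x)"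

definition heat_solution :: "(real ^ 'd::finite \<Rightarrow> real) \<Rightarrow> (real \<Rightarrow> real ^ 'd \<Rightarrow> real) \<Rightarrow> bool" where
  "heat_solution u0 u \<longleftrightarrow>
     (\<forall>t\<ge>0. torus_fun (u t)) \<and>
     continuous_on ({0..} \<times> UNIV) (\<lambda>(t, x). u t x) \<and>
     (\<forall>x. u 0 x = u0 x) \<and>
     (\<forall>t>0. C2_fun (u t)) \<and>
     (\<forall>t>0. \<forall>x. ((\<lambda>s. u s x) has_real_derivative (1/2) * laplacian (u t) x) (at t))"

definition poisson_process :: "'w measure \<Rightarrow> real \<Rightarrow> (real \<Rightarrow> 'w \<Rightarrow> nat) \<Rightarrow> bool" where
  "poisson_process M r N \<longleftrightarrow>
     (\<forall>t\<ge>0. N t \<in> measurable M (count_space UNIV)) \<and>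
     (\<forall>\<omega>\<in>space M. N 0 \<omega> = 0 \<and> mono_on {0..} (\<lambda>t. N t \<omega>) \<and>
        (\<forall>t\<ge>0. ((\<lambda>s. N s \<omega>) \<longlongrightarrow> N t \<omega>) (at_right t))) \<and>
     (\<forall>s t. 0 \<le> s \<and> s < t \<longrightarrow>
        distr M (count_space UNIV) (\<lambda>\<omega>. N t \<omega> - N s \<omega>) = measure_pmf (poisson_pmf (r * (t - s)))) \<and>
     (\<forall>(\<tau> :: nat \<Rightarrow> real) n. 0 \<le> \<tau> 0 \<and> (\<forall>k<n. \<tau> k \<le> \<tau> (Suc k)) \<longrightarrow>
        prob_space.indep_vars M (\<lambda>_. count_space UNIV)
          (\<lambda>k \<omega>. N (\<tau> (Suc k)) \<omega> - N (\<tau> k) \<omega>) {..<n})"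

definition iid_poisson_clocks ::
    "'w measure \<Rightarrow> real \<Rightarrow> ('d::finite \<Rightarrow> real ^ 'd \<Rightarrow> real \<Rightarrow> 'w \<Rightarrow> nat) \<Rightarrow> bool" where
  "iid_poisson_clocks M \<epsilon> N \<longleftrightarrow>
     (\<forall>i. \<forall>x\<in>torus_lattice \<epsilon>. poisson_process M (1 / \<epsilon>\<^sup>2) (N i x)) \<and>
     prob_space.indep_vars M (\<lambda>_. Pi\<^sub>M {0..} (\<lambda>_. count_space UNIV))
       (\<lambda>(i, x) \<omega>. \<lambda>t\<in>{0..}. N i x t \<omega>) (UNIV \<times> torus_lattice \<epsilon>)"

text \<open>Jump times of a counting path, i.e. of a nondecreasing \<open>n\<close>.\<close>

definition arrival :: "(real \<Rightarrow> nat) \<Rightarrow> real \<Rightarrow> bool" where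
  "arrival n t \<longleftrightarrow> 0 < t \<and> (\<forall>s. 0 \<le> s \<and> s < t \<longrightarrow> n s < n t)"

definition cadlag :: "(real \<Rightarrow> real) \<Rightarrow> bool" where
  "cadlag f \<longleftrightarrow> (\<forall>t\<ge>0. (f \<longlongrightarrow> f t) (at_right t)) \<and> (\<forall>t>0. \<exists>l. (f \<longlongrightarrow> l) (at_left t))"

definition left_lim :: "(real \<Rightarrow> real) \<Rightarrow> real \<Rightarrow> real" where
  "left_lim f t = Lim (at_left t) f"

definition averaging_path ::
    "real \<Rightarrow> ('d::finite \<Rightarrow> real ^ 'd \<Rightarrow> real \<Rightarrow> nat) \<Rightarrow> (real ^ 'd \<Rightarrow> real)
      \<Rightarrow> (real \<Rightarrow> real ^ 'd \<Rightarrow> real) \<Rightarrow> bool" where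
  "averaging_path \<epsilon> n u0 u \<longleftrightarrow>
     (\<forall>y\<in>torus_lattice \<epsilon>. u 0 y = u0 y) \<and>
     (\<forall>i. \<forall>x\<in>torus_lattice \<epsilon>. \<forall>t. arrival (n i x) t \<longrightarrow>
        (\<forall>y\<in>torus_lattice \<epsilon>. u t y =
           (if y = x \<or> y = torus_shift \<epsilon> i x
            then (left_lim (\<lambda>s. u s x) t + left_lim (\<lambda>s. u s (torus_shift \<epsilon> i x)) t) / 2
            else left_lim (\<lambda>s. u s y) t))) \<and>
     (\<forall>s t. 0 \<le> s \<and> s \<le> t \<and> (\<forall>r\<in>{s<..t}. \<forall>i. \<forall>x\<in>torus_lattice \<epsilon>. \<not> arrival (n i x) r) \<longrightarrow>
        (\<forall>y\<in>torus_lattice \<epsilon>. u t y = u s y))"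

text \<open>
  The update rule is imposed almost surely only: it is contradictory on the null event that two
  distinct clocks ring simultaneously. Regularity of the paths is imposed surely, so that time
  integrals along the paths are random variables even if the measure is not complete.
\<close>

definition averaging_process ::
    "'w measure \<Rightarrow> real \<Rightarrow> ('d::finite \<Rightarrow> real ^ 'd \<Rightarrow> real \<Rightarrow> 'w \<Rightarrow> nat) \<Rightarrow> (real ^ 'd \<Rightarrow> real)
      \<Rightarrow> (real \<Rightarrow> real ^ 'd \<Rightarrow> 'w \<Rightarrow> real) \<Rightarrow> bool" where
  "averaging_process M \<epsilon> N u0 U \<longleftrightarrow>
     (\<forall>t\<ge>0. \<forall>x\<in>torus_lattice \<epsilon>. U t x \<in> borel_measurable M) \<and>
     (\<forall>\<omega>\<in>space M. \<forall>x\<in>torus_lattice \<epsilon>. cadlag (\<lambda>t. U t x \<omega>)) \<and>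
     (AE \<omega> in M. averaging_path \<epsilon> (\<lambda>i x t. N i x t \<omega>) u0 (\<lambda>t x. U t x \<omega>))"

definition psi :: "real \<Rightarrow> real" where
  "psi z = 1 - cos (2 * pi * z)"

definition J_const :: "nat \<Rightarrow> real" where
  "J_const d = (LINT x:(\<Pi>\<^sub>E k\<in>{1..d}. {0..<1})|(\<Pi>\<^sub>M k\<in>{1..d}. lborel).
                  psi (x 1) * psi (x 2) / (\<Sum>k=1..d. psi (x k)))"

definition a_const :: "nat \<Rightarrow> real" where
  "a_const d = (if d = 1 then 1
                else (1 - (real d - 2) * J_const d) / (1 + real d * J_const d))"

definition Gamma_eps ::
    "real \<Rightarrow> ('d::finite \<Rightarrow> real \<Rightarrow> real ^ 'd \<Rightarrow> real) \<Rightarrow> (real \<Rightarrow> real ^ 'd \<Rightarrow> real) \<Rightarrow> real \<Rightarrow> real" where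
  "Gamma_eps \<epsilon> g u t =
     (\<Sum>i\<in>UNIV. LINT s:{0..t}|lborel.
        \<epsilon> ^ CARD('d) * (\<Sum>x\<in>torus_lattice \<epsilon>. (disc_grad \<epsilon> i (u s) x)\<^sup>2 * g i s x))"

definition Gamma_lim ::
    "('d::finite \<Rightarrow> real \<Rightarrow> real ^ 'd \<Rightarrow> real) \<Rightarrow> (real \<Rightarrow> real ^ 'd \<Rightarrow> real) \<Rightarrow> real \<Rightarrow> real" where
  "Gamma_lim g u t =
     (\<Sum>i\<in>UNIV. \<Sum>j\<in>UNIV.
        (if i = j then 1 + a_const CARD('d)
         else (1 - a_const CARD('d)) / (real CARD('d) - 1)) *
        (LINT s:{0..t}|lborel. LINT x:torus_cell|lborel. (partial_deriv j (u s) x)\<^sup>2 * g i s x))"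

end

theory Submission
  imports Defs
begin

text \<open>
  Write \<open>n = 1 / \<epsilon>\<close>. Averaging along an edge is linear, so the second moments
  \<open>E[u(x) u(y)]\<close> solve a closed linear system: it is the generator of two independent walks
  except for a defect supported where the two points share an edge. Duhamel's formula relative to
  the independent walks turns this defect into a renewal equation for the edge energies
  \<open>D\<^sub>i(t, x) = E[(\<nabla>\<^sub>i u(x))\<^sup>2]\<close>,
  \<open>D\<^sub>i(t, x) = (\<nabla>\<^sub>i S\<^sub>t u\<^sub>0(x))\<^sup>2 + \<Sum>\<^sub>j\<^sub>,\<^sub>z \<integral>\<^sub>0\<^sup>t K\<^sub>i\<^sub>j(x, z, t - s) D\<^sub>j(s, z) ds\<close>,
  with a nonnegative kernel \<open>K\<close> of total mass at most \<open>1/2\<close>. In Fourier variables the mass of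
  \<open>K\<^sub>i\<^sub>j\<close> is half the lattice mean of \<open>\<psi>\<^sub>i \<psi>\<^sub>j / (\<psi>\<^sub>1 + \<dots> + \<psi>\<^sub>d)\<close>, which tends to the integral
  defining \<open>J_const\<close> if \<open>i \<noteq> j\<close>, and it concentrates at \<open>(t, x)\<close> on the scale \<open>1 / n\<close>. Hence the
  energies converge to the solution of the local equation
  \<open>D\<^sub>i = (\<nabla>\<^sub>i u)\<^sup>2 + (1/2) \<Sum>\<^sub>j J\<^sub>i\<^sub>j D\<^sub>j\<close>, uniformly for \<open>t\<close> away from \<open>0\<close>: the mass bound makes the
  error contract by the factor \<open>1/2\<close>. Inverting \<open>1 - J/2\<close> produces the coefficients of the limit.
\<close>

section \<open>Exponentials of matrices over finite index sets\<close>

text \<open>The obstacle is that the process converges to \<open>u\<close> while its energies do not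
  converge to those of \<open>u\<close>: microscopic fluctuations keep squared gradients of order
  one and feed back through the kernel. In each row the limit coefficients add up to 2, so this is
  no small correction. Averaging along an edge removes half of the gradient \<open>g\<close> there,
  turning f into f - (g/2) \<zeta> with \<zeta> the dipole of the edge. In the tensor square the
  linear terms give the independent walks and the quadratic term g^2/4 gives the defect; this is why
  the kernel is a square and hence nonnegative. Its mass is 1/2 because the ratios \<psi>_i \<psi>_j
  / (\<psi>_1 + ... + \<psi>_d) sum over j to \<psi>_i, whose lattice mean is 1. At time zero the
  fluctuations have not yet built up, so every contraction step gives up half of the initial time; a
  given accuracy takes finitely many steps. The gradient of \<open>u\<close> is needed up to time
  zero, where a solution is only known to be continuous. The maximum principle is therefore applied
  to increments of \<open>u\<close>, compared with line integrals of trigonometric heat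
  flows.\<close>

definition mat_app :: "'a set \<Rightarrow> ('a \<Rightarrow> 'a \<Rightarrow> real) \<Rightarrow> ('a \<Rightarrow> real) \<Rightarrow> 'a \<Rightarrow> real" where
  "mat_app S a f x = (\<Sum>y\<in>S. a x y * f y)"

text \<open>An operator on functions over a finite set, since the lattices and their squares are
  sets that vary with \<open>n\<close>. At points of \<open>S\<close> only values on
  \<open>S\<close> enter, so functions may be arbitrary elsewhere.\<close>

definition mat_exp :: "'a set \<Rightarrow> ('a \<Rightarrow> 'a \<Rightarrow> real) \<Rightarrow> real \<Rightarrow> ('a \<Rightarrow> real) \<Rightarrow> 'a \<Rightarrow> real" where
  "mat_exp S a t f x = (\<Sum>k. (mat_app S a ^^ k) f x / fact k * t ^ k)"

text \<open>The sum of all entries dominates every absolute row sum, hence the operator norm for the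
  supremum. It grows with \<open>n\<close>, but is only used at fixed \<open>n\<close>.\<close>

definition mat_bound :: "'a set \<Rightarrow> ('a \<Rightarrow> 'a \<Rightarrow> real) \<Rightarrow> real" where
  "mat_bound S a = (\<Sum>x\<in>S. \<Sum>y\<in>S. \<bar>a x y\<bar>)"

lemma mat_app_cong: "(\<And>y. y \<in> S \<Longrightarrow> f y = g y) \<Longrightarrow> mat_app S a f x = mat_app S a g x"
  unfolding mat_app_def by (auto intro: sum.cong)

lemma mat_bound_nonneg: "0 \<le> mat_bound S a"
  unfolding mat_bound_def by (intro sum_nonneg) auto

lemma mat_app_diff: "mat_app S a f x - mat_app S a g x = mat_app S a (\<lambda>y. f y - g y) x"
  unfolding mat_app_def by (simp add: sum_subtractf[symmetric] algebra_simps)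

lemma mat_app_bound:
  assumes "finite S" "x \<in> S" "\<And>y. y \<in> S \<Longrightarrow> \<bar>f y\<bar> \<le> B"
  shows "\<bar>mat_app S a f x\<bar> \<le> mat_bound S a * B"
proof -
  have B: "0 \<le> B" using assms(2,3) by fastforce
  have "\<bar>mat_app S a f x\<bar> \<le> (\<Sum>y\<in>S. \<bar>a x y\<bar> * B)"
    unfolding mat_app_def
    by (rule order_trans[OF sum_abs]) (intro sum_mono, simp add: abs_mult mult_left_mono assms(3))
  also have "\<dots> = (\<Sum>y\<in>S. \<bar>a x y\<bar>) * B" by (simp add: sum_distrib_right)
  also have "(\<Sum>y\<in>S. \<bar>a x y\<bar>) \<le> mat_bound S a"
    unfolding mat_bound_def
    using assms(1,2) by (intro member_le_sum[where f="\<lambda>x. \<Sum>y\<in>S. \<bar>a x y\<bar>"]) (auto intro!: sum_nonneg)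
  finally show ?thesis using B by (simp add: mult_right_mono)
qed

lemma mat_pow_bound:
  assumes "finite S" "x \<in> S" "\<And>y. y \<in> S \<Longrightarrow> \<bar>f y\<bar> \<le> B"
  shows "\<bar>(mat_app S a ^^ k) f x\<bar> \<le> mat_bound S a ^ k * B"
  using assms(2)
proof (induction k arbitrary: x)
  case 0 then show ?case using assms by simp
next
  case (Suc k)
  have "\<bar>mat_app S a ((mat_app S a ^^ k) f) x\<bar> \<le> mat_bound S a * (mat_bound S a ^ k * B)"
    by (rule mat_app_bound) (use Suc assms in auto)
  then show ?case by simp
qed

lemma finite_bounded_abs:
  assumes "finite S" obtains B :: real where "0 \<le> B" "\<And>y. y \<in> S \<Longrightarrow> \<bar>f y\<bar> \<le> B"
proof
  show "0 \<le> (\<Sum>y\<in>S. \<bar>f y\<bar>)" by (intro sum_nonneg) auto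
  show "\<bar>f y\<bar> \<le> (\<Sum>y\<in>S. \<bar>f y\<bar>)" if "y \<in> S" for y
    by (rule member_le_sum[where f="\<lambda>y. \<bar>f y\<bar>"]) (use that assms in auto)
qed

lemma mat_exp_summable_norm:
  assumes "finite S" "x \<in> S"
  shows "summable (\<lambda>k. \<bar>(mat_app S a ^^ k) f x / fact k * t ^ k\<bar>)"
proof -
  obtain B where B: "0 \<le> B" "\<And>y. y \<in> S \<Longrightarrow> \<bar>f y\<bar> \<le> B" using finite_bounded_abs[OF assms(1), of f] by metis
  have "summable (\<lambda>k. B * (inverse (fact k) * (mat_bound S a * \<bar>t\<bar>) ^ k))"
    by (intro summable_mult summable_exp)
  moreover have "norm \<bar>(mat_app S a ^^ k) f x / fact k * t ^ k\<bar> \<le> B * (inverse (fact k) * (mat_bound S a * \<bar>t\<bar>) ^ k)" for k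
  proof -
    have "\<bar>(mat_app S a ^^ k) f x\<bar> * (\<bar>t\<bar> ^ k * inverse (fact k)) \<le> mat_bound S a ^ k * B * (\<bar>t\<bar> ^ k * inverse (fact k))"
      by (rule mult_right_mono[OF mat_pow_bound[OF assms(1,2) B(2)]]) auto
    then show ?thesis by (simp add: abs_mult power_mult_distrib power_abs field_simps)
  qed
  ultimately show ?thesis by (rule summable_comparison_test'[where N=0])
qed

lemma mat_exp_summable:
  assumes "finite S" "x \<in> S"
  shows "summable (\<lambda>k. (mat_app S a ^^ k) f x / fact k * t ^ k)"
  using summable_rabs_cancel[OF mat_exp_summable_norm[OF assms]] .

text \<open>Differentiation shifts the power series by one matrix factor; that factor is a finite
  sum and can be pulled out of the series.\<close>

lemma mat_exp_has_derivative:
  assumes S: "finite S" "x \<in> S"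
  shows "((\<lambda>t. mat_exp S a t f x) has_real_derivative mat_app S a (mat_exp S a t f) x) (at t)"
proof -
  define c where "c x k = (mat_app S a ^^ k) f x / fact k" for x k
  have sm: "summable (\<lambda>k. c y k * t ^ k)" if "y \<in> S" for y t
    unfolding c_def by (rule mat_exp_summable[OF S(1) that])
  have "((\<lambda>t. \<Sum>k. c x k * t ^ k) has_real_derivative (\<Sum>k. diffs (c x) k * t ^ k)) (at t)"
    by (rule termdiffs_strong_converges_everywhere) (rule sm[OF S(2)])
  moreover have "(\<Sum>k. diffs (c x) k * t ^ k) = mat_app S a (mat_exp S a t f) x"
  proof -
    have "diffs (c x) k * t ^ k = (\<Sum>y\<in>S. a x y * (c y k * t ^ k))" for k
    proof -
      have "diffs (c x) k * t ^ k = mat_app S a ((mat_app S a ^^ k) f) x / fact k * t ^ k"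
        unfolding diffs_def c_def by (simp del: of_nat_Suc)
      then show ?thesis unfolding c_def
        by (simp add: mat_app_def[of S a "(mat_app S a ^^ k) f"] sum_distrib_left sum_distrib_right sum_divide_distrib algebra_simps)
    qed
    then have "(\<Sum>k. diffs (c x) k * t ^ k) = (\<Sum>k. \<Sum>y\<in>S. a x y * (c y k * t ^ k))" by simp
    also have "\<dots> = (\<Sum>y\<in>S. \<Sum>k. a x y * (c y k * t ^ k))"
      by (rule suminf_sum) (intro summable_mult sm)
    also have "\<dots> = (\<Sum>y\<in>S. a x y * (\<Sum>k. c y k * t ^ k))"
      by (intro sum.cong refl suminf_mult sm)
    finally show ?thesis unfolding mat_app_def mat_exp_def c_def .
  qed
  ultimately show ?thesis unfolding mat_exp_def c_def by simp
qed

lemma mat_exp_0 [simp]: "mat_exp S a 0 f x = f x"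
  unfolding mat_exp_def using powser_zero[of "\<lambda>k. (mat_app S a ^^ k) f x / fact k"] by simp

lemma mat_exp_continuous: "finite S \<Longrightarrow> x \<in> S \<Longrightarrow> continuous_on T (\<lambda>t. mat_exp S a t f x)"
  by (intro continuous_at_imp_continuous_on ballI DERIV_isCont[OF mat_exp_has_derivative])

lemma mat_exp_eigen:
  assumes "\<And>x. x \<in> S \<Longrightarrow> mat_app S a f x = \<mu> * f x" "x \<in> S"
  shows "mat_exp S a t f x = exp (\<mu> * t) * f x"
proof -
  have p: "(mat_app S a ^^ k) f y = \<mu> ^ k * f y" if "y \<in> S" for k y
    using that
  proof (induction k arbitrary: y)
    case (Suc k)
    have "mat_app S a ((mat_app S a ^^ k) f) y = mat_app S a (\<lambda>y. \<mu> ^ k * f y) y"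
      by (rule mat_app_cong) (use Suc in auto)
    also have "\<dots> = \<mu> ^ k * mat_app S a f y" unfolding mat_app_def by (simp add: sum_distrib_left algebra_simps)
    finally show ?case using assms(1) Suc.prems by simp
  qed simp
  have "(\<lambda>k. (\<mu> * t) ^ k /\<^sub>R fact k * f x) sums (exp (\<mu> * t) * f x)"
    by (intro sums_mult2 exp_converges)
  then have "(\<lambda>k. (mat_app S a ^^ k) f x / fact k * t ^ k) sums (exp (\<mu> * t) * f x)"
    by (simp add: p[OF assms(2)] power_mult_distrib divide_inverse algebra_simps)
  then show ?thesis unfolding mat_exp_def by (simp add: sums_iff)
qed

lemma mat_pow_sum:
  assumes "finite I" 
  shows "(mat_app S a ^^ k) (\<lambda>y. \<Sum>i\<in>I. c i * f i y) x = (\<Sum>i\<in>I. c i * (mat_app S a ^^ k) (f i) x)"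
proof (induction k arbitrary: x)
  case (Suc k)
  have "(mat_app S a ^^ Suc k) (\<lambda>y. \<Sum>i\<in>I. c i * f i y) x = mat_app S a (\<lambda>x. \<Sum>i\<in>I. c i * (mat_app S a ^^ k) (f i) x) x"
    by (simp add: Suc[abs_def])
  also have "\<dots> = (\<Sum>i\<in>I. c i * mat_app S a ((mat_app S a ^^ k) (f i)) x)"
    unfolding mat_app_def sum_distrib_left by (subst sum.swap) (simp add: algebra_simps)
  finally show ?case by simp
qed simp

lemma mat_exp_sum:
  assumes "finite S" "x \<in> S" "finite I"
  shows "mat_exp S a t (\<lambda>y. \<Sum>i\<in>I. c i * f i y) x = (\<Sum>i\<in>I. c i * mat_exp S a t (f i) x)"
proof -
  have "mat_exp S a t (\<lambda>y. \<Sum>i\<in>I. c i * f i y) x = (\<Sum>k. \<Sum>i\<in>I. c i * ((mat_app S a ^^ k) (f i) x / fact k * t ^ k))"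
    unfolding mat_exp_def mat_pow_sum[OF assms(3)]
    by (simp add: sum_distrib_left sum_distrib_right sum_divide_distrib algebra_simps)
  also have "\<dots> = (\<Sum>i\<in>I. \<Sum>k. c i * ((mat_app S a ^^ k) (f i) x / fact k * t ^ k))"
    by (rule suminf_sum) (intro summable_mult mat_exp_summable assms)
  also have "\<dots> = (\<Sum>i\<in>I. c i * mat_exp S a t (f i) x)"
    unfolding mat_exp_def by (intro sum.cong refl suminf_mult mat_exp_summable assms)
  finally show ?thesis .
qed

lemma mat_exp_diff:
  assumes "finite S" "x \<in> S"
  shows "mat_exp S a t (\<lambda>y. f y - g y) x = mat_exp S a t f x - mat_exp S a t g x"
  using mat_exp_sum[OF assms, of "UNIV::bool set" a t "\<lambda>b. if b then 1 else -1" "\<lambda>b. if b then f else g"]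
  by (simp add: UNIV_bool)

lemma mat_exp_cong:
  assumes "\<And>y. y \<in> S \<Longrightarrow> f y = g y" "x \<in> S"
  shows "mat_exp S a t f x = mat_exp S a t g x"
proof -
  have "(mat_app S a ^^ k) f y = (mat_app S a ^^ k) g y" if "y \<in> S" for k y
    using that
  proof (induction k arbitrary: y)
    case (Suc k) then show ?case by (auto intro: mat_app_cong)
  qed (use assms in auto)
  then show ?thesis unfolding mat_exp_def using assms(2) by simp
qed

text \<open>A permutation of the indices that preserves the matrix commutes with all its powers. The
  application is to lattice translations.\<close>

lemma mat_exp_comp:
  assumes \<sigma>: "bij_betw \<sigma> S S" and a: "\<And>x y. x \<in> S \<Longrightarrow> y \<in> S \<Longrightarrow> a (\<sigma> x) (\<sigma> y) = a x y" and x: "x \<in> S"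
  shows "mat_exp S a t (\<lambda>x. f (\<sigma> x)) x = mat_exp S a t f (\<sigma> x)"
proof -
  have "(mat_app S a ^^ k) (\<lambda>x. f (\<sigma> x)) y = (mat_app S a ^^ k) f (\<sigma> y)" if "y \<in> S" for k y
    using that
  proof (induction k arbitrary: y)
    case (Suc k)
    have "(mat_app S a ^^ Suc k) f (\<sigma> y) = (\<Sum>z\<in>S. a (\<sigma> y) z * (mat_app S a ^^ k) f z)"
      by (simp add: mat_app_def[of S a "(mat_app S a ^^ k) f"])
    also have "\<dots> = (\<Sum>z\<in>S. a (\<sigma> y) (\<sigma> z) * (mat_app S a ^^ k) f (\<sigma> z))"
      by (subst sum.reindex_bij_betw[OF \<sigma>, symmetric]) (rule refl)
    also have "\<dots> = (\<Sum>z\<in>S. a y z * (mat_app S a ^^ k) (\<lambda>x. f (\<sigma> x)) z)"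
      by (intro sum.cong refl) (simp add: Suc a)
    also have "\<dots> = (mat_app S a ^^ Suc k) (\<lambda>x. f (\<sigma> x)) y"
      by (simp add: mat_app_def[of S a "(mat_app S a ^^ k) (\<lambda>x. f (\<sigma> x))"])
    finally show ?case by simp
  qed simp
  then show ?thesis unfolding mat_exp_def using x by simp
qed

text \<open>Self-adjointness and the semigroup law in one statement: the pairing of the exponentials
  at times q and s + r - q has zero derivative in q, so its values at q = s and q = 0 agree.\<close>

lemma mat_exp_symmetric:
  assumes S: "finite S" and a: "\<And>x y. x \<in> S \<Longrightarrow> y \<in> S \<Longrightarrow> a x y = a y x"
  shows "(\<Sum>x\<in>S. mat_exp S a s f x * mat_exp S a r g x) = (\<Sum>x\<in>S. f x * mat_exp S a (s + r) g x)"
proof -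
  define h where "h q = (\<Sum>x\<in>S. mat_exp S a q f x * mat_exp S a (s + r - q) g x)" for q
  have "(h has_real_derivative 0) (at q)" for q
  proof -
    let ?F = "mat_exp S a q f" and ?G = "mat_exp S a (s + r - q) g"
    have G: "((\<lambda>q. mat_exp S a (s + r - q) g x) has_real_derivative - mat_app S a ?G x) (at q)" if "x \<in> S" for x
    proof -
      have "((\<lambda>q. s + r - q) has_real_derivative -1) (at q)" by (auto intro!: derivative_eq_intros)
      from DERIV_chain2[where f="\<lambda>t. mat_exp S a t g x" and g="\<lambda>q. s + r - q", OF mat_exp_has_derivative[OF S that] this]
      show ?thesis by simp
    qed
    have "(h has_real_derivative (\<Sum>x\<in>S. mat_app S a ?F x * ?G x + (- mat_app S a ?G x) * ?F x)) (at q)"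
      unfolding h_def by (intro derivative_intros DERIV_mult mat_exp_has_derivative S G)
    moreover have "(\<Sum>x\<in>S. mat_app S a ?F x * ?G x) = (\<Sum>x\<in>S. mat_app S a ?G x * ?F x)"
    proof -
      have "(\<Sum>x\<in>S. mat_app S a ?F x * ?G x) = (\<Sum>x\<in>S. \<Sum>y\<in>S. a x y * ?F y * ?G x)"
        by (simp add: mat_app_def sum_distrib_right)
      also have "\<dots> = (\<Sum>y\<in>S. \<Sum>x\<in>S. a y x * ?G x * ?F y)"
        by (subst sum.swap) (intro sum.cong refl, simp add: a algebra_simps)
      finally show ?thesis by (simp add: mat_app_def sum_distrib_right)
    qed
    ultimately show ?thesis by (simp add: sum.distrib sum_negf sum_subtractf)
  qed
  then have "h s = h 0" using DERIV_isconst_all by metis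
  then show ?thesis by (simp add: h_def)
qed

lemma mat_exp_growth:
  assumes S: "finite S" "x \<in> S" and B: "\<And>y. y \<in> S \<Longrightarrow> \<bar>f y\<bar> \<le> B" and t: "0 \<le> t"
  shows "\<bar>mat_exp S a t f x\<bar> \<le> B * exp (mat_bound S a * t)"
proof -
  have le: "\<bar>(mat_app S a ^^ k) f x / fact k * t ^ k\<bar> \<le> B * ((mat_bound S a * t) ^ k /\<^sub>R fact k)" for k
  proof -
    have "\<bar>(mat_app S a ^^ k) f x\<bar> * (t ^ k * inverse (fact k)) \<le> mat_bound S a ^ k * B * (t ^ k * inverse (fact k))"
      by (rule mult_right_mono[OF mat_pow_bound[OF S B]]) (use t in auto)
    then show ?thesis using t by (simp add: abs_mult power_mult_distrib power_abs field_simps)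
  qed
  have "\<bar>mat_exp S a t f x\<bar> \<le> (\<Sum>k. B * ((mat_bound S a * t) ^ k /\<^sub>R fact k))"
    unfolding mat_exp_def
    by (rule order_trans[OF summable_rabs[OF mat_exp_summable_norm[OF S]] suminf_le[OF le mat_exp_summable_norm[OF S]]])
      (rule summable_mult[OF summable_exp_generic])
  also have "\<dots> = B * exp (mat_bound S a * t)"
    by (subst suminf_mult[OF summable_exp_generic]) (simp add: exp_def)
  finally show ?thesis .
qed

text \<open>Consistency of the scheme together with its stability in the sup norm.\<close>

lemma euler_tendsto_mat_exp:
  fixes T :: "real \<Rightarrow> ('a \<Rightarrow> real) \<Rightarrow> 'a \<Rightarrow> real"
  assumes S: "finite S"
    and contr: "\<And>h f g B. 0 < h \<Longrightarrow> h < \<eta> \<Longrightarrow> (\<And>x. x \<in> S \<Longrightarrow> \<bar>f x - g x\<bar> \<le> B) \<Longrightarrow> (\<And>x. x \<in> S \<Longrightarrow> \<bar>T h f x - T h g x\<bar> \<le> B)"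
    and cons: "\<And>h f B x. 0 < h \<Longrightarrow> h < \<eta> \<Longrightarrow> (\<And>x. x \<in> S \<Longrightarrow> \<bar>f x\<bar> \<le> B) \<Longrightarrow> x \<in> S \<Longrightarrow> \<bar>T h f x - f x - h * mat_app S a f x\<bar> \<le> c * h\<^sup>2 * B"
    and \<eta>: "0 < \<eta>" and t: "0 < t" and x: "x \<in> S"
  shows "(\<lambda>m. (T (t / real m) ^^ m) f x) \<longlonglongrightarrow> mat_exp S a t f x"
proof -
  obtain B0 where B0: "0 \<le> B0" "\<And>y. y \<in> S \<Longrightarrow> \<bar>f y\<bar> \<le> B0" using finite_bounded_abs[OF S, of f] by metis
  define C where "C = mat_bound S a"
  define B where "B = B0 * exp (C * t)"
  have C: "0 \<le> C" unfolding C_def by (rule mat_bound_nonneg)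
  have B_nn: "0 \<le> B" unfolding B_def using B0 by simp
  let ?v = "\<lambda>s. mat_exp S a s f"
  have vB: "\<bar>?v s y\<bar> \<le> B" if "0 \<le> s" "s \<le> t" "y \<in> S" for s y
  proof -
    have "\<bar>?v s y\<bar> \<le> B0 * exp (C * s)" unfolding C_def by (rule mat_exp_growth[OF S that(3) B0(2) that(1)])
    also have "\<dots> \<le> B" unfolding B_def using that B0 C by (intro mult_left_mono) (auto intro: mult_left_mono)
    finally show ?thesis .
  qed
  have lip: "\<bar>?v r y - ?v s y\<bar> \<le> (r - s) * (C * B)" if asm: "0 \<le> s" "s < r" "r \<le> t" "y \<in> S" for s r y
  proof -
    obtain z where z: "s < z" "z < r" "?v r y - ?v s y = (r - s) * mat_app S a (?v z) y"
      using MVT2[OF asm(2), of "\<lambda>q. ?v q y" "\<lambda>q. mat_app S a (?v q) y"] mat_exp_has_derivative[OF S asm(4)] by metis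
    have "\<bar>mat_app S a (?v z) y\<bar> \<le> C * B"
      unfolding C_def by (rule mat_app_bound[OF S asm(4)]) (rule vB, use z asm in auto)
    then show ?thesis using z asm by (simp add: abs_mult)
  qed
  have step: "\<bar>?v r y - ?v s y - (r - s) * mat_app S a (?v s) y\<bar> \<le> (r - s)\<^sup>2 * (C * C * B)"
    if asm: "0 \<le> s" "s < r" "r \<le> t" "y \<in> S" for s r y
  proof -
    obtain z where z: "s < z" "z < r" "?v r y - ?v s y = (r - s) * mat_app S a (?v z) y"
      using MVT2[OF asm(2), of "\<lambda>q. ?v q y" "\<lambda>q. mat_app S a (?v q) y"] mat_exp_has_derivative[OF S asm(4)] by metis
    have "\<bar>mat_app S a (?v z) y - mat_app S a (?v s) y\<bar> \<le> C * ((r - s) * (C * B))"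
      unfolding C_def mat_app_diff
    proof (rule mat_app_bound[OF S asm(4)])
      fix q assume "q \<in> S"
      have "\<bar>?v z q - ?v s q\<bar> \<le> (z - s) * (C * B)" by (rule lip) (use z asm \<open>q \<in> S\<close> in auto)
      also have "\<dots> \<le> (r - s) * (C * B)" using z C B_nn by (intro mult_right_mono) auto
      finally show "\<bar>?v z q - ?v s q\<bar> \<le> (r - s) * (mat_bound S a * B)" by (simp add: C_def)
    qed
    then have "(r - s) * \<bar>mat_app S a (?v z) y - mat_app S a (?v s) y\<bar> \<le> (r - s) * (C * ((r - s) * (C * B)))"
      using asm by (intro mult_left_mono) auto
    moreover have "?v r y - ?v s y - (r - s) * mat_app S a (?v s) y = (r - s) * (mat_app S a (?v z) y - mat_app S a (?v s) y)"
      unfolding z(3) by (simp add: algebra_simps)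
    ultimately show ?thesis using asm by (simp add: abs_mult power2_eq_square mult_ac)
  qed
  \<comment> \<open>The error of one step is at most \<open>K\<close> times the square of the step
    size: \<open>C * C * B\<close> is the second-order remainder of the exponential,
    \<open>c * B\<close> the consistency error of the scheme. Stability lets these errors add up
    without amplification.\<close>
  define K where "K = C * C * B + c * B"
  have main: "\<bar>(T h ^^ k) f y - ?v (real k * h) y\<bar> \<le> real k * (h\<^sup>2 * K)"
    if "0 < h" "h < \<eta>" "real k * h \<le> t" "y \<in> S" for h k y
    using that
  proof (induction k arbitrary: y)
    case (Suc k)
    have kt: "real k * h \<le> t" "real (Suc k) * h = real k * h + h" using Suc.prems by (auto simp: algebra_simps)
    let ?w = "?v (real k * h)"
    have 1: "\<bar>T h ((T h ^^ k) f) y - T h ?w y\<bar> \<le> real k * (h\<^sup>2 * K)"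
      by (rule contr) (use Suc kt in auto)
    have 2: "\<bar>T h ?w y - ?w y - h * mat_app S a ?w y\<bar> \<le> c * h\<^sup>2 * B"
      by (rule cons) (use Suc kt in \<open>auto intro!: vB\<close>)
    have 3: "\<bar>?v (real (Suc k) * h) y - ?w y - h * mat_app S a ?w y\<bar> \<le> h\<^sup>2 * (C * C * B)"
      using step[of "real k * h" "real (Suc k) * h" y] Suc.prems kt by simp
    have "\<bar>(T h ^^ Suc k) f y - ?v (real (Suc k) * h) y\<bar> \<le> real k * (h\<^sup>2 * K) + c * h\<^sup>2 * B + h\<^sup>2 * (C * C * B)"
      using 1 2 3 by simp
    then show ?case by (simp add: K_def algebra_simps)
  qed simp
  have ev: "\<forall>\<^sub>F m in sequentially. \<bar>(T (t / real m) ^^ m) f x - ?v t x\<bar> \<le> t\<^sup>2 * K / real m"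
  proof -
    have "\<forall>\<^sub>F m in sequentially. t / real m < \<eta>"
      by (rule order_tendstoD(2)[OF _ \<eta>]) (rule tendsto_divide_0[OF tendsto_const], rule filterlim_at_top_imp_at_infinity, rule filterlim_real_sequentially)
    then show ?thesis using eventually_gt_at_top[of 0]
    proof eventually_elim
      case (elim m)
      have "\<bar>(T (t / real m) ^^ m) f x - ?v (real m * (t / real m)) x\<bar> \<le> real m * ((t / real m)\<^sup>2 * K)"
        by (rule main) (use elim t x in auto)
      then show ?case using elim by (simp add: power2_eq_square)
    qed
  qed
  have "(\<lambda>m. t\<^sup>2 * K / real m) \<longlonglongrightarrow> 0"
    by (rule tendsto_divide_0[OF tendsto_const], rule filterlim_at_top_imp_at_infinity, rule filterlim_real_sequentially)
  then have "(\<lambda>m. (T (t / real m) ^^ m) f x - ?v t x) \<longlonglongrightarrow> 0"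
    by (rule Lim_null_comparison[rotated]) (use ev in simp)
  then show ?thesis by (simp add: LIM_zero_iff)
qed

text \<open>For small h the matrix 1 + h a is stochastic, so all Euler iterates of a nonnegative
  function are nonnegative and the limit inherits the sign.\<close>

lemma mat_exp_nonneg:
  assumes S: "finite S" "x \<in> S"
    and off: "\<And>x y. x \<in> S \<Longrightarrow> y \<in> S \<Longrightarrow> x \<noteq> y \<Longrightarrow> 0 \<le> a x y"
    and row: "\<And>x. x \<in> S \<Longrightarrow> (\<Sum>y\<in>S. a x y) = 0"
    and f: "\<And>y. y \<in> S \<Longrightarrow> 0 \<le> f y" and t: "0 \<le> t"
  shows "0 \<le> mat_exp S a t f x"
proof (cases "t = 0")
  case False
  \<comment> \<open>For steps below \<open>1 / C\<close> the diagonal of 1 + h a stays nonnegative.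
    The summand 1 keeps \<open>C\<close> positive even for the zero matrix.\<close>
  define C where "C = mat_bound S a + 1"
  have C: "0 < C" unfolding C_def using mat_bound_nonneg[of S a] by simp
  define T where "T h f x = f x + h * mat_app S a f x" for h f x
  define p where "p h x y = (if x = y then 1 else 0) + h * a x y" for h x y
  have T_eq: "T h f x = (\<Sum>y\<in>S. p h x y * f y)" if "x \<in> S" for h f x
  proof -
    have "(\<Sum>y\<in>S. p h x y * f y) = (\<Sum>y\<in>S. (if x = y then f y else 0) + h * (a x y * f y))"
      unfolding p_def by (intro sum.cong) (auto simp: algebra_simps)
    also have "\<dots> = f x + h * (\<Sum>y\<in>S. a x y * f y)"
      using S(1) that by (simp add: sum.distrib sum_distrib_left)
    finally show ?thesis unfolding T_def mat_app_def by simp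
  qed
  have diag: "\<bar>a x y\<bar> \<le> C" if "x \<in> S" "y \<in> S" for x y
  proof -
    have "\<bar>a x y\<bar> \<le> (\<Sum>y\<in>S. \<bar>a x y\<bar>)" by (rule member_le_sum[where f="\<lambda>y. \<bar>a x y\<bar>"]) (use S that in auto)
    also have "\<dots> \<le> mat_bound S a" unfolding mat_bound_def
      by (rule member_le_sum[where f="\<lambda>x. \<Sum>y\<in>S. \<bar>a x y\<bar>"]) (use S that in \<open>auto intro!: sum_nonneg\<close>)
    finally show ?thesis unfolding C_def by simp
  qed
  have p_nn: "0 \<le> p h x y" if "0 < h" "h < 1 / C" "x \<in> S" "y \<in> S" for h x y
  proof (cases "x = y")
    case True
    have "h * \<bar>a x y\<bar> \<le> (1 / C) * C" by (rule mult_mono) (use that diag C in auto)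
    then have "\<bar>h * a x y\<bar> \<le> 1" using C that by (simp add: abs_mult)
    then show ?thesis unfolding p_def using True by auto
  qed (use that off in \<open>simp add: p_def\<close>)
  have p_sum: "(\<Sum>y\<in>S. p h x y) = 1" if "x \<in> S" for h x
    unfolding p_def using that S row by (simp add: sum.distrib sum_distrib_left[symmetric])
  have nn: "0 \<le> (T h ^^ m) f y" if "0 < h" "h < 1 / C" "y \<in> S" for h m y
    using that
  proof (induction m arbitrary: y)
    case (Suc m) then show ?case
      by (simp add: T_eq) (intro sum_nonneg mult_nonneg_nonneg p_nn, auto)
  qed (use f in auto)
  have lim: "(\<lambda>m. (T (t / real m) ^^ m) f x) \<longlonglongrightarrow> mat_exp S a t f x"
  proof (rule euler_tendsto_mat_exp[OF S(1), where \<eta>="1/C" and c=0])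
    fix h B x and f g :: "'a \<Rightarrow> real"
    assume h: "0 < h" "h < 1 / C" and B: "\<And>x. x \<in> S \<Longrightarrow> \<bar>f x - g x\<bar> \<le> B" and x: "x \<in> S"
    have "\<bar>T h f x - T h g x\<bar> = \<bar>\<Sum>y\<in>S. p h x y * (f y - g y)\<bar>"
      unfolding T_eq[OF x] by (simp add: sum_subtractf algebra_simps)
    also have "\<dots> \<le> (\<Sum>y\<in>S. p h x y * B)"
      by (rule order_trans[OF sum_abs]) (intro sum_mono, simp add: abs_mult p_nn h x B mult_left_mono)
    also have "\<dots> = B" by (simp add: sum_distrib_right[symmetric] p_sum x)
    finally show "\<bar>T h f x - T h g x\<bar> \<le> B" .
  qed (use S C t False in \<open>auto simp: T_def\<close>)
  show ?thesis
  proof (rule tendsto_lowerbound[OF lim])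
    have "\<forall>\<^sub>F m in sequentially. t / real m < 1 / C"
      by (rule order_tendstoD(2)) (rule tendsto_divide_0[OF tendsto_const], rule filterlim_at_top_imp_at_infinity, rule filterlim_real_sequentially, use C in simp)
    then show "\<forall>\<^sub>F m in sequentially. 0 \<le> (T (t / real m) ^^ m) f x" using eventually_gt_at_top[of 0]
      by eventually_elim (use t False S in \<open>auto intro!: nn\<close>)
  qed simp
qed (use f S in simp)

lemma mat_exp_const:
  assumes "finite S" "x \<in> S" and row: "\<And>x. x \<in> S \<Longrightarrow> (\<Sum>y\<in>S. a x y) = 0"
  shows "mat_exp S a t (\<lambda>_. c) x = c"
  by (subst mat_exp_eigen[where \<mu>=0]) (use assms in \<open>auto simp: mat_app_def sum_distrib_right[symmetric]\<close>)

lemma mat_exp_mono: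
  assumes S: "finite S" "x \<in> S"
    and off: "\<And>x y. x \<in> S \<Longrightarrow> y \<in> S \<Longrightarrow> x \<noteq> y \<Longrightarrow> 0 \<le> a x y"
    and row: "\<And>x. x \<in> S \<Longrightarrow> (\<Sum>y\<in>S. a x y) = 0"
    and f: "\<And>y. y \<in> S \<Longrightarrow> f y \<le> g y" and t: "0 \<le> t"
  shows "mat_exp S a t f x \<le> mat_exp S a t g x"
proof -
  have "0 \<le> mat_exp S a t (\<lambda>y. g y - f y) x"
    by (rule mat_exp_nonneg[OF S off row _ t]) (use f in auto)
  then show ?thesis by (simp add: mat_exp_diff[OF S])
qed

text \<open>Comparison of the difference with the constants \<open>B\<close> and \<open>-B\<close>,
  which the exponential preserves.\<close>

lemma mat_exp_contraction:
  assumes S: "finite S" "x \<in> S"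
    and off: "\<And>x y. x \<in> S \<Longrightarrow> y \<in> S \<Longrightarrow> x \<noteq> y \<Longrightarrow> 0 \<le> a x y"
    and row: "\<And>x. x \<in> S \<Longrightarrow> (\<Sum>y\<in>S. a x y) = 0"
    and f: "\<And>y. y \<in> S \<Longrightarrow> \<bar>f y - g y\<bar> \<le> B" and t: "0 \<le> t"
  shows "\<bar>mat_exp S a t f x - mat_exp S a t g x\<bar> \<le> B"
proof -
  have "mat_exp S a t (\<lambda>y. f y - g y) x \<le> mat_exp S a t (\<lambda>_. B) x"
    by (rule mat_exp_mono[OF S off row _ t]) (use f abs_le_D1 in blast)+
  moreover have "mat_exp S a t (\<lambda>_. -B) x \<le> mat_exp S a t (\<lambda>y. f y - g y) x"
    by (rule mat_exp_mono[OF S off row _ t]) (use f in \<open>force simp: abs_le_iff\<close>)+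
  ultimately show ?thesis by (simp add: mat_exp_const[OF S row] mat_exp_diff[OF S])
qed

section \<open>The discrete torus and its heat semigroup\<close>

abbreviation lat :: "nat \<Rightarrow> (real ^ 'd::finite) set" where
  "lat n \<equiv> torus_lattice (1 / real n)"

lemma torus_lattice_iff:
  assumes "0 < n"
  shows "x \<in> lat n \<longleftrightarrow> (\<forall>i. \<exists>k<n. x $ i = real k / real n)"
proof -
  have "(0 \<le> a \<and> a < 1 \<and> (\<exists>k::int. a = 1 / real n * of_int k)) \<longleftrightarrow> (\<exists>k<n. a = real k / real n)" for a :: real
  proof safe
    fix k :: int assume "0 \<le> 1 / real n * of_int k" "1 / real n * of_int k < 1"
    then have "0 \<le> k" "k < int n" using assms by (auto simp: field_simps zero_le_divide_iff)
    then show "\<exists>j<n. 1 / real n * real_of_int k = real j / real n" by (intro exI[of _ "nat k"]) auto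
  next
    fix k assume "k < n"
    then show "0 \<le> real k / real n" "real k / real n < 1" by auto
    show "\<exists>j::int. real k / real n = 1 / real n * real_of_int j" by (rule exI[of _ "int k"]) simp
  qed
  then show ?thesis unfolding torus_lattice_def torus_cell_def by blast
qed

text \<open>Digit vectors turn sums of products over the lattice into products of one-dimensional
  sums.\<close>

lemma bij_betw_lattice:
  assumes "0 < n"
  shows "bij_betw (\<lambda>f. \<chi> i. real (f i) / real n) (PiE UNIV (\<lambda>_. {..<n})) (lat n :: (real ^ 'd::finite) set)"
proof (rule bij_betw_imageI)
  show "inj_on (\<lambda>f. \<chi> i. real (f i) / real n) (PiE (UNIV::'d set) (\<lambda>_. {..<n}))"
    using assms by (auto simp: inj_on_def vec_eq_iff fun_eq_iff)
  show "(\<lambda>f. \<chi> i. real (f i) / real n) ` PiE (UNIV::'d set) (\<lambda>_. {..<n}) = lat n"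
  proof safe
    fix x :: "real ^ 'd" assume "x \<in> lat n"
    then obtain f where f: "\<And>i. f i < n \<and> x $ i = real (f i) / real n"
      unfolding torus_lattice_iff[OF assms] by metis
    then show "x \<in> (\<lambda>f. \<chi> i. real (f i) / real n) ` PiE UNIV (\<lambda>_. {..<n})"
      by (intro image_eqI[of _ _ f]) (auto simp: vec_eq_iff)
  qed (auto simp: torus_lattice_iff[OF assms] PiE_iff)
qed

lemma finite_lattice: "0 < n \<Longrightarrow> finite (lat n)"
  using bij_betw_finite[OF bij_betw_lattice] by (metis finite_PiE finite finite_lessThan)

lemma card_lattice: "0 < n \<Longrightarrow> card (lat n :: (real ^ 'd::finite) set) = n ^ CARD('d)"
proof -
  assume "0 < n"
  have "card (lat n :: (real ^ 'd) set) = card (PiE (UNIV :: 'd set) (\<lambda>_. {..<n}))"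
    by (rule bij_betw_same_card[OF bij_betw_lattice[OF \<open>0 < n\<close>], symmetric])
  then show ?thesis by (simp add: card_PiE)
qed

lemma sum_lattice_prod:
  fixes f :: "'d::finite \<Rightarrow> real \<Rightarrow> 'b::comm_semiring_1"
  assumes "0 < n"
  shows "(\<Sum>x\<in>lat n. \<Prod>j\<in>UNIV. f j (x $ j)) = (\<Prod>j\<in>UNIV. \<Sum>k<n. f j (real k / real n))"
  by (simp add: sum.reindex_bij_betw[OF bij_betw_lattice[OF assms], symmetric] prod_sum_PiE)

lemma torus_shift_nth: "torus_shift s i x $ j = frac (x $ j + (if i = j then s else 0))"
  by (simp add: torus_shift_def axis_def)

lemma torus_shift_commute: "torus_shift s i (torus_shift r j x) = torus_shift r j (torus_shift s i x)"
  by (simp add: vec_eq_iff torus_shift_nth frac_add_simps ac_simps)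

lemma torus_shift_inverse:
  assumes "x \<in> torus_cell"
  shows "torus_shift s i (torus_shift (- s) i x) = x"
proof -
  have "frac (x $ j) = x $ j" for j using assms by (simp add: torus_cell_def frac_eq)
  then show ?thesis by (simp add: vec_eq_iff torus_shift_nth frac_add_simps)
qed

lemma lattice_cell: "x \<in> lat n \<Longrightarrow> x \<in> torus_cell"
  by (simp add: torus_lattice_def)

lemma torus_shift_lattice:
  assumes "0 < n" "x \<in> lat n" "\<exists>m::int. s = of_int m / real n"
  shows "torus_shift s i x \<in> lat n"
proof -
  have "\<exists>k::int. frac (x $ j + (if i = j then s else 0)) = (1 / real n) * of_int k" for j
  proof -
    obtain a :: int where a: "x $ j = (1 / real n) * of_int a" using assms(2) by (auto simp: torus_lattice_def)
    obtain m :: int where m: "s = of_int m / real n" using assms(3) by auto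
    let ?b = "if i = j then m else 0"
    have "x $ j + (if i = j then s else 0) = (1 / real n) * of_int (a + ?b)"
      using a m by (simp add: add_divide_distrib)
    then have "frac (x $ j + (if i = j then s else 0)) = (1 / real n) * of_int (a + ?b - int n * \<lfloor>x $ j + (if i = j then s else 0)\<rfloor>)"
      using assms(1) unfolding frac_def by (simp add: field_simps)
    then show ?thesis by blast
  qed
  then show ?thesis
    by (auto simp: torus_lattice_def torus_cell_def torus_shift_nth frac_lt_1)
qed

lemma torus_shift_lattice_next: "0 < n \<Longrightarrow> x \<in> lat n \<Longrightarrow> torus_shift (1 / real n) i x \<in> lat n"
  by (rule torus_shift_lattice) (auto intro: exI[of _ "1::int"])

lemma torus_shift_lattice_prev: "0 < n \<Longrightarrow> x \<in> lat n \<Longrightarrow> torus_shift (- (1 / real n)) i x \<in> lat n"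
  by (rule torus_shift_lattice) (auto intro: exI[of _ "-1::int"])

lemma bij_betw_torus_shift: "0 < n \<Longrightarrow> bij_betw (torus_shift (1 / real n) i) (lat n) (lat n)"
  by (rule bij_betw_byWitness[where f'="torus_shift (- (1 / real n)) i"])
    (use torus_shift_inverse[of _ "- (1 / real n)" i] in
      \<open>auto simp: torus_shift_inverse torus_shift_lattice_next torus_shift_lattice_prev dest: lattice_cell\<close>)

text \<open>For n = 1 the shift is a full period and the edge degenerates to a loop. This is the
  source of the assumption \<open>2 \<le> n\<close> in the renewal estimates.\<close>

lemma torus_shift_neq:
  assumes "2 \<le> n" "x \<in> lat n" shows "torus_shift (1 / real n) i x \<noteq> x"
proof
  assume *: "torus_shift (1 / real n) i x = x"
  have "frac (x $ i + 1 / real n) = x $ i" using arg_cong[OF *, of "\<lambda>y. y $ i"] by (simp add: torus_shift_nth)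
  then have "1 / real n = of_int \<lfloor>x $ i + 1 / real n\<rfloor>" by (simp add: frac_def)
  moreover have "0 < 1 / real n" "1 / real n < 1" using assms by auto
  ultimately show False by (metis of_int_0_less_iff of_int_less_1_iff zless_imp_add1_zle not_less add_0)
qed

section \<open>Integer-periodic functions and plane waves\<close>

lemma torus_fun_int:
  assumes "torus_fun f"
  shows "f (x + of_int m *\<^sub>R axis i 1) = f x"
proof -
  have nat: "f (x + real m *\<^sub>R axis i 1) = f x" for m x
  proof (induction m)
    case (Suc m)
    have "x + real (Suc m) *\<^sub>R axis i 1 = (x + real m *\<^sub>R axis i 1) + axis i 1" by (simp add: algebra_simps)
    then show ?case using assms Suc unfolding torus_fun_def by metis
  qed simp
  show ?thesis
  proof (cases "0 \<le> m")
    case True then show ?thesis using nat[of x "nat m"] by simp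
  next
    case False
    then have "f (x + of_int m *\<^sub>R axis i 1 + real (nat (- m)) *\<^sub>R axis i 1) = f x" by (simp add: algebra_simps)
    then show ?thesis using nat[of "x + of_int m *\<^sub>R axis i 1" "nat (-m)"] by simp
  qed
qed

lemma torus_fun_int_vec:
  assumes f: "torus_fun f" and k: "\<And>i. k $ i \<in> \<int>"
  shows "f (x + k) = f x"
proof -
  have "f (x + (\<Sum>i\<in>I. k $ i *\<^sub>R axis i 1)) = f x" if "finite I" for I
    using that
  proof (induction I arbitrary: x)
    case (insert i I)
    obtain m :: int where "k $ i = of_int m" using k[of i] by (auto elim: Ints_cases)
    then have "f ((x + (\<Sum>i\<in>I. k $ i *\<^sub>R axis i 1)) + k $ i *\<^sub>R axis i 1) = f x"
      using torus_fun_int[OF f] insert.IH by metis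
    then show ?case using insert by (simp add: algebra_simps)
  qed simp
  moreover have "(\<Sum>i\<in>UNIV. k $ i *\<^sub>R axis i 1) = k"
    by (simp add: vec_eq_iff axis_def if_distrib[of "\<lambda>c. _ * c"] cong: if_cong)
  ultimately show ?thesis by (metis finite)
qed

lemma torus_fun_frac: "torus_fun f \<Longrightarrow> f (\<chi> j. frac (y $ j)) = f y"
  using torus_fun_int_vec[of f "\<chi> j. - of_int \<lfloor>y $ j\<rfloor>" y]
  by (simp add: frac_def plus_vec_def)

lemma torus_fun_shift: "torus_fun f \<Longrightarrow> f (torus_shift s i x) = f (x + s *\<^sub>R axis i 1)"
  unfolding torus_shift_def by (rule torus_fun_frac)

text \<open>The phase makes products of waves sums of waves, so that complex values are avoided.\<close>

definition plane_wave :: "real ^ 'd::finite \<Rightarrow> real \<Rightarrow> real ^ 'd \<Rightarrow> real" where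
  "plane_wave k \<theta> x = cos (2 * pi * (k \<bullet> x) + \<theta>)"

lemma plane_wave_shift: "plane_wave k \<theta> (x + s *\<^sub>R axis i 1) = cos (2 * pi * (k \<bullet> x) + \<theta> + 2 * pi * (s * k $ i))"
  unfolding plane_wave_def by (simp add: inner_add_right inner_axis algebra_simps)

lemma torus_fun_plane_wave:
  assumes "\<And>i. k $ i \<in> \<int>" shows "torus_fun (plane_wave k \<theta>)"
  unfolding torus_fun_def
proof (intro allI)
  fix x i
  obtain m :: int where m: "k $ i = of_int m" using assms[of i] by (auto elim: Ints_cases)
  show "plane_wave k \<theta> (x + axis i 1) = plane_wave k \<theta> x"
    using plane_wave_shift[of k \<theta> x 1 i] cos.plus_of_int[of "2 * pi * (k \<bullet> x) + \<theta>" m]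
    by (simp add: plane_wave_def m mult_ac)
qed

text \<open>Generator of a single walker: each adjacent edge rings at rate n^2 and moves the walker
  with probability 1/2. The two neighbours are added as separate indicators, so that they count
  twice when they coincide, as for n = 2.\<close>

definition lap_mat :: "nat \<Rightarrow> real ^ 'd::finite \<Rightarrow> real ^ 'd \<Rightarrow> real" where
  "lap_mat n x y = (real n)\<^sup>2 / 2 * (\<Sum>i\<in>UNIV. of_bool (y = torus_shift (1 / real n) i x)
      + of_bool (y = torus_shift (- (1 / real n)) i x) - 2 * of_bool (y = x))"

definition heat_sg :: "nat \<Rightarrow> real \<Rightarrow> (real ^ 'd::finite \<Rightarrow> real) \<Rightarrow> real ^ 'd \<Rightarrow> real" where
  "heat_sg n = mat_exp (lat n) (lap_mat n)"

lemma mat_app_lap: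
  fixes x :: "real ^ 'd::finite"
  assumes n: "0 < n" and x: "x \<in> lat n"
  shows "mat_app (lat n) (lap_mat n) f x = (real n)\<^sup>2 / 2 *
    (\<Sum>i\<in>UNIV. f (torus_shift (1 / real n) i x) + f (torus_shift (- (1 / real n)) i x) - 2 * f x)"
proof -
  have delta: "(\<Sum>y\<in>lat n. of_bool (y = z) * f y) = f z" if "z \<in> lat n" for z :: "real ^ 'd"
  proof -
    have "(\<Sum>y\<in>lat n. of_bool (y = z) * f y) = (\<Sum>y\<in>lat n. if z = y then f y else 0)"
      by (intro sum.cong) auto
    moreover have "finite (lat n :: (real ^ 'd) set)" by (rule finite_lattice[OF n])
    ultimately show ?thesis using that by simp
  qed
  have "mat_app (lat n) (lap_mat n) f x = (real n)\<^sup>2 / 2 * (\<Sum>y\<in>lat n. \<Sum>i\<in>UNIV. of_bool (y = torus_shift (1 / real n) i x) * f y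
      + of_bool (y = torus_shift (- (1 / real n)) i x) * f y - 2 * (of_bool (y = x) * f y))"
    unfolding mat_app_def lap_mat_def by (simp add: sum_distrib_left sum_distrib_right algebra_simps)
  also have "\<dots> = (real n)\<^sup>2 / 2 * (\<Sum>i\<in>UNIV. \<Sum>y\<in>lat n. of_bool (y = torus_shift (1 / real n) i x) * f y
      + of_bool (y = torus_shift (- (1 / real n)) i x) * f y - 2 * (of_bool (y = x) * f y))"
    by (subst sum.swap) simp
  finally show ?thesis
    by (simp only: sum.distrib sum_subtractf sum_distrib_left[symmetric] delta[OF x]
      delta[OF torus_shift_lattice_next[OF n x]] delta[OF torus_shift_lattice_prev[OF n x]])
qed

lemma lap_mat_symmetric:
  assumes "0 < n" "x \<in> lat n" "y \<in> lat n"
  shows "lap_mat n x y = lap_mat n y x"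
proof -
  have "y = torus_shift (1 / real n) i x \<longleftrightarrow> x = torus_shift (- (1 / real n)) i y"
    "y = torus_shift (- (1 / real n)) i x \<longleftrightarrow> x = torus_shift (1 / real n) i y" for i
    using torus_shift_inverse[OF lattice_cell[OF assms(2)], of "1 / real n" i]
      torus_shift_inverse[OF lattice_cell[OF assms(2)], of "- (1 / real n)" i]
      torus_shift_inverse[OF lattice_cell[OF assms(3)], of "1 / real n" i]
      torus_shift_inverse[OF lattice_cell[OF assms(3)], of "- (1 / real n)" i] by auto
  then show ?thesis unfolding lap_mat_def by (auto simp: algebra_simps eq_commute[of x y])
qed

lemma lap_mat_off_diag: "x \<noteq> y \<Longrightarrow> 0 \<le> lap_mat n x y"
  unfolding lap_mat_def by (intro mult_nonneg_nonneg sum_nonneg) auto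

lemma lap_mat_row_sum: "0 < n \<Longrightarrow> x \<in> lat n \<Longrightarrow> (\<Sum>y\<in>lat n. lap_mat n x y) = 0"
  using mat_app_lap[of n x "\<lambda>_. 1"] by (simp add: mat_app_def)

lemma lap_mat_shift:
  assumes "0 < n" "x \<in> lat n" "y \<in> lat n"
  shows "lap_mat n (torus_shift (1 / real n) j x) (torus_shift (1 / real n) j y) = lap_mat n x y"
proof -
  have inj: "torus_shift (1 / real n) j a = torus_shift (1 / real n) j b \<longleftrightarrow> a = b" if "a \<in> lat n" "b \<in> lat n" for a b
    using bij_betw_torus_shift[OF assms(1), of j] that by (auto simp: bij_betw_def inj_on_def)
  show ?thesis unfolding lap_mat_def
    using assms by (simp add: torus_shift_commute[of _ _ _ j] inj torus_shift_lattice_next torus_shift_lattice_prev)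
qed

lemma heat_sg_shift:
  assumes "0 < n" "x \<in> lat n"
  shows "heat_sg n t (\<lambda>x. f (torus_shift (1 / real n) j x)) x = heat_sg n t f (torus_shift (1 / real n) j x)"
  unfolding heat_sg_def using assms by (intro mat_exp_comp bij_betw_torus_shift lap_mat_shift)

lemma heat_sg_symmetric:
  assumes "0 < n"
  shows "(\<Sum>x\<in>lat n. heat_sg n s f x * heat_sg n r g x) = (\<Sum>x\<in>lat n. f x * heat_sg n (s + r) g x)"
  unfolding heat_sg_def using assms by (intro mat_exp_symmetric finite_lattice lap_mat_symmetric)

text \<open>Since cos (A + B) + cos (A - B) - 2 cos A = -2 (1 - cos B) cos A, every lattice wave is
  an eigenfunction whatever its phase, and each direction contributes \<open>psi\<close> of its
  frequency divided by \<open>n\<close>.\<close>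

lemma heat_sg_plane_wave:
  fixes k x :: "real ^ 'd::finite"
  assumes n: "0 < n" and x: "x \<in> lat n" and k: "\<And>i. k $ i \<in> \<int>"
  shows "heat_sg n t (plane_wave k \<theta>) x = exp (- ((real n)\<^sup>2 * (\<Sum>i\<in>UNIV. psi (k $ i / real n))) * t) * plane_wave k \<theta> x"
  unfolding heat_sg_def
proof (rule mat_exp_eigen[OF _ x])
  fix y :: "real ^ 'd" assume y: "y \<in> lat n"
  have *: "plane_wave k \<theta> (torus_shift (1 / real n) i y) + plane_wave k \<theta> (torus_shift (- (1 / real n)) i y) - 2 * plane_wave k \<theta> y
    = - 2 * psi (k $ i / real n) * plane_wave k \<theta> y" for i
  proof -
    have "cos (A + B) + cos (A + - B) - 2 * cos A = - 2 * (1 - cos B) * cos A" for A B :: real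
      by (simp add: cos_add cos_diff algebra_simps)
    from this[of "2 * pi * (k \<bullet> y) + \<theta>" "2 * pi * (k $ i / real n)"]
    show ?thesis
      unfolding torus_fun_shift[OF torus_fun_plane_wave[OF k]] plane_wave_shift psi_def
      by (simp add: plane_wave_def)
  qed
  show "mat_app (lat n) (lap_mat n) (plane_wave k \<theta>) y = - ((real n)\<^sup>2 * (\<Sum>i\<in>UNIV. psi (k $ i / real n))) * plane_wave k \<theta> y"
    unfolding mat_app_lap[OF n y] * by (simp add: sum_distrib_left sum_distrib_right sum_negf algebra_simps)
qed

text \<open>A geometric sum of an n-th root of unity. The bound on \<open>m\<close> makes 0 the only
  multiple of \<open>n\<close> in range.\<close>

lemma sum_cis_root_unity:
  fixes m :: int assumes n: "0 < n" and m: "\<bar>m\<bar> < int n"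
  shows "(\<Sum>k<n. cis (2 * pi * real k * (of_int m / real n))) = (if m = 0 then of_nat n else 0)"
proof (cases "m = 0")
  case False
  let ?z = "cis (2 * pi * (of_int m / real n))"
  have "?z \<noteq> 1"
  proof
    assume "?z = 1"
    then have "cos (2 * pi * (of_int m / real n)) = 1" by (metis cis.simps(1) one_complex.simps(1))
    then obtain q :: int where "2 * pi * (of_int m / real n) = of_int q * 2 * pi" using cos_one_2pi_int by auto
    then have "2 * pi * (of_int m / real n) = 2 * pi * of_int q" by (simp add: mult_ac)
    then have "of_int m / real n = (of_int q :: real)" by (metis mult_cancel_left pi_neq_zero mult_eq_0_iff zero_neq_numeral)
    then have "(of_int m :: real) = of_int (q * int n)" using n by (simp add: field_simps)
    then have "m = q * int n" by (metis of_int_eq_iff)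
    then have "int n dvd m" by simp
    then show False using m False by (metis abs_of_nat dvd_imp_le_int not_less)
  qed
  moreover have "?z ^ n = 1"
  proof -
    have "real n * (2 * pi * (of_int m / real n)) = 2 * pi * of_int m" using n by (simp add: field_simps)
    show ?thesis unfolding Complex.DeMoivre \<open>real n * _ = _\<close> by (rule cis_multiple_2pi) simp
  qed
  moreover have "(\<Sum>k<n. cis (2 * pi * real k * (of_int m / real n))) = (\<Sum>k<n. ?z ^ k)"
    unfolding Complex.DeMoivre by (intro sum.cong refl arg_cong[of _ _ cis]) (simp add: mult_ac)
  ultimately show ?thesis using False by (simp add: geometric_sum)
qed (simp)

text \<open>Frequencies are indexed by the lattice: its dual group is \<open>n\<close> times the lattice itself.\<close>

lemma lattice_delta:
  fixes x y :: "real ^ 'd::finite"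
  assumes n: "0 < n" and x: "x \<in> lat n" and y: "y \<in> lat n"
  shows "(\<Sum>\<kappa>\<in>lat n. plane_wave (real n *\<^sub>R \<kappa>) (- (2 * pi * real n * (\<kappa> \<bullet> y))) x) / real n ^ CARD('d) = of_bool (x = y)"
proof -
  have "\<exists>m::int. \<bar>m\<bar> < int n \<and> x $ j - y $ j = of_int m / real n" for j
  proof -
    obtain a b where "a < n" "x $ j = real a / real n" "b < n" "y $ j = real b / real n"
      using x y unfolding torus_lattice_iff[OF n] by metis
    then show ?thesis by (intro exI[of _ "int a - int b"]) (auto simp: diff_divide_distrib)
  qed
  then obtain m :: "'d \<Rightarrow> int" where m: "\<And>j. \<bar>m j\<bar> < int n" "\<And>j. x $ j - y $ j = of_int (m j) / real n" by metis
  \<comment> \<open>Only in exponential form does the wave factor over the coordinates, so the real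
    sum is obtained as the real part of a product of complex sums.\<close>
  have "(\<Sum>\<kappa>\<in>lat n. cis (2 * pi * real n * (\<kappa> \<bullet> (x - y)))) = (\<Sum>\<kappa>\<in>lat n. \<Prod>j\<in>UNIV. cis (2 * pi * (real n * \<kappa> $ j) * (x $ j - y $ j)))"
  proof (intro sum.cong refl)
    fix \<kappa> :: "real ^ 'd"
    have cp: "cis (\<Sum>j\<in>I. f j) = (\<Prod>j\<in>I. cis (f j))" if "finite I" for f :: "'d \<Rightarrow> real" and I
      using that by induction (auto simp: cis_mult[symmetric])
    show "cis (2 * pi * real n * (\<kappa> \<bullet> (x - y))) = (\<Prod>j\<in>UNIV. cis (2 * pi * (real n * \<kappa> $ j) * (x $ j - y $ j)))"
      unfolding cp[OF finite, symmetric] inner_vec_def by (simp add: sum_distrib_left mult_ac)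
  qed
  also have "\<dots> = (\<Prod>j\<in>UNIV. \<Sum>k<n. cis (2 * pi * (real n * (real k / real n)) * (x $ j - y $ j)))"
    by (rule sum_lattice_prod[OF n, of "\<lambda>j a. cis (2 * pi * (real n * a) * (x $ j - y $ j))"])
  also have "\<dots> = (\<Prod>j\<in>UNIV. \<Sum>k<n. cis (2 * pi * real k * (of_int (m j) / real n)))"
    using n by (simp add: m(2))
  also have "\<dots> = (\<Prod>j\<in>UNIV. if m j = 0 then of_nat n else 0)"
    by (intro prod.cong refl sum_cis_root_unity n m)
  also have "\<dots> = (if x = y then of_nat n ^ CARD('d) else 0)"
  proof -
    have "x = y \<longleftrightarrow> (\<forall>j. m j = 0)"
      unfolding vec_eq_iff using m(2) n by (metis diff_0_right divide_eq_0_iff eq_iff_diff_eq_0 of_int_eq_0_iff of_nat_0_less_iff less_irrefl)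
    then show ?thesis by auto
  qed
  finally have "(\<Sum>\<kappa>\<in>lat n. cis (2 * pi * real n * (\<kappa> \<bullet> (x - y)))) = (if x = y then of_nat n ^ CARD('d) else 0)" .
  from arg_cong[OF this, of Re]
  have "(\<Sum>\<kappa>\<in>lat n. cos (2 * pi * real n * (\<kappa> \<bullet> (x - y)))) = (if x = y then real n ^ CARD('d) else 0)"
    by (simp flip: of_nat_power)
  moreover have "plane_wave (real n *\<^sub>R \<kappa>) (- (2 * pi * real n * (\<kappa> \<bullet> y))) x = cos (2 * pi * real n * (\<kappa> \<bullet> (x - y)))" for \<kappa>
    unfolding plane_wave_def by (simp add: inner_diff_right algebra_simps)
  ultimately show ?thesis using n by simp
qed

section \<open>Poisson increments over short time steps\<close>

text \<open>The edge that rings during a time step. A step with two or more rings is recorded as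
  \<open>None\<close>, like one without rings; its probability is quadratic in the step size and it
  is treated separately as an exceptional event.\<close>

definition mark :: "'e set \<Rightarrow> ('e \<Rightarrow> nat) \<Rightarrow> 'e option" where
  "mark E \<xi> = (if (\<Sum>e\<in>E. \<xi> e) = 1 then Some (THE e. e \<in> E \<and> \<xi> e = 1) else None)"

lemma sum_nat_eq_1_iff:
  fixes \<xi> :: "'e \<Rightarrow> nat"
  assumes "finite E"
  shows "(\<Sum>e\<in>E. \<xi> e) = 1 \<longleftrightarrow> (\<exists>e\<in>E. \<xi> e = 1 \<and> (\<forall>e'\<in>E. e' \<noteq> e \<longrightarrow> \<xi> e' = 0))"
  using sum_eq_1_iff[OF assms, of \<xi>] by metis

lemma mark_eq_Some_iff:
  assumes "finite E"
  shows "mark E \<xi> = Some e \<longleftrightarrow> e \<in> E \<and> \<xi> e = 1 \<and> (\<forall>e'\<in>E. e' \<noteq> e \<longrightarrow> \<xi> e' = 0)"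
proof
  assume "mark E \<xi> = Some e"
  then have s: "(\<Sum>e\<in>E. \<xi> e) = 1" and e: "e = (THE e. e \<in> E \<and> \<xi> e = 1)"
    by (auto simp: mark_def split: if_splits)
  obtain f where f: "f \<in> E" "\<xi> f = 1" "\<forall>e'\<in>E. e' \<noteq> f \<longrightarrow> \<xi> e' = 0"
    using s sum_nat_eq_1_iff[OF assms] by blast
  have "(THE e. e \<in> E \<and> \<xi> e = 1) = f" by (rule the_equality) (use f in auto)
  then show "e \<in> E \<and> \<xi> e = 1 \<and> (\<forall>e'\<in>E. e' \<noteq> e \<longrightarrow> \<xi> e' = 0)" using e f by simp
next
  assume a: "e \<in> E \<and> \<xi> e = 1 \<and> (\<forall>e'\<in>E. e' \<noteq> e \<longrightarrow> \<xi> e' = 0)"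
  then have "(\<Sum>e\<in>E. \<xi> e) = 1" using sum_nat_eq_1_iff[OF assms] by blast
  moreover have "(THE e. e \<in> E \<and> \<xi> e = 1) = e" by (rule the_equality) (use a in auto)
  ultimately show "mark E \<xi> = Some e" by (simp add: mark_def)
qed

lemma mark_cong: "(\<And>e. e \<in> E \<Longrightarrow> \<xi> e = \<xi>' e) \<Longrightarrow> mark E \<xi> = mark E \<xi>'"
  unfolding mark_def by (auto intro!: arg_cong[of _ _ The] simp: fun_eq_iff cong: sum.cong)

lemma mark_cases: "finite E \<Longrightarrow> mark E \<xi> \<in> insert None (Some ` E)"
  using mark_eq_Some_iff[of E \<xi>] by (cases "mark E \<xi>") auto

text \<open>A finite product of countable discrete spaces is again discrete. Hence
  \<open>mark\<close> and every functional of finitely many increments are measurable for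
  free.\<close>

lemma measurable_PiM_nat:
  assumes "finite A"
  shows "f \<in> measurable (PiM A (\<lambda>_. count_space (UNIV :: nat set))) N \<longleftrightarrow> f \<in> PiE A (\<lambda>_. UNIV) \<rightarrow> space N"
  using count_space_PiM_finite[OF assms, of "\<lambda>_. UNIV :: nat set"] by (auto simp: measurable_def)

lemma measurable_count_space_event:
  "X \<in> measurable M (count_space UNIV) \<Longrightarrow> {\<omega> \<in> space M. P (X \<omega>)} \<in> sets M"
  using measurable_sets[of X M "count_space UNIV" "{x. P x}"] by (simp add: vimage_def Int_def conj_commute)

context prob_space begin

context
  fixes X :: "nat \<Rightarrow> 'e \<Rightarrow> 'a \<Rightarrow> nat" and E :: "'e set" and m :: nat and \<mu> :: real
  assumes E: "finite E" "E \<noteq> {}"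
    and ind: "indep_vars (\<lambda>_. count_space UNIV) (\<lambda>(k, e). X k e) ({..<m} \<times> E)"
    and law: "\<And>k e j. k < m \<Longrightarrow> e \<in> E \<Longrightarrow> j \<le> 1 \<Longrightarrow> prob {\<omega> \<in> space M. X k e \<omega> = j} = \<mu> ^ j * exp (- \<mu>)"
    and mu: "0 \<le> \<mu>"
begin

lemma X_measurable: "k < m \<Longrightarrow> e \<in> E \<Longrightarrow> X k e \<in> measurable M (count_space UNIV)"
  using ind unfolding indep_vars_def by force

text \<open>Only the counts 0 and 1 occur, for which the factorial in the Poisson weight equals 1;
  the product over the edges then depends on the pattern only through its total.\<close>

lemma prob_pattern:
  assumes k: "k < m" and a: "\<And>e. e \<in> E \<Longrightarrow> a e \<le> 1"
  shows "prob {\<omega> \<in> space M. \<forall>e\<in>E. X k e \<omega> = a e} = \<mu> ^ (\<Sum>e\<in>E. a e) * exp (- (real (card E) * \<mu>))"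
proof -
  have "prob (\<Inter>i\<in>{k} \<times> E. (case i of (k, e) \<Rightarrow> X k e) -` {a (snd i)} \<inter> space M)
    = (\<Prod>i\<in>{k} \<times> E. prob ((case i of (k, e) \<Rightarrow> X k e) -` {a (snd i)} \<inter> space M))"
    by (rule indep_varsD[OF ind]) (use k E in auto)
  also have "(\<Inter>i\<in>{k} \<times> E. (case i of (k, e) \<Rightarrow> X k e) -` {a (snd i)} \<inter> space M) = {\<omega> \<in> space M. \<forall>e\<in>E. X k e \<omega> = a e}"
    using E by auto
  also have "(\<Prod>i\<in>{k} \<times> E. prob ((case i of (k, e) \<Rightarrow> X k e) -` {a (snd i)} \<inter> space M))
    = (\<Prod>e\<in>E. prob {\<omega> \<in> space M. X k e \<omega> = a e})"
  proof -
    have "{k} \<times> E = Pair k ` E" by auto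
    moreover have "inj_on (Pair k) E" by (auto simp: inj_on_def)
    ultimately show ?thesis
      by (simp add: prod.reindex vimage_def) (intro prod.cong refl arg_cong[of _ _ prob], auto)
  qed
  also have "\<dots> = (\<Prod>e\<in>E. \<mu> ^ a e * exp (- \<mu>))"
    by (intro prod.cong refl law k a)
  also have "\<dots> = \<mu> ^ (\<Sum>e\<in>E. a e) * exp (- (real (card E) * \<mu>))"
    by (simp add: prod.distrib power_sum exp_of_nat_mult[symmetric])
  finally show ?thesis .
qed

lemma prob_mark_Some:
  assumes "k < m" "e \<in> E"
  shows "prob {\<omega> \<in> space M. mark E (\<lambda>e. X k e \<omega>) = Some e} = \<mu> * exp (- (real (card E) * \<mu>))"
proof -
  have "{\<omega> \<in> space M. mark E (\<lambda>e. X k e \<omega>) = Some e} = {\<omega> \<in> space M. \<forall>e'\<in>E. X k e' \<omega> = of_bool (e' = e)}"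
    using assms by (auto simp: mark_eq_Some_iff[OF E(1)])
  moreover have "(\<Sum>e'\<in>E. of_bool (e' = e) :: nat) = 1"
    using assms E by (simp add: of_bool_def)
  ultimately show ?thesis using prob_pattern[OF assms(1), of "\<lambda>e'. of_bool (e' = e)"] by simp
qed

lemma mark_measurable:
  assumes "k < m"
  shows "(\<lambda>\<omega>. mark E (\<lambda>e. X k e \<omega>)) \<in> measurable M (count_space UNIV)"
proof -
  have "(\<lambda>\<omega>. \<lambda>e\<in>E. X k e \<omega>) \<in> measurable M (PiM E (\<lambda>_. count_space UNIV))"
    by (rule measurable_restrict) (rule X_measurable[OF assms])
  moreover have "mark E \<in> measurable (PiM E (\<lambda>_. count_space UNIV)) (count_space UNIV)"
    by (simp add: measurable_PiM_nat[OF E(1)])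
  ultimately have "(\<lambda>\<omega>. mark E (\<lambda>e\<in>E. X k e \<omega>)) \<in> measurable M (count_space UNIV)"
    by (rule measurable_compose)
  then show ?thesis by (simp cong: mark_cong)
qed

lemma prob_mark_None:
  assumes k: "k < m"
  shows "prob {\<omega> \<in> space M. mark E (\<lambda>e. X k e \<omega>) = None} = 1 - real (card E) * (\<mu> * exp (- (real (card E) * \<mu>)))"
proof -
  let ?A = "\<lambda>c. {\<omega> \<in> space M. mark E (\<lambda>e. X k e \<omega>) = c}"
  have ev: "?A c \<in> events" for c by (rule measurable_count_space_event[OF mark_measurable[OF k]])
  have "space M = (\<Union>c\<in>insert None (Some ` E). ?A c)"
  proof (intro equalityI subsetI)
    fix \<omega> assume "\<omega> \<in> space M"
    then show "\<omega> \<in> (\<Union>c\<in>insert None (Some ` E). ?A c)"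
      by (intro UN_I[OF mark_cases[OF E(1), of "\<lambda>e. X _ e \<omega>"]]) simp
  qed auto
  then have "1 = prob (\<Union>c\<in>insert None (Some ` E). ?A c)" by (metis prob_space)
  also have "\<dots> = (\<Sum>c\<in>insert None (Some ` E). prob (?A c))"
    by (rule finite_measure_finite_Union) (use ev E in \<open>auto simp: disjoint_family_on_def\<close>)
  also have "\<dots> = prob (?A None) + (\<Sum>e\<in>E. prob (?A (Some e)))"
    using E by (simp add: sum.reindex)
  also have "(\<Sum>e\<in>E. prob (?A (Some e))) = (\<Sum>e\<in>E. \<mu> * exp (- (real (card E) * \<mu>)))"
    by (intro sum.cong refl prob_mark_Some k)
  finally show ?thesis by simp
qed

lemma sum_X_measurable: "k < m \<Longrightarrow> (\<lambda>\<omega>. \<Sum>e\<in>E. X k e \<omega>) \<in> measurable M (count_space UNIV)"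
proof -
  assume k: "k < m"
  have [measurable]: "X k e \<in> measurable M (count_space UNIV)" if "e \<in> E" for e by (rule X_measurable[OF k that])
  show ?thesis by measurable
qed

text \<open>With l the total intensity of the step, the complement of at most one ring has
  probability 1 - (1 + l) exp (-l), and exp (-l) \<ge> 1 - l bounds this by l^2. A union over m
  steps of length t / m is then of order 1 / m.\<close>

lemma prob_two_or_more:
  assumes k: "k < m"
  shows "prob {\<omega> \<in> space M. 2 \<le> (\<Sum>e\<in>E. X k e \<omega>)} \<le> (real (card E) * \<mu>)\<^sup>2"
proof -
  let ?l = "real (card E) * \<mu>"
  let ?S = "\<lambda>\<omega>. \<Sum>e\<in>E. X k e \<omega>"
  have ev: "{\<omega> \<in> space M. ?S \<omega> = 0} \<in> events" "{\<omega> \<in> space M. ?S \<omega> = 1} \<in> events" "{\<omega> \<in> space M. 2 \<le> ?S \<omega>} \<in> events"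
    by (rule measurable_count_space_event[OF sum_X_measurable[OF k]])+
  have "{\<omega> \<in> space M. ?S \<omega> = 1} = space M - {\<omega> \<in> space M. mark E (\<lambda>e. X k e \<omega>) = None}"
    by (auto simp: mark_def)
  moreover have "{\<omega> \<in> space M. mark E (\<lambda>e. X k e \<omega>) = None} \<in> events"
    by (rule measurable_count_space_event[OF mark_measurable[OF k]])
  ultimately have p1: "prob {\<omega> \<in> space M. ?S \<omega> = 1} = ?l * exp (- ?l)"
    using prob_compl prob_mark_None[OF k] by simp
  have p0: "prob {\<omega> \<in> space M. ?S \<omega> = 0} = exp (- ?l)"
    using prob_pattern[OF k, of "\<lambda>_. 0"] E by simp
  have "space M = ({\<omega> \<in> space M. ?S \<omega> = 0} \<union> {\<omega> \<in> space M. ?S \<omega> = 1}) \<union> {\<omega> \<in> space M. 2 \<le> ?S \<omega>}"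
    by auto
  then have "1 = prob (({\<omega> \<in> space M. ?S \<omega> = 0} \<union> {\<omega> \<in> space M. ?S \<omega> = 1}) \<union> {\<omega> \<in> space M. 2 \<le> ?S \<omega>})"
    by (metis prob_space)
  also have "\<dots> = prob ({\<omega> \<in> space M. ?S \<omega> = 0} \<union> {\<omega> \<in> space M. ?S \<omega> = 1}) + prob {\<omega> \<in> space M. 2 \<le> ?S \<omega>}"
    by (rule finite_measure_Union) (use ev in auto)
  also have "prob ({\<omega> \<in> space M. ?S \<omega> = 0} \<union> {\<omega> \<in> space M. ?S \<omega> = 1}) = prob {\<omega> \<in> space M. ?S \<omega> = 0} + prob {\<omega> \<in> space M. ?S \<omega> = 1}"
    by (rule finite_measure_Union) (use ev in auto)
  finally have "prob {\<omega> \<in> space M. 2 \<le> ?S \<omega>} = 1 - (1 + ?l) * exp (- ?l)"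
    using p0 p1 by (simp add: algebra_simps)
  moreover have "(1 + ?l) * (1 - ?l) \<le> (1 + ?l) * exp (- ?l)"
    using mu exp_ge_add_one_self[of "- ?l"] by (intro mult_left_mono) auto
  ultimately show ?thesis by (simp add: power2_eq_square algebra_simps)
qed

text \<open>The Markov property of the discretised chain: the mark of step \<open>k\<close> is
  independent of everything built from earlier steps. Dependence on the past is expressed
  functionally by \<open>dep\<close>; measurability is automatic because finitely many discrete
  increments are involved.\<close>

lemma expectation_mark_mult:
  fixes \<Phi> :: "(nat \<times> 'e \<Rightarrow> nat) \<Rightarrow> real"
  assumes k: "k < m"
    and dep: "\<And>p q. (\<And>j e. j < k \<Longrightarrow> e \<in> E \<Longrightarrow> p (j, e) = q (j, e)) \<Longrightarrow> \<Phi> p = \<Phi> q"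
    and bd: "\<And>p. \<bar>\<Phi> p\<bar> \<le> B"
  shows "integrable M (\<lambda>\<omega>. \<Phi> (\<lambda>(j, e). X j e \<omega>))"
    and "expectation (\<lambda>\<omega>. of_bool (mark E (\<lambda>e. X k e \<omega>) = c) * \<Phi> (\<lambda>(j, e). X j e \<omega>))
      = prob {\<omega> \<in> space M. mark E (\<lambda>e. X k e \<omega>) = c} * expectation (\<lambda>\<omega>. \<Phi> (\<lambda>(j, e). X j e \<omega>))"
    and "integrable M (\<lambda>\<omega>. of_bool (mark E (\<lambda>e. X k e \<omega>) = c) * \<Phi> (\<lambda>(j, e). X j e \<omega>))"
proof -
  let ?A = "{..<k} \<times> E" and ?B = "{k} \<times> E"
  let ?X = "\<lambda>(k, e). X k e"
  have iv: "indep_var (PiM ?A (\<lambda>_. count_space UNIV)) (\<lambda>\<omega>. restrict (\<lambda>i. ?X i \<omega>) ?A)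
      (PiM ?B (\<lambda>_. count_space UNIV)) (\<lambda>\<omega>. restrict (\<lambda>i. ?X i \<omega>) ?B)"
    by (rule indep_var_restrict[OF ind]) (use k in auto)
  let ?G = "\<lambda>p. of_bool (mark E (\<lambda>e. p (k, e)) = c) :: real"
  have "indep_var borel (\<Phi> \<circ> (\<lambda>\<omega>. restrict (\<lambda>i. ?X i \<omega>) ?A)) borel (?G \<circ> (\<lambda>\<omega>. restrict (\<lambda>i. ?X i \<omega>) ?B))"
    by (rule indep_var_compose[OF iv]) (use E in \<open>simp_all add: measurable_PiM_nat\<close>)
  moreover have 1: "\<Phi> \<circ> (\<lambda>\<omega>. restrict (\<lambda>i. ?X i \<omega>) ?A) = (\<lambda>\<omega>. \<Phi> (\<lambda>(j, e). X j e \<omega>))"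
    by (rule ext) (auto intro!: dep)
  moreover have 2: "?G \<circ> (\<lambda>\<omega>. restrict (\<lambda>i. ?X i \<omega>) ?B) = (\<lambda>\<omega>. of_bool (mark E (\<lambda>e. X k e \<omega>) = c))"
    by (rule ext) (simp cong: mark_cong)
  ultimately have iv2: "indep_var borel (\<lambda>\<omega>. \<Phi> (\<lambda>(j, e). X j e \<omega>)) borel (\<lambda>\<omega>. of_bool (mark E (\<lambda>e. X k e \<omega>) = c))"
    by simp
  then have meas: "(\<lambda>\<omega>. \<Phi> (\<lambda>(j, e). X j e \<omega>)) \<in> borel_measurable M" "(\<lambda>\<omega>. of_bool (mark E (\<lambda>e. X k e \<omega>) = c) :: real) \<in> borel_measurable M"
    by (auto dest: indep_var_rv1 indep_var_rv2)
  show int1: "integrable M (\<lambda>\<omega>. \<Phi> (\<lambda>(j, e). X j e \<omega>))"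
    by (rule integrable_const_bound[where B=B]) (use bd meas in auto)
  have int2: "integrable M (\<lambda>\<omega>. of_bool (mark E (\<lambda>e. X k e \<omega>) = c) :: real)"
    by (rule integrable_const_bound[where B=1]) (use meas in auto)
  have ev: "{\<omega> \<in> space M. mark E (\<lambda>e. X k e \<omega>) = c} \<in> events"
    by (rule measurable_count_space_event[OF mark_measurable[OF k]])
  have "expectation (\<lambda>\<omega>. of_bool (mark E (\<lambda>e. X k e \<omega>) = c) :: real) = expectation (indicator {\<omega> \<in> space M. mark E (\<lambda>e. X k e \<omega>) = c})"
    by (intro Bochner_Integration.integral_cong) (auto simp: indicator_def)
  then have e2: "expectation (\<lambda>\<omega>. of_bool (mark E (\<lambda>e. X k e \<omega>) = c)) = prob {\<omega> \<in> space M. mark E (\<lambda>e. X k e \<omega>) = c}"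
    using ev by simp
  show "expectation (\<lambda>\<omega>. of_bool (mark E (\<lambda>e. X k e \<omega>) = c) * \<Phi> (\<lambda>(j, e). X j e \<omega>))
      = prob {\<omega> \<in> space M. mark E (\<lambda>e. X k e \<omega>) = c} * expectation (\<lambda>\<omega>. \<Phi> (\<lambda>(j, e). X j e \<omega>))"
    using indep_var_lebesgue_integral[OF iv2 int1 int2] e2 by (simp add: mult.commute)
  show "integrable M (\<lambda>\<omega>. of_bool (mark E (\<lambda>e. X k e \<omega>) = c) * \<Phi> (\<lambda>(j, e). X j e \<omega>))"
    using indep_var_integrable[OF iv2 int1 int2] by (simp add: mult.commute)
qed

end

end

section \<open>Increments of independent Poisson clocks on a time grid\<close>

lemma measurable_nat_diff:
  assumes "f \<in> measurable M (count_space UNIV)" "g \<in> measurable M (count_space UNIV)"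
  shows "(\<lambda>x. f x - g x :: nat) \<in> measurable M (count_space UNIV)"
  using assms by measurable

context prob_space begin

lemma poisson_clock_increment_law:
  assumes P: "poisson_process M r C" and st: "0 \<le> s" "s < t" and r: "0 < r"
  shows "(\<lambda>\<omega>. C t \<omega> - C s \<omega>) \<in> measurable M (count_space UNIV)"
    and "prob {\<omega> \<in> space M. C t \<omega> - C s \<omega> = j} = (r * (t - s)) ^ j / fact j * exp (- (r * (t - s)))"
proof -
  have [measurable]: "C t \<in> measurable M (count_space UNIV)" "C s \<in> measurable M (count_space UNIV)"
    using P st unfolding poisson_process_def by auto
  show m: "(\<lambda>\<omega>. C t \<omega> - C s \<omega>) \<in> measurable M (count_space UNIV)" by measurable
  have "distr M (count_space UNIV) (\<lambda>\<omega>. C t \<omega> - C s \<omega>) = measure_pmf (poisson_pmf (r * (t - s)))"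
    using P st unfolding poisson_process_def by blast
  then have "measure (distr M (count_space UNIV) (\<lambda>\<omega>. C t \<omega> - C s \<omega>)) {j} = pmf (poisson_pmf (r * (t - s))) j"
    by (simp add: measure_pmf_single)
  then show "prob {\<omega> \<in> space M. C t \<omega> - C s \<omega> = j} = (r * (t - s)) ^ j / fact j * exp (- (r * (t - s)))"
    using st r by (simp add: measure_distr[OF m] vimage_def Int_def conj_commute pmf_poisson)
qed

text \<open>Two sources of independence are merged into one family: that of the increments of a
  single clock, and that of different clocks as random elements of path space.\<close>

lemma clock_increments_indep:
  fixes C :: "'e \<Rightarrow> real \<Rightarrow> 'a \<Rightarrow> nat"
  assumes E: "finite E" "E \<noteq> {}" and m: "0 < m" and h: "0 \<le> h"
    and P: "\<And>e. e \<in> E \<Longrightarrow> poisson_process M r (C e)"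
    and ind: "indep_vars (\<lambda>_. Pi\<^sub>M {0..} (\<lambda>_. count_space UNIV)) (\<lambda>e \<omega>. \<lambda>t\<in>{0..}. C e t \<omega>) E"
  shows "indep_vars (\<lambda>_. count_space UNIV)
    (\<lambda>(k, e) \<omega>. C e (real (Suc k) * h) \<omega> - C e (real k * h) \<omega>) ({..<m} \<times> E)"
proof -
  define X where "X = (\<lambda>(k, e) \<omega>. C e (real (Suc k) * h) \<omega> - C e (real k * h) \<omega>)"
  have C_meas [measurable]: "C e t \<in> measurable M (count_space UNIV)" if "e \<in> E" "0 \<le> t" for e t
    using P[OF that(1)] that(2) unfolding poisson_process_def by blast
  have X_meas: "X (k, e) \<in> measurable M (count_space UNIV)" if "e \<in> E" for k e
  proof -
    have [measurable]: "C e (real (Suc k) * h) \<in> measurable M (count_space UNIV)" "C e (real k * h) \<in> measurable M (count_space UNIV)"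
      by (intro C_meas that mult_nonneg_nonneg h of_nat_0_le_iff)+
    show ?thesis unfolding X_def split by measurable
  qed
  have fin: "finite ({..<m} \<times> E)" "{..<m} \<times> E \<noteq> {}" using E m by auto
  have "indep_vars (\<lambda>_. count_space UNIV) X ({..<m} \<times> E) \<longleftrightarrow>
    (\<forall>A\<in>(\<Pi> i\<in>{..<m} \<times> E. UNIV). prob (\<Inter>j\<in>{..<m} \<times> E. X j -` A j \<inter> space M) = (\<Prod>j\<in>{..<m} \<times> E. prob (X j -` A j \<inter> space M)))"
  proof (rule indep_vars_finite[OF fin(2,1)])
    show "sets (count_space UNIV) = sigma_sets (space (count_space (UNIV :: nat set))) UNIV" for i
      using sets.sigma_sets_eq[of "count_space (UNIV :: nat set)"] by simp
    show "X i \<in> measurable M (count_space UNIV)" if "i \<in> {..<m} \<times> E" for i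
      using that X_meas by auto
    show "Int_stable UNIV" by (auto simp: Int_stable_def)
    show "space (count_space UNIV) \<in> (UNIV :: nat set set)" "(UNIV :: nat set set) \<subseteq> Pow (space (count_space UNIV))" by auto
  qed
  moreover have "prob (\<Inter>j\<in>{..<m} \<times> E. X j -` A j \<inter> space M) = (\<Prod>j\<in>{..<m} \<times> E. prob (X j -` A j \<inter> space M))" for A
  proof -
    \<comment> \<open>All constraints on the increments of clock \<open>e\<close>, gathered in one
      cylinder set of its path space. Independence of the clocks factors over \<open>e\<close>, and
      independent increments then factor over the steps \<open>k\<close>.\<close>
    define B where "B e = {p \<in> space (Pi\<^sub>M {0..} (\<lambda>_. count_space UNIV)). \<forall>k<m. p (real (Suc k) * h) - p (real k * h) \<in> A (k, e)}" for e :: 'e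
    have B: "B e \<in> sets (Pi\<^sub>M {0..} (\<lambda>_. count_space UNIV))" for e
    proof -
      have "(\<lambda>p. p (real (Suc k) * h) - p (real k * h)) \<in> measurable (Pi\<^sub>M {0..} (\<lambda>_. count_space UNIV)) (count_space (UNIV :: nat set))" for k
      proof -
        have "(\<lambda>p. p (real j * h)) \<in> measurable (Pi\<^sub>M {0..} (\<lambda>_. count_space UNIV)) (count_space (UNIV :: nat set))" for j
          by (rule measurable_component_singleton) (use h in auto)
        then show ?thesis by (intro measurable_nat_diff)
      qed
      then have "{p \<in> space (Pi\<^sub>M {0..} (\<lambda>_. count_space UNIV)). p (real (Suc k) * h) - p (real k * h) \<in> A (k, e)} \<in> sets (Pi\<^sub>M {0..} (\<lambda>_. count_space UNIV))" for k
        by (rule measurable_count_space_event)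
      then have "(\<Inter>k\<in>{..<m}. {p \<in> space (Pi\<^sub>M {0..} (\<lambda>_. count_space UNIV)). p (real (Suc k) * h) - p (real k * h) \<in> A (k, e)}) \<in> sets (Pi\<^sub>M {0..} (\<lambda>_. count_space UNIV))"
        by (intro sets.finite_INT) (use m in auto)
      moreover have "B e = (\<Inter>k\<in>{..<m}. {p \<in> space (Pi\<^sub>M {0..} (\<lambda>_. count_space UNIV)). p (real (Suc k) * h) - p (real k * h) \<in> A (k, e)})"
        using m by (auto simp: B_def)
      ultimately show ?thesis by simp
    qed
    have pre: "(\<lambda>\<omega>. \<lambda>t\<in>{0..}. C e t \<omega>) -` B e \<inter> space M = (\<Inter>k\<in>{..<m}. X (k, e) -` A (k, e) \<inter> space M)" for e
      using m h by (auto simp: B_def X_def space_PiM)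
    have "prob (\<Inter>j\<in>{..<m} \<times> E. X j -` A j \<inter> space M) = prob (\<Inter>e\<in>E. (\<lambda>\<omega>. \<lambda>t\<in>{0..}. C e t \<omega>) -` B e \<inter> space M)"
      unfolding pre by (rule arg_cong[of _ _ prob]) auto
    also have "\<dots> = (\<Prod>e\<in>E. prob ((\<lambda>\<omega>. \<lambda>t\<in>{0..}. C e t \<omega>) -` B e \<inter> space M))"
      by (rule indep_varsD_finite[OF ind E(2,1)]) (use B in auto)
    also have "\<dots> = (\<Prod>e\<in>E. \<Prod>k<m. prob (X (k, e) -` A (k, e) \<inter> space M))"
    proof (intro prod.cong refl)
      fix e assume "e \<in> E"
      have "\<forall>(\<tau> :: nat \<Rightarrow> real) n. 0 \<le> \<tau> 0 \<and> (\<forall>k<n. \<tau> k \<le> \<tau> (Suc k)) \<longrightarrow>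
        indep_vars (\<lambda>_. count_space UNIV) (\<lambda>k \<omega>. C e (\<tau> (Suc k)) \<omega> - C e (\<tau> k) \<omega>) {..<n}"
        using P[OF \<open>e \<in> E\<close>] unfolding poisson_process_def by blast
      from this[rule_format, of "\<lambda>k. real k * h" m]
      have "indep_vars (\<lambda>_. count_space UNIV) (\<lambda>k. X (k, e)) {..<m}"
        using h by (simp add: X_def algebra_simps)
      from indep_varsD_finite[OF this, of "\<lambda>k. A (k, e)"] m
      show "prob ((\<lambda>\<omega>. \<lambda>t\<in>{0..}. C e t \<omega>) -` B e \<inter> space M) = (\<Prod>k<m. prob (X (k, e) -` A (k, e) \<inter> space M))"
        unfolding pre by (auto simp: lessThan_empty_iff)
    qed
    also have "\<dots> = (\<Prod>j\<in>{..<m} \<times> E. prob (X j -` A j \<inter> space M))"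
      by (subst prod.swap) (simp add: prod.cartesian_product split_def)
    finally show ?thesis .
  qed
  ultimately show ?thesis unfolding X_def by blast
qed

end

section \<open>Arrival times of counting paths\<close>

lemma arrival_increases: "arrival n r \<Longrightarrow> 0 \<le> s \<Longrightarrow> s < r \<Longrightarrow> n s < n r"
  unfolding arrival_def by blast

lemma no_arrival:
  assumes "mono_on {0..} n" "0 \<le> s" "s < r" "r \<le> t" "n t = n s"
  shows "\<not> arrival n r"
proof
  assume "arrival n r"
  then have "n s < n r" using assms arrival_increases by blast
  moreover have "n r \<le> n t" by (rule mono_onD[OF assms(1)]) (use assms in auto)
  ultimately show False using assms by simp
qed

text \<open>The jump sits at the infimum of the times after \<open>s\<close> at which the final
  value is taken. Right continuity of an integer-valued path means that it is constant just to the
  right of each time, so the infimum is attained.\<close>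

lemma unique_arrival:
  fixes n :: "real \<Rightarrow> nat"
  assumes mono: "mono_on {0..} n" and rc: "\<And>t. 0 \<le> t \<Longrightarrow> (n \<longlongrightarrow> n t) (at_right t)"
    and st: "0 \<le> s" "s < t" and inc: "n t = Suc (n s)"
  obtains r where "s < r" "r \<le> t" "arrival n r" "\<And>q. s < q \<Longrightarrow> q \<le> t \<Longrightarrow> q \<noteq> r \<Longrightarrow> \<not> arrival n q"
proof -
  have rc': "\<exists>b>q. \<forall>a. q < a \<and> a < b \<longrightarrow> n a = n q" if "0 \<le> q" for q
  proof -
    have "\<forall>\<^sub>F a in at_right q. n a = n q"
      using rc[OF that] by (simp add: tendsto_discrete)
    then show ?thesis unfolding eventually_at_right_field by auto
  qed
  define A where "A = {q. s < q \<and> q \<le> t \<and> n q = n t}"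
  define r where "r = Inf A"
  have tA: "t \<in> A" using st by (simp add: A_def)
  have bdd: "bdd_below A" by (rule bdd_belowI[of _ s]) (auto simp: A_def)
  have r_le: "r \<le> q" if "q \<in> A" for q unfolding r_def by (rule cInf_lower[OF that bdd])
  have sr: "s \<le> r" unfolding r_def by (rule cInf_greatest) (use tA in \<open>auto simp: A_def\<close>)
  have nr: "n r = n t"
  proof -
    obtain b where b: "b > r" "\<forall>a. r < a \<and> a < b \<longrightarrow> n a = n r" using rc'[of r] sr st by auto
    obtain a where a: "a \<in> A" "a < b" using b(1) tA unfolding r_def by (metis cInf_lessD empty_iff)
    then show ?thesis using b r_le[OF a(1)] by (cases "a = r") (auto simp: A_def)
  qed
  have s_r: "s < r" using nr inc sr by (cases "s = r") auto
  have r_t: "r \<le> t" using r_le[OF tA] .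
  have below: "n q \<le> n s" if "0 \<le> q" "q < r" for q
  proof (cases "q \<le> s")
    case True then show ?thesis using mono that st by (auto simp: mono_on_def)
  next
    case False
    then have "n q \<noteq> n t" using r_le[of q] that r_t by (auto simp: A_def)
    moreover have "n q \<le> n t" using mono that r_t False st by (auto simp: mono_on_def)
    ultimately show ?thesis using inc by simp
  qed
  show ?thesis
  proof
    show "arrival n r" unfolding arrival_def using s_r st nr inc below by (auto simp: less_Suc_eq_le)
    fix q assume q: "s < q" "q \<le> t" "q \<noteq> r"
    show "\<not> arrival n q"
    proof
      assume a: "arrival n q"
      show False
      proof (cases "q < r")
        case True
        then show False using below[of q] arrival_increases[OF a, of s] q st by auto
      next
        case False
        then have "n r < n q" using arrival_increases[OF a, of r] q s_r st by auto
        moreover have "n q \<le> n t" using mono q st by (auto simp: mono_on_def)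
        ultimately show False using nr by simp
      qed
    qed
  qed (use s_r r_t in auto)
qed

section \<open>Second moments of the averaging process\<close>

definition edge_avg :: "real \<Rightarrow> ('d::finite \<times> (real ^ 'd)) option \<Rightarrow> (real ^ 'd \<Rightarrow> real) \<Rightarrow> real ^ 'd \<Rightarrow> real" where
  "edge_avg \<epsilon> c f y = (case c of None \<Rightarrow> f y
    | Some (i, x) \<Rightarrow> if y = x \<or> y = torus_shift \<epsilon> i x then (f x + f (torus_shift \<epsilon> i x)) / 2 else f y)"

text \<open>With at most one ring in the interval, the path is constant before and after it, so the
  left limits in the update rule are the values at time \<open>s\<close>. No further information on
  the path is required at the exact ring time.\<close>

lemma averaging_path_step:
  fixes n :: "'d::finite \<Rightarrow> real ^ 'd \<Rightarrow> real \<Rightarrow> nat"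
  assumes path: "averaging_path (1 / real N) n u0 u" and N: "0 < N"
    and mono: "\<And>i x. x \<in> lat N \<Longrightarrow> mono_on {0..} (n i x)"
    and rc: "\<And>i x t. x \<in> lat N \<Longrightarrow> 0 \<le> t \<Longrightarrow> (n i x \<longlongrightarrow> n i x t) (at_right t)"
    and st: "0 \<le> s" "s < t" and y: "y \<in> lat N"
    and le: "(\<Sum>(i, x)\<in>UNIV \<times> lat N. n i x t - n i x s) \<le> 1"
  shows "u t y = edge_avg (1 / real N) (mark (UNIV \<times> lat N) (\<lambda>(i, x). n i x t - n i x s)) (u s) y"
proof -
  let ?E = "UNIV \<times> lat N :: ('d \<times> (real ^ 'd)) set"
  let ?\<xi> = "\<lambda>(i, x). n i x t - n i x s"
  have E: "finite ?E" by (intro finite_cartesian_product finite_lattice N) simp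
  have const: "u q y = u r y" if "0 \<le> r" "r \<le> q" "\<forall>p\<in>{r<..q}. \<forall>i. \<forall>x\<in>lat N. \<not> arrival (n i x) p" "y \<in> lat N" for r q y
    using path that unfolding averaging_path_def by blast
  have n_le: "n i x s \<le> n i x t" if "x \<in> lat N" for i x
    using mono[OF that] st by (auto simp: mono_on_def)
  show ?thesis
  proof (cases "(\<Sum>e\<in>?E. ?\<xi> e) = 1")
    case True
    then obtain e where "e \<in> ?E" "?\<xi> e = 1" "\<forall>e'\<in>?E. e' \<noteq> e \<longrightarrow> ?\<xi> e' = 0"
      using sum_nat_eq_1_iff[OF E, of ?\<xi>] by blast
    then have mk: "mark ?E ?\<xi> = Some e" using mark_eq_Some_iff[OF E] by blast
    obtain i x where e: "e = (i, x)" by (cases e)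
    have x: "x \<in> lat N" using \<open>e \<in> ?E\<close> e by simp
    have inc: "n i x t = Suc (n i x s)" using \<open>?\<xi> e = 1\<close> e n_le[OF x, of i] by simp
    have other: "n j z t = n j z s" if "z \<in> lat N" "(j, z) \<noteq> (i, x)" for j z
    proof -
      have "(j, z) \<in> ?E" "(j, z) \<noteq> e" using that e by auto
      then have "?\<xi> (j, z) = 0" using \<open>\<forall>e'\<in>?E. e' \<noteq> e \<longrightarrow> ?\<xi> e' = 0\<close> by blast
      then show ?thesis using n_le[OF that(1), of j] by simp
    qed
    obtain r where r: "s < r" "r \<le> t" "arrival (n i x) r" "\<And>q. s < q \<Longrightarrow> q \<le> t \<Longrightarrow> q \<noteq> r \<Longrightarrow> \<not> arrival (n i x) q"
      using unique_arrival[OF mono[OF x] rc[OF x] st inc] by blast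
    have no: "\<not> arrival (n j z) q" if "s < q" "q \<le> t" "q \<noteq> r" "z \<in> lat N" for j z q
      using that r no_arrival[OF mono[OF that(4)] st(1) that(1,2) other[OF that(4)]]
      by (cases "(j, z) = (i, x)") auto
    have left: "left_lim (\<lambda>q. u q z) r = u s z" if "z \<in> lat N" for z
      unfolding left_lim_def
    proof (rule tendsto_Lim)
      have "\<forall>\<^sub>F q in at_left r. u q z = u s z"
        using eventually_at_left_real[OF r(1)]
        by eventually_elim (rule const, use st r no that in auto)
      then show "((\<lambda>q. u q z) \<longlongrightarrow> u s z) (at_left r)" by (rule tendsto_eventually)
    qed simp
    have sx: "torus_shift (1 / real N) i x \<in> lat N" by (rule torus_shift_lattice_next[OF N x])
    have upd: "\<forall>y\<in>lat N. u r y = (if y = x \<or> y = torus_shift (1 / real N) i x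
            then (left_lim (\<lambda>s. u s x) r + left_lim (\<lambda>s. u s (torus_shift (1 / real N) i x)) r) / 2
            else left_lim (\<lambda>s. u s y) r)"
      using path r(3) x unfolding averaging_path_def by blast
    have "u t y = u r y" by (rule const) (use st r no y in auto)
    also have "\<dots> = edge_avg (1 / real N) (Some (i, x)) (u s) y"
      using upd y by (simp add: edge_avg_def left[OF x] left[OF sx] left[OF y])
    finally show ?thesis using mk e by simp
  next
    case False
    then have "(\<Sum>e\<in>?E. ?\<xi> e) = 0" using le by linarith
    then have z: "n i x t = n i x s" if "x \<in> lat N" for i x
    proof -
      have "\<forall>e\<in>?E. ?\<xi> e = 0" by (rule iffD1[OF sum_eq_0_iff[OF E] \<open>(\<Sum>e\<in>?E. ?\<xi> e) = 0\<close>])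
      then have "?\<xi> (i, x) = 0" by (rule bspec) (use that in simp)
      then show ?thesis using n_le[OF that, of i] by simp
    qed
    have "u t y = u s y"
    proof (rule const[OF st(1) less_imp_le[OF st(2)] _ y], intro ballI allI)
      fix q i and x :: "real ^ 'd" assume "q \<in> {s<..t}" "x \<in> lat N"
      then show "\<not> arrival (n i x) q"
        by (intro no_arrival[OF mono st(1) _ _ z]) auto
    qed
    then show ?thesis using False by (simp add: mark_def edge_avg_def)
  qed
qed

lemma edge_avg_bound:
  assumes "0 < n" "c \<in> insert None (Some ` (UNIV \<times> lat n))" "y \<in> lat n" "\<And>z. z \<in> lat n \<Longrightarrow> \<bar>f z\<bar> \<le> B"
  shows "\<bar>edge_avg (1 / real n) c f y\<bar> \<le> B"
proof (cases c)
  case None then show ?thesis using assms by (simp add: edge_avg_def)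
next
  case (Some e)
  obtain i x where e: "e = (i, x)" by (cases e)
  have x: "x \<in> lat n" using assms Some e by auto
  have "\<bar>f x\<bar> \<le> B" "\<bar>f (torus_shift (1 / real n) i x)\<bar> \<le> B"
    using assms(4) x torus_shift_lattice_next[OF assms(1) x] by auto
  then have "\<bar>(f x + f (torus_shift (1 / real n) i x)) / 2\<bar> \<le> B"
    by (simp only: abs_le_iff) (simp add: field_simps)
  then show ?thesis using Some e assms by (simp add: edge_avg_def)
qed

definition ring_mat :: "real \<Rightarrow> ('d::finite \<times> (real ^ 'd)) option \<Rightarrow> real ^ 'd \<Rightarrow> real ^ 'd \<Rightarrow> real" where
  "ring_mat \<epsilon> c y a = edge_avg \<epsilon> c (\<lambda>z. of_bool (z = a)) y"

lemma sum_lattice_delta: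
  assumes "0 < n" "z \<in> lat n"
  shows "(\<Sum>a\<in>lat n. of_bool (z = a) * f a) = (f z :: real)"
proof -
  have "finite (lat n :: (real ^ 'a) set)" by (rule finite_lattice[OF assms(1)])
  moreover have "(\<Sum>a\<in>lat n. of_bool (z = a) * f a) = (\<Sum>a\<in>lat n. if z = a then f a else 0)"
    by (intro sum.cong) auto
  ultimately show ?thesis using assms(2) by simp
qed

lemma edge_avg_ring_mat:
  fixes f :: "real ^ 'd::finite \<Rightarrow> real"
  assumes n: "0 < n" and c: "c \<in> insert None (Some ` (UNIV \<times> lat n))" and y: "y \<in> lat n"
  shows "edge_avg (1 / real n) c f y = (\<Sum>a\<in>lat n. ring_mat (1 / real n) c y a * f a)"
proof (cases c)
  case None then show ?thesis using sum_lattice_delta[OF n y, of f] by (simp add: edge_avg_def ring_mat_def)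
next
  case (Some e)
  obtain i x where e: "e = (i, x)" by (cases e)
  have x: "x \<in> lat n" using c Some e by auto
  note sx = torus_shift_lattice_next[OF n x, of i]
  show ?thesis
    using sum_lattice_delta[OF n x, of f] sum_lattice_delta[OF n sx, of f] sum_lattice_delta[OF n y, of f]
    by (simp add: Some e edge_avg_def ring_mat_def sum.distrib add_divide_distrib
        distrib_right sum_divide_distrib[symmetric] del: sum_of_bool_mult_eq)
qed

text \<open>Both points see the same ring: this is the tensor square of one update, and the common
  ring is what correlates the two walkers.\<close>

definition pair_avg :: "real \<Rightarrow> ('d::finite \<times> (real ^ 'd)) option \<Rightarrow> ((real ^ 'd) \<times> (real ^ 'd) \<Rightarrow> real) \<Rightarrow> (real ^ 'd) \<times> (real ^ 'd) \<Rightarrow> real" where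
  "pair_avg \<epsilon> c v p = edge_avg \<epsilon> c (\<lambda>a. edge_avg \<epsilon> c (\<lambda>b. v (a, b)) (snd p)) (fst p)"

definition pair_mat :: "nat \<Rightarrow> (real ^ 'd::finite) \<times> (real ^ 'd) \<Rightarrow> (real ^ 'd) \<times> (real ^ 'd) \<Rightarrow> real" where
  "pair_mat n p q = (real n)\<^sup>2 * (\<Sum>e\<in>UNIV \<times> lat n. ring_mat (1 / real n) (Some e) (fst p) (fst q) * ring_mat (1 / real n) (Some e) (snd p) (snd q)
     - of_bool (p = q))"

lemma pair_avg_ring_mat:
  fixes v :: "(real ^ 'd::finite) \<times> (real ^ 'd) \<Rightarrow> real"
  assumes n: "0 < n" and c: "c \<in> insert None (Some ` (UNIV \<times> lat n))" and p: "p \<in> lat n \<times> lat n"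
  shows "pair_avg (1 / real n) c v p
    = (\<Sum>q\<in>lat n \<times> lat n. ring_mat (1 / real n) c (fst p) (fst q) * ring_mat (1 / real n) c (snd p) (snd q) * v q)"
proof -
  have p': "fst p \<in> lat n" "snd p \<in> lat n" using p by auto
  show ?thesis
    unfolding pair_avg_def edge_avg_ring_mat[OF n c p'(1)] edge_avg_ring_mat[OF n c p'(2)]
    by (simp add: sum_distrib_left sum.cartesian_product split_def mult_ac)
qed

lemma mat_app_pair:
  fixes v :: "(real ^ 'd::finite) \<times> (real ^ 'd) \<Rightarrow> real"
  assumes n: "0 < n" and p: "p \<in> lat n \<times> lat n"
  shows "mat_app (lat n \<times> lat n) (pair_mat n) v p
    = (real n)\<^sup>2 * (\<Sum>e\<in>UNIV \<times> lat n. pair_avg (1 / real n) (Some e) v p - v p)"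
proof -
  let ?R = "\<lambda>e q. ring_mat (1 / real n) (Some e) (fst p) (fst q) * ring_mat (1 / real n) (Some e) (snd p) (snd q)"
  have fin: "finite (lat n \<times> lat n :: ((real ^ 'd) \<times> (real ^ 'd)) set)" by (intro finite_cartesian_product finite_lattice n)
  have d: "(\<Sum>q\<in>lat n \<times> lat n. of_bool (p = q) * v q) = v p"
  proof -
    have "(\<Sum>q\<in>lat n \<times> lat n. of_bool (p = q) * v q) = (\<Sum>q\<in>lat n \<times> lat n. if p = q then v q else 0)"
      by (intro sum.cong) auto
    then show ?thesis using p fin by simp
  qed
  have "mat_app (lat n \<times> lat n) (pair_mat n) v p
    = (real n)\<^sup>2 * (\<Sum>q\<in>lat n \<times> lat n. \<Sum>e\<in>UNIV \<times> lat n. ?R e q * v q - of_bool (p = q) * v q)"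
    unfolding mat_app_def pair_mat_def by (simp add: sum_distrib_left sum_distrib_right mult.assoc left_diff_distrib)
  also have "\<dots> = (real n)\<^sup>2 * (\<Sum>e\<in>UNIV \<times> lat n. (\<Sum>q\<in>lat n \<times> lat n. ?R e q * v q) - (\<Sum>q\<in>lat n \<times> lat n. of_bool (p = q) * v q))"
    by (subst sum.swap) (simp only: sum_subtractf)
  also have "\<dots> = (real n)\<^sup>2 * (\<Sum>e\<in>UNIV \<times> lat n. pair_avg (1 / real n) (Some e) v p - v p)"
    unfolding d by (intro arg_cong[of _ _ "\<lambda>s. (real n)\<^sup>2 * s"] sum.cong refl arg_cong2[of _ _ _ _ "(-)"] pair_avg_ring_mat[OF n _ p, symmetric]) auto
  finally show ?thesis .
qed

lemma pair_avg_bound: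
  assumes n: "0 < n" and c: "c \<in> insert None (Some ` (UNIV \<times> lat n))" and p: "p \<in> lat n \<times> lat n"
    and B: "\<And>q. q \<in> lat n \<times> lat n \<Longrightarrow> \<bar>v q\<bar> \<le> B"
  shows "\<bar>pair_avg (1 / real n) c v p\<bar> \<le> B"
  unfolding pair_avg_def by (intro edge_avg_bound[OF n c]) (use p B in auto)

text \<open>The exact transition operator of second moments over one time step. A given edge is the
  mark with probability n^2 h exp (-l), where l is the total intensity of the step; all remaining
  probability leaves the configuration unchanged.\<close>

definition pair_step :: "nat \<Rightarrow> real \<Rightarrow> ((real ^ 'd::finite) \<times> (real ^ 'd) \<Rightarrow> real) \<Rightarrow> (real ^ 'd) \<times> (real ^ 'd) \<Rightarrow> real" where
  "pair_step n h v p = v p + h * exp (- (real (card (UNIV \<times> lat n :: ('d \<times> (real ^ 'd)) set)) * ((real n)\<^sup>2 * h)))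
      * mat_app (lat n \<times> lat n) (pair_mat n) v p"

text \<open>Since l exp (-l) \<le> 1, the operator is a convex combination of the identity and of
  pair updates, each a contraction for the supremum. Replacing the factor exp (-l) by 1 costs at
  most l, which is linear in h, and this gives consistency.\<close>

lemma pair_step_tendsto:
  fixes v :: "(real ^ 'd::finite) \<times> (real ^ 'd) \<Rightarrow> real"
  assumes n: "0 < n" and p: "p \<in> lat n \<times> lat n" and t: "0 < t"
  shows "(\<lambda>m. (pair_step n (t / real m) ^^ m) v p) \<longlonglongrightarrow> mat_exp (lat n \<times> lat n) (pair_mat n) t v p"
proof (rule euler_tendsto_mat_exp[OF _ _ _ zero_less_one t p])
  let ?E = "UNIV \<times> lat n :: ('d \<times> (real ^ 'd)) set"
  let ?c = "real (card ?E)"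
  let ?L = "lat n \<times> lat n :: ((real ^ 'd) \<times> (real ^ 'd)) set"
  show fin: "finite ?L" by (intro finite_cartesian_product finite_lattice n)
  have finE: "finite ?E" by (intro finite_cartesian_product finite_lattice n) simp
  fix h B :: real and x assume h: "0 < h" "h < 1" and x: "x \<in> ?L"
  let ?l = "?c * ((real n)\<^sup>2 * h)"
  have l: "0 \<le> ?l" using h by simp
  have le1: "?l * exp (- ?l) \<le> 1"
  proof -
    have "?l \<le> exp ?l" using exp_ge_add_one_self[of ?l] by linarith
    then have "?l * exp (- ?l) \<le> exp ?l * exp (- ?l)" by (intro mult_right_mono) auto
    then show ?thesis by (simp add: exp_minus)
  qed
  {
    fix f g :: "(real ^ 'd) \<times> (real ^ 'd) \<Rightarrow> real"
    assume B: "\<And>x. x \<in> ?L \<Longrightarrow> \<bar>f x - g x\<bar> \<le> B"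
    let ?u = "\<lambda>x. f x - g x"
    define w where "w = h * exp (- ?l) * (real n)\<^sup>2"
    define c where "c = ?c"
    have w: "0 \<le> w" "c * w \<le> 1" using h le1 by (simp_all add: w_def c_def mult_ac)
    have "pair_step n h f x - pair_step n h g x = ?u x + h * exp (- ?l) * mat_app ?L (pair_mat n) ?u x"
      unfolding pair_step_def mat_app_diff[symmetric] by (simp add: algebra_simps)
    \<comment> \<open>The convex combination: weight \<open>w\<close> for every edge and the rest
      for no update. The bound \<open>le1\<close> on \<open>c * w\<close> makes the rest
      nonnegative.\<close>
    also have "\<dots> = (1 - c * w) * ?u x + (\<Sum>e\<in>?E. w * pair_avg (1 / real n) (Some e) ?u x)"
    proof -
      have "(\<Sum>e\<in>?E. pair_avg (1 / real n) (Some e) ?u x - ?u x) = (\<Sum>e\<in>?E. pair_avg (1 / real n) (Some e) ?u x) - ?c * ?u x"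
        by (simp only: sum_subtractf sum_constant right_diff_distrib)
      show ?thesis
        unfolding mat_app_pair[OF n x] \<open>(\<Sum>e\<in>?E. pair_avg (1 / real n) (Some e) ?u x - ?u x) = _\<close> sum_distrib_left[symmetric] w_def c_def
        by (simp add: algebra_simps)
    qed
    also have "\<bar>\<dots>\<bar> \<le> \<bar>(1 - c * w) * ?u x\<bar> + (\<Sum>e\<in>?E. \<bar>w * pair_avg (1 / real n) (Some e) ?u x\<bar>)"
      by (rule order_trans[OF abs_triangle_ineq add_left_mono[OF sum_abs]])
    also have "\<dots> \<le> (1 - c * w) * B + (\<Sum>e\<in>?E. w * B)"
    proof (rule add_mono)
      have "0 \<le> 1 - c * w" using w by simp
      then show "\<bar>(1 - c * w) * ?u x\<bar> \<le> (1 - c * w) * B"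
        using B[OF x] by (simp only: abs_mult abs_of_nonneg mult_left_mono)
      show "(\<Sum>e\<in>?E. \<bar>w * pair_avg (1 / real n) (Some e) ?u x\<bar>) \<le> (\<Sum>e\<in>?E. w * B)"
      proof (rule sum_mono)
        fix e assume "e \<in> ?E"
        have "\<bar>pair_avg (1 / real n) (Some e) ?u x\<bar> \<le> B" by (rule pair_avg_bound[OF n _ x B]) (use \<open>e \<in> ?E\<close> in auto)
        then have "w * \<bar>pair_avg (1 / real n) (Some e) ?u x\<bar> \<le> w * B" using w by (intro mult_left_mono) auto
        then show "\<bar>w * pair_avg (1 / real n) (Some e) ?u x\<bar> \<le> w * B" using w by (simp add: abs_mult)
      qed
    qed
    also have "(\<Sum>e\<in>?E. w * B) = c * (w * B)" by (simp only: sum_constant c_def)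
    also have "(1 - c * w) * B + c * (w * B) = B" by (simp add: algebra_simps)
    finally show "\<bar>pair_step n h f x - pair_step n h g x\<bar> \<le> B" .
  }
  fix f :: "(real ^ 'd) \<times> (real ^ 'd) \<Rightarrow> real"
  assume B: "\<And>x. x \<in> ?L \<Longrightarrow> \<bar>f x\<bar> \<le> B"
  have B0: "0 \<le> B" using B[OF x] by linarith
  have "\<bar>pair_step n h f x - f x - h * mat_app ?L (pair_mat n) f x\<bar> = h * (1 - exp (- ?l)) * \<bar>mat_app ?L (pair_mat n) f x\<bar>"
  proof -
    have "pair_step n h f x - f x - h * mat_app ?L (pair_mat n) f x = - (h * (1 - exp (- ?l)) * mat_app ?L (pair_mat n) f x)"
      unfolding pair_step_def by (simp add: algebra_simps)
    moreover have "0 \<le> h * (1 - exp (- ?l))" using h l by simp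
    then have "\<bar>- (h * (1 - exp (- ?l)) * z)\<bar> = h * (1 - exp (- ?l)) * \<bar>z\<bar>" for z
      by (simp only: abs_minus_cancel abs_mult[of "h * (1 - exp (- ?l))"] abs_of_nonneg)
    ultimately show ?thesis by presburger
  qed
  also have "\<dots> \<le> h * ?l * (mat_bound ?L (pair_mat n) * B)"
  proof (rule mult_mono[OF mult_left_mono mat_app_bound[OF fin x B]])
    show "1 - exp (- ?l) \<le> ?l" using exp_ge_add_one_self[of "- ?l"] by linarith
    show "0 \<le> h" "0 \<le> h * ?l" using h by auto
  qed auto
  also have "\<dots> = (?c * (real n)\<^sup>2 * mat_bound ?L (pair_mat n)) * h\<^sup>2 * B" by (simp add: power2_eq_square)
  finally show "\<bar>pair_step n h f x - f x - h * mat_app ?L (pair_mat n) f x\<bar> \<le> (?c * (real n)\<^sup>2 * mat_bound ?L (pair_mat n)) * h\<^sup>2 * B" .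
qed

text \<open>The averaging dynamics on a time grid as a deterministic functional of the increments,
  with the argument \<open>(k, e)\<close> giving the number of rings of edge \<open>e\<close> in
  step \<open>k\<close>. A step with several rings changes nothing.\<close>

primrec ring_chain :: "nat \<Rightarrow> (nat \<times> ('d::finite \<times> (real ^ 'd)) \<Rightarrow> nat) \<Rightarrow> (real ^ 'd \<Rightarrow> real) \<Rightarrow> nat \<Rightarrow> real ^ 'd \<Rightarrow> real" where
  "ring_chain n p u0 0 = u0"
| "ring_chain n p u0 (Suc k) = edge_avg (1 / real n) (mark (UNIV \<times> lat n) (\<lambda>e. p (k, e))) (ring_chain n p u0 k)"

lemma ring_chain_cong:
  assumes "\<And>j e. j < k \<Longrightarrow> e \<in> UNIV \<times> lat n \<Longrightarrow> p (j, e) = q (j, e)"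
  shows "ring_chain n p u0 k = ring_chain n q u0 k"
  using assms
proof (induction k)
  case (Suc k)
  have "mark (UNIV \<times> lat n) (\<lambda>e. p (k, e)) = mark (UNIV \<times> lat n) (\<lambda>e. q (k, e))"
    by (rule mark_cong) (use Suc in auto)
  then show ?case using Suc by simp
qed simp

lemma finite_edges: "0 < n \<Longrightarrow> finite (UNIV \<times> lat n :: ('d::finite \<times> (real ^ 'd)) set)"
  by (intro finite_cartesian_product finite_lattice) simp

lemma ring_chain_bound:
  assumes n: "0 < n" and "y \<in> lat n" and B: "\<And>z. z \<in> lat n \<Longrightarrow> \<bar>u0 z\<bar> \<le> B"
  shows "\<bar>ring_chain n p u0 k y\<bar> \<le> B"
  using assms(2)
proof (induction k arbitrary: y)
  case (Suc k)
  show ?case unfolding ring_chain.simps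
    by (rule edge_avg_bound[OF n mark_cases[OF finite_edges[OF n]] Suc.prems Suc.IH])
qed (use B in simp)

lemma edge_avg_mult: "edge_avg \<epsilon> c f y * edge_avg \<epsilon> c g z = pair_avg \<epsilon> c (\<lambda>(a, b). f a * g b) (y, z)"
  unfolding pair_avg_def edge_avg_def by (cases c) (auto simp: field_simps split: if_splits)

lemma integral_double_sum:
  fixes F :: "'c \<Rightarrow> 'q \<Rightarrow> 'w \<Rightarrow> real"
  assumes "\<And>c q. q \<in> L \<Longrightarrow> integrable M (F c q)"
  shows "(\<integral>\<omega>. (\<Sum>c\<in>C. \<Sum>q\<in>L. a c q * F c q \<omega>) \<partial>M) = (\<Sum>c\<in>C. \<Sum>q\<in>L. a c q * (\<integral>\<omega>. F c q \<omega> \<partial>M))"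
  by (subst Bochner_Integration.integral_sum) (auto intro!: Bochner_Integration.integrable_sum assms simp: Bochner_Integration.integral_sum assms)

context prob_space begin

text \<open>The last mark is independent of the chain so far, so averaging over it applies the
  transition operator once to the second moments of the previous step.\<close>

lemma expectation_ring_chain:
  fixes X :: "nat \<Rightarrow> 'd::finite \<times> (real ^ 'd) \<Rightarrow> 'a \<Rightarrow> nat"
  assumes n: "0 < n" and h: "0 \<le> h"
    and ind: "indep_vars (\<lambda>_. count_space UNIV) (\<lambda>(k, e). X k e) ({..<m} \<times> (UNIV \<times> lat n))"
    and law: "\<And>k e j. k < m \<Longrightarrow> e \<in> UNIV \<times> lat n \<Longrightarrow> j \<le> 1 \<Longrightarrow>
       prob {\<omega> \<in> space M. X k e \<omega> = j} = ((real n)\<^sup>2 * h) ^ j * exp (- ((real n)\<^sup>2 * h))"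
    and k: "k \<le> m" and p: "p \<in> lat n \<times> lat n"
  shows "expectation (\<lambda>\<omega>. ring_chain n (\<lambda>(j, e). X j e \<omega>) u0 k (fst p) * ring_chain n (\<lambda>(j, e). X j e \<omega>) u0 k (snd p))
    = (pair_step n h ^^ k) (\<lambda>(y, z). u0 y * u0 z) p"
  using k p
proof (induction k arbitrary: p)
  case 0 then show ?case by (simp add: prob_space split_def)
next
  case (Suc k)
  let ?E = "UNIV \<times> lat n :: ('d \<times> (real ^ 'd)) set"
  let ?L = "lat n \<times> lat n :: ((real ^ 'd) \<times> (real ^ 'd)) set"
  let ?C = "insert None (Some ` ?E)"
  let ?R = "\<lambda>c q. ring_mat (1 / real n) c (fst p) (fst q) * ring_mat (1 / real n) c (snd p) (snd q)"
  let ?\<Phi> = "\<lambda>q (P :: nat \<times> ('d \<times> (real ^ 'd)) \<Rightarrow> nat). ring_chain n P u0 k (fst q) * ring_chain n P u0 k (snd q)"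
  let ?X = "\<lambda>\<omega> (j, e). X j e \<omega>"
  let ?mk = "\<lambda>\<omega>. mark ?E (\<lambda>e. X k e \<omega>)"
  let ?mu = "(real n)\<^sup>2 * h"
  let ?W = "(pair_step n h ^^ k) (\<lambda>(y, z). u0 y * u0 z)"
  have km: "k < m" using Suc.prems by simp
  have E: "finite ?E" "?E \<noteq> {}"
    using finite_edges[OF n] Suc.prems(2) by auto
  have finL: "finite ?L" by (intro finite_cartesian_product finite_lattice n)
  have mu: "0 \<le> ?mu" using h by simp
  note fam = E ind law mu
  obtain B where B: "0 \<le> B" "\<And>z. z \<in> lat n \<Longrightarrow> \<bar>u0 z\<bar> \<le> B" using finite_bounded_abs[OF finite_lattice[OF n], of u0] by metis
  have dep: "?\<Phi> q P = ?\<Phi> q Q" if "\<And>j e. j < k \<Longrightarrow> e \<in> ?E \<Longrightarrow> P (j, e) = Q (j, e)" for q P Q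
    using ring_chain_cong[of k n P Q u0] that by simp
  have bd: "\<bar>?\<Phi> q P\<bar> \<le> B * B" if "q \<in> ?L" for q P
    unfolding abs_mult using that B by (intro mult_mono ring_chain_bound[OF n]) auto
  have em1: "integrable M (\<lambda>\<omega>. of_bool (?mk \<omega> = c) * ?\<Phi> q (?X \<omega>))" if "q \<in> ?L" for q c
  proof (rule expectation_mark_mult(3)[OF fam km, where \<Phi>="?\<Phi> q" and B="B * B"])
    show "?\<Phi> q P = ?\<Phi> q Q" if eq: "\<And>j e. j < k \<Longrightarrow> e \<in> ?E \<Longrightarrow> P (j, e) = Q (j, e)" for P Q
      by (rule dep) (rule eq)
  qed (assumption | rule bd[OF that])+
  have em2: "expectation (\<lambda>\<omega>. of_bool (?mk \<omega> = c) * ?\<Phi> q (?X \<omega>)) = prob {\<omega> \<in> space M. ?mk \<omega> = c} * expectation (\<lambda>\<omega>. ?\<Phi> q (?X \<omega>))"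
    if "q \<in> ?L" for q c
  proof (rule expectation_mark_mult(2)[OF fam km, where \<Phi>="?\<Phi> q" and B="B * B"])
    show "?\<Phi> q P = ?\<Phi> q Q" if eq: "\<And>j e. j < k \<Longrightarrow> e \<in> ?E \<Longrightarrow> P (j, e) = Q (j, e)" for P Q
      by (rule dep) (rule eq)
  qed (assumption | rule bd[OF that])+
  have IH: "expectation (\<lambda>\<omega>. ?\<Phi> q (?X \<omega>)) = ?W q" if "q \<in> ?L" for q
    using Suc.IH[OF _ that] km by simp
  have "ring_chain n (?X \<omega>) u0 (Suc k) (fst p) * ring_chain n (?X \<omega>) u0 (Suc k) (snd p)
      = (\<Sum>c\<in>?C. \<Sum>q\<in>?L. ?R c q * (of_bool (?mk \<omega> = c) * ?\<Phi> q (?X \<omega>)))" for \<omega>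
  proof -
    have c: "?mk \<omega> \<in> ?C" by (rule mark_cases[OF E(1)])
    have "ring_chain n (?X \<omega>) u0 (Suc k) (fst p) * ring_chain n (?X \<omega>) u0 (Suc k) (snd p)
      = pair_avg (1 / real n) (?mk \<omega>) (\<lambda>q. ?\<Phi> q (?X \<omega>)) p"
      by (simp add: edge_avg_mult split_def)
    \<comment> \<open>Summing over all possible marks, of which exactly one is realised, separates
      the random mark from updates that are now deterministic matrices.\<close>
    also have "\<dots> = (\<Sum>c\<in>?C. of_bool (?mk \<omega> = c) * pair_avg (1 / real n) c (\<lambda>q. ?\<Phi> q (?X \<omega>)) p)"
    proof -
      have "(\<Sum>c\<in>?C. of_bool (?mk \<omega> = c) * pair_avg (1 / real n) c (\<lambda>q. ?\<Phi> q (?X \<omega>)) p)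
        = (\<Sum>c\<in>?C. if ?mk \<omega> = c then pair_avg (1 / real n) c (\<lambda>q. ?\<Phi> q (?X \<omega>)) p else 0)"
        by (intro sum.cong) auto
      also have "\<dots> = pair_avg (1 / real n) (?mk \<omega>) (\<lambda>q. ?\<Phi> q (?X \<omega>)) p"
        using c E(1) by (subst sum.delta') auto
      finally show ?thesis by simp
    qed
    also have "\<dots> = (\<Sum>c\<in>?C. \<Sum>q\<in>?L. ?R c q * (of_bool (?mk \<omega> = c) * ?\<Phi> q (?X \<omega>)))"
      by (intro sum.cong refl) (subst pair_avg_ring_mat[OF n _ Suc.prems(2)], simp, simp add: sum_distrib_left mult_ac)
    finally show ?thesis .
  qed
  then have "expectation (\<lambda>\<omega>. ring_chain n (?X \<omega>) u0 (Suc k) (fst p) * ring_chain n (?X \<omega>) u0 (Suc k) (snd p))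
      = expectation (\<lambda>\<omega>. \<Sum>c\<in>?C. \<Sum>q\<in>?L. ?R c q * (of_bool (?mk \<omega> = c) * ?\<Phi> q (?X \<omega>)))" by presburger
  also have "\<dots> = (\<Sum>c\<in>?C. \<Sum>q\<in>?L. ?R c q * expectation (\<lambda>\<omega>. of_bool (?mk \<omega> = c) * ?\<Phi> q (?X \<omega>)))"
    by (rule integral_double_sum) (rule em1)
  also have "\<dots> = (\<Sum>c\<in>?C. \<Sum>q\<in>?L. ?R c q * (prob {\<omega> \<in> space M. ?mk \<omega> = c} * ?W q))"
  proof -
    have "expectation (\<lambda>\<omega>. of_bool (?mk \<omega> = c) * ?\<Phi> q (?X \<omega>)) = prob {\<omega> \<in> space M. ?mk \<omega> = c} * ?W q" if "q \<in> ?L" for c q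
      unfolding IH[OF that, symmetric] by (rule em2[OF that])
    then show ?thesis by (intro sum.cong refl arg_cong2[where f="(*)"])
  qed
  also have "\<dots> = (\<Sum>c\<in>?C. prob {\<omega> \<in> space M. ?mk \<omega> = c} * pair_avg (1 / real n) c ?W p)"
    by (intro sum.cong refl) (subst pair_avg_ring_mat[OF n _ Suc.prems(2)], simp, simp add: sum_distrib_left mult_ac)
  also have "\<dots> = prob {\<omega> \<in> space M. ?mk \<omega> = None} * pair_avg (1 / real n) None ?W p
      + (\<Sum>e\<in>?E. prob {\<omega> \<in> space M. ?mk \<omega> = Some e} * pair_avg (1 / real n) (Some e) ?W p)"
    using E by (simp add: sum.reindex)
  also have "\<dots> = (1 - real (card ?E) * (?mu * exp (- (real (card ?E) * ?mu)))) * ?W p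
      + (\<Sum>e\<in>?E. ?mu * exp (- (real (card ?E) * ?mu)) * pair_avg (1 / real n) (Some e) ?W p)"
  proof -
    have "prob {\<omega> \<in> space M. ?mk \<omega> = None} = 1 - real (card ?E) * (?mu * exp (- (real (card ?E) * ?mu)))"
      by (rule prob_mark_None[OF fam km]; assumption)
    moreover have "prob {\<omega> \<in> space M. ?mk \<omega> = Some e} = ?mu * exp (- (real (card ?E) * ?mu))" if "e \<in> ?E" for e
      by (rule prob_mark_Some[OF fam km that]; assumption)
    moreover have "pair_avg (1 / real n) None ?W p = ?W p" by (simp add: pair_avg_def edge_avg_def)
    ultimately show ?thesis by (simp only: cong: sum.cong)
  qed
  also have "\<dots> = pair_step n h ?W p"
  proof -
    have "(\<Sum>e\<in>?E. pair_avg (1 / real n) (Some e) ?W p - ?W p) = (\<Sum>e\<in>?E. pair_avg (1 / real n) (Some e) ?W p) - real (card ?E) * ?W p"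
      by (simp only: sum_subtractf sum_constant right_diff_distrib)
    show ?thesis
      unfolding pair_step_def[of n h ?W p] mat_app_pair[OF n Suc.prems(2)]
      unfolding \<open>(\<Sum>e\<in>?E. pair_avg (1 / real n) (Some e) ?W p - ?W p) = _\<close> sum_distrib_left[symmetric]
      by (simp add: algebra_simps)
  qed
  finally show ?case by simp
qed

end

section \<open>From the discretised chain to the second moments of the process\<close>

definition second_moment :: "nat \<Rightarrow> (real ^ 'd::finite \<Rightarrow> real) \<Rightarrow> real \<Rightarrow> (real ^ 'd) \<times> (real ^ 'd) \<Rightarrow> real" where
  "second_moment n u0 s = mat_exp (lat n \<times> lat n) (pair_mat n) s (\<lambda>(y, z). u0 y * u0 z)"

text \<open>The expected squared discrete gradient, expanded into second moments. It is defined from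
  the moment equation alone, so that the analysis of the limit is free of probability.\<close>

definition grad_energy :: "nat \<Rightarrow> (real ^ 'd::finite \<Rightarrow> real) \<Rightarrow> 'd \<Rightarrow> real \<Rightarrow> real ^ 'd \<Rightarrow> real" where
  "grad_energy n u0 i s x = (let v = second_moment n u0 s; y = torus_shift (1 / real n) i x
     in (real n)\<^sup>2 * (v (y, y) + v (x, x) - v (y, x) - v (x, y)))"

lemma edge_avg_cong:
  assumes "0 < n" "c \<in> insert None (Some ` (UNIV \<times> lat n))" "y \<in> lat n" "\<And>z. z \<in> lat n \<Longrightarrow> f z = g z"
  shows "edge_avg (1 / real n) c f y = edge_avg (1 / real n) c g y"
  unfolding edge_avg_ring_mat[OF assms(1-3)] by (intro sum.cong refl) (simp add: assms(4))

lemma averaging_path_ring_chain: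
  fixes C :: "'d::finite \<Rightarrow> real ^ 'd \<Rightarrow> real \<Rightarrow> nat"
  assumes path: "averaging_path (1 / real n) C u0 u" and n: "0 < n" and h: "0 < h"
    and mono: "\<And>i x. x \<in> lat n \<Longrightarrow> mono_on {0..} (C i x)"
    and rc: "\<And>i x t. x \<in> lat n \<Longrightarrow> 0 \<le> t \<Longrightarrow> (C i x \<longlongrightarrow> C i x t) (at_right t)"
    and le: "\<And>k. k < m \<Longrightarrow> (\<Sum>e\<in>UNIV \<times> lat n. C (fst e) (snd e) (real (Suc k) * h) - C (fst e) (snd e) (real k * h)) \<le> 1"
    and k: "k \<le> m" and y: "y \<in> lat n"
  shows "u (real k * h) y = ring_chain n (\<lambda>(j, e). C (fst e) (snd e) (real (Suc j) * h) - C (fst e) (snd e) (real j * h)) u0 k y"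
  using k y
proof (induction k arbitrary: y)
  case 0 then show ?case using path by (simp add: averaging_path_def)
next
  case (Suc k)
  have lt: "real k * h < real (Suc k) * h" using h by simp
  have "u (real (Suc k) * h) y = edge_avg (1 / real n) (mark (UNIV \<times> lat n)
      (\<lambda>(i, x). C i x (real (Suc k) * h) - C i x (real k * h))) (u (real k * h)) y"
    by (rule averaging_path_step[OF path n mono rc _ lt Suc.prems(2)])
      (use h le[of k] Suc.prems in \<open>auto simp: split_def\<close>)
  also have "\<dots> = edge_avg (1 / real n) (mark (UNIV \<times> lat n)
      (\<lambda>(i, x). C i x (real (Suc k) * h) - C i x (real k * h)))
      (ring_chain n (\<lambda>(j, e). C (fst e) (snd e) (real (Suc j) * h) - C (fst e) (snd e) (real j * h)) u0 k) y"
    by (rule edge_avg_cong[OF n mark_cases[OF finite_edges[OF n]] Suc.prems(2)]) (use Suc in auto)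
  finally show ?case by (simp only: ring_chain.simps split_def prod.sel)
qed

context
  fixes M :: "'w measure" and n :: nat
    and C :: "'d::finite \<Rightarrow> real ^ 'd \<Rightarrow> real \<Rightarrow> 'w \<Rightarrow> nat"
    and u0 :: "real ^ 'd \<Rightarrow> real" and U :: "real \<Rightarrow> real ^ 'd \<Rightarrow> 'w \<Rightarrow> real" and B :: real
  assumes ps: "prob_space M" and n: "0 < n"
    and clocks: "iid_poisson_clocks M (1 / real n) C"
    and process: "averaging_process M (1 / real n) C u0 U"
    and B: "\<And>y. y \<in> lat n \<Longrightarrow> \<bar>u0 y\<bar> \<le> B"
begin

interpretation prob_space M by (rule ps)

lemma U_measurable: "0 \<le> t \<Longrightarrow> y \<in> lat n \<Longrightarrow> U t y \<in> borel_measurable M"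
  using process by (simp add: averaging_process_def)

text \<open>The process at time t equals the chain unless one of the m steps contains two rings. The
  quadratic bound on each step, summed over m steps of length t / m, yields
  \<open>K / real m\<close>.\<close>

lemma discretised_chain:
  assumes t: "0 < t" and m: "0 < m"
  defines "h \<equiv> t / real m"
  defines "X \<equiv> \<lambda>k e \<omega>. C (fst e) (snd e) (real (Suc k) * h) \<omega> - C (fst e) (snd e) (real k * h) \<omega>"
  obtains Bad K where "Bad \<in> events" "prob Bad \<le> K / real m" "K = (real (card (UNIV \<times> lat n :: ('d \<times> (real ^ 'd)) set)) * ((real n)\<^sup>2 * t))\<^sup>2"
    "AE \<omega> in M. \<omega> \<notin> Bad \<longrightarrow> (\<forall>y\<in>lat n. U t y \<omega> = ring_chain n (\<lambda>(j, e). X j e \<omega>) u0 m y)"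
    "\<And>p. p \<in> lat n \<times> lat n \<Longrightarrow> integrable M (\<lambda>\<omega>. ring_chain n (\<lambda>(j, e). X j e \<omega>) u0 m (fst p) * ring_chain n (\<lambda>(j, e). X j e \<omega>) u0 m (snd p))"
    "\<And>p. p \<in> lat n \<times> lat n \<Longrightarrow> expectation (\<lambda>\<omega>. ring_chain n (\<lambda>(j, e). X j e \<omega>) u0 m (fst p) * ring_chain n (\<lambda>(j, e). X j e \<omega>) u0 m (snd p))
       = (pair_step n (t / real m) ^^ m) (\<lambda>(y, z). u0 y * u0 z) p"
proof -
  let ?E = "UNIV \<times> lat n :: ('d \<times> (real ^ 'd)) set"
  let ?mu = "(real n)\<^sup>2 * h"
  have h: "0 < h" using t m by (simp add: h_def)
  have "(0 :: real ^ 'd) \<in> lat n" using n by (auto simp: torus_lattice_iff)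
  then have E: "finite ?E" "?E \<noteq> {}" using finite_edges[OF n] by auto
  have P: "poisson_process M ((real n)\<^sup>2) (C (fst e) (snd e))" if "e \<in> ?E" for e
    using clocks that n by (auto simp: iid_poisson_clocks_def power_divide)
  have ic: "indep_vars (\<lambda>_. Pi\<^sub>M {0..} (\<lambda>_. count_space UNIV)) (\<lambda>e \<omega>. \<lambda>t\<in>{0..}. C (fst e) (snd e) t \<omega>) ?E"
    using clocks by (simp add: iid_poisson_clocks_def split_def)
  \<comment> \<open>One step more than the chain uses: integrability after \<open>m\<close> steps is
    read off from the lemma about the mark of step \<open>m\<close>, whose index must lie in the
    family.\<close>
  have ind: "indep_vars (\<lambda>_. count_space UNIV) (\<lambda>(k, e). X k e) ({..<Suc m} \<times> ?E)"
    using clock_increments_indep[OF E _ _ P ic, of "Suc m" h] h by (simp add: X_def split_def)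
  have law: "prob {\<omega> \<in> space M. X k e \<omega> = j} = ?mu ^ j * exp (- ?mu)" if "k < Suc m" "e \<in> ?E" "j \<le> 1" for k e j
  proof -
    have "prob {\<omega> \<in> space M. X k e \<omega> = j}
      = ((real n)\<^sup>2 * (real (Suc k) * h - real k * h)) ^ j / fact j * exp (- ((real n)\<^sup>2 * (real (Suc k) * h - real k * h)))"
      unfolding X_def by (rule poisson_clock_increment_law(2)[OF P[OF that(2)]]) (use h n in auto)
    moreover have "real (Suc k) * h - real k * h = h" by (simp add: algebra_simps)
    moreover have "fact j = (1 :: real)" using that(3) by (cases j) auto
    ultimately show ?thesis by simp
  qed
  have mu: "0 \<le> ?mu" using h by simp
  define Bad where "Bad = (\<Union>k<m. {\<omega> \<in> space M. 2 \<le> (\<Sum>e\<in>?E. X k e \<omega>)})"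
  have ev: "{\<omega> \<in> space M. 2 \<le> (\<Sum>e\<in>?E. X k e \<omega>)} \<in> events" if "k < m" for k
    by (rule measurable_count_space_event, rule sum_X_measurable[OF E ind law mu]) (use that in auto)
  show ?thesis
  proof (rule that)
    show "Bad \<in> events" unfolding Bad_def using ev by auto
    have "prob Bad \<le> (\<Sum>k<m. prob {\<omega> \<in> space M. 2 \<le> (\<Sum>e\<in>?E. X k e \<omega>)})"
      unfolding Bad_def by (rule finite_measure_subadditive_finite) (use ev in auto)
    also have "\<dots> \<le> (\<Sum>k<m. (real (card ?E) * ?mu)\<^sup>2)"
    proof (rule sum_mono)
      fix k assume "k \<in> {..<m}"
      show "prob {\<omega> \<in> space M. 2 \<le> (\<Sum>e\<in>?E. X k e \<omega>)} \<le> (real (card ?E) * ?mu)\<^sup>2"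
        by (rule prob_two_or_more[OF E ind law mu]) (use \<open>k \<in> {..<m}\<close> in auto)
    qed
    also have "\<dots> = (real (card ?E) * ((real n)\<^sup>2 * t))\<^sup>2 / real m"
      using m by (simp add: h_def power2_eq_square field_simps)
    finally show "prob Bad \<le> (real (card ?E) * ((real n)\<^sup>2 * t))\<^sup>2 / real m" .
    have "AE \<omega> in M. averaging_path (1 / real n) (\<lambda>i x t. C i x t \<omega>) u0 (\<lambda>t x. U t x \<omega>)"
      using process by (simp add: averaging_process_def)
    then show "AE \<omega> in M. \<omega> \<notin> Bad \<longrightarrow> (\<forall>y\<in>lat n. U t y \<omega> = ring_chain n (\<lambda>(j, e). X j e \<omega>) u0 m y)"
    proof (rule AE_mp, intro AE_I2 impI ballI)
      fix \<omega> and y :: "real ^ 'd" assume \<omega>: "\<omega> \<in> space M" "\<omega> \<notin> Bad" and path: "averaging_path (1 / real n) (\<lambda>i x t. C i x t \<omega>) u0 (\<lambda>t x. U t x \<omega>)"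
        and y: "y \<in> lat n"
      have P': "poisson_process M ((real n)\<^sup>2) (C i x)" if "x \<in> lat n" for i x using P[of "(i, x)"] that by simp
      have "U (real m * h) y \<omega> = ring_chain n (\<lambda>(j, e). C (fst e) (snd e) (real (Suc j) * h) \<omega> - C (fst e) (snd e) (real j * h) \<omega>) u0 m y"
      proof (rule averaging_path_ring_chain[OF path n h _ _ _ order_refl y])
        show "mono_on {0..} (\<lambda>t. C i x t \<omega>)" if "x \<in> lat n" for i x
          using P'[OF that] \<omega> unfolding poisson_process_def by blast
        show "((\<lambda>t. C i x t \<omega>) \<longlongrightarrow> C i x t \<omega>) (at_right t)" if "x \<in> lat n" "0 \<le> t" for i x t
          using P'[OF that(1)] \<omega> that(2) unfolding poisson_process_def by blast
        show "(\<Sum>e\<in>?E. C (fst e) (snd e) (real (Suc k) * h) \<omega> - C (fst e) (snd e) (real k * h) \<omega>) \<le> 1" if "k < m" for k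
          using \<omega> that unfolding Bad_def X_def by fastforce
      qed
      then show "U t y \<omega> = ring_chain n (\<lambda>(j, e). X j e \<omega>) u0 m y" using m by (simp add: h_def X_def)
    qed
  next
    fix p :: "(real ^ 'd) \<times> (real ^ 'd)" assume p: "p \<in> lat n \<times> lat n"
    have B0: "0 \<le> B" using B[of "fst p"] p by force
    show "integrable M (\<lambda>\<omega>. ring_chain n (\<lambda>(j, e). X j e \<omega>) u0 m (fst p) * ring_chain n (\<lambda>(j, e). X j e \<omega>) u0 m (snd p))"
    proof (rule expectation_mark_mult(1)[OF E ind law mu, where \<Phi>="\<lambda>P. ring_chain n P u0 m (fst p) * ring_chain n P u0 m (snd p)" and B="B * B"])
      show "m < Suc m" by simp
      show "ring_chain n P u0 m (fst p) * ring_chain n P u0 m (snd p) = ring_chain n Q u0 m (fst p) * ring_chain n Q u0 m (snd p)"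
        if "\<And>j e. j < m \<Longrightarrow> e \<in> ?E \<Longrightarrow> P (j, e) = Q (j, e)" for P Q
        using ring_chain_cong[of m n P Q u0] that by simp
      show "\<bar>ring_chain n P u0 m (fst p) * ring_chain n P u0 m (snd p)\<bar> \<le> B * B" for P
        unfolding abs_mult using p B B0 by (intro mult_mono ring_chain_bound[OF n]) auto
    qed assumption+
    show "expectation (\<lambda>\<omega>. ring_chain n (\<lambda>(j, e). X j e \<omega>) u0 m (fst p) * ring_chain n (\<lambda>(j, e). X j e \<omega>) u0 m (snd p))
       = (pair_step n (t / real m) ^^ m) (\<lambda>(y, z). u0 y * u0 z) p"
      unfolding h_def[symmetric] by (rule expectation_ring_chain[OF n _ ind law _ p]) (use h in auto)
  qed simp
qed

text \<open>The chain satisfies the bound surely and agrees with the process outside an event of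
  probability \<open>K / real m\<close>; letting m grow, the exceptional set becomes null.\<close>

lemma U_bounded:
  assumes t: "0 \<le> t" and y: "y \<in> lat n"
  shows "AE \<omega> in M. \<bar>U t y \<omega>\<bar> \<le> B"
proof (cases "t = 0")
  case True
  have "AE \<omega> in M. averaging_path (1 / real n) (\<lambda>i x t. C i x t \<omega>) u0 (\<lambda>t x. U t x \<omega>)"
    using process by (simp add: averaging_process_def)
  then show ?thesis by eventually_elim (use B y True in \<open>simp add: averaging_path_def\<close>)
next
  case False
  then have t0: "0 < t" using t by simp
  let ?A = "{\<omega> \<in> space M. \<not> \<bar>U t y \<omega>\<bar> \<le> B}"
  have A: "?A \<in> events" using U_measurable[OF t y] by measurable
  define K where "K = (real (card (UNIV \<times> lat n :: ('d \<times> (real ^ 'd)) set)) * ((real n)\<^sup>2 * t))\<^sup>2"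
  have le: "prob ?A \<le> K / real m" if m: "0 < m" for m
  proof -
    obtain Bad K' where bad: "Bad \<in> events" "prob Bad \<le> K' / real m" "K' = (real (card (UNIV \<times> lat n :: ('d \<times> (real ^ 'd)) set)) * ((real n)\<^sup>2 * t))\<^sup>2"
      "AE \<omega> in M. \<omega> \<notin> Bad \<longrightarrow> (\<forall>y\<in>lat n. U t y \<omega> = ring_chain n (\<lambda>(j, e). C (fst e) (snd e) (real (Suc j) * (t / real m)) \<omega> - C (fst e) (snd e) (real j * (t / real m)) \<omega>) u0 m y)"
      by (rule discretised_chain[OF t0 m])
    have "prob ?A \<le> prob Bad"
    proof (rule finite_measure_mono_AE)
      show "AE \<omega> in M. \<omega> \<in> ?A \<longrightarrow> \<omega> \<in> Bad"
        using bad(4) by eventually_elim (use ring_chain_bound[OF n y B] y in auto)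
    qed (rule bad(1))
    then show ?thesis using bad(2,3) by (simp add: K_def)
  qed
  have "(\<lambda>m. K / real m) \<longlonglongrightarrow> 0"
    by (rule tendsto_divide_0[OF tendsto_const], rule filterlim_at_top_imp_at_infinity, rule filterlim_real_sequentially)
  then have "prob ?A \<le> 0"
    by (rule tendsto_lowerbound) (auto intro!: eventually_mono[OF eventually_gt_at_top[of 0]] le)
  then have "prob ?A = 0" by (simp add: measure_le_0_iff)
  then show ?thesis using A by (subst AE_iff_measurable[OF A refl]) (simp add: emeasure_eq_measure)
qed

lemma U_product_integrable:
  assumes t: "0 \<le> t" and p: "p \<in> lat n \<times> lat n"
  shows "integrable M (\<lambda>\<omega>. U t (fst p) \<omega> * U t (snd p) \<omega>)"
proof (rule integrable_const_bound[where B="B * B"])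
  have "AE \<omega> in M. \<bar>U t (fst p) \<omega>\<bar> \<le> B" "AE \<omega> in M. \<bar>U t (snd p) \<omega>\<bar> \<le> B"
    using U_bounded[OF t] p by auto
  then show "AE \<omega> in M. norm (U t (fst p) \<omega> * U t (snd p) \<omega>) \<le> B * B"
    by eventually_elim (auto simp: abs_mult intro!: mult_mono)
  show "(\<lambda>\<omega>. U t (fst p) \<omega> * U t (snd p) \<omega>) \<in> borel_measurable M"
    using U_measurable[OF t] p by (intro borel_measurable_times) auto
qed

text \<open>Process and chain are bounded by \<open>B\<close> and differ only on an event of
  probability at most \<open>K / real m\<close>, so their moments differ by at most 2 B^2 K / m. The
  moments of the chain are Euler iterates and converge to the matrix exponential.\<close>

lemma expectation_U_product:
  assumes t: "0 \<le> t" and p: "p \<in> lat n \<times> lat n"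
  shows "expectation (\<lambda>\<omega>. U t (fst p) \<omega> * U t (snd p) \<omega>) = second_moment n u0 t p"
proof (cases "t = 0")
  case True
  have "AE \<omega> in M. averaging_path (1 / real n) (\<lambda>i x t. C i x t \<omega>) u0 (\<lambda>t x. U t x \<omega>)"
    using process by (simp add: averaging_process_def)
  then have "AE \<omega> in M. U t (fst p) \<omega> * U t (snd p) \<omega> = u0 (fst p) * u0 (snd p)"
    by eventually_elim (use p True in \<open>auto simp: averaging_path_def\<close>)
  then have "expectation (\<lambda>\<omega>. U t (fst p) \<omega> * U t (snd p) \<omega>) = expectation (\<lambda>\<omega>. u0 (fst p) * u0 (snd p))"
    using U_product_integrable[OF t p] by (intro integral_cong_AE) auto
  then show ?thesis using True by (simp add: second_moment_def prob_space split_def)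
next
  case False
  then have t0: "0 < t" using t by simp
  let ?V = "expectation (\<lambda>\<omega>. U t (fst p) \<omega> * U t (snd p) \<omega>)"
  let ?T = "\<lambda>m. (pair_step n (t / real m) ^^ m) (\<lambda>(y, z). u0 y * u0 z) p"
  define K where "K = (real (card (UNIV \<times> lat n :: ('d \<times> (real ^ 'd)) set)) * ((real n)\<^sup>2 * t))\<^sup>2"
  have B0: "0 \<le> B" using B[of "fst p"] p by force
  have le: "\<bar>?T m - ?V\<bar> \<le> 2 * B * B * K / real m" if m: "0 < m" for m
  proof -
    let ?R = "\<lambda>\<omega>. ring_chain n (\<lambda>(j, e). C (fst e) (snd e) (real (Suc j) * (t / real m)) \<omega> - C (fst e) (snd e) (real j * (t / real m)) \<omega>) u0 m"
    obtain Bad K' where bad: "Bad \<in> events" "prob Bad \<le> K' / real m" "K' = (real (card (UNIV \<times> lat n :: ('d \<times> (real ^ 'd)) set)) * ((real n)\<^sup>2 * t))\<^sup>2"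
      "AE \<omega> in M. \<omega> \<notin> Bad \<longrightarrow> (\<forall>y\<in>lat n. U t y \<omega> = ?R \<omega> y)"
      "integrable M (\<lambda>\<omega>. ?R \<omega> (fst p) * ?R \<omega> (snd p))"
      "expectation (\<lambda>\<omega>. ?R \<omega> (fst p) * ?R \<omega> (snd p)) = ?T m"
      by (rule discretised_chain[OF t0 m]) (use p in auto)
    have "\<bar>?T m - ?V\<bar> = \<bar>expectation (\<lambda>\<omega>. ?R \<omega> (fst p) * ?R \<omega> (snd p) - U t (fst p) \<omega> * U t (snd p) \<omega>)\<bar>"
      using bad(5,6) U_product_integrable[OF t p] by simp
    also have "\<dots> \<le> expectation (\<lambda>\<omega>. \<bar>?R \<omega> (fst p) * ?R \<omega> (snd p) - U t (fst p) \<omega> * U t (snd p) \<omega>\<bar>)"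
      by (rule integral_abs_bound)
    also have "\<dots> \<le> expectation (\<lambda>\<omega>. 2 * B * B * indicator Bad \<omega>)"
    proof (rule integral_mono_AE)
      show "integrable M (\<lambda>\<omega>. \<bar>?R \<omega> (fst p) * ?R \<omega> (snd p) - U t (fst p) \<omega> * U t (snd p) \<omega>\<bar>)"
        using bad(5) U_product_integrable[OF t p] by simp
      show "integrable M (\<lambda>\<omega>. 2 * B * B * indicator Bad \<omega>)"
        by (intro integrable_mult_right integrable_real_indicator bad(1)) (simp add: less_top[symmetric])
      have "AE \<omega> in M. \<bar>U t (fst p) \<omega>\<bar> \<le> B" "AE \<omega> in M. \<bar>U t (snd p) \<omega>\<bar> \<le> B"
        using U_bounded[OF t] p by auto
      then show "AE \<omega> in M. \<bar>?R \<omega> (fst p) * ?R \<omega> (snd p) - U t (fst p) \<omega> * U t (snd p) \<omega>\<bar> \<le> 2 * B * B * indicator Bad \<omega>"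
        using bad(4)
      proof eventually_elim
        case (elim \<omega>)
        have 1: "\<bar>?R \<omega> (fst p) * ?R \<omega> (snd p)\<bar> \<le> B * B"
          unfolding abs_mult using p B B0 by (intro mult_mono ring_chain_bound[OF n]) auto
        have 2: "\<bar>U t (fst p) \<omega> * U t (snd p) \<omega>\<bar> \<le> B * B"
          unfolding abs_mult using elim B0 by (intro mult_mono) auto
        show ?case
        proof (cases "\<omega> \<in> Bad")
          case True then show ?thesis using 1 2 by simp
        next
          case False then show ?thesis using elim p by (auto simp: mem_Times_iff)
        qed
      qed
    qed
    also have "\<dots> = 2 * B * B * prob Bad" using bad(1) by simp
    also have "\<dots> \<le> 2 * B * B * (K / real m)" using bad(2,3) B0 by (intro mult_left_mono) (auto simp: K_def)
    finally show ?thesis by simp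
  qed
  have "(\<lambda>m. 2 * B * B * K / real m) \<longlonglongrightarrow> 0"
    by (rule tendsto_divide_0[OF tendsto_const], rule filterlim_at_top_imp_at_infinity, rule filterlim_real_sequentially)
  then have "(\<lambda>m. ?T m - ?V) \<longlonglongrightarrow> 0"
    by (rule Lim_null_comparison[rotated]) (auto intro!: eventually_mono[OF eventually_gt_at_top[of 0]] simp: le)
  then have "?T \<longlonglongrightarrow> ?V" by (simp add: LIM_zero_iff)
  then show ?thesis
    unfolding second_moment_def using pair_step_tendsto[OF n p t0] LIMSEQ_unique by blast
qed

lemma expectation_disc_grad_square:
  assumes t: "0 \<le> t" and x: "x \<in> lat n"
  shows "integrable M (\<lambda>\<omega>. (disc_grad (1 / real n) i (\<lambda>x. U t x \<omega>) x)\<^sup>2)"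
    and "expectation (\<lambda>\<omega>. (disc_grad (1 / real n) i (\<lambda>x. U t x \<omega>) x)\<^sup>2) = grad_energy n u0 i t x"
    and "AE \<omega> in M. (disc_grad (1 / real n) i (\<lambda>x. U t x \<omega>) x)\<^sup>2 \<le> (2 * real n * B)\<^sup>2"
proof -
  let ?y = "torus_shift (1 / real n) i x"
  have y: "?y \<in> lat n" by (rule torus_shift_lattice_next[OF n x])
  have eq: "(disc_grad (1 / real n) i (\<lambda>x. U t x \<omega>) x)\<^sup>2
    = (real n)\<^sup>2 * (U t ?y \<omega> * U t ?y \<omega> + U t x \<omega> * U t x \<omega> - U t ?y \<omega> * U t x \<omega> - U t x \<omega> * U t ?y \<omega>)" for \<omega>
    unfolding disc_grad_def by (simp add: power2_eq_square algebra_simps)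
  have int: "integrable M (\<lambda>\<omega>. U t a \<omega> * U t b \<omega>)" if "a \<in> lat n" "b \<in> lat n" for a b
    using U_product_integrable[OF t, of "(a, b)"] that by simp
  have ex: "expectation (\<lambda>\<omega>. U t a \<omega> * U t b \<omega>) = second_moment n u0 t (a, b)" if "a \<in> lat n" "b \<in> lat n" for a b
    using expectation_U_product[OF t, of "(a, b)"] that by simp
  note ints = int[OF x x] int[OF y y] int[OF x y] int[OF y x]
  show "integrable M (\<lambda>\<omega>. (disc_grad (1 / real n) i (\<lambda>x. U t x \<omega>) x)\<^sup>2)"
    unfolding eq using ints by simp
  show "expectation (\<lambda>\<omega>. (disc_grad (1 / real n) i (\<lambda>x. U t x \<omega>) x)\<^sup>2) = grad_energy n u0 i t x"
  proof -
    have "second_moment n u0 t (x, ?y) = second_moment n u0 t (?y, x)"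
      using ex[OF x y] ex[OF y x] by (simp add: mult.commute)
    then show ?thesis
      unfolding eq grad_energy_def Let_def using ints by (simp add: ex[OF x x] ex[OF y y] ex[OF x y] ex[OF y x])
  qed
  have "AE \<omega> in M. \<bar>U t x \<omega>\<bar> \<le> B" "AE \<omega> in M. \<bar>U t ?y \<omega>\<bar> \<le> B"
    using U_bounded[OF t] x y by auto
  then show "AE \<omega> in M. (disc_grad (1 / real n) i (\<lambda>x. U t x \<omega>) x)\<^sup>2 \<le> (2 * real n * B)\<^sup>2"
  proof eventually_elim
    case (elim \<omega>)
    have "\<bar>U t ?y \<omega> - U t x \<omega>\<bar> \<le> 2 * B" using elim by linarith
    then have "\<bar>disc_grad (1 / real n) i (\<lambda>x. U t x \<omega>) x\<bar> \<le> real n * (2 * B)"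
      unfolding disc_grad_def using n by (simp add: abs_mult mult.commute[of _ "real n"] mult_left_mono)
    moreover have "0 \<le> B" using elim by linarith
    ultimately show ?case by (intro power2_le_iff_abs_le[THEN iffD2]) (simp_all add: mult_ac)
  qed
qed

text \<open>Right continuity makes the process a pointwise limit of versions frozen on countable
  time grids. Negative times, about which nothing is assumed, are folded to 0 by
  \<open>max 0 s\<close>.\<close>

lemma U_jointly_measurable:
  assumes y: "y \<in> lat n"
  shows "(\<lambda>(s, \<omega>). U (max 0 s) y \<omega>) \<in> borel_measurable (lborel \<Otimes>\<^sub>M M)"
proof -
  \<comment> \<open>The next grid point strictly to the right of \<open>max 0 s\<close>. Strictness
    comes from the added 1 and is needed because the right limit ignores the value at the point
    itself.\<close>
  define r where "r j s = (real_of_int \<lfloor>max 0 s * real (Suc j)\<rfloor> + 1) / real (Suc j)" for j :: nat and s :: real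
  have r_gt: "max 0 s < r j s" for j s
    unfolding r_def by (subst pos_less_divide_eq) (simp, linarith)
  have r_le: "r j s \<le> max 0 s + 1 / real (Suc j)" for j s
  proof -
    have "(max 0 s + 1 / real (Suc j)) * real (Suc j) = max 0 s * real (Suc j) + 1" by (simp add: distrib_right del: of_nat_Suc)
    then show ?thesis unfolding r_def by (subst pos_divide_le_eq) (simp, linarith)
  qed
  have "(\<lambda>p. U (max 0 (r j (fst p))) y (snd p)) \<in> borel_measurable (lborel \<Otimes>\<^sub>M M)" for j
  proof -
    have "(\<lambda>p. U (max 0 ((real_of_int i + 1) / real (Suc j))) y (snd p)) \<in> borel_measurable (lborel \<Otimes>\<^sub>M M)" for i
      by (rule measurable_compose[OF measurable_snd U_measurable[OF _ y]]) simp
    moreover have "(\<lambda>p. \<lfloor>max 0 (fst p) * real (Suc j)\<rfloor>) \<in> measurable (lborel \<Otimes>\<^sub>M M) (count_space UNIV)"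
      by measurable
    ultimately show ?thesis unfolding r_def by (rule measurable_compose_countable)
  qed
  then show ?thesis unfolding split_def
  proof (rule borel_measurable_LIMSEQ_real[rotated])
    fix p :: "real \<times> 'w" assume "p \<in> space (lborel \<Otimes>\<^sub>M M)"
    then have "snd p \<in> space M" by (simp add: space_pair_measure mem_Times_iff)
    then have "cadlag (\<lambda>t. U t y (snd p))" using process y by (auto simp: averaging_process_def)
    then have lim: "((\<lambda>t. U t y (snd p)) \<longlongrightarrow> U (max 0 (fst p)) y (snd p)) (at_right (max 0 (fst p)))"
      by (simp add: cadlag_def)
    have "(\<lambda>j. r j (fst p)) \<longlonglongrightarrow> max 0 (fst p)"
    proof (rule tendsto_sandwich[of "\<lambda>_. max 0 (fst p)" _ _ "\<lambda>j. max 0 (fst p) + 1 / real (Suc j)"])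
      show "(\<lambda>j. max 0 (fst p) + 1 / real (Suc j)) \<longlonglongrightarrow> max 0 (fst p)"
        using tendsto_add[OF tendsto_const LIMSEQ_inverse_real_of_nat, of "max 0 (fst p)"] by (simp add: inverse_eq_divide)
    qed (use less_imp_le[OF r_gt] r_le in \<open>auto simp del: max.bounded_iff\<close>)
    moreover have "\<forall>\<^sub>F j in sequentially. r j (fst p) \<in> {max 0 (fst p)<..} \<and> r j (fst p) \<noteq> max 0 (fst p)"
      using less_imp_neq[OF r_gt, symmetric] r_gt by (intro always_eventually) auto
    ultimately have "filterlim (\<lambda>j. r j (fst p)) (at_right (max 0 (fst p))) sequentially"
      by (simp add: filterlim_at)
    from filterlim_compose[OF lim this]
    have "(\<lambda>j. U (r j (fst p)) y (snd p)) \<longlonglongrightarrow> U (max 0 (fst p)) y (snd p)" .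
    moreover have "max 0 (r j (fst p)) = r j (fst p)" for j using r_gt[of "fst p" j] by simp
    ultimately show "(\<lambda>j. U (max 0 (r j (fst p))) y (snd p)) \<longlonglongrightarrow> U (max 0 (fst p)) y (snd p)" by simp
  qed
qed

text \<open>Fubini's theorem. Joint measurability holds surely, and the almost sure bound on
  gradients, with the continuity of \<open>g\<close> in time, supplies an integrable majorant on the
  compact time interval.\<close>

lemma expectation_Gamma_eps:
  assumes g: "\<And>i. continuous_on ({0..} \<times> UNIV) (\<lambda>(s, x). g i s x)" and t: "0 \<le> t"
  shows "expectation (\<lambda>\<omega>. Gamma_eps (1 / real n) g (\<lambda>s x. U s x \<omega>) t)
    = (\<Sum>i\<in>UNIV. LINT s:{0..t}|lborel. (1 / real n) ^ CARD('d) * (\<Sum>x\<in>lat n. grad_energy n u0 i s x * g i s x))"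
proof -
  interpret pair_sigma_finite lborel M ..
  define F where "F i s \<omega> = indicator {0..t} s * ((1 / real n) ^ CARD('d) *
    (\<Sum>x\<in>lat n. (disc_grad (1 / real n) i (\<lambda>x. U (max 0 s) x \<omega>) x)\<^sup>2 * g i (max 0 s) x))" for i s \<omega>
  define G where "G i s = indicator {0..t} s * ((1 / real n) ^ CARD('d) *
    (\<Sum>x\<in>lat n. grad_energy n u0 i (max 0 s) x * g i (max 0 s) x))" for i s
  have fin: "finite (lat n :: (real ^ 'd) set)" by (rule finite_lattice[OF n])
  have g_cont: "continuous_on UNIV (\<lambda>s. g i (max 0 s) x)" for i x
  proof -
    have "continuous_on UNIV (\<lambda>s :: real. (max 0 s, x))" by (intro continuous_on_Pair continuous_on_max continuous_on_const continuous_on_id)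
    moreover have "range (\<lambda>s :: real. (max 0 s, x)) \<subseteq> {0..} \<times> UNIV" by auto
    ultimately show ?thesis using continuous_on_compose2[OF g[of i]] by fastforce
  qed
  have g_meas: "(\<lambda>s. g i (max 0 s) x) \<in> borel_measurable borel" for i x
    by (rule borel_measurable_continuous_onI[OF g_cont])
  have meas: "(\<lambda>(s, \<omega>). F i s \<omega>) \<in> borel_measurable (lborel \<Otimes>\<^sub>M M)" for i
  proof -
    have gm: "(\<lambda>p. g i (max 0 (fst p)) x) \<in> borel_measurable (lborel \<Otimes>\<^sub>M M)" for x
      by (rule measurable_compose[OF measurable_fst]) (use g_meas in simp)
    have dg: "(\<lambda>p. disc_grad (1 / real n) i (\<lambda>x. U (max 0 (fst p)) x (snd p)) x) \<in> borel_measurable (lborel \<Otimes>\<^sub>M M)" if x: "x \<in> lat n" for x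
    proof -
      have [measurable]: "(\<lambda>p. U (max 0 (fst p)) x (snd p)) \<in> borel_measurable (lborel \<Otimes>\<^sub>M M)"
        "(\<lambda>p. U (max 0 (fst p)) (torus_shift (1 / real n) i x) (snd p)) \<in> borel_measurable (lborel \<Otimes>\<^sub>M M)"
        using U_jointly_measurable[OF x] U_jointly_measurable[OF torus_shift_lattice_next[OF n x]] by (simp_all add: split_def)
      show ?thesis unfolding disc_grad_def by measurable
    qed
    then have "(\<lambda>p. \<Sum>x\<in>lat n. (disc_grad (1 / real n) i (\<lambda>x. U (max 0 (fst p)) x (snd p)) x)\<^sup>2 * g i (max 0 (fst p)) x) \<in> borel_measurable (lborel \<Otimes>\<^sub>M M)"
      by (intro borel_measurable_sum borel_measurable_times borel_measurable_power gm)
    moreover have "(\<lambda>p. indicator {0..t} (fst p) :: real) \<in> borel_measurable (lborel \<Otimes>\<^sub>M M)"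
      by measurable
    ultimately show ?thesis unfolding F_def split_def
      by (intro borel_measurable_times borel_measurable_const)
  qed
  have int1: "integrable M (\<lambda>\<omega>. F i s \<omega>)" for i s
    unfolding F_def
    by (intro integrable_mult_right Bochner_Integration.integrable_sum integrable_mult_left expectation_disc_grad_square(1)) auto
  have ex1: "expectation (\<lambda>\<omega>. F i s \<omega>) = G i s" for i s
  proof -
    have "expectation (\<lambda>\<omega>. F i s \<omega>) = indicator {0..t} s * ((1 / real n) ^ CARD('d) *
      (\<Sum>x\<in>lat n. expectation (\<lambda>\<omega>. (disc_grad (1 / real n) i (\<lambda>x. U (max 0 s) x \<omega>) x)\<^sup>2 * g i (max 0 s) x)))"
      unfolding F_def
      by (subst Bochner_Integration.integral_sum[symmetric]) (auto intro!: integrable_mult_left expectation_disc_grad_square(1))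
    also have "\<dots> = G i s" unfolding G_def
      by (intro arg_cong2[where f="(*)"] refl sum.cong) (auto simp: expectation_disc_grad_square(2))
    finally show ?thesis .
  qed
  have int: "integrable (lborel \<Otimes>\<^sub>M M) (\<lambda>(s, \<omega>). F i s \<omega>)" for i
  proof (rule Fubini_integrable[OF meas])
    obtain b where b: "\<And>x s. x \<in> lat n \<Longrightarrow> s \<in> {0..t} \<Longrightarrow> \<bar>g i s x\<bar> \<le> b"
    proof -
      have "\<exists>b. \<forall>s\<in>{0..t}. \<bar>g i (max 0 s) x\<bar> \<le> b" for x
      proof -
        have "compact ((\<lambda>s. g i (max 0 s) x) ` {0..t})"
          by (intro compact_continuous_image continuous_on_subset[OF g_cont]) auto
        then show ?thesis using compact_imp_bounded bounded_iff by (metis imageI real_norm_def)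
      qed
      then obtain b' where b': "\<And>x s. s \<in> {0..t} \<Longrightarrow> \<bar>g i (max 0 s) x\<bar> \<le> b' x" by metis
      obtain b where "\<And>x. x \<in> lat n \<Longrightarrow> \<bar>b' x\<bar> \<le> b" using finite_bounded_abs[OF fin, of b'] by metis
      then have "\<bar>g i s x\<bar> \<le> b" if "x \<in> lat n" "s \<in> {0..t}" for x s
        using b'[OF that(2), of x] that by (force simp: max_def)
      then show ?thesis using that by blast
    qed
    define K where "K = (1 / real n) ^ CARD('d) * (\<Sum>x\<in>(lat n :: (real ^ 'd) set). (2 * real n * B)\<^sup>2 * b)"
    have "AE \<omega> in M. norm (F i s \<omega>) \<le> indicator {0..t} s * K" for s
    proof (cases "s \<in> {0..t}")
      case True
      have "AE \<omega> in M. \<forall>x\<in>lat n. (disc_grad (1 / real n) i (\<lambda>x. U s x \<omega>) x)\<^sup>2 \<le> (2 * real n * B)\<^sup>2"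
        by (rule AE_finite_allI[OF fin]) (rule expectation_disc_grad_square(3), use True in auto)
      then show ?thesis
      proof eventually_elim
        case (elim \<omega>)
        have "\<bar>\<Sum>x\<in>lat n. (disc_grad (1 / real n) i (\<lambda>x. U s x \<omega>) x)\<^sup>2 * g i s x\<bar> \<le> (\<Sum>x\<in>(lat n :: (real ^ 'd) set). (2 * real n * B)\<^sup>2 * b)"
          by (rule order_trans[OF sum_abs], rule sum_mono) (use elim b True in \<open>auto simp: abs_mult intro!: mult_mono\<close>)
        then have "(1 / real n) ^ CARD('d) * \<bar>\<Sum>x\<in>lat n. (disc_grad (1 / real n) i (\<lambda>x. U s x \<omega>) x)\<^sup>2 * g i s x\<bar> \<le> K"
          unfolding K_def by (rule mult_left_mono) simp
        then show ?case using True unfolding F_def by (simp add: abs_mult)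
      qed
    qed (simp add: F_def)
    then have "expectation (\<lambda>\<omega>. norm (F i s \<omega>)) \<le> expectation (\<lambda>\<omega>. indicator {0..t} s * K)" for s
      by (intro integral_mono_AE integrable_norm int1) auto
    then have le: "expectation (\<lambda>\<omega>. norm (F i s \<omega>)) \<le> indicator {0..t} s * K" for s by (simp add: prob_space)
    have "integrable lborel (\<lambda>s. indicator {0..t} s * K)" by (intro integrable_mult_left integrable_real_indicator) (auto simp: emeasure_lborel_Icc_eq)
    then show "integrable lborel (\<lambda>s. LINT \<omega>|M. norm (case (s, \<omega>) of (s, \<omega>) \<Rightarrow> F i s \<omega>))"
    proof (rule Bochner_Integration.integrable_bound)
      have "(\<lambda>(s, \<omega>). norm (F i s \<omega>)) \<in> borel_measurable (lborel \<Otimes>\<^sub>M M)"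
        using measurable_compose[OF meas[of i] borel_measurable_norm] by (simp add: split_def)
      then show "(\<lambda>s. LINT \<omega>|M. norm (case (s, \<omega>) of (s, \<omega>) \<Rightarrow> F i s \<omega>)) \<in> borel_measurable lborel"
        using sigma_finite_measure.borel_measurable_lebesgue_integral[OF prob_space_imp_sigma_finite[OF ps], of "\<lambda>s \<omega>. norm (F i s \<omega>)" lborel]
        by simp
      have "0 \<le> expectation (\<lambda>\<omega>. norm (F i s \<omega>))" for s by (intro integral_nonneg_AE) simp
      then show "AE s in lborel. norm (LINT \<omega>|M. norm (case (s, \<omega>) of (s, \<omega>) \<Rightarrow> F i s \<omega>)) \<le> norm (indicator {0..t} s * K)"
        by (intro AE_I2) (use order_trans[OF le[unfolded real_norm_def] abs_ge_self] in simp)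
    qed
    show "AE s in lborel. integrable M (\<lambda>\<omega>. case (s, \<omega>) of (s, \<omega>) \<Rightarrow> F i s \<omega>)" using int1 by simp
  qed
  have "Gamma_eps (1 / real n) g (\<lambda>s x. U s x \<omega>) t = (\<Sum>i\<in>UNIV. LINT s|lborel. F i s \<omega>)" for \<omega>
    unfolding Gamma_eps_def set_lebesgue_integral_def F_def
    by (intro sum.cong refl Bochner_Integration.integral_cong) (auto simp: indicator_def max_def)
  then have "expectation (\<lambda>\<omega>. Gamma_eps (1 / real n) g (\<lambda>s x. U s x \<omega>) t) = expectation (\<lambda>\<omega>. \<Sum>i\<in>UNIV. LINT s|lborel. F i s \<omega>)"
    by simp
  also have "\<dots> = (\<Sum>i\<in>UNIV. expectation (\<lambda>\<omega>. LINT s|lborel. F i s \<omega>))"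
    by (rule Bochner_Integration.integral_sum) (use integrable_snd[OF int] in simp)
  also have "\<dots> = (\<Sum>i\<in>UNIV. LINT s|lborel. expectation (\<lambda>\<omega>. F i s \<omega>))"
    by (intro sum.cong refl Fubini_integral int)
  also have "\<dots> = (\<Sum>i\<in>UNIV. LINT s:{0..t}|lborel. (1 / real n) ^ CARD('d) * (\<Sum>x\<in>lat n. grad_energy n u0 i s x * g i s x))"
    unfolding ex1 G_def set_lebesgue_integral_def
    by (intro sum.cong refl Bochner_Integration.integral_cong) (auto simp: indicator_def max_def)
  finally show ?thesis .
qed

end

section \<open>The renewal equation for the edge energies\<close>

text \<open>The dipole of an edge: pairing it with a function gives the difference across the
  edge.\<close>

definition edge_fun :: "nat \<Rightarrow> 'd::finite \<Rightarrow> real ^ 'd \<Rightarrow> real ^ 'd \<Rightarrow> real" where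
  "edge_fun n i x y = of_bool (y = torus_shift (1 / real n) i x) - of_bool (y = x)"

text \<open>The heat flow of one dipole, differenced across another edge and squared. In the
  prefactor n^2 is the ring rate and 1/4 is the square of the half of the gradient that an averaging
  removes.\<close>

definition renewal_kernel :: "nat \<Rightarrow> 'd::finite \<Rightarrow> real ^ 'd \<Rightarrow> 'd \<Rightarrow> real ^ 'd \<Rightarrow> real \<Rightarrow> real" where
  "renewal_kernel n i x j z r = (real n)\<^sup>2 / 4 *
     (heat_sg n r (edge_fun n i x) (torus_shift (1 / real n) j z) - heat_sg n r (edge_fun n i x) z)\<^sup>2"

lemma sum_delta_left:
  fixes f :: "real ^ 'd::finite \<Rightarrow> real"
  assumes "0 < n" "z \<in> lat n"
  shows "(\<Sum>a\<in>lat n. of_bool (a = z) * f a) = f z"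
  using sum_lattice_delta[OF assms, of f] by (simp add: eq_commute[of z])

lemma sum_edge_fun:
  fixes f :: "real ^ 'd::finite \<Rightarrow> real"
  assumes "0 < n" "x \<in> lat n"
  shows "(\<Sum>a\<in>lat n. edge_fun n i x a * f a) = f (torus_shift (1 / real n) i x) - f x"
  unfolding edge_fun_def left_diff_distrib sum_subtractf
  by (simp only: sum_delta_left[OF assms] sum_delta_left[OF assms(1) torus_shift_lattice_next[OF assms]])

lemma ring_mat_symmetric:
  assumes "0 < n" "x \<in> lat n"
  shows "ring_mat (1 / real n) (Some (i, x)) a b = ring_mat (1 / real n) (Some (i, x)) b a"
  unfolding ring_mat_def edge_avg_def by (auto simp: of_bool_def)

text \<open>An averaging is a rank-one correction of the identity. The ends of the edge must be
  distinct, or the dipole would vanish.\<close>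

lemma edge_avg_edge_fun:
  assumes "2 \<le> n" "x \<in> lat n"
  shows "edge_avg (1 / real n) (Some (i, x)) f b
    = f b - (f (torus_shift (1 / real n) i x) - f x) / 2 * edge_fun n i x b"
  using torus_shift_neq[OF assms, of i] unfolding edge_avg_def edge_fun_def by (auto simp: field_simps)

lemma sum_pair_product:
  "(\<Sum>q\<in>A \<times> A. f (fst q) * g (snd q) * V q) = (\<Sum>a\<in>A. \<Sum>b\<in>A. f a * g b * V (a, b))"
  by (simp add: sum.cartesian_product split_def)

text \<open>Ring matrices are symmetric, so the update moves from the moments to the test function;
  on a product test function the tensor square then acts on each factor separately.\<close>

lemma sum_pair_avg_adjoint:
  fixes V :: "(real ^ 'd::finite) \<times> (real ^ 'd) \<Rightarrow> real"
  assumes n: "0 < n" and x: "x \<in> lat n"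
  shows "(\<Sum>p\<in>lat n \<times> lat n. \<rho> (fst p) * \<rho> (snd p) * pair_avg (1 / real n) (Some (i, x)) V p)
    = (\<Sum>q\<in>lat n \<times> lat n. edge_avg (1 / real n) (Some (i, x)) \<rho> (fst q) * edge_avg (1 / real n) (Some (i, x)) \<rho> (snd q) * V q)"
proof -
  let ?c = "Some (i, x)" and ?L = "lat n :: (real ^ 'd) set"
  let ?m = "ring_mat (1 / real n) ?c"
  have c: "?c \<in> insert None (Some ` (UNIV \<times> lat n))" using x by auto
  have adj: "edge_avg (1 / real n) ?c \<rho> b = (\<Sum>a\<in>?L. ?m a b * \<rho> a)" if "b \<in> ?L" for b
    unfolding edge_avg_ring_mat[OF n c that] ring_mat_symmetric[OF n x, of i b] ..
  have "(\<Sum>p\<in>?L \<times> ?L. \<rho> (fst p) * \<rho> (snd p) * pair_avg (1 / real n) ?c V p)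
    = (\<Sum>p\<in>?L \<times> ?L. \<Sum>q\<in>?L \<times> ?L. (?m (fst p) (fst q) * \<rho> (fst p)) * (?m (snd p) (snd q) * \<rho> (snd p)) * V q)"
    by (intro sum.cong refl) (simp only: pair_avg_ring_mat[OF n c] sum_distrib_left mult_ac)
  also have "\<dots> = (\<Sum>q\<in>?L \<times> ?L. \<Sum>p\<in>?L \<times> ?L. (?m (fst p) (fst q) * \<rho> (fst p)) * (?m (snd p) (snd q) * \<rho> (snd p)) * V q)"
    by (rule sum.swap)
  also have "\<dots> = (\<Sum>q\<in>?L \<times> ?L. edge_avg (1 / real n) ?c \<rho> (fst q) * edge_avg (1 / real n) ?c \<rho> (snd q) * V q)"
  proof (intro sum.cong refl)
    fix q assume "q \<in> ?L \<times> ?L"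
    then have q: "fst q \<in> ?L" "snd q \<in> ?L" by auto
    show "(\<Sum>p\<in>?L \<times> ?L. (?m (fst p) (fst q) * \<rho> (fst p)) * (?m (snd p) (snd q) * \<rho> (snd p)) * V q)
      = edge_avg (1 / real n) ?c \<rho> (fst q) * edge_avg (1 / real n) ?c \<rho> (snd q) * V q"
    proof -
      have "(\<Sum>a\<in>?L. f a) * (\<Sum>b\<in>?L. g b) * v = (\<Sum>p\<in>?L \<times> ?L. f (fst p) * g (snd p) * v)" for f g :: "real ^ 'd \<Rightarrow> real" and v
        by (subst sum_product) (simp add: sum.cartesian_product split_def sum_distrib_right)
      then show ?thesis unfolding adj[OF q(1)] adj[OF q(2)] by simp
    qed
  qed
  finally show ?thesis .
qed

text \<open>Summation by parts: the divergence of the gradient, where each site collects its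
  incoming and outgoing edge in every direction. The factor 2 / n^2 undoes the normalisation of
  \<open>lap_mat\<close>.\<close>

lemma sum_edge_gradients:
  fixes \<rho> :: "real ^ 'd::finite \<Rightarrow> real"
  assumes n: "0 < n" and a: "a \<in> lat n"
  shows "(\<Sum>e\<in>UNIV \<times> lat n. (\<rho> (torus_shift (1 / real n) (fst e) (snd e)) - \<rho> (snd e)) * edge_fun n (fst e) (snd e) a)
    = - (2 / (real n)\<^sup>2) * mat_app (lat n) (lap_mat n) \<rho> a"
proof -
  let ?s = "torus_shift (1 / real n)" and ?p = "torus_shift (- (1 / real n))"
  have "(\<Sum>z\<in>lat n. (\<rho> (?s i z) - \<rho> z) * edge_fun n i z a) = (\<rho> a - \<rho> (?p i a)) - (\<rho> (?s i a) - \<rho> a)" for i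
  proof -
    have "a = ?s i z \<longleftrightarrow> ?p i a = z" if "z \<in> lat n" for z
      using torus_shift_inverse[OF lattice_cell[OF that], of "- (1 / real n)" i]
        torus_shift_inverse[OF lattice_cell[OF a], of "1 / real n" i] by auto
    then have "(\<Sum>z\<in>lat n. (\<rho> (?s i z) - \<rho> z) * edge_fun n i z a)
      = (\<Sum>z\<in>lat n. of_bool (?p i a = z) * (\<rho> (?s i z) - \<rho> z)) - (\<Sum>z\<in>lat n. of_bool (a = z) * (\<rho> (?s i z) - \<rho> z))"
      unfolding sum_subtractf[symmetric] edge_fun_def by (intro sum.cong refl) (simp add: algebra_simps)
    also have "\<dots> = (\<rho> (?s i (?p i a)) - \<rho> (?p i a)) - (\<rho> (?s i a) - \<rho> a)"
      by (simp only: sum_lattice_delta[OF n torus_shift_lattice_prev[OF n a]] sum_lattice_delta[OF n a])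
    also have "?s i (?p i a) = a" by (rule torus_shift_inverse[OF lattice_cell[OF a]])
    finally show ?thesis .
  qed
  then have "(\<Sum>e\<in>UNIV \<times> lat n. (\<rho> (?s (fst e) (snd e)) - \<rho> (snd e)) * edge_fun n (fst e) (snd e) a)
    = (\<Sum>i\<in>UNIV. (\<rho> a - \<rho> (?p i a)) - (\<rho> (?s i a) - \<rho> a))"
    using sum.cartesian_product[of "\<lambda>i z. (\<rho> (?s i z) - \<rho> z) * edge_fun n i z a" "lat n" UNIV] by (simp add: split_def)
  also have "\<dots> = - (\<Sum>i\<in>UNIV. \<rho> (?s i a) + \<rho> (?p i a) - 2 * \<rho> a)"
    unfolding sum_negf[symmetric] by (intro sum.cong refl) simp
  finally show ?thesis unfolding mat_app_lap[OF n a] using n by simp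
qed

text \<open>Each ring turns \<rho> into \<rho> - (g/2) \<zeta>, with \<zeta> the dipole and g the
  difference of \<rho> across the edge. In the expanded product, the terms linear in \<zeta> sum to
  a Laplacian acting on each variable, that is, to two independent walks; the quadratic terms remain
  as the defect on the edges.\<close>

lemma pair_generator_dual:
  fixes V :: "(real ^ 'd::finite) \<times> (real ^ 'd) \<Rightarrow> real"
  assumes n: "2 \<le> n"
  shows "(\<Sum>p\<in>lat n \<times> lat n. \<rho> (fst p) * \<rho> (snd p) * mat_app (lat n \<times> lat n) (pair_mat n) V p)
    = (\<Sum>p\<in>lat n \<times> lat n. (mat_app (lat n) (lap_mat n) \<rho> (fst p) * \<rho> (snd p)
        + \<rho> (fst p) * mat_app (lat n) (lap_mat n) \<rho> (snd p)) * V p)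
      + (\<Sum>e\<in>UNIV \<times> lat n. (real n)\<^sup>2 / 4 * (\<rho> (torus_shift (1 / real n) (fst e) (snd e)) - \<rho> (snd e))\<^sup>2
          * (let x = snd e; y = torus_shift (1 / real n) (fst e) x in V (y, y) + V (x, x) - V (y, x) - V (x, y)))"
proof -
  let ?L = "lat n :: (real ^ 'd) set" and ?E = "UNIV \<times> lat n :: ('d \<times> (real ^ 'd)) set"
  let ?s = "torus_shift (1 / real n)"
  let ?A = "mat_app (lat n) (lap_mat n) \<rho>"
  define g where "g e = \<rho> (?s (fst e) (snd e)) - \<rho> (snd e)" for e
  define \<zeta> where "\<zeta> e = edge_fun n (fst e) (snd e)" for e :: "'d \<times> (real ^ 'd)"
  define W where "W e = (let x = snd e; y = ?s (fst e) x in V (y, y) + V (x, x) - V (y, x) - V (x, y))" for e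
  have n0: "0 < n" using n by simp
  have W: "(\<Sum>p\<in>?L \<times> ?L. \<zeta> e (fst p) * \<zeta> e (snd p) * V p) = W e" if "e \<in> ?E" for e
  proof -
    have x: "snd e \<in> ?L" using that by auto
    have "(\<Sum>p\<in>?L \<times> ?L. \<zeta> e (fst p) * \<zeta> e (snd p) * V p) = (\<Sum>a\<in>?L. \<zeta> e a * (\<Sum>b\<in>?L. \<zeta> e b * V (a, b)))"
      unfolding sum_pair_product by (simp add: sum_distrib_left mult.assoc)
    then show ?thesis unfolding \<zeta>_def sum_edge_fun[OF n0 x] W_def Let_def by simp
  qed
  have step: "(\<Sum>p\<in>?L \<times> ?L. \<rho> (fst p) * \<rho> (snd p) * (pair_avg (1 / real n) (Some e) V p - V p))
    = (\<Sum>p\<in>?L \<times> ?L. - (1/2) * (g e * \<zeta> e (fst p) * \<rho> (snd p) + \<rho> (fst p) * (g e * \<zeta> e (snd p))) * V p) + (g e)\<^sup>2 / 4 * W e"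
    if "e \<in> ?E" for e
  proof -
    obtain i x where e: "e = (i, x)" by (cases e)
    have x: "x \<in> ?L" using that e by simp
    have "(\<Sum>p\<in>?L \<times> ?L. \<rho> (fst p) * \<rho> (snd p) * (pair_avg (1 / real n) (Some e) V p - V p))
      = (\<Sum>p\<in>?L \<times> ?L. (\<rho> (fst p) - g e / 2 * \<zeta> e (fst p)) * (\<rho> (snd p) - g e / 2 * \<zeta> e (snd p)) * V p)
        - (\<Sum>p\<in>?L \<times> ?L. \<rho> (fst p) * \<rho> (snd p) * V p)"
      unfolding right_diff_distrib sum_subtractf e sum_pair_avg_adjoint[OF n0 x] edge_avg_edge_fun[OF n x] g_def \<zeta>_def by simp
    also have "\<dots> = (\<Sum>p\<in>?L \<times> ?L. - (1/2) * (g e * \<zeta> e (fst p) * \<rho> (snd p) + \<rho> (fst p) * (g e * \<zeta> e (snd p))) * V p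
        + (g e)\<^sup>2 / 4 * (\<zeta> e (fst p) * \<zeta> e (snd p) * V p))"
      unfolding sum_subtractf[symmetric] by (intro sum.cong refl) (simp add: power2_eq_square algebra_simps)
    also have "\<dots> = (\<Sum>p\<in>?L \<times> ?L. - (1/2) * (g e * \<zeta> e (fst p) * \<rho> (snd p) + \<rho> (fst p) * (g e * \<zeta> e (snd p))) * V p) + (g e)\<^sup>2 / 4 * W e"
      unfolding sum.distrib sum_distrib_left[symmetric] W[OF that] ..
    finally show ?thesis .
  qed
  have lap: "(\<Sum>e\<in>?E. g e * \<zeta> e a) = - (2 / (real n)\<^sup>2) * ?A a" if "a \<in> ?L" for a
    unfolding g_def \<zeta>_def by (rule sum_edge_gradients[OF n0 that])
  have "(\<Sum>p\<in>?L \<times> ?L. \<rho> (fst p) * \<rho> (snd p) * mat_app (?L \<times> ?L) (pair_mat n) V p)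
    = (\<Sum>p\<in>?L \<times> ?L. \<Sum>e\<in>?E. (real n)\<^sup>2 * (\<rho> (fst p) * \<rho> (snd p) * (pair_avg (1 / real n) (Some e) V p - V p)))"
    by (intro sum.cong refl) (simp only: mat_app_pair[OF n0] sum_distrib_left mult_ac)
  also have "\<dots> = (\<Sum>e\<in>?E. (real n)\<^sup>2 * (\<Sum>p\<in>?L \<times> ?L. \<rho> (fst p) * \<rho> (snd p) * (pair_avg (1 / real n) (Some e) V p - V p)))"
    unfolding sum_distrib_left by (rule sum.swap)
  also have "\<dots> = (\<Sum>e\<in>?E. (real n)\<^sup>2 * ((\<Sum>p\<in>?L \<times> ?L. - (1/2) * (g e * \<zeta> e (fst p) * \<rho> (snd p) + \<rho> (fst p) * (g e * \<zeta> e (snd p))) * V p) + (g e)\<^sup>2 / 4 * W e))"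
    by (intro sum.cong refl) (simp only: step)
  also have "\<dots> = (\<Sum>e\<in>?E. \<Sum>p\<in>?L \<times> ?L. (real n)\<^sup>2 * (- (1/2) * (g e * \<zeta> e (fst p) * \<rho> (snd p) + \<rho> (fst p) * (g e * \<zeta> e (snd p))) * V p))
      + (\<Sum>e\<in>?E. (real n)\<^sup>2 / 4 * (g e)\<^sup>2 * W e)"
    unfolding distrib_left sum.distrib sum_distrib_left by (simp add: mult_ac)
  also have "(\<Sum>e\<in>?E. \<Sum>p\<in>?L \<times> ?L. (real n)\<^sup>2 * (- (1/2) * (g e * \<zeta> e (fst p) * \<rho> (snd p) + \<rho> (fst p) * (g e * \<zeta> e (snd p))) * V p))
    = (\<Sum>p\<in>?L \<times> ?L. (?A (fst p) * \<rho> (snd p) + \<rho> (fst p) * ?A (snd p)) * V p)"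
  proof (subst sum.swap, intro sum.cong refl)
    fix p assume "p \<in> ?L \<times> ?L"
    then have p: "fst p \<in> ?L" "snd p \<in> ?L" by auto
    have "(\<Sum>e\<in>?E. (real n)\<^sup>2 * (- (1/2) * (g e * \<zeta> e (fst p) * \<rho> (snd p) + \<rho> (fst p) * (g e * \<zeta> e (snd p))) * V p))
      = (real n)\<^sup>2 * (- (1/2)) * ((\<Sum>e\<in>?E. g e * \<zeta> e (fst p)) * \<rho> (snd p) + \<rho> (fst p) * (\<Sum>e\<in>?E. g e * \<zeta> e (snd p))) * V p"
      unfolding distrib_left distrib_right sum_distrib_left sum_distrib_right sum.distrib[symmetric]
      by (intro sum.cong refl) (simp add: algebra_simps)
    also have "\<dots> = (?A (fst p) * \<rho> (snd p) + \<rho> (fst p) * ?A (snd p)) * V p"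
      unfolding lap[OF p(1)] lap[OF p(2)] using n0 by (simp add: field_simps)
    finally show "(\<Sum>e\<in>?E. (real n)\<^sup>2 * (- (1/2) * (g e * \<zeta> e (fst p) * \<rho> (snd p) + \<rho> (fst p) * (g e * \<zeta> e (snd p))) * V p))
      = (?A (fst p) * \<rho> (snd p) + \<rho> (fst p) * ?A (snd p)) * V p" .
  qed
  finally show ?thesis unfolding g_def W_def .
qed

text \<open>Duhamel's formula for the second moments, tested against an edge.\<close>

theorem grad_energy_renewal:
  fixes x :: "real ^ 'd::finite"
  assumes n: "2 \<le> n" and x: "x \<in> lat n" and t: "0 \<le> t"
  shows "((\<lambda>s. \<Sum>(j, z)\<in>UNIV \<times> lat n. renewal_kernel n i x j z (t - s) * grad_energy n u0 j s z)
    has_integral grad_energy n u0 i t x - (heat_sg n t (disc_grad (1 / real n) i u0) x)\<^sup>2) {0..t}"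
proof -
  let ?L = "lat n :: (real ^ 'd) set" and ?E = "UNIV \<times> lat n :: ('d \<times> (real ^ 'd)) set"
  let ?y = "torus_shift (1 / real n) i x"
  \<comment> \<open>Evolving the dipole backwards under independent walks cancels the Laplacian part
    of the moment equation, so that the derivative of \<open>H\<close> consists of the defect
    alone.\<close>
  define \<rho> where "\<rho> s = heat_sg n (t - s) (edge_fun n i x)" for s
  let ?V = "second_moment n u0"
  define H where "H s = (real n)\<^sup>2 * (\<Sum>p\<in>?L \<times> ?L. \<rho> s (fst p) * \<rho> s (snd p) * ?V s p)" for s
  have n0: "0 < n" using n by simp
  have y: "?y \<in> ?L" by (rule torus_shift_lattice_next[OF n0 x])
  have fin: "finite ?L" "finite (?L \<times> ?L)" using finite_lattice[OF n0] by (auto intro: finite_cartesian_product)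
  have d\<rho>: "((\<lambda>s. \<rho> s a) has_real_derivative - mat_app ?L (lap_mat n) (\<rho> s) a) (at s)" if "a \<in> ?L" for a s
  proof -
    have "((\<lambda>s. t - s) has_real_derivative -1) (at s)" by (auto intro!: derivative_eq_intros)
    from DERIV_chain2[where f="\<lambda>r. mat_exp ?L (lap_mat n) r (edge_fun n i x) a" and g="\<lambda>s. t - s", OF mat_exp_has_derivative[OF fin(1) that] this]
    show ?thesis unfolding \<rho>_def heat_sg_def by simp
  qed
  have dV: "((\<lambda>s. ?V s p) has_real_derivative mat_app (?L \<times> ?L) (pair_mat n) (?V s) p) (at s)" if "p \<in> ?L \<times> ?L" for p s
    unfolding second_moment_def by (rule mat_exp_has_derivative[OF fin(2) that])
  have dH: "(H has_real_derivative (\<Sum>(j, z)\<in>?E. renewal_kernel n i x j z (t - s) * grad_energy n u0 j s z)) (at s)" for s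
  proof -
    let ?A = "mat_app ?L (lap_mat n) (\<rho> s)"
    have "(H has_real_derivative (real n)\<^sup>2 * (\<Sum>p\<in>?L \<times> ?L. (- ?A (fst p) * \<rho> s (snd p) + - ?A (snd p) * \<rho> s (fst p)) * ?V s p
        + mat_app (?L \<times> ?L) (pair_mat n) (?V s) p * (\<rho> s (fst p) * \<rho> s (snd p)))) (at s)"
      unfolding H_def by (intro DERIV_cmult DERIV_sum DERIV_mult d\<rho> dV) auto
    moreover have "(\<Sum>p\<in>?L \<times> ?L. (- ?A (fst p) * \<rho> s (snd p) + - ?A (snd p) * \<rho> s (fst p)) * ?V s p
        + mat_app (?L \<times> ?L) (pair_mat n) (?V s) p * (\<rho> s (fst p) * \<rho> s (snd p)))
      = (\<Sum>e\<in>?E. (real n)\<^sup>2 / 4 * (\<rho> s (torus_shift (1 / real n) (fst e) (snd e)) - \<rho> s (snd e))\<^sup>2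
          * (let x = snd e; y = torus_shift (1 / real n) (fst e) x in ?V s (y, y) + ?V s (x, x) - ?V s (y, x) - ?V s (x, y)))"
    proof -
      have "(\<Sum>p\<in>?L \<times> ?L. (- ?A (fst p) * \<rho> s (snd p) + - ?A (snd p) * \<rho> s (fst p)) * ?V s p
        + mat_app (?L \<times> ?L) (pair_mat n) (?V s) p * (\<rho> s (fst p) * \<rho> s (snd p)))
        = (\<Sum>p\<in>?L \<times> ?L. \<rho> s (fst p) * \<rho> s (snd p) * mat_app (?L \<times> ?L) (pair_mat n) (?V s) p)
          - (\<Sum>p\<in>?L \<times> ?L. (?A (fst p) * \<rho> s (snd p) + \<rho> s (fst p) * ?A (snd p)) * ?V s p)"
        unfolding sum_subtractf[symmetric] by (intro sum.cong refl) (simp add: algebra_simps)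
      then show ?thesis unfolding pair_generator_dual[OF n] by simp
    qed
    ultimately have "(H has_real_derivative (real n)\<^sup>2 * (\<Sum>e\<in>?E. (real n)\<^sup>2 / 4 * (\<rho> s (torus_shift (1 / real n) (fst e) (snd e)) - \<rho> s (snd e))\<^sup>2
          * (let x = snd e; y = torus_shift (1 / real n) (fst e) x in ?V s (y, y) + ?V s (x, x) - ?V s (y, x) - ?V s (x, y)))) (at s)"
      by simp
    moreover have "(real n)\<^sup>2 * (\<Sum>e\<in>?E. (real n)\<^sup>2 / 4 * (\<rho> s (torus_shift (1 / real n) (fst e) (snd e)) - \<rho> s (snd e))\<^sup>2
          * (let x = snd e; y = torus_shift (1 / real n) (fst e) x in ?V s (y, y) + ?V s (x, x) - ?V s (y, x) - ?V s (x, y)))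
      = (\<Sum>(j, z)\<in>?E. renewal_kernel n i x j z (t - s) * grad_energy n u0 j s z)"
      unfolding sum_distrib_left split_def
      by (intro sum.cong refl) (simp add: renewal_kernel_def grad_energy_def \<rho>_def Let_def)
    ultimately show ?thesis by simp
  qed
  have "((\<lambda>s. \<Sum>(j, z)\<in>?E. renewal_kernel n i x j z (t - s) * grad_energy n u0 j s z) has_integral (H t - H 0)) {0..t}"
    by (rule fundamental_theorem_of_calculus[OF t])
      (use dH in \<open>auto simp: has_real_derivative_iff_has_vector_derivative[symmetric] intro: DERIV_subset\<close>)
  moreover have "H t = grad_energy n u0 i t x"
  proof -
    have "\<rho> t a = edge_fun n i x a" for a unfolding \<rho>_def heat_sg_def by simp
    then have "H t = (real n)\<^sup>2 * (\<Sum>a\<in>?L. edge_fun n i x a * (\<Sum>b\<in>?L. edge_fun n i x b * ?V t (a, b)))"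
      unfolding H_def sum_pair_product by (simp add: sum_distrib_left mult.assoc)
    then show ?thesis unfolding sum_edge_fun[OF n0 x] grad_energy_def Let_def by simp
  qed
  \<comment> \<open>The initial configuration is deterministic, so its second moments factor and the
    value at time 0 is a perfect square.\<close>
  moreover have "H 0 = (heat_sg n t (disc_grad (1 / real n) i u0) x)\<^sup>2"
  proof -
    have "(\<Sum>p\<in>?L \<times> ?L. \<rho> 0 (fst p) * \<rho> 0 (snd p) * ?V 0 p) = (\<Sum>a\<in>?L. \<rho> 0 a * u0 a)\<^sup>2"
      unfolding sum_pair_product power2_eq_square sum_product second_moment_def by (simp add: mult_ac)
    moreover have "(\<Sum>a\<in>?L. \<rho> 0 a * u0 a) = heat_sg n t u0 ?y - heat_sg n t u0 x"
      using heat_sg_symmetric[OF n0, of t "edge_fun n i x" 0 u0]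
      unfolding \<rho>_def sum_edge_fun[OF n0 x] by (simp add: heat_sg_def)
    moreover have "heat_sg n t (disc_grad (1 / real n) i u0) x = real n * (heat_sg n t u0 ?y - heat_sg n t u0 x)"
    proof -
      have "heat_sg n t (disc_grad (1 / real n) i u0) x
        = heat_sg n t (\<lambda>z. \<Sum>b\<in>UNIV. (if b then real n else - real n) * (if b then u0 (torus_shift (1 / real n) i z) else u0 z)) x"
        unfolding heat_sg_def disc_grad_def by (intro mat_exp_cong[OF _ x]) (simp add: UNIV_bool algebra_simps)
      also have "\<dots> = (\<Sum>b\<in>UNIV. (if b then real n else - real n) * heat_sg n t (\<lambda>z. if b then u0 (torus_shift (1 / real n) i z) else u0 z) x)"
        unfolding heat_sg_def by (rule mat_exp_sum[OF fin(1) x]) simp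
      finally show ?thesis by (simp add: UNIV_bool heat_sg_shift[OF n0 x] algebra_simps)
    qed
    ultimately show ?thesis unfolding H_def by (simp add: power_mult_distrib)
  qed
  ultimately show ?thesis by simp
qed

section \<open>The renewal kernel in Fourier variables: mass, decay and row sums\<close>

definition freq_ratio :: "'d::finite \<Rightarrow> 'd \<Rightarrow> real ^ 'd \<Rightarrow> real" where
  "freq_ratio i j \<kappa> = psi (\<kappa> $ i) * psi (\<kappa> $ j) / (\<Sum>l\<in>UNIV. psi (\<kappa> $ l))"

text \<open>The mass that the kernel carries at ages above \<open>r\<close>. Integrating exp (-2 n^2
  (\<psi>_1 + ... + \<psi>_d) s) over s > r cancels the factor n^2 of the kernel and leaves the
  ratio. At \<open>r = 0\<close> it is half a lattice mean.\<close>

definition kernel_tail :: "nat \<Rightarrow> 'd::finite \<Rightarrow> 'd \<Rightarrow> real \<Rightarrow> real" where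
  "kernel_tail n i j r = (\<Sum>\<kappa>\<in>lat n. freq_ratio i j \<kappa> * exp (- (2 * (real n)\<^sup>2 * (\<Sum>l\<in>UNIV. psi (\<kappa> $ l))) * r)) / (2 * real n ^ CARD('d))"

lemma psi_nonneg: "0 \<le> psi z"
  by (simp add: psi_def)

lemma psi_le_2: "psi z \<le> 2"
  using cos_ge_minus_one[of "2 * pi * z"] by (simp add: psi_def)

lemma psi_0 [simp]: "psi 0 = 0"
  by (simp add: psi_def)

lemma psi_minus [simp]: "psi (- z) = psi z"
  by (simp add: psi_def)

lemma psi_of_int [simp]: "psi (z + of_int m) = psi z"
  using cos.plus_of_int[of "2 * pi * z" m] by (simp add: psi_def algebra_simps)

lemma psi_sin: "psi z = 2 * (sin (pi * z))\<^sup>2"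
  using cos_double_sin[of "pi * z"] by (simp add: psi_def mult_ac)

text \<open>A triangle inequality for the squared distance \<open>psi\<close>, inherited from
  \<bar>sin (a + b)\<bar> \<le> \<bar>sin a\<bar> + \<bar>sin b\<bar>.\<close>

lemma psi_add_le: "psi (a + b) \<le> 2 * psi a + 2 * psi b"
proof -
  have "\<bar>sin (pi * a + pi * b)\<bar> \<le> \<bar>sin (pi * a)\<bar> + \<bar>sin (pi * b)\<bar>"
  proof -
    have "\<bar>sin (pi * a) * cos (pi * b)\<bar> \<le> \<bar>sin (pi * a)\<bar>" "\<bar>cos (pi * a) * sin (pi * b)\<bar> \<le> \<bar>sin (pi * b)\<bar>"
      by (simp_all add: abs_mult mult_left_le mult_left_le_one_le)
    then show ?thesis unfolding sin_add by linarith
  qed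
  then have "(sin (pi * a + pi * b))\<^sup>2 \<le> (\<bar>sin (pi * a)\<bar> + \<bar>sin (pi * b)\<bar>)\<^sup>2"
    using power_mono[of "\<bar>sin (pi * a + pi * b)\<bar>" _ 2] by simp
  also have "\<dots> \<le> 2 * (sin (pi * a))\<^sup>2 + 2 * (sin (pi * b))\<^sup>2"
    using sum_squares_bound[of "\<bar>sin (pi * a)\<bar>" "\<bar>sin (pi * b)\<bar>"] by (simp add: power2_sum)
  finally show ?thesis by (simp add: psi_sin distrib_left)
qed

lemma psi_le_square: "psi z \<le> 2 * (pi * z)\<^sup>2"
proof -
  have "\<bar>sin (pi * z)\<bar>\<^sup>2 \<le> \<bar>pi * z\<bar>\<^sup>2" by (intro power_mono abs_sin_x_le_abs_x) auto
  then show ?thesis by (simp add: psi_sin)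
qed

text \<open>The constant rounds up 2 pi^2. It measures one lattice step in the squared distance
  \<open>psi\<close> and is the origin of the numerical constants in the spatial estimates.\<close>

lemma square_mult_psi_inverse_le:
  assumes "0 < n" shows "(real n)\<^sup>2 * psi (1 / real n) \<le> 20"
proof -
  have "(real n)\<^sup>2 * psi (1 / real n) \<le> (real n)\<^sup>2 * (2 * (pi * (1 / real n))\<^sup>2)"
    by (intro mult_left_mono psi_le_square) auto
  also have "\<dots> = 2 * pi\<^sup>2" using assms by (simp add: power_mult_distrib power_divide)
  also have "pi\<^sup>2 \<le> 3.15\<^sup>2" using pi_approx by (intro power_mono) auto
  finally show ?thesis by (simp add: power2_eq_square)
qed

lemma psi_le_sum: "psi (\<kappa> $ i) \<le> (\<Sum>l\<in>UNIV. psi (\<kappa> $ l))"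
  by (rule member_le_sum[where f="\<lambda>l. psi (\<kappa> $ l)"]) (auto simp: psi_nonneg)

lemma freq_ratio_nonneg: "0 \<le> freq_ratio i j \<kappa>"
  unfolding freq_ratio_def by (intro divide_nonneg_nonneg mult_nonneg_nonneg sum_nonneg psi_nonneg)

text \<open>Division by zero is harmless here: where the denominator vanishes, so does the numerator.\<close>

lemma freq_ratio_mult: "freq_ratio i j \<kappa> * (\<Sum>l\<in>UNIV. psi (\<kappa> $ l)) = psi (\<kappa> $ i) * psi (\<kappa> $ j)"
  using psi_le_sum[of \<kappa> i] psi_nonneg[of "\<kappa> $ i"] by (auto simp: freq_ratio_def)

text \<open>Summing over the second direction cancels the denominator. This makes the total mass of
  the kernel equal to 1/2 in every dimension.\<close>

lemma sum_freq_ratio: "(\<Sum>j\<in>UNIV. freq_ratio i j \<kappa>) = psi (\<kappa> $ i)"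
proof -
  have "(\<Sum>j\<in>UNIV. freq_ratio i j \<kappa>) = psi (\<kappa> $ i) * (\<Sum>j\<in>UNIV. psi (\<kappa> $ j)) / (\<Sum>l\<in>UNIV. psi (\<kappa> $ l))"
    by (simp add: freq_ratio_def sum_divide_distrib sum_distrib_left)
  then show ?thesis using psi_le_sum[of \<kappa> i] psi_nonneg[of "\<kappa> $ i"] by auto
qed

lemma freq_ratio_le: "freq_ratio i j \<kappa> \<le> psi (\<kappa> $ i)"
  unfolding sum_freq_ratio[symmetric] by (rule member_le_sum) (auto simp: freq_ratio_nonneg)

lemma kernel_tail_nonneg: "0 \<le> kernel_tail n i j r"
  unfolding kernel_tail_def by (intro divide_nonneg_nonneg sum_nonneg mult_nonneg_nonneg freq_ratio_nonneg) auto

lemma lattice_plane_wave_int: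
  assumes "0 < n" "\<kappa> \<in> lat n" shows "(real n *\<^sub>R \<kappa>) $ i \<in> \<int>"
proof -
  obtain k where "\<kappa> $ i = real k / real n" using assms(2) unfolding torus_lattice_iff[OF assms(1)] by blast
  then show ?thesis using assms(1) by simp
qed

abbreviation lattice_wave :: "nat \<Rightarrow> real ^ 'd::finite \<Rightarrow> real ^ 'd \<Rightarrow> real ^ 'd \<Rightarrow> real" where
  "lattice_wave n \<kappa> y \<equiv> plane_wave (real n *\<^sub>R \<kappa>) (- (2 * pi * real n * (\<kappa> \<bullet> y)))"

lemma lattice_wave_shift:
  assumes "0 < n" "\<kappa> \<in> lat n"
  shows "lattice_wave n \<kappa> y (torus_shift (1 / real n) i x) = cos (2 * pi * real n * (\<kappa> \<bullet> (x - y)) + 2 * pi * \<kappa> $ i)"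
    "lattice_wave n \<kappa> y (torus_shift (- (1 / real n)) i x) = cos (2 * pi * real n * (\<kappa> \<bullet> (x - y)) - 2 * pi * \<kappa> $ i)"
  unfolding torus_fun_shift[OF torus_fun_plane_wave[OF lattice_plane_wave_int[OF assms]]] plane_wave_shift
  using assms(1) by (simp_all add: inner_diff_right algebra_simps)

lemma lattice_wave_eq: "lattice_wave n \<kappa> y x = cos (2 * pi * real n * (\<kappa> \<bullet> (x - y)))"
  unfolding plane_wave_def by (simp add: inner_diff_right algebra_simps)

lemma lattice_wave_center_shift:
  assumes "0 < n" "\<kappa> \<in> lat n"
  shows "lattice_wave n \<kappa> (torus_shift (1 / real n) i y) x = cos (2 * pi * real n * (\<kappa> \<bullet> (x - y)) - 2 * pi * \<kappa> $ i)"
proof -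
  have "lattice_wave n \<kappa> (torus_shift (1 / real n) i y) x = lattice_wave n \<kappa> x (torus_shift (1 / real n) i y)"
    unfolding lattice_wave_eq
    by (metis cos_minus inner_minus_right minus_diff_eq mult_minus_right)
  also have "\<dots> = cos (- (2 * pi * real n * (\<kappa> \<bullet> (x - y)) - 2 * pi * \<kappa> $ i))"
    unfolding lattice_wave_shift[OF assms] by (simp add: inner_diff_right algebra_simps)
  finally show ?thesis by (simp only: cos_minus)
qed

lemma heat_sg_shift_prev:
  assumes n: "0 < n" and x: "x \<in> lat n"
  shows "heat_sg n t (\<lambda>x. f (torus_shift (- (1 / real n)) j x)) x = heat_sg n t f (torus_shift (- (1 / real n)) j x)"
proof -
  let ?s = "torus_shift (1 / real n) j" and ?p = "torus_shift (- (1 / real n)) j"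
  have ps: "?p (?s z) = z" if "z \<in> lat n" for z
    using torus_shift_inverse[OF lattice_cell[OF that], of "- (1 / real n)" j] by simp
  have px: "?p x \<in> lat n" by (rule torus_shift_lattice_prev[OF n x])
  have "heat_sg n t (\<lambda>x. f (?p x)) (?s (?p x)) = heat_sg n t (\<lambda>x. f (?p (?s x))) (?p x)"
    using heat_sg_shift[OF n px, of t "\<lambda>x. f (?p x)" j] by simp
  also have "\<dots> = heat_sg n t f (?p x)"
    unfolding heat_sg_def by (rule mat_exp_cong[OF _ px]) (simp add: ps)
  finally show ?thesis unfolding torus_shift_inverse[OF lattice_cell[OF x]] .
qed

text \<open>Summation by parts for the Dirichlet form in one direction. It replaces a square, for
  which Parseval would be required, by a pairing to which the semigroup law applies.\<close>

lemma sum_square_gradient: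
  fixes f :: "real ^ 'd::finite \<Rightarrow> real"
  assumes n: "0 < n"
  shows "(\<Sum>z\<in>lat n. (f (torus_shift (1 / real n) j z) - f z)\<^sup>2)
    = (\<Sum>z\<in>lat n. f z * (2 * f z - f (torus_shift (1 / real n) j z) - f (torus_shift (- (1 / real n)) j z)))"
proof -
  let ?s = "torus_shift (1 / real n) j" and ?p = "torus_shift (- (1 / real n)) j"
  have re: "(\<Sum>z\<in>lat n. h (?s z)) = (\<Sum>z\<in>lat n. h z)" for h :: "real ^ 'd \<Rightarrow> real"
    by (rule sum.reindex_bij_betw[OF bij_betw_torus_shift[OF n]])
  have ps: "?p (?s z) = z" if "z \<in> lat n" for z
    using torus_shift_inverse[OF lattice_cell[OF that], of "- (1 / real n)" j] by simp
  have "(\<Sum>z\<in>lat n. f z * f (?p z)) = (\<Sum>z\<in>lat n. f (?s z) * f z)"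
    unfolding re[of "\<lambda>z. f z * f (?p z)", symmetric] by (intro sum.cong refl) (simp add: ps)
  moreover have "(\<Sum>z\<in>lat n. f (?s z) * f (?s z)) = (\<Sum>z\<in>lat n. f z * f z)"
    by (rule re[of "\<lambda>z. f z * f z"])
  moreover have "(\<Sum>z\<in>lat n. (f (?s z) - f z)\<^sup>2)
      = (\<Sum>z\<in>lat n. f (?s z) * f (?s z)) + (\<Sum>z\<in>lat n. f z * f z) - 2 * (\<Sum>z\<in>lat n. f (?s z) * f z)"
    unfolding sum_distrib_left sum.distrib[symmetric] sum_subtractf[symmetric]
    by (intro sum.cong refl) (simp add: power2_eq_square algebra_simps)
  moreover have "(\<Sum>z\<in>lat n. f z * (2 * f z - f (?s z) - f (?p z)))
      = 2 * (\<Sum>z\<in>lat n. f z * f z) - (\<Sum>z\<in>lat n. f (?s z) * f z) - (\<Sum>z\<in>lat n. f z * f (?p z))"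
    unfolding sum_distrib_left sum_subtractf[symmetric] by (intro sum.cong refl) (simp add: algebra_simps)
  ultimately show ?thesis by simp
qed

lemma heat_sg_sum:
  assumes "0 < n" "x \<in> lat n" "finite I"
  shows "heat_sg n t (\<lambda>y. \<Sum>i\<in>I. c i * f i y) x = (\<Sum>i\<in>I. c i * heat_sg n t (f i) x)"
  unfolding heat_sg_def using assms by (intro mat_exp_sum finite_lattice)

text \<open>After summation by parts the squared gradient becomes a pairing of the flow with its own
  second difference. Symmetry of the semigroup moves all time to one side, so the dipole is paired
  with the flow at the doubled time 2 r, and the expansion in waves diagonalises everything.\<close>

lemma kernel_mass:
  fixes x :: "real ^ 'd::finite"
  assumes n: "0 < n" and x: "x \<in> lat n"
  shows "(\<Sum>z\<in>lat n. renewal_kernel n i x j z r)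
    = (\<Sum>\<kappa>\<in>lat n. (real n)\<^sup>2 * psi (\<kappa> $ i) * psi (\<kappa> $ j) * exp (- (2 * (real n)\<^sup>2 * (\<Sum>l\<in>UNIV. psi (\<kappa> $ l))) * r)) / real n ^ CARD('d)"
proof -
  let ?L = "lat n :: (real ^ 'd) set"
  let ?s = "torus_shift (1 / real n)" and ?p = "torus_shift (- (1 / real n))"
  let ?\<zeta> = "edge_fun n i x"
  define Q where "Q f z = 2 * f z - f (?s j z) - f (?p j z)" for f :: "real ^ 'd \<Rightarrow> real" and z
  define \<mu> where "\<mu> \<kappa> = (real n)\<^sup>2 * (\<Sum>l\<in>UNIV. psi (\<kappa> $ l))" for \<kappa> :: "real ^ 'd"
  define w where "w \<kappa> y = lattice_wave n \<kappa> (?s i x) y - lattice_wave n \<kappa> x y" for \<kappa> y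
  have fin: "finite ?L" by (rule finite_lattice[OF n])
  have y: "?s i x \<in> ?L" by (rule torus_shift_lattice_next[OF n x])
  have Qw: "Q (w \<kappa>) z = 2 * psi (\<kappa> $ j) * w \<kappa> z" if "\<kappa> \<in> ?L" for \<kappa> z
  proof -
    have "2 * cos A - cos (A + B) - cos (A - B) = 2 * (1 - cos B) * cos A" for A B :: real
      by (simp add: cos_add cos_diff algebra_simps)
    then have *: "2 * lattice_wave n \<kappa> y z - lattice_wave n \<kappa> y (?s j z) - lattice_wave n \<kappa> y (?p j z) = 2 * psi (\<kappa> $ j) * lattice_wave n \<kappa> y z" for y
      unfolding lattice_wave_shift[OF n that] lattice_wave_eq[of n \<kappa> y z] psi_def by (simp add: mult.assoc)
    show ?thesis using *[of "?s i x"] *[of x] unfolding Q_def w_def by (simp add: algebra_simps)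
  qed
  have Sw: "heat_sg n t (w \<kappa>) z = exp (- \<mu> \<kappa> * t) * w \<kappa> z" if "\<kappa> \<in> ?L" "z \<in> ?L" for \<kappa> t z
  proof -
    have "heat_sg n t (lattice_wave n \<kappa> y) z = exp (- \<mu> \<kappa> * t) * lattice_wave n \<kappa> y z" for y
      using heat_sg_plane_wave[OF n that(2) lattice_plane_wave_int[OF n that(1)]] n by (simp add: \<mu>_def)
    moreover have "heat_sg n t (w \<kappa>) z = heat_sg n t (lattice_wave n \<kappa> (?s i x)) z - heat_sg n t (lattice_wave n \<kappa> x) z"
      unfolding w_def[abs_def] heat_sg_def by (rule mat_exp_diff[OF fin that(2)])
    ultimately show ?thesis unfolding w_def by (simp add: right_diff_distrib)
  qed
  have \<zeta>: "?\<zeta> z = (\<Sum>\<kappa>\<in>?L. 1 / real n ^ CARD('d) * w \<kappa> z)" if "z \<in> ?L" for z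
    unfolding edge_fun_def lattice_delta[OF n that y, symmetric] lattice_delta[OF n that x, symmetric] w_def
    by (simp add: sum_subtractf diff_divide_distrib sum_divide_distrib)
  have Q\<zeta>: "Q ?\<zeta> z = (\<Sum>\<kappa>\<in>?L. 2 * psi (\<kappa> $ j) / real n ^ CARD('d) * w \<kappa> z)" if "z \<in> ?L" for z
  proof -
    have "Q ?\<zeta> z = (\<Sum>\<kappa>\<in>?L. 1 / real n ^ CARD('d) * Q (w \<kappa>) z)"
      unfolding Q_def \<zeta>[OF that] \<zeta>[OF torus_shift_lattice_next[OF n that]] \<zeta>[OF torus_shift_lattice_prev[OF n that]]
      by (simp add: sum_distrib_left sum_subtractf[symmetric] algebra_simps diff_divide_distrib)
    then show ?thesis by (simp add: Qw)
  qed
  have QS: "Q (heat_sg n r ?\<zeta>) z = heat_sg n r (Q ?\<zeta>) z" if "z \<in> ?L" for z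
  proof -
    have "heat_sg n r (Q ?\<zeta>) z = heat_sg n r (\<lambda>y. (2 * ?\<zeta> y - ?\<zeta> (?s j y)) - ?\<zeta> (?p j y)) z"
      by (simp add: Q_def[abs_def])
    also have "\<dots> = 2 * heat_sg n r ?\<zeta> z - heat_sg n r (\<lambda>y. ?\<zeta> (?s j y)) z - heat_sg n r (\<lambda>y. ?\<zeta> (?p j y)) z"
      using mat_exp_diff[OF fin that] mat_exp_sum[OF fin that, of "{()}" _ r "\<lambda>_. 2" "\<lambda>_. ?\<zeta>"] by (simp add: heat_sg_def)
    finally show ?thesis unfolding Q_def heat_sg_shift[OF n that] heat_sg_shift_prev[OF n that] by simp
  qed
  have S2: "heat_sg n (r + r) (Q ?\<zeta>) z = (\<Sum>\<kappa>\<in>?L. 2 * psi (\<kappa> $ j) / real n ^ CARD('d) * (exp (- \<mu> \<kappa> * (r + r)) * w \<kappa> z))" if "z \<in> ?L" for z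
  proof -
    have "heat_sg n (r + r) (Q ?\<zeta>) z = heat_sg n (r + r) (\<lambda>y. \<Sum>\<kappa>\<in>?L. 2 * psi (\<kappa> $ j) / real n ^ CARD('d) * w \<kappa> y) z"
      unfolding heat_sg_def by (rule mat_exp_cong[OF Q\<zeta> that])
    also have "\<dots> = (\<Sum>\<kappa>\<in>?L. 2 * psi (\<kappa> $ j) / real n ^ CARD('d) * heat_sg n (r + r) (w \<kappa>) z)"
      by (rule heat_sg_sum[OF n that fin])
    finally show ?thesis using that by (simp add: Sw)
  qed
  \<comment> \<open>Evaluating the wave part of a dipole on the same dipole gives 1 - cos twice,
    which contributes the factor \<open>psi\<close> of direction \<open>i\<close>.\<close>
  have ww: "w \<kappa> (?s i x) - w \<kappa> x = 2 * psi (\<kappa> $ i)" if "\<kappa> \<in> ?L" for \<kappa>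
    unfolding w_def lattice_wave_center_shift[OF n that] lattice_wave_shift[OF n that]
    using lattice_wave_shift(1)[OF n that, of "?s i x" i "x"] lattice_wave_center_shift[OF n that, of i x "?s i x"]
    by (simp add: lattice_wave_eq psi_def)
  have "(\<Sum>z\<in>?L. (heat_sg n r ?\<zeta> (?s j z) - heat_sg n r ?\<zeta> z)\<^sup>2) = (\<Sum>z\<in>?L. heat_sg n r ?\<zeta> z * Q (heat_sg n r ?\<zeta>) z)"
    unfolding sum_square_gradient[OF n] Q_def ..
  also have "\<dots> = (\<Sum>z\<in>?L. heat_sg n r ?\<zeta> z * heat_sg n r (Q ?\<zeta>) z)"
    by (intro sum.cong refl) (simp add: QS)
  also have "\<dots> = (\<Sum>z\<in>?L. ?\<zeta> z * heat_sg n (r + r) (Q ?\<zeta>) z)"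
    by (rule heat_sg_symmetric[OF n])
  also have "\<dots> = heat_sg n (r + r) (Q ?\<zeta>) (?s i x) - heat_sg n (r + r) (Q ?\<zeta>) x"
    by (rule sum_edge_fun[OF n x])
  also have "\<dots> = (\<Sum>\<kappa>\<in>?L. 2 * psi (\<kappa> $ j) / real n ^ CARD('d) * (exp (- \<mu> \<kappa> * (r + r)) * (w \<kappa> (?s i x) - w \<kappa> x)))"
    unfolding S2[OF x] S2[OF y] by (simp add: sum_subtractf[symmetric] right_diff_distrib)
  also have "\<dots> = (\<Sum>\<kappa>\<in>?L. 4 * psi (\<kappa> $ i) * psi (\<kappa> $ j) * exp (- (2 * (real n)\<^sup>2 * (\<Sum>l\<in>UNIV. psi (\<kappa> $ l))) * r)) / real n ^ CARD('d)"
    unfolding sum_divide_distrib by (intro sum.cong refl) (simp add: ww \<mu>_def algebra_simps)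
  finally show ?thesis
    unfolding renewal_kernel_def sum_distrib_left[symmetric] by (simp add: sum_distrib_left mult_ac)
qed

lemma kernel_mass_has_integral:
  fixes x :: "real ^ 'd::finite"
  assumes n: "0 < n" and x: "x \<in> lat n" and ab: "a \<le> b"
  shows "((\<lambda>s. \<Sum>z\<in>lat n. renewal_kernel n i x j z (t - s)) has_integral (kernel_tail n i j (t - b) - kernel_tail n i j (t - a))) {a..b}"
proof -
  let ?P = "\<lambda>\<kappa> :: real ^ 'd. \<Sum>l\<in>UNIV. psi (\<kappa> $ l)"
  have "((\<lambda>s. kernel_tail n i j (t - s)) has_real_derivative (\<Sum>z\<in>lat n. renewal_kernel n i x j z (t - s))) (at s)" for s
  proof -
    have "((\<lambda>s. kernel_tail n i j (t - s)) has_real_derivative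
      (\<Sum>\<kappa>\<in>lat n. freq_ratio i j \<kappa> * (exp (- (2 * (real n)\<^sup>2 * ?P \<kappa>) * (t - s)) * (2 * (real n)\<^sup>2 * ?P \<kappa>))) / (2 * real n ^ CARD('d))) (at s)"
      unfolding kernel_tail_def by (rule DERIV_cdivide) (auto intro!: derivative_eq_intros sum.cong)
    also have "(\<Sum>\<kappa>\<in>lat n. freq_ratio i j \<kappa> * (exp (- (2 * (real n)\<^sup>2 * ?P \<kappa>) * (t - s)) * (2 * (real n)\<^sup>2 * ?P \<kappa>))) / (2 * real n ^ CARD('d))
      = (\<Sum>z\<in>lat n. renewal_kernel n i x j z (t - s))"
    proof -
      have "freq_ratio i j \<kappa> * (exp (- (2 * (real n)\<^sup>2 * ?P \<kappa>) * (t - s)) * (2 * (real n)\<^sup>2 * ?P \<kappa>))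
        = 2 * ((real n)\<^sup>2 * psi (\<kappa> $ i) * psi (\<kappa> $ j) * exp (- (2 * (real n)\<^sup>2 * ?P \<kappa>) * (t - s)))" for \<kappa>
        using arg_cong[OF freq_ratio_mult[of i j \<kappa>], of "\<lambda>q. q * exp (- (2 * (real n)\<^sup>2 * ?P \<kappa>) * (t - s)) * (2 * (real n)\<^sup>2)"]
        by (simp only: mult_ac)
      then show ?thesis unfolding kernel_mass[OF n x] by (simp only: sum_distrib_left[symmetric])
    qed
    finally show ?thesis .
  qed
  then show ?thesis
    by (intro fundamental_theorem_of_calculus[OF ab])
      (auto simp: has_real_derivative_iff_has_vector_derivative[symmetric] intro: DERIV_subset)
qed

lemma mult_exp_minus_le: "0 \<le> (a::real) \<Longrightarrow> 0 < c \<Longrightarrow> a * exp (- (c * a)) \<le> 1 / c"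
proof -
  assume a: "0 \<le> a" "0 < c"
  have "c * a \<le> exp (c * a)" using exp_ge_add_one_self[of "c * a"] by linarith
  then have "c * a * exp (- (c * a)) \<le> exp (c * a) * exp (- (c * a))" by (intro mult_right_mono) auto
  then show ?thesis using a by (simp add: exp_minus field_simps)
qed

text \<open>The ratio is at most \<psi>_i and the exponential decays at least at the rate of
  \<psi>_i alone, so the bound a exp (-c a) \<le> 1 / c applies to each frequency separately. The
  kernel therefore lives on ages of order n^(-2).\<close>

lemma kernel_tail_decay:
  fixes i j :: "'d::finite"
  assumes n: "0 < n" and r: "0 < r"
  shows "kernel_tail n i j r \<le> 1 / (4 * (real n)\<^sup>2 * r)"
proof -
  let ?c = "2 * (real n)\<^sup>2 * r"
  have c: "0 < ?c" using n r by simp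
  have "kernel_tail n i j r \<le> (\<Sum>\<kappa>\<in>(lat n :: (real ^ 'd) set). 1 / ?c) / (2 * real n ^ CARD('d))"
    unfolding kernel_tail_def
  proof (intro divide_right_mono sum_mono)
    fix \<kappa> :: "real ^ 'd"
    have "freq_ratio i j \<kappa> * exp (- (2 * (real n)\<^sup>2 * (\<Sum>l\<in>UNIV. psi (\<kappa> $ l))) * r) \<le> psi (\<kappa> $ i) * exp (- (?c * psi (\<kappa> $ i)))"
    proof (rule mult_mono[OF freq_ratio_le])
      have "?c * psi (\<kappa> $ i) \<le> ?c * (\<Sum>l\<in>UNIV. psi (\<kappa> $ l))" using c by (intro mult_left_mono psi_le_sum) auto
      then show "exp (- (2 * (real n)\<^sup>2 * (\<Sum>l\<in>UNIV. psi (\<kappa> $ l))) * r) \<le> exp (- (?c * psi (\<kappa> $ i)))"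
        by (simp add: mult_ac)
    qed (auto simp: psi_nonneg)
    also have "\<dots> \<le> 1 / ?c" by (rule mult_exp_minus_le[OF psi_nonneg c])
    finally show "freq_ratio i j \<kappa> * exp (- (2 * (real n)\<^sup>2 * (\<Sum>l\<in>UNIV. psi (\<kappa> $ l))) * r) \<le> 1 / ?c" .
  qed simp
  also have "\<dots> = 1 / (4 * (real n)\<^sup>2 * r)" using n by (simp add: card_lattice)
  finally show ?thesis .
qed

text \<open>The mean of the cosine is the Fourier expansion of the delta function at 0, evaluated at
  a neighbour of 0. It vanishes because the neighbour is a different point.\<close>

lemma sum_psi_lattice:
  fixes i :: "'d::finite"
  assumes n: "2 \<le> n"
  shows "(\<Sum>\<kappa>\<in>lat n. psi (\<kappa> $ i)) = real n ^ CARD('d)"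
proof -
  let ?L = "lat n :: (real ^ 'd) set" and ?s = "torus_shift (1 / real n) i"
  have n0: "0 < n" using n by simp
  have z: "0 \<in> ?L" unfolding torus_lattice_iff[OF n0] using n0 by (auto intro: exI[of _ 0])
  have y: "?s 0 \<in> ?L" by (rule torus_shift_lattice_next[OF n0 z])
  have "(\<Sum>\<kappa>\<in>?L. lattice_wave n \<kappa> 0 (?s 0)) = 0"
    using lattice_delta[OF n0 y z] torus_shift_neq[OF n z, of i] n0 by (simp del: inner_zero_right)
  moreover have "(\<Sum>\<kappa>\<in>?L. lattice_wave n \<kappa> 0 (?s 0)) = (\<Sum>\<kappa>\<in>?L. cos (2 * pi * \<kappa> $ i))"
    by (intro sum.cong refl) (simp only: lattice_wave_shift(1)[OF n0], simp)
  ultimately show ?thesis unfolding psi_def by (simp add: sum_subtractf card_lattice[OF n0])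
qed

text \<open>The factor 1/2 by which errors contract in every later estimate.\<close>

lemma sum_kernel_tail_0:
  fixes i :: "'d::finite"
  assumes n: "2 \<le> n"
  shows "(\<Sum>j\<in>UNIV. kernel_tail n i j 0) = 1 / 2"
proof -
  have "(\<Sum>j\<in>UNIV. kernel_tail n i j 0) = (\<Sum>\<kappa>\<in>lat n. \<Sum>j\<in>UNIV. freq_ratio i j \<kappa>) / (2 * real n ^ CARD('d))"
    unfolding kernel_tail_def by (subst sum.swap) (simp add: sum_divide_distrib)
  then show ?thesis using n by (simp add: sum_freq_ratio sum_psi_lattice)
qed

section \<open>Spatial localisation of the renewal kernel\<close>

definition lattice_delta_fun :: "real ^ 'd::finite \<Rightarrow> real ^ 'd \<Rightarrow> real" where
  "lattice_delta_fun a y = of_bool (y = a)"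

lemma heat_sg_mono:
  assumes n: "0 < n" and x: "x \<in> lat n" and f: "\<And>y. y \<in> lat n \<Longrightarrow> f y \<le> g y" and t: "0 \<le> t"
  shows "heat_sg n t f x \<le> heat_sg n t g x"
  unfolding heat_sg_def
  by (rule mat_exp_mono[OF finite_lattice[OF n] x _ _ f t]) (auto intro: lap_mat_off_diag lap_mat_row_sum n)

lemma heat_sg_const: "0 < n \<Longrightarrow> x \<in> lat n \<Longrightarrow> heat_sg n t (\<lambda>_. c) x = c"
  unfolding heat_sg_def by (rule mat_exp_const) (auto intro: finite_lattice lap_mat_row_sum)

lemma heat_sg_contraction:
  assumes n: "0 < n" and x: "x \<in> lat n" and f: "\<And>y. y \<in> lat n \<Longrightarrow> \<bar>f y - g y\<bar> \<le> B" and t: "0 \<le> t"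
  shows "\<bar>heat_sg n t f x - heat_sg n t g x\<bar> \<le> B"
  unfolding heat_sg_def
  by (rule mat_exp_contraction[OF finite_lattice[OF n] x _ _ f t]) (auto intro: lap_mat_off_diag lap_mat_row_sum n)

lemma heat_kernel_bounds:
  assumes n: "0 < n" and z: "z \<in> lat n" and r: "0 \<le> r"
  shows "0 \<le> heat_sg n r (lattice_delta_fun a) z" "heat_sg n r (lattice_delta_fun a) z \<le> 1"
  using heat_sg_mono[OF n z _ r, of "\<lambda>_. 0" "lattice_delta_fun a"] heat_sg_mono[OF n z _ r, of "lattice_delta_fun a" "\<lambda>_. 1"]
  by (auto simp: lattice_delta_fun_def heat_sg_const[OF n z])

lemma sum_heat_kernel:
  assumes n: "0 < n" and a: "a \<in> lat n"
  shows "(\<Sum>z\<in>lat n. heat_sg n r (lattice_delta_fun a) z * h z) = heat_sg n r h a"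
  using heat_sg_symmetric[OF n, of r "lattice_delta_fun a" 0 h] sum_delta_left[OF n a]
  by (simp add: lattice_delta_fun_def[abs_def] heat_sg_def)

text \<open>\<open>psi\<close> serves as a squared distance on the torus because \<open>1 - psi\<close> is an eigenfunction.\<close>

lemma heat_sg_psi_le:
  fixes x a :: "real ^ 'd::finite"
  assumes n: "0 < n" and a: "a \<in> lat n" and r: "0 \<le> r"
  shows "heat_sg n r (\<lambda>z. psi (z $ l - c)) a \<le> psi (a $ l - c) + r * 20"
proof -
  let ?w = "plane_wave (axis l 1) (- (2 * pi * c)) :: real ^ 'd \<Rightarrow> real"
  let ?m = "(real n)\<^sup>2 * psi (1 / real n)"
  have psi_w: "psi (z $ l - c) = 1 - ?w z" for z :: "real ^ 'd"
    by (simp add: psi_def plane_wave_def inner_axis' algebra_simps)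
  have int: "(axis l 1 :: real ^ 'd) $ i \<in> \<int>" for i by (simp add: axis_def)
  have "(\<Sum>i\<in>UNIV. psi ((axis l 1 :: real ^ 'd) $ i / real n)) = (\<Sum>i\<in>UNIV. if i = l then psi (1 / real n) else 0)"
    by (intro sum.cong refl) (auto simp: axis_def)
  then have S: "heat_sg n r ?w a = exp (- ?m * r) * ?w a"
    using heat_sg_plane_wave[OF n a int] by simp
  have "heat_sg n r (\<lambda>z. psi (z $ l - c)) a = heat_sg n r (\<lambda>z. 1) a - heat_sg n r ?w a"
    unfolding psi_w heat_sg_def by (rule mat_exp_diff[OF finite_lattice[OF n] a])
  also have "\<dots> = psi (a $ l - c) + (1 - exp (- ?m * r)) * ?w a"
    unfolding heat_sg_const[OF n a] S psi_w by (simp add: algebra_simps)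
  also have "(1 - exp (- ?m * r)) * ?w a \<le> (1 - exp (- ?m * r)) * 1"
    using r by (intro mult_left_mono) (auto simp: plane_wave_def psi_nonneg)
  also have "1 - exp (- ?m * r) \<le> ?m * r" using exp_ge_add_one_self[of "- ?m * r"] by simp
  also have "?m * r \<le> 20 * r" using square_mult_psi_inverse_le[OF n] r by (intro mult_right_mono) auto
  finally show ?thesis by (simp add: mult.commute)
qed

text \<open>The kernel is at most n^2 times a sum of four heat kernels, each centred at an end of
  the first edge and evaluated at an end of the second. Their mean squared displacement is of order
  1 / n^2 + r. The time decay of the square is lost, but the bound is only integrated over a window
  of length of order n^(-2).\<close>

lemma kernel_spatial_bound:
  fixes x :: "real ^ 'd::finite"
  assumes n: "0 < n" and x: "x \<in> lat n" and r: "0 \<le> r"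
  shows "(\<Sum>z\<in>lat n. renewal_kernel n i x j z r * psi (z $ l - x $ l)) \<le> 200 + 120 * ((real n)\<^sup>2 * r)"
proof -
  let ?L = "lat n :: (real ^ 'd) set"
  let ?s = "torus_shift (1 / real n)" and ?p = "torus_shift (- (1 / real n))"
  let ?h = "\<lambda>z :: real ^ 'd. psi (z $ l - x $ l)"
  let ?P = "\<lambda>a. heat_sg n r (lattice_delta_fun a)"
  have y: "?s i x \<in> ?L" by (rule torus_shift_lattice_next[OF n x])
  have \<zeta>: "heat_sg n r (edge_fun n i x) z = ?P (?s i x) z - ?P x z" if "z \<in> ?L" for z
    using mat_exp_diff[OF finite_lattice[OF n] that, of "lap_mat n" r "lattice_delta_fun (?s i x)" "lattice_delta_fun x"]
    by (simp add: heat_sg_def edge_fun_def[abs_def] lattice_delta_fun_def)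
  have psi1: "psi (1 / real n) \<le> 20 / (real n)\<^sup>2"
    using square_mult_psi_inverse_le[OF n] n by (simp add: field_simps)
  have psi_b: "psi (if b then 1 / real n else 0) \<le> 20 / (real n)\<^sup>2" for b
    using psi1 by simp
  have point: "renewal_kernel n i x j z r \<le> (real n)\<^sup>2 * (?P (?s i x) (?s j z) + ?P x (?s j z) + ?P (?s i x) z + ?P x z)" if z: "z \<in> ?L" for z
  proof -
    \<comment> \<open>Trades the square for an expression linear in heat kernels, to which the
      eigenfunction estimate applies: of the two equal factors one is bounded by 4 and the other by
      the sum.\<close>
    have sq: "(a - b - (c - d))\<^sup>2 \<le> 4 * (a + b + c + d)" if "0 \<le> a" "a \<le> 1" "0 \<le> b" "b \<le> 1" "0 \<le> c" "c \<le> 1" "0 \<le> d" "d \<le> 1" for a b c d :: real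
    proof -
      have le: "\<bar>a - b - (c - d)\<bar> \<le> a + b + c + d" "\<bar>a - b - (c - d)\<bar> \<le> 4" using that by auto
      have "(a - b - (c - d))\<^sup>2 = \<bar>a - b - (c - d)\<bar> * \<bar>a - b - (c - d)\<bar>" by (simp add: power2_eq_square)
      also have "\<dots> \<le> 4 * (a + b + c + d)" by (rule mult_mono) (use le in auto)
      finally show ?thesis .
    qed
    have sz: "?s j z \<in> ?L" by (rule torus_shift_lattice_next[OF n z])
    have "(?P (?s i x) (?s j z) - ?P x (?s j z) - (?P (?s i x) z - ?P x z))\<^sup>2
      \<le> 4 * (?P (?s i x) (?s j z) + ?P x (?s j z) + ?P (?s i x) z + ?P x z)"
      by (intro sq heat_kernel_bounds n r z sz)
    then have "(real n)\<^sup>2 / 4 * (?P (?s i x) (?s j z) - ?P x (?s j z) - (?P (?s i x) z - ?P x z))\<^sup>2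
      \<le> (real n)\<^sup>2 / 4 * (4 * (?P (?s i x) (?s j z) + ?P x (?s j z) + ?P (?s i x) z + ?P x z))"
      by (rule mult_left_mono) simp
    also have "(real n)\<^sup>2 / 4 * (4 * S) = (real n)\<^sup>2 * S" for S :: real by simp
    finally show ?thesis unfolding renewal_kernel_def \<zeta>[OF z] \<zeta>[OF sz] .
  qed
  have near: "(\<Sum>z\<in>?L. ?P a z * ?h z) \<le> 20 / (real n)\<^sup>2 + r * 20" if "a = x \<or> a = ?s i x" for a
  proof -
    have a: "a \<in> ?L" using that x y by auto
    have "?h a \<le> 20 / (real n)\<^sup>2"
    proof (cases "a = x")
      case False
      then have "a $ l = frac (x $ l + (if i = l then 1 / real n else 0))" using that by (simp add: torus_shift_nth)
      then have "?h a = psi (if i = l then 1 / real n else 0)"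
        using psi_of_int[of "if i = l then 1 / real n else 0" "- \<lfloor>x $ l + (if i = l then 1 / real n else 0)\<rfloor>"]
        by (simp add: frac_def)
      then show ?thesis using psi_b by simp
    qed simp
    then show ?thesis using heat_sg_psi_le[OF n a r, of l "x $ l"] by (simp add: sum_heat_kernel[OF n a])
  qed
  have far: "(\<Sum>z\<in>?L. ?P a (?s j z) * ?h z) \<le> 2 * (20 / (real n)\<^sup>2 + r * 20) + 40 / (real n)\<^sup>2" if "a = x \<or> a = ?s i x" for a
  proof -
    have a: "a \<in> ?L" using that x y by auto
    have hz: "?h z \<le> 2 * ?h (?s j z) + 40 / (real n)\<^sup>2" for z
    proof -
      let ?q = "if j = l then 1 / real n else 0"
      have "?h (?s j z) = psi (z $ l - x $ l + ?q)"
        using psi_of_int[of "z $ l - x $ l + ?q" "- \<lfloor>z $ l + ?q\<rfloor>"] by (simp add: torus_shift_nth frac_def algebra_simps)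
      moreover have "?h z \<le> 2 * psi (z $ l - x $ l + ?q) + 2 * psi (- ?q)"
        using psi_add_le[of "z $ l - x $ l + ?q" "- ?q"] by simp
      moreover have "psi (- ?q) \<le> 20 / (real n)\<^sup>2" using psi_b[of "j = l"] by (simp only: psi_minus)
      ultimately show ?thesis by linarith
    qed
    have "(\<Sum>z\<in>?L. ?P a (?s j z) * ?h z) \<le> (\<Sum>z\<in>?L. ?P a (?s j z) * (2 * ?h (?s j z) + 40 / (real n)\<^sup>2))"
      by (intro sum_mono mult_left_mono hz heat_kernel_bounds(1)[OF n torus_shift_lattice_next[OF n] r])
    also have "\<dots> = (\<Sum>z\<in>?L. ?P a z * (2 * ?h z + 40 / (real n)\<^sup>2))"
      by (rule sum.reindex_bij_betw[OF bij_betw_torus_shift[OF n], of "\<lambda>z. ?P a z * (2 * ?h z + 40 / (real n)\<^sup>2)" j])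
    also have "\<dots> = 2 * (\<Sum>z\<in>?L. ?P a z * ?h z) + 40 / (real n)\<^sup>2 * (\<Sum>z\<in>?L. ?P a z * 1)"
      unfolding sum_distrib_left sum.distrib[symmetric] by (intro sum.cong refl) (simp add: algebra_simps)
    also have "(\<Sum>z\<in>?L. ?P a z * 1) = 1" unfolding sum_heat_kernel[OF n a] by (rule heat_sg_const[OF n a])
    finally show ?thesis using near[OF that] by simp
  qed
  have "(\<Sum>z\<in>?L. renewal_kernel n i x j z r * ?h z)
    \<le> (\<Sum>z\<in>?L. (real n)\<^sup>2 * (?P (?s i x) (?s j z) + ?P x (?s j z) + ?P (?s i x) z + ?P x z) * ?h z)"
    by (intro sum_mono mult_right_mono point psi_nonneg)
  also have "\<dots> = (real n)\<^sup>2 * ((\<Sum>z\<in>?L. ?P (?s i x) (?s j z) * ?h z) + (\<Sum>z\<in>?L. ?P x (?s j z) * ?h z)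
      + (\<Sum>z\<in>?L. ?P (?s i x) z * ?h z) + (\<Sum>z\<in>?L. ?P x z * ?h z))"
    unfolding sum_distrib_left sum.distrib[symmetric] by (intro sum.cong refl) (simp add: algebra_simps)
  \<comment> \<open>The kernels evaluated at the shifted end pay the factor 2 and the extra 40 / n^2
    of the triangle inequality for \<open>psi\<close>; the other two do not.\<close>
  also have "\<dots> \<le> (real n)\<^sup>2 * ((2 * (20 / (real n)\<^sup>2 + r * 20) + 40 / (real n)\<^sup>2) + (2 * (20 / (real n)\<^sup>2 + r * 20) + 40 / (real n)\<^sup>2)
      + (20 / (real n)\<^sup>2 + r * 20) + (20 / (real n)\<^sup>2 + r * 20))"
    by (intro mult_left_mono add_mono near far) auto
  also have "\<dots> = 200 + 120 * ((real n)\<^sup>2 * r)" using n by (simp add: field_simps)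
  finally show ?thesis by simp
qed


lemma renewal_kernel_nonneg: "0 \<le> renewal_kernel n i x j z r"
  unfolding renewal_kernel_def by simp

lemma renewal_kernel_continuous:
  assumes n: "0 < n" and z: "z \<in> lat n"
  shows "continuous_on A (\<lambda>s. renewal_kernel n i x j z (t - s))"
proof -
  have "continuous_on A (\<lambda>s. heat_sg n (t - s) f a)" if "a \<in> lat n" for a f
    unfolding heat_sg_def
    by (rule continuous_on_compose2[OF mat_exp_continuous[OF finite_lattice[OF n] that, of UNIV]])
      (auto intro!: continuous_intros)
  then show ?thesis unfolding renewal_kernel_def
    by (intro continuous_intros) (use z torus_shift_lattice_next[OF n z] in auto)
qed

text \<open>The mass of the kernel sits at parabolic distance of order \<open>1 / n\<close> from \<open>(t, x)\<close>.\<close>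

lemma renewal_bound:
  fixes \<Phi> :: "'d::finite \<Rightarrow> real \<Rightarrow> real ^ 'd \<Rightarrow> real"
  assumes n: "2 \<le> n" and x: "x \<in> lat n" and \<delta>: "0 \<le> \<delta>" "\<delta> \<le> t" and C: "0 \<le> C" and c: "0 \<le> c" "0 \<le> c'"
    and cont: "\<And>j z. z \<in> lat n \<Longrightarrow> continuous_on {0..t} (\<lambda>s. \<Phi> j s z)"
    and far: "\<And>j z s. z \<in> lat n \<Longrightarrow> 0 \<le> s \<Longrightarrow> s \<le> t \<Longrightarrow> \<bar>\<Phi> j s z\<bar> \<le> C"
    and near: "\<And>j z s. z \<in> lat n \<Longrightarrow> t - \<delta> \<le> s \<Longrightarrow> s \<le> t \<Longrightarrow> \<bar>\<Phi> j s z\<bar> \<le> c + c' * (\<Sum>l\<in>UNIV. psi (z $ l - x $ l))"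
  shows "(\<lambda>s. \<Sum>(j, z)\<in>UNIV \<times> lat n. renewal_kernel n i x j z (t - s) * \<Phi> j s z) integrable_on {0..t}"
    and "\<bar>integral {0..t} (\<lambda>s. \<Sum>(j, z)\<in>UNIV \<times> lat n. renewal_kernel n i x j z (t - s) * \<Phi> j s z)\<bar>
      \<le> C * (\<Sum>j\<in>UNIV. kernel_tail n i j \<delta>) + c / 2
        + c' * (\<delta> * ((real CARD('d))\<^sup>2 * (200 + 120 * ((real n)\<^sup>2 * \<delta>))))"
proof -
  let ?L = "lat n :: (real ^ 'd) set" and ?E = "UNIV \<times> lat n :: ('d \<times> (real ^ 'd)) set"
  let ?K = "\<lambda>j z s. renewal_kernel n i x j z (t - s)"
  let ?f = "\<lambda>s. \<Sum>(j, z)\<in>?E. ?K j z s * \<Phi> j s z"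
  let ?m = "\<lambda>s. \<Sum>j\<in>UNIV. \<Sum>z\<in>?L. ?K j z s"
  let ?sp = "(real CARD('d))\<^sup>2 * (200 + 120 * ((real n)\<^sup>2 * \<delta>))"
  have n0: "0 < n" using n by simp
  have "continuous_on {0..t} ?f"
    unfolding split_def by (intro continuous_on_sum continuous_on_mult renewal_kernel_continuous[OF n0] cont) auto
  then show int: "?f integrable_on {0..t}" by (rule integrable_continuous_interval)
  have f_sum: "?f s = (\<Sum>j\<in>UNIV. \<Sum>z\<in>?L. ?K j z s * \<Phi> j s z)" for s
    by (simp add: sum.cartesian_product)
  have mass: "(?m has_integral (\<Sum>j\<in>UNIV. kernel_tail n i j (t - b) - kernel_tail n i j (t - a))) {a..b}" if "a \<le> b" for a b
    by (intro has_integral_sum kernel_mass_has_integral[OF n0 x that]) auto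
  have f_abs: "\<bar>?f s\<bar> \<le> (\<Sum>j\<in>UNIV. \<Sum>z\<in>?L. ?K j z s * \<bar>\<Phi> j s z\<bar>)" for s
    unfolding f_sum
    by (rule order_trans[OF sum_abs], rule sum_mono, rule order_trans[OF sum_abs])
      (simp add: abs_mult renewal_kernel_nonneg)
  \<comment> \<open>Ages above \<delta> carry only the tail mass at \<delta> and are met with the
    crude bound \<open>C\<close>. For younger ages the mass 1/2 multiplies \<open>c\<close>, and the
    spatial moment multiplies \<open>c'\<close>.\<close>
  have split: "integral {0..t} ?f = integral {0..t - \<delta>} ?f + integral {t - \<delta>..t} ?f"
    by (rule Henstock_Kurzweil_Integration.integral_combine[symmetric]) (use \<delta> int in auto)
  have "norm (integral {0..t - \<delta>} ?f) \<le> integral {0..t - \<delta>} (\<lambda>s. C * ?m s)"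
  proof (rule integral_norm_bound_integral)
    show "?f integrable_on {0..t - \<delta>}" by (rule integrable_subinterval_real[OF int]) (use \<delta> in auto)
    show "(\<lambda>s. C * ?m s) integrable_on {0..t - \<delta>}"
      using has_integral_mult_right[OF mass[of 0 "t - \<delta>"]] \<delta> by (auto simp: integrable_on_def)
    fix s assume s: "s \<in> {0..t - \<delta>}"
    have "(\<Sum>j\<in>UNIV. \<Sum>z\<in>?L. ?K j z s * \<bar>\<Phi> j s z\<bar>) \<le> (\<Sum>j\<in>UNIV. \<Sum>z\<in>?L. ?K j z s * C)"
      by (intro sum_mono mult_left_mono far renewal_kernel_nonneg) (use s \<delta> in auto)
    then show "norm (?f s) \<le> C * ?m s" using f_abs[of s] by (simp add: sum_distrib_left mult.commute)
  qed
  also have "\<dots> = C * (\<Sum>j\<in>UNIV. kernel_tail n i j (t - (t - \<delta>)) - kernel_tail n i j (t - 0))"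
    by (rule integral_unique[OF has_integral_mult_right[OF mass]]) (use \<delta> in auto)
  also have "\<dots> \<le> C * (\<Sum>j\<in>UNIV. kernel_tail n i j \<delta>)"
    using C by (intro mult_left_mono sum_mono) (auto simp: kernel_tail_nonneg)
  finally have 1: "\<bar>integral {0..t - \<delta>} ?f\<bar> \<le> C * (\<Sum>j\<in>UNIV. kernel_tail n i j \<delta>)" by simp
  have int2: "((\<lambda>s. c * ?m s + c' * ?sp) has_integral
      (c * (\<Sum>j\<in>UNIV. kernel_tail n i j (t - t) - kernel_tail n i j (t - (t - \<delta>))) + c' * ?sp * \<delta>)) {t - \<delta>..t}"
    using has_integral_add[OF has_integral_mult_right[OF mass[of "t - \<delta>" t], of c] has_integral_const_real[of "c' * ?sp" "t - \<delta>" t]] \<delta>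
    by (simp add: mult_ac)
  have "norm (integral {t - \<delta>..t} ?f) \<le> integral {t - \<delta>..t} (\<lambda>s. c * ?m s + c' * ?sp)"
  proof (rule integral_norm_bound_integral)
    show "?f integrable_on {t - \<delta>..t}" by (rule integrable_subinterval_real[OF int]) (use \<delta> in auto)
    show "(\<lambda>s. c * ?m s + c' * ?sp) integrable_on {t - \<delta>..t}" using int2 by blast
    fix s assume s: "s \<in> {t - \<delta>..t}"
    have "(\<Sum>j\<in>UNIV. \<Sum>z\<in>?L. ?K j z s * \<bar>\<Phi> j s z\<bar>) \<le> (\<Sum>j\<in>UNIV. \<Sum>z\<in>?L. ?K j z s * (c + c' * (\<Sum>l\<in>UNIV. psi (z $ l - x $ l))))"
      by (intro sum_mono mult_left_mono near renewal_kernel_nonneg) (use s in auto)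
    also have "\<dots> = c * ?m s + c' * (\<Sum>j\<in>UNIV. \<Sum>l\<in>UNIV. \<Sum>z\<in>?L. ?K j z s * psi (z $ l - x $ l))"
    proof -
      have "(\<Sum>z\<in>?L. ?K j z s * (c + c' * (\<Sum>l\<in>UNIV. psi (z $ l - x $ l))))
        = c * (\<Sum>z\<in>?L. ?K j z s) + c' * (\<Sum>l\<in>UNIV. \<Sum>z\<in>?L. ?K j z s * psi (z $ l - x $ l))" for j
        by (subst sum.swap) (simp add: sum_distrib_left sum.distrib distrib_left mult_ac)
      then show ?thesis by (simp add: sum.distrib sum_distrib_left)
    qed
    also have "(\<Sum>j\<in>UNIV. \<Sum>l\<in>UNIV. \<Sum>z\<in>?L. ?K j z s * psi (z $ l - x $ l)) \<le> (\<Sum>j\<in>(UNIV :: 'd set). \<Sum>l\<in>(UNIV :: 'd set). 200 + 120 * ((real n)\<^sup>2 * \<delta>))"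
    proof (intro sum_mono)
      fix j l :: 'd
      have "(\<Sum>z\<in>?L. ?K j z s * psi (z $ l - x $ l)) \<le> 200 + 120 * ((real n)\<^sup>2 * (t - s))"
        by (rule kernel_spatial_bound[OF n0 x]) (use s in auto)
      also have "\<dots> \<le> 200 + 120 * ((real n)\<^sup>2 * \<delta>)" using s by (intro add_left_mono mult_left_mono) auto
      finally show "(\<Sum>z\<in>?L. ?K j z s * psi (z $ l - x $ l)) \<le> 200 + 120 * ((real n)\<^sup>2 * \<delta>)" .
    qed
    also have "\<dots> = ?sp" by (simp add: power2_eq_square)
    finally show "norm (?f s) \<le> c * ?m s + c' * ?sp" using f_abs[of s] c by (simp add: mult_left_mono)
  qed
  also have "\<dots> = c * (\<Sum>j\<in>UNIV. kernel_tail n i j (t - t) - kernel_tail n i j (t - (t - \<delta>))) + c' * ?sp * \<delta>"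
    by (rule integral_unique[OF int2])
  also have "\<dots> \<le> c / 2 + c' * (\<delta> * ?sp)"
  proof -
    have "(\<Sum>j\<in>UNIV. kernel_tail n i j (t - t) - kernel_tail n i j (t - (t - \<delta>))) \<le> (\<Sum>j\<in>UNIV. kernel_tail n i j 0)"
      by (intro sum_mono) (auto simp: kernel_tail_nonneg)
    also have "\<dots> = 1 / 2" by (rule sum_kernel_tail_0[OF n])
    finally have "c * (\<Sum>j\<in>UNIV. kernel_tail n i j (t - t) - kernel_tail n i j (t - (t - \<delta>))) \<le> c * (1 / 2)"
      by (rule mult_left_mono) (rule c)
    then show ?thesis by (simp only: mult_ac)
  qed
  finally have 2: "\<bar>integral {t - \<delta>..t} ?f\<bar> \<le> c / 2 + c' * (\<delta> * ?sp)" by simp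
  show "\<bar>integral {0..t} ?f\<bar> \<le> C * (\<Sum>j\<in>UNIV. kernel_tail n i j \<delta>) + c / 2 + c' * (\<delta> * ?sp)"
    unfolding split using 1 2 by linarith
qed


text \<open>The a priori version without localisation: a uniform bound on the data meets the whole
  kernel mass. It makes the energies bounded before anything is known about their limit.\<close>

lemma renewal_bound_half:
  fixes \<Phi> :: "'d::finite \<Rightarrow> real \<Rightarrow> real ^ 'd \<Rightarrow> real"
  assumes n: "2 \<le> n" and x: "x \<in> lat n" and t: "0 \<le> t" and C: "0 \<le> C"
    and cont: "\<And>j z. z \<in> lat n \<Longrightarrow> continuous_on {0..t} (\<lambda>s. \<Phi> j s z)"
    and far: "\<And>j z s. z \<in> lat n \<Longrightarrow> 0 \<le> s \<Longrightarrow> s \<le> t \<Longrightarrow> \<bar>\<Phi> j s z\<bar> \<le> C"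
  shows "\<bar>integral {0..t} (\<lambda>s. \<Sum>(j, z)\<in>UNIV \<times> lat n. renewal_kernel n i x j z (t - s) * \<Phi> j s z)\<bar> \<le> C / 2"
proof -
  let ?L = "lat n :: (real ^ 'd) set" and ?E = "UNIV \<times> lat n :: ('d \<times> (real ^ 'd)) set"
  let ?K = "\<lambda>j z s. renewal_kernel n i x j z (t - s)"
  let ?f = "\<lambda>s. \<Sum>(j, z)\<in>?E. ?K j z s * \<Phi> j s z"
  let ?m = "\<lambda>s. \<Sum>j\<in>UNIV. \<Sum>z\<in>?L. ?K j z s"
  have n0: "0 < n" using n by simp
  have mass: "(?m has_integral (\<Sum>j\<in>UNIV. kernel_tail n i j (t - t) - kernel_tail n i j (t - 0))) {0..t}"
    by (intro has_integral_sum kernel_mass_has_integral[OF n0 x t]) auto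
  have "norm (integral {0..t} ?f) \<le> integral {0..t} (\<lambda>s. C * ?m s)"
  proof (rule integral_norm_bound_integral)
    have "continuous_on {0..t} ?f"
      unfolding split_def by (intro continuous_on_sum continuous_on_mult renewal_kernel_continuous[OF n0] cont) auto
    then show "?f integrable_on {0..t}" by (rule integrable_continuous_interval)
    show "(\<lambda>s. C * ?m s) integrable_on {0..t}" using has_integral_mult_right[OF mass] by (auto simp: integrable_on_def)
    fix s assume s: "s \<in> {0..t}"
    have "\<bar>?f s\<bar> \<le> (\<Sum>j\<in>UNIV. \<Sum>z\<in>?L. ?K j z s * \<bar>\<Phi> j s z\<bar>)"
      unfolding sum.cartesian_product[symmetric]
      by (rule order_trans[OF sum_abs], rule sum_mono, rule order_trans[OF sum_abs])
        (simp add: abs_mult renewal_kernel_nonneg)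
    also have "\<dots> \<le> (\<Sum>j\<in>UNIV. \<Sum>z\<in>?L. ?K j z s * C)"
      by (intro sum_mono mult_left_mono far renewal_kernel_nonneg) (use s in auto)
    finally show "norm (?f s) \<le> C * ?m s" by (simp add: sum_distrib_left mult.commute)
  qed
  also have "\<dots> = C * (\<Sum>j\<in>UNIV. kernel_tail n i j (t - t) - kernel_tail n i j (t - 0))"
    by (rule integral_unique[OF has_integral_mult_right[OF mass]])
  also have "\<dots> \<le> C * (\<Sum>j\<in>UNIV. kernel_tail n i j 0)"
    using C by (intro mult_left_mono sum_mono) (auto simp: kernel_tail_nonneg)
  finally show ?thesis using sum_kernel_tail_0[OF n, of i] by simp
qed

section \<open>Moduli of continuity on the torus\<close>

lemma psi_eq_0_imp_int:
  assumes "psi z = 0" shows "\<exists>k::int. z = of_int k"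
proof -
  have "cos (2 * pi * z) = 1" using assms by (simp add: psi_def)
  then obtain k :: int where "2 * pi * z = of_int k * 2 * pi" using cos_one_2pi_int by blast
  then have "2 * pi * z = 2 * pi * of_int k" by simp
  then show ?thesis by (intro exI[of _ k]) (metis mult_cancel_left pi_neq_zero mult_eq_0_iff zero_neq_numeral)
qed

text \<open>By compactness \<open>psi\<close> has a positive minimum on the part of the fundamental
  interval from -1/2 to 1/2 at distance at least \<delta> from 0; rounding moves any point into that
  interval.\<close>

lemma psi_small_imp_near_int:
  assumes \<delta>: "0 < \<delta>"
  obtains \<theta> where "0 < \<theta>" "\<And>z. psi z < \<theta> \<Longrightarrow> \<exists>k::int. \<bar>z - of_int k\<bar> < \<delta>"
proof -
  let ?K = "{-(1/2)..-\<delta>} \<union> {\<delta>..1/2} :: real set"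
  have "\<exists>\<theta>>0. \<forall>w\<in>?K. \<theta> \<le> psi w"
  proof (cases "?K = {}")
    case False
    have "compact ?K" by (intro compact_Un compact_Icc)
    moreover have "continuous_on ?K psi" unfolding psi_def by (intro continuous_intros)
    ultimately obtain w where w: "w \<in> ?K" "\<forall>v\<in>?K. psi w \<le> psi v" using continuous_attains_inf[OF _ False] by metis
    have "psi w \<noteq> 0"
    proof
      assume "psi w = 0"
      then obtain k :: int where k: "w = of_int k" using psi_eq_0_imp_int by blast
      have "w \<noteq> 0" "\<bar>w\<bar> \<le> 1/2" using w(1) \<delta> by auto
      then have "k \<noteq> 0" "\<bar>k\<bar> < 1" using k by auto
      then show False by simp
    qed
    then show ?thesis using w psi_nonneg[of w] by (intro exI[of _ "psi w"]) auto
  qed (auto intro: exI[of _ 1])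
  then obtain \<theta> where \<theta>: "0 < \<theta>" "\<And>w. w \<in> ?K \<Longrightarrow> \<theta> \<le> psi w" by blast
  have "\<exists>k::int. \<bar>z - of_int k\<bar> < \<delta>" if "psi z < \<theta>" for z
  proof -
    let ?w = "z - of_int (round z)"
    have "psi ?w = psi z" using psi_of_int[of z "- round z"] by simp
    then have "?w \<notin> ?K" using \<theta>(2)[of ?w] that by auto
    moreover have "\<bar>?w\<bar> \<le> 1/2" using of_int_round_abs_le[of z] by (simp add: abs_minus_commute)
    ultimately have "\<bar>?w\<bar> < \<delta>" by auto
    then show ?thesis by blast
  qed
  then show ?thesis using \<theta>(1) that by blast
qed

context
  fixes f :: "real \<Rightarrow> real ^ 'd::finite \<Rightarrow> real" and T :: real
  assumes cont: "continuous_on ({0..T} \<times> UNIV) (\<lambda>(t, x). f t x)"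
    and per: "\<And>t. t \<in> {0..T} \<Longrightarrow> torus_fun (f t)"
begin

lemma torus_bounded: obtains B where "0 \<le> B" "\<And>t x. t \<in> {0..T} \<Longrightarrow> \<bar>f t x\<bar> \<le> B"
proof -
  let ?c = "cbox (\<chi> i. 0) (\<chi> i. 1) :: (real ^ 'd) set"
  have "compact ((\<lambda>(t, x). f t x) ` ({0..T} \<times> ?c))"
    by (intro compact_continuous_image compact_Times compact_Icc compact_cbox continuous_on_subset[OF cont]) auto
  then have "bounded ((\<lambda>(t, x). f t x) ` ({0..T} \<times> ?c))" by (rule compact_imp_bounded)
  then obtain B where B: "\<forall>y\<in>(\<lambda>(t, x). f t x) ` ({0..T} \<times> ?c). norm y \<le> B" unfolding bounded_iff by (rule exE)
  have "\<bar>f t x\<bar> \<le> B" if "t \<in> {0..T}" for t x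
  proof -
    have "(\<chi> j. frac (x $ j)) \<in> ?c" by (auto simp: mem_box_cart less_imp_le[OF frac_lt_1])
    then have "(t, \<chi> j. frac (x $ j)) \<in> {0..T} \<times> ?c" using that by blast
    then have "norm ((\<lambda>(t, x). f t x) (t, \<chi> j. frac (x $ j))) \<le> B" using bspec[OF B imageI] by blast
    then have "\<bar>f t (\<chi> j. frac (x $ j))\<bar> \<le> B" by simp
    then show ?thesis using torus_fun_frac[OF per[OF that]] by simp
  qed
  then show ?thesis using that[of "max B 0"] by (simp add: le_max_iff_disj)
qed

lemma torus_uniformly_continuous:
  assumes \<eta>: "0 < \<eta>"
  obtains \<delta> where "0 < \<delta>" "\<And>s t x y. s \<in> {0..T} \<Longrightarrow> t \<in> {0..T} \<Longrightarrow> \<bar>s - t\<bar> < \<delta> \<Longrightarrow> (\<And>l. \<bar>x $ l - y $ l\<bar> < \<delta>) \<Longrightarrow> \<bar>f s x - f t y\<bar> < \<eta>"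
proof -
  \<comment> \<open>A margin of one unit around the unit cube: once the first point is translated
    into the cube, the second stays in this box under the same translation, so two nearby points
    never wrap around separately.\<close>
  let ?c = "cbox (\<chi> i. -1) (\<chi> i. 2) :: (real ^ 'd) set"
  have "uniformly_continuous_on ({0..T} \<times> ?c) (\<lambda>(t, x). f t x)"
    by (intro compact_uniformly_continuous compact_Times compact_Icc compact_cbox continuous_on_subset[OF cont]) auto
  then obtain d where d: "0 < d" "\<And>p q. p \<in> {0..T} \<times> ?c \<Longrightarrow> q \<in> {0..T} \<times> ?c \<Longrightarrow> dist q p < d \<Longrightarrow> dist ((\<lambda>(t, x). f t x) q) ((\<lambda>(t, x). f t x) p) < \<eta>"
    unfolding uniformly_continuous_on_def using \<eta> by meson
  define \<delta> where "\<delta> = min 1 (d / (2 + real CARD('d)))"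
  have \<delta>: "0 < \<delta>" "\<delta> \<le> 1" "\<delta> * (1 + real CARD('d)) < d"
  proof -
    show "0 < \<delta>" "\<delta> \<le> 1" using d(1) by (auto simp: \<delta>_def)
    have "\<delta> \<le> d / (2 + real CARD('d))" by (simp add: \<delta>_def)
    then have "\<delta> * (2 + real CARD('d)) \<le> d" by (simp add: field_simps)
    then show "\<delta> * (1 + real CARD('d)) < d" using \<open>0 < \<delta>\<close> by (simp add: algebra_simps)
  qed
  have "\<bar>f s x - f t y\<bar> < \<eta>" if st: "s \<in> {0..T}" "t \<in> {0..T}" "\<bar>s - t\<bar> < \<delta>" and xy: "\<And>l. \<bar>x $ l - y $ l\<bar> < \<delta>" for s t x y
  proof -
    define k :: "real ^ 'd" where "k = (\<chi> l. - of_int \<lfloor>x $ l\<rfloor>)"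
    have k: "k $ l \<in> \<int>" for l by (simp add: k_def)
    have xk: "0 \<le> (x + k) $ l" "(x + k) $ l < 1" for l
      using frac_lt_1[of "x $ l"] frac_ge_0[of "x $ l"] by (auto simp: k_def frac_def)
    have xk': "-1 \<le> (x + k) $ l" "(x + k) $ l \<le> 2" for l using xk[of l] by auto
    have yk: "-1 \<le> (y + k) $ l" "(y + k) $ l \<le> 2" for l
      using xk[of l] xy[of l] \<delta>(2) by auto
    have "norm (x - y) \<le> (\<Sum>l\<in>UNIV. \<bar>(x - y) $ l\<bar>)" by (rule norm_le_l1_cart)
    also have "\<dots> \<le> (\<Sum>l\<in>(UNIV :: 'd set). \<delta>)" by (intro sum_mono) (use xy in \<open>auto intro: less_imp_le\<close>)
    finally have nxy: "norm (x - y) \<le> \<delta> * real CARD('d)" by (simp add: mult.commute)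
    have "dist (s, x + k) (t, y + k) = norm (s - t, x - y)" by (simp add: dist_norm)
    also have "\<dots> \<le> norm (s - t) + norm (x - y)" by (rule norm_Pair_le)
    also have "\<dots> < d" using nxy st(3) \<delta>(3) by (simp add: algebra_simps)
    finally have "dist (s, x + k) (t, y + k) < d" .
    moreover have "(s, x + k) \<in> {0..T} \<times> ?c" "(t, y + k) \<in> {0..T} \<times> ?c"
      using st xk' yk by (simp_all add: mem_box_cart del: vector_add_component)
    ultimately have "\<bar>f s (x + k) - f t (y + k)\<bar> < \<eta>" using d(2)[of "(t, y + k)" "(s, x + k)"] by (simp add: dist_real_def)
    then show ?thesis using torus_fun_int_vec[OF per[OF st(1)] k] torus_fun_int_vec[OF per[OF st(2)] k] by simp
  qed
  then show ?thesis using \<delta>(1) that by blast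
qed

text \<open>Uniform continuity in a form that can be integrated against the spatial moment of the
  kernel. If the \<open>psi\<close>-distance is below \<theta>, an integer translate of one point is
  close to the other; otherwise the bound \<open>2 * B\<close> on the difference is paid for by the
  coefficient \<open>2 * B / \<theta>\<close>.\<close>

lemma torus_psi_modulus:
  assumes \<eta>: "0 < \<eta>"
  obtains \<delta> c where "0 < \<delta>" "0 \<le> c"
    "\<And>s t x y. s \<in> {0..T} \<Longrightarrow> t \<in> {0..T} \<Longrightarrow> \<bar>s - t\<bar> < \<delta> \<Longrightarrow> \<bar>f s x - f t y\<bar> \<le> \<eta> + c * (\<Sum>l\<in>UNIV. psi (x $ l - y $ l))"
proof -
  obtain \<delta> where \<delta>: "0 < \<delta>" "\<And>s t x y. s \<in> {0..T} \<Longrightarrow> t \<in> {0..T} \<Longrightarrow> \<bar>s - t\<bar> < \<delta> \<Longrightarrow> (\<And>l. \<bar>x $ l - y $ l\<bar> < \<delta>) \<Longrightarrow> \<bar>f s x - f t y\<bar> < \<eta>"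
    using torus_uniformly_continuous[OF \<eta>] by metis
  obtain B where B: "0 \<le> B" "\<And>t x. t \<in> {0..T} \<Longrightarrow> \<bar>f t x\<bar> \<le> B" using torus_bounded by metis
  obtain \<theta> where \<theta>: "0 < \<theta>" "\<And>z. psi z < \<theta> \<Longrightarrow> \<exists>k::int. \<bar>z - of_int k\<bar> < \<delta>"
    using psi_small_imp_near_int[OF \<delta>(1)] by metis
  have "\<bar>f s x - f t y\<bar> \<le> \<eta> + 2 * B / \<theta> * (\<Sum>l\<in>UNIV. psi (x $ l - y $ l))" if st: "s \<in> {0..T}" "t \<in> {0..T}" "\<bar>s - t\<bar> < \<delta>" for s t x y
  proof (cases "(\<Sum>l\<in>UNIV. psi (x $ l - y $ l)) < \<theta>")
    case True
    have "\<exists>k::int. \<bar>x $ l - y $ l - of_int k\<bar> < \<delta>" for l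
      by (rule \<theta>(2)) (use True psi_le_sum[of "x - y" l] in simp)
    then obtain k :: "'d \<Rightarrow> int" where k: "\<And>l. \<bar>x $ l - y $ l - of_int (k l)\<bar> < \<delta>" by metis
    let ?k = "(\<chi> l. of_int (k l)) :: real ^ 'd"
    have "\<bar>f s x - f t (y + ?k)\<bar> < \<eta>" by (rule \<delta>(2)[OF st]) (use k in \<open>simp add: algebra_simps\<close>)
    moreover have "f t (y + ?k) = f t y" by (rule torus_fun_int_vec[OF per[OF st(2)]]) simp
    moreover have "0 \<le> 2 * B / \<theta> * (\<Sum>l\<in>UNIV. psi (x $ l - y $ l))"
      using B \<theta> by (intro mult_nonneg_nonneg sum_nonneg psi_nonneg) auto
    ultimately show ?thesis by linarith
  next
    case False
    have "\<bar>f s x - f t y\<bar> \<le> 2 * B" using B(2)[OF st(1), of x] B(2)[OF st(2), of y] by linarith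
    also have "\<dots> = 2 * B / \<theta> * \<theta>" using \<theta> by simp
    also have "\<dots> \<le> 2 * B / \<theta> * (\<Sum>l\<in>UNIV. psi (x $ l - y $ l))"
      using False B \<theta> by (intro mult_left_mono) auto
    finally show ?thesis using \<eta> by linarith
  qed
  then show ?thesis using that[of \<delta> "2 * B / \<theta>"] \<delta>(1) B(1) \<theta>(1) by simp
qed

end

section \<open>Solutions of the heat equation\<close>

text \<open>The heat equation at one point in terms of directional derivatives only: stable under
  linear combinations and translations, and still enough for the maximum principle. First
  derivatives are required along whole lines because the second derivative test uses them near the
  point.\<close>

definition heat_at :: "(real \<Rightarrow> real ^ 'd::finite \<Rightarrow> real) \<Rightarrow> real \<Rightarrow> real ^ 'd \<Rightarrow> bool" where
  "heat_at W t x \<longleftrightarrow> (\<exists>p l. (\<forall>j s. ((\<lambda>s. W t (x + s *\<^sub>R axis j 1)) has_real_derivative p j s) (at s)) \<and>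
     (\<forall>j. (p j has_real_derivative l j) (at 0)) \<and>
     ((\<lambda>s. W s x) has_real_derivative (1/2) * (\<Sum>j\<in>UNIV. l j)) (at t))"

lemma heat_at_diff:
  assumes "heat_at V t x" "heat_at W t x"
  shows "heat_at (\<lambda>t x. V t x - W t x) t x"
proof -
  obtain p l where 1: "\<And>j s. ((\<lambda>s. V t (x + s *\<^sub>R axis j 1)) has_real_derivative p j s) (at s)"
    "\<And>j. (p j has_real_derivative l j) (at 0)" "((\<lambda>s. V s x) has_real_derivative (1/2) * (\<Sum>j\<in>UNIV. l j)) (at t)"
    using assms(1) unfolding heat_at_def by blast
  obtain q m where 2: "\<And>j s. ((\<lambda>s. W t (x + s *\<^sub>R axis j 1)) has_real_derivative q j s) (at s)"
    "\<And>j. (q j has_real_derivative m j) (at 0)" "((\<lambda>s. W s x) has_real_derivative (1/2) * (\<Sum>j\<in>UNIV. m j)) (at t)"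
    using assms(2) unfolding heat_at_def by blast
  show ?thesis unfolding heat_at_def
  proof (intro exI conjI allI)
    show "((\<lambda>s. V t (x + s *\<^sub>R axis j 1) - W t (x + s *\<^sub>R axis j 1)) has_real_derivative (\<lambda>j s. p j s - q j s) j s) (at s)" for j s
      using DERIV_diff[OF 1(1) 2(1)] by simp
    show "((\<lambda>j s. p j s - q j s) j has_real_derivative (\<lambda>j. l j - m j) j) (at 0)" for j
      using DERIV_diff[OF 1(2) 2(2)] by simp
    show "((\<lambda>s. V s x - W s x) has_real_derivative (1/2) * (\<Sum>j\<in>UNIV. (\<lambda>j. l j - m j) j)) (at t)"
      using DERIV_diff[OF 1(3) 2(3)] by (simp add: sum_subtractf right_diff_distrib)
  qed
qed

lemma heat_at_cmult:
  assumes "heat_at V t x"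
  shows "heat_at (\<lambda>t x. c * V t x) t x"
proof -
  obtain p l where 1: "\<And>j s. ((\<lambda>s. V t (x + s *\<^sub>R axis j 1)) has_real_derivative p j s) (at s)"
    "\<And>j. (p j has_real_derivative l j) (at 0)" "((\<lambda>s. V s x) has_real_derivative (1/2) * (\<Sum>j\<in>UNIV. l j)) (at t)"
    using assms(1) unfolding heat_at_def by blast
  show ?thesis unfolding heat_at_def
  proof (intro exI conjI allI)
    show "((\<lambda>s. c * V t (x + s *\<^sub>R axis j 1)) has_real_derivative (\<lambda>j s. c * p j s) j s) (at s)" for j s
      using DERIV_cmult[OF 1(1)] by simp
    show "((\<lambda>j s. c * p j s) j has_real_derivative (\<lambda>j. c * l j) j) (at 0)" for j
      using DERIV_cmult[OF 1(2)] by simp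
    show "((\<lambda>s. c * V s x) has_real_derivative (1/2) * (\<Sum>j\<in>UNIV. (\<lambda>j. c * l j) j)) (at t)"
      using DERIV_cmult[OF 1(3), of c] by (simp add: sum_distrib_left[symmetric])
  qed
qed

lemma heat_at_zero: "heat_at (\<lambda>t x. 0) t x"
  unfolding heat_at_def by (rule exI[of _ "\<lambda>_ _. 0"], rule exI[of _ "\<lambda>_. 0"]) simp

lemma heat_at_sum:
  assumes "finite I" "\<And>i. i \<in> I \<Longrightarrow> heat_at (V i) t x"
  shows "heat_at (\<lambda>t x. \<Sum>i\<in>I. V i t x) t x"
  using assms
proof (induction I)
  case (insert i I)
  have "heat_at (\<lambda>t x. V i t x - (-1) * (\<Sum>i\<in>I. V i t x)) t x"
    by (rule heat_at_diff[OF _ heat_at_cmult]) (use insert in auto)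
  then show ?case using insert by simp
qed (simp add: heat_at_zero)

lemma heat_at_shift: "heat_at V t (x + h) \<Longrightarrow> heat_at (\<lambda>t x. V t (x + h)) t x"
proof -
  assume "heat_at V t (x + h)"
  moreover have "x + s *\<^sub>R axis j 1 + h = x + h + s *\<^sub>R axis j 1" for s and j :: 'a by (simp only: ac_simps)
  ultimately show ?thesis unfolding heat_at_def by (simp only:)
qed

lemma heat_at_plane_wave:
  "heat_at (\<lambda>t x. exp (- (2 * pi\<^sup>2 * (k \<bullet> k)) * t) * plane_wave k \<theta> x) t (x :: real ^ 'd::finite)"
proof -
  let ?e = "exp (- (2 * pi\<^sup>2 * (k \<bullet> k)) * t)" and ?a = "2 * pi * (k \<bullet> x) + \<theta>"
  show ?thesis unfolding heat_at_def
  proof (intro exI conjI allI)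
    fix j s
    show "((\<lambda>s. ?e * plane_wave k \<theta> (x + s *\<^sub>R axis j 1)) has_real_derivative (\<lambda>j s. ?e * (- sin (?a + 2 * pi * (s * k $ j)) * (2 * pi * k $ j))) j s) (at s)"
      unfolding plane_wave_shift by (auto intro!: derivative_eq_intros)
    show "((\<lambda>j s. ?e * (- sin (?a + 2 * pi * (s * k $ j)) * (2 * pi * k $ j))) j has_real_derivative (\<lambda>j. ?e * (- cos ?a * (2 * pi * k $ j) * (2 * pi * k $ j))) j) (at 0)"
      by (auto intro!: derivative_eq_intros)
  next
    have "(1/2) * (\<Sum>j\<in>UNIV. ?e * (- cos ?a * (2 * pi * k $ j) * (2 * pi * k $ j))) = - (2 * pi\<^sup>2 * (k \<bullet> k)) * ?e * cos ?a"
      by (simp add: inner_vec_def sum_distrib_left sum_distrib_right power2_eq_square mult_ac sum_negf)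
    moreover have "((\<lambda>t. exp (- (2 * pi\<^sup>2 * (k \<bullet> k)) * t) * plane_wave k \<theta> x) has_real_derivative - (2 * pi\<^sup>2 * (k \<bullet> k)) * ?e * cos ?a) (at t)"
      unfolding plane_wave_def by (auto intro!: derivative_eq_intros)
    ultimately show "((\<lambda>t. exp (- (2 * pi\<^sup>2 * (k \<bullet> k)) * t) * plane_wave k \<theta> x) has_real_derivative
      (1/2) * (\<Sum>j\<in>UNIV. (\<lambda>j. ?e * (- cos ?a * (2 * pi * k $ j) * (2 * pi * k $ j))) j)) (at t)" by (simp only:)
  qed
qed

lemma directional_derivative:
  assumes "C1_fun f"
  shows "((\<lambda>s. f (x + s *\<^sub>R axis j 1)) has_real_derivative partial_deriv j f (x + s *\<^sub>R axis j 1)) (at s)"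
proof -
  let ?y = "x + s *\<^sub>R axis j 1"
  have "f differentiable (at ?y)" using assms by (simp add: C1_fun_def)
  then have "f differentiable (at (?y + 0 *\<^sub>R axis j 1))" by simp
  then have "(\<lambda>r. f (?y + r *\<^sub>R axis j 1)) differentiable (at 0)"
    by (intro differentiable_compose[of f "\<lambda>r. ?y + r *\<^sub>R axis j 1"]) (auto intro!: derivative_intros)
  then have "(\<lambda>r. f (?y + r *\<^sub>R axis j 1)) field_differentiable (at 0)"
    by (simp add: field_differentiable_def real_differentiable_def)
  then have "((\<lambda>r. f (?y + r *\<^sub>R axis j 1)) has_real_derivative partial_deriv j f ?y) (at 0)"
    unfolding partial_deriv_def by (simp add: field_differentiable_derivI)
  then have "((\<lambda>r. f (x + (r + s) *\<^sub>R axis j 1)) has_real_derivative partial_deriv j f ?y) (at 0)"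
    by (simp add: algebra_simps)
  then show ?thesis using DERIV_shift[of "\<lambda>r. f (x + r *\<^sub>R axis j 1)" "partial_deriv j f ?y" 0 s] by simp
qed

lemma heat_solution_heat_at:
  assumes "heat_solution u0 u" "0 < t"
  shows "heat_at u t x"
proof -
  have C: "C1_fun (u t)" "\<And>j. C1_fun (partial_deriv j (u t))" using assms by (auto simp: heat_solution_def C2_fun_def)
  show ?thesis unfolding heat_at_def
  proof (intro exI conjI allI)
    fix j s
    show "((\<lambda>s. u t (x + s *\<^sub>R axis j 1)) has_real_derivative (\<lambda>j s. partial_deriv j (u t) (x + s *\<^sub>R axis j 1)) j s) (at s)"
      using directional_derivative[OF C(1)] by simp
    show "((\<lambda>j s. partial_deriv j (u t) (x + s *\<^sub>R axis j 1)) j has_real_derivative (\<lambda>j. partial_deriv j (partial_deriv j (u t)) x) j) (at 0)"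
      using directional_derivative[OF C(2), of j x j 0] by simp
  next
    show "((\<lambda>s. u s x) has_real_derivative (1/2) * (\<Sum>j\<in>UNIV. (\<lambda>j. partial_deriv j (partial_deriv j (u t)) x) j)) (at t)"
      using assms unfolding heat_solution_def laplacian_def by simp
  qed
qed

text \<open>The first derivative vanishes at the maximum; a positive second derivative would make it
  positive just to the right, and the function would increase there.\<close>

lemma second_derivative_at_max:
  fixes f :: "real \<Rightarrow> real"
  assumes f: "\<And>s. (f has_real_derivative p s) (at s)" and p: "(p has_real_derivative l) (at 0)" and max: "\<And>s. f s \<le> f 0"
  shows "l \<le> 0"
proof (rule ccontr)
  assume "\<not> l \<le> 0"
  then have l: "0 < l" by simp
  have "p 0 = 0" by (rule DERIV_local_max[OF f zero_less_one]) (use max in auto)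
  obtain d where d: "0 < d" "\<And>h. 0 < h \<Longrightarrow> h < d \<Longrightarrow> p 0 < p (0 + h)"
    using DERIV_pos_inc_right[OF p l] by blast
  obtain z where z: "0 < z" "z < d / 2" "f (d / 2) - f 0 = (d / 2 - 0) * p z"
    using MVT2[of 0 "d / 2" f p] d(1) f by auto
  have "0 < p z" using d(2)[of z] z \<open>p 0 = 0\<close> d(1) by auto
  then have "0 < (d / 2 - 0) * p z" using d(1) by simp
  then have "f 0 < f (d / 2)" using z(3) by linarith
  then show False using max[of "d / 2"] by simp
qed

text \<open>Subtracting a small multiple of time makes the solution a strict subsolution. At a
  maximum with positive time the space derivatives contribute nothing positive, so the time
  derivative is negative and slightly earlier values are larger, a contradiction.\<close>

lemma heat_max_principle:
  fixes W :: "real \<Rightarrow> real ^ 'd::finite \<Rightarrow> real"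
  assumes cont: "continuous_on ({0..T} \<times> UNIV) (\<lambda>(t, x). W t x)"
    and per: "\<And>t. t \<in> {0..T} \<Longrightarrow> torus_fun (W t)"
    and sol: "\<And>t x. 0 < t \<Longrightarrow> t \<le> T \<Longrightarrow> heat_at W t x"
    and init: "\<And>x. W 0 x \<le> m" and t: "t \<in> {0..T}"
  shows "W t x \<le> m"
proof (rule ccontr)
  assume "\<not> W t x \<le> m"
  then have gt: "m < W t x" by simp
  have t0: "0 < t" using gt init[of x] t by (cases "t = 0") auto
  \<comment> \<open>Half of the excess over \<open>m\<close> is spent on the strictness, so the
    corrected function still exceeds \<open>m\<close> and its maximum cannot lie at time 0.\<close>
  define \<kappa> where "\<kappa> = (W t x - m) / (2 * t)"
  have \<kappa>: "0 < \<kappa>" "\<kappa> * t = (W t x - m) / 2" using gt t0 by (auto simp: \<kappa>_def)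
  define Z where "Z s y = W s y - \<kappa> * s" for s y
  let ?c = "cbox (\<chi> i. 0) (\<chi> i. 1) :: (real ^ 'd) set"
  have red: "(\<chi> j. frac (y $ j)) \<in> ?c" for y :: "real ^ 'd" by (auto simp: mem_box_cart less_imp_le[OF frac_lt_1])
  have Zper: "Z s (\<chi> j. frac (y $ j)) = Z s y" if "s \<in> {0..t}" for s y
    using torus_fun_frac[OF per[of s], of y] that t by (simp add: Z_def)
  have "continuous_on ({0..t} \<times> ?c) (\<lambda>p. (\<lambda>(t, x). W t x) p - \<kappa> * fst p)"
    by (intro continuous_intros continuous_on_subset[OF cont]) (use t in auto)
  moreover have "compact ({0..t} \<times> ?c)" by (intro compact_Times compact_Icc compact_cbox)
  moreover have "{0..t} \<times> ?c \<noteq> {}" using t0 red[of 0] by auto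
  ultimately have "\<exists>q\<in>{0..t} \<times> ?c. \<forall>p\<in>{0..t} \<times> ?c. (\<lambda>(t, x). W t x) p - \<kappa> * fst p \<le> (\<lambda>(t, x). W t x) q - \<kappa> * fst q"
    by (intro continuous_attains_sup)
  then obtain q where q: "q \<in> {0..t} \<times> ?c"
    "\<forall>p\<in>{0..t} \<times> ?c. (\<lambda>(t, x). W t x) p - \<kappa> * fst p \<le> (\<lambda>(t, x). W t x) q - \<kappa> * fst q" by blast
  obtain s z where sz: "q = (s, z)" by (cases q)
  have s: "s \<in> {0..t}" using q(1) sz by simp
  \<comment> \<open>Periodicity makes the maximum over the closed cube a maximum over the whole
    space, so a maximiser on a face of the cube is treated like an interior one.\<close>
  have max: "Z r y \<le> Z s z" if "r \<in> {0..t}" for r y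
  proof -
    have "Z r (\<chi> j. frac (y $ j)) \<le> Z s z" using bspec[OF q(2), of "(r, \<chi> j. frac (y $ j))"] red[of y] that sz by (simp add: Z_def)
    then show ?thesis using Zper[OF that] by simp
  qed
  have "m < Z t x" using gt \<kappa> by (simp add: Z_def field_simps)
  then have "m < Z s z" using max[of t x] t0 by auto
  then have s0: "0 < s" using init[of z] s by (cases "s = 0") (auto simp: Z_def)
  obtain p l where pl: "\<And>j s'. ((\<lambda>s'. W s (z + s' *\<^sub>R axis j 1)) has_real_derivative p j s') (at s')"
    "\<And>j. (p j has_real_derivative l j) (at 0)" "((\<lambda>r. W r z) has_real_derivative (1/2) * (\<Sum>j\<in>UNIV. l j)) (at s)"
    using sol[OF s0, of z] s t unfolding heat_at_def by auto
  have "l j \<le> 0" for j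
    by (rule second_derivative_at_max[OF pl(1,2)]) (use max[OF s] in \<open>simp add: Z_def\<close>)
  then have "(1/2) * (\<Sum>j\<in>UNIV. l j) \<le> 0" by (simp add: sum_nonpos)
  moreover have "((\<lambda>r. Z r z) has_real_derivative (1/2) * (\<Sum>j\<in>UNIV. l j) - \<kappa>) (at s)"
    unfolding Z_def using DERIV_diff[OF pl(3), of "\<lambda>r. \<kappa> * r" \<kappa>] by (auto intro!: derivative_eq_intros)
  ultimately obtain d where d: "0 < d" "\<And>h. 0 < h \<Longrightarrow> h < d \<Longrightarrow> Z s z < Z (s - h) z"
    using DERIV_neg_dec_left[of "\<lambda>r. Z r z" _ s] \<kappa>(1) by (smt (verit))
  have "Z s z < Z (s - min (d / 2) s) z" by (rule d(2)) (use d(1) s0 in auto)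
  moreover have "Z (s - min (d / 2) s) z \<le> Z s z" by (rule max) (use s s0 d(1) in auto)
  ultimately show False by simp
qed

section \<open>Density of trigonometric polynomials\<close>

definition trig_poly :: "(real ^ 'd::finite \<Rightarrow> real) \<Rightarrow> bool" where
  "trig_poly q \<longleftrightarrow> (\<exists>(N::nat) c k \<theta>. (\<forall>m<N. \<forall>i. k m $ i \<in> \<int>) \<and> q = (\<lambda>x. \<Sum>m<N. c m * plane_wave (k m) (\<theta> m) x))"

lemma trig_poly_const: "trig_poly (\<lambda>x. c)"
  unfolding trig_poly_def
  by (rule exI[of _ 1], rule exI[of _ "\<lambda>_. c"], rule exI[of _ "\<lambda>_. 0"], rule exI[of _ "\<lambda>_. 0"]) (simp add: plane_wave_def)

lemma trig_poly_plane_wave: "(\<And>i. k $ i \<in> \<int>) \<Longrightarrow> trig_poly (\<lambda>x. c * plane_wave k \<theta> x)"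
  unfolding trig_poly_def
  by (rule exI[of _ 1], rule exI[of _ "\<lambda>_. c"], rule exI[of _ "\<lambda>_. k"], rule exI[of _ "\<lambda>_. \<theta>"]) simp

lemma sum_lessThan_add: "(\<Sum>m<N + N'. f m) = (\<Sum>m<N. f m) + (\<Sum>m<N'. f (N + m))"
  for f :: "nat \<Rightarrow> 'a::comm_monoid_add"
  by (induction N') (simp_all add: add.assoc)

lemma trig_poly_add:
  assumes "trig_poly p" "trig_poly q" shows "trig_poly (\<lambda>x. p x + q x)"
proof -
  obtain N c k \<theta> where 1: "\<forall>m<N. \<forall>i. k m $ i \<in> \<int>" "p = (\<lambda>x. \<Sum>m<(N::nat). c m * plane_wave (k m) (\<theta> m) x)"
    using assms(1) unfolding trig_poly_def by blast
  obtain N' c' k' \<theta>' where 2: "\<forall>m<N'. \<forall>i. k' m $ i \<in> \<int>" "q = (\<lambda>x. \<Sum>m<(N'::nat). c' m * plane_wave (k' m) (\<theta>' m) x)"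
    using assms(2) unfolding trig_poly_def by blast
  let ?f = "\<lambda>a b m. if m < N then a m else b (m - N)"
  have "p x + q x = (\<Sum>m<N + N'. ?f c c' m * plane_wave (?f k k' m) (?f \<theta> \<theta>' m) x)" for x
  proof -
    have "(\<Sum>m<N + N'. ?f c c' m * plane_wave (?f k k' m) (?f \<theta> \<theta>' m) x)
      = (\<Sum>m<N. ?f c c' m * plane_wave (?f k k' m) (?f \<theta> \<theta>' m) x) + (\<Sum>m<N'. ?f c c' (N + m) * plane_wave (?f k k' (N + m)) (?f \<theta> \<theta>' (N + m)) x)"
      by (rule sum_lessThan_add)
    then show ?thesis unfolding 1 2 by simp
  qed
  then show ?thesis unfolding trig_poly_def using 1 2
    by (intro exI[of _ "N + N'"] exI[of _ "?f c c'"] exI[of _ "?f k k'"] exI[of _ "?f \<theta> \<theta>'"]) auto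
qed

lemma trig_poly_sum: "finite I \<Longrightarrow> (\<And>i. i \<in> I \<Longrightarrow> trig_poly (q i)) \<Longrightarrow> trig_poly (\<lambda>x. \<Sum>i\<in>I. q i x)"
  by (induction I rule: finite_induct) (auto intro: trig_poly_const trig_poly_add)

text \<open>A product of two waves is the half sum of the waves with the difference and the sum of
  frequencies and phases.\<close>

lemma trig_poly_mult:
  assumes "trig_poly p" "trig_poly q" shows "trig_poly (\<lambda>x. p x * q x)"
proof -
  obtain N c k \<theta> where 1: "\<forall>m<N. \<forall>i. k m $ i \<in> \<int>" "p = (\<lambda>x. \<Sum>m<(N::nat). c m * plane_wave (k m) (\<theta> m) x)"
    using assms(1) unfolding trig_poly_def by blast
  obtain N' c' k' \<theta>' where 2: "\<forall>m<N'. \<forall>i. k' m $ i \<in> \<int>" "q = (\<lambda>x. \<Sum>m<(N'::nat). c' m * plane_wave (k' m) (\<theta>' m) x)"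
    using assms(2) unfolding trig_poly_def by blast
  have prod: "c m * plane_wave (k m) (\<theta> m) x * (c' m' * plane_wave (k' m') (\<theta>' m') x)
    = c m * c' m' / 2 * plane_wave (k m - k' m') (\<theta> m - \<theta>' m') x + c m * c' m' / 2 * plane_wave (k m + k' m') (\<theta> m + \<theta>' m') x" for m m' x
  proof -
    let ?a = "2 * pi * (k m \<bullet> x) + \<theta> m" and ?b = "2 * pi * (k' m' \<bullet> x) + \<theta>' m'"
    have 1: "plane_wave (k m - k' m') (\<theta> m - \<theta>' m') x = cos (?a - ?b)" "plane_wave (k m + k' m') (\<theta> m + \<theta>' m') x = cos (?a + ?b)"
      unfolding plane_wave_def by (simp_all add: inner_diff_left inner_add_left algebra_simps)
    have "cos ?a * cos ?b = (cos (?a - ?b) + cos (?a + ?b)) / 2" by (rule cos_times_cos)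
    then have "c m * c' m' * (cos ?a * cos ?b) = c m * c' m' * ((cos (?a - ?b) + cos (?a + ?b)) / 2)" by (rule arg_cong)
    then show ?thesis unfolding 1 plane_wave_def[of "k m" "\<theta> m"] plane_wave_def[of "k' m'" "\<theta>' m'"]
      by (simp only: mult_ac distrib_left add_divide_distrib times_divide_eq_left times_divide_eq_right)
  qed
  have "trig_poly (\<lambda>x. \<Sum>m<N. \<Sum>m'<N'. c m * c' m' / 2 * plane_wave (k m - k' m') (\<theta> m - \<theta>' m') x
      + c m * c' m' / 2 * plane_wave (k m + k' m') (\<theta> m + \<theta>' m') x)"
    by (intro trig_poly_sum trig_poly_add trig_poly_plane_wave) (use 1 2 in auto)
  then show ?thesis unfolding 1 2 sum_product prod .
qed

text \<open>Stone-Weierstrass on a compact model of the torus: the image of the unit cube under the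
  coordinatewise map to the unit circle. Periodic functions descend to it, and real and imaginary
  parts of the coordinates, which pull back to waves, separate its points.\<close>

lemma trig_poly_dense:
  fixes f :: "real ^ 'd::finite \<Rightarrow> real"
  assumes f: "continuous_on UNIV f" and per: "torus_fun f" and \<eta>: "0 < \<eta>"
  obtains q where "trig_poly q" "\<And>x. \<bar>f x - q x\<bar> < \<eta>"
proof -
  define E :: "real ^ 'd \<Rightarrow> complex ^ 'd" where "E x = (\<chi> j. cis (2 * pi * x $ j))" for x
  let ?c = "cbox (\<chi> i. 0) (\<chi> i. 1) :: (real ^ 'd) set"
  define S where "S = E ` ?c"
  have E_cont: "continuous_on A E" for A unfolding E_def by (intro continuous_intros)
  have E_frac: "E (\<chi> j. frac (x $ j)) = E x" for x
    unfolding E_def vec_eq_iff by (simp add: cis.ctr complex_eq_iff frac_def right_diff_distrib sin_diff cos_diff)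
  have red: "(\<chi> j. frac (y $ j)) \<in> ?c" for y :: "real ^ 'd" by (auto simp: mem_box_cart less_imp_le[OF frac_lt_1])
  have ES: "E x \<in> S" for x using imageI[OF red[of x], of E] by (simp only: S_def E_frac)
  have E_inj: "f x = f y" if "E x = E y" for x y
  proof -
    have "(x - y) $ j \<in> \<int>" for j
    proof -
      have "cis (2 * pi * x $ j) = cis (2 * pi * y $ j)" using that by (simp add: E_def vec_eq_iff)
      then have "cis (2 * pi * (x $ j - y $ j)) = 1"
        by (simp add: right_diff_distrib cis_divide[symmetric])
      then have "cos (2 * pi * (x $ j - y $ j)) = 1" by (simp add: complex_eq_iff)
      then have "psi (x $ j - y $ j) = 0" by (simp add: psi_def)
      then show ?thesis using psi_eq_0_imp_int by fastforce
    qed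
    then show ?thesis using torus_fun_int_vec[OF per, of "x - y" y] by simp
  qed
  define F where "F z = f (SOME x. E x = z)" for z
  have FE: "F (E x) = f x" for x unfolding F_def by (rule E_inj) (rule someI[of "\<lambda>y. E y = E x"], simp)
  have S: "compact S" unfolding S_def by (intro compact_continuous_image E_cont compact_cbox)
  have F_cont: "continuous_on S F"
    unfolding continuous_openin_preimage_eq
  proof (intro allI impI)
    fix U :: "real set" assume "open U"
    \<comment> \<open>A continuous map from a compact set is a quotient map onto its image, so
      continuity of the descended function can be checked on the cube.\<close>
    have "openin (top_of_set ?c) (?c \<inter> E -` (S \<inter> F -` U)) \<longleftrightarrow> openin (top_of_set S) (S \<inter> F -` U)"
      by (rule Abstract_Topology_2.continuous_imp_quotient_map[OF E_cont _ compact_cbox]) (auto simp: S_def)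
    moreover have "?c \<inter> E -` (S \<inter> F -` U) = ?c \<inter> f -` U" using ES FE by auto
    moreover have "openin (top_of_set ?c) (?c \<inter> f -` U)"
      using continuous_on_subset[OF f, of ?c] \<open>open U\<close> unfolding continuous_openin_preimage_eq by simp
    ultimately show "openin (top_of_set S) (S \<inter> F -` U)" by simp
  qed
  define P where "P G \<longleftrightarrow> continuous_on S G \<and> (\<exists>q. trig_poly q \<and> (\<forall>x. G (E x) = q x))" for G :: "complex ^ 'd \<Rightarrow> real"
  have "\<exists>G. P G \<and> (\<forall>z\<in>S. \<bar>F z - G z\<bar> < \<eta>)"
  proof (rule Stone_Weierstrass_HOL[OF S _ _ _ _ _ F_cont \<eta>])
    show "P (\<lambda>x. c)" for c unfolding P_def using trig_poly_const by (auto intro: continuous_on_const)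
    show "continuous_on S G" if "P G" for G using that by (simp add: P_def)
    show "P (\<lambda>x. G x + H x)" if "P G \<and> P H" for G H
      using that unfolding P_def by (auto intro!: continuous_on_add intro: trig_poly_add)
    show "P (\<lambda>x. G x * H x)" if "P G \<and> P H" for G H
      using that unfolding P_def by (auto intro!: continuous_on_mult intro: trig_poly_mult)
    fix z z' assume zz: "z \<in> S \<and> z' \<in> S \<and> z \<noteq> z'"
    then obtain j where j: "z $ j \<noteq> z' $ j" by (auto simp: vec_eq_iff)
    have int: "(axis j 1 :: real ^ 'd) $ i \<in> \<int>" for i by (simp add: axis_def)
    have tp: "trig_poly (plane_wave (axis j 1 :: real ^ 'd) \<theta>)" for \<theta>
      using trig_poly_plane_wave[OF int, of 1 \<theta>] by simp
    have "Re (E x $ j) = plane_wave (axis j 1) 0 x" "Im (E x $ j) = plane_wave (axis j 1) (- (pi / 2)) x" for x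
      by (simp_all add: E_def plane_wave_def inner_axis' cos_diff)
    then have re: "P (\<lambda>z. Re (z $ j))" and im: "P (\<lambda>z. Im (z $ j))"
      unfolding P_def using tp by (auto intro!: continuous_intros)
    show "\<exists>G. P G \<and> G z \<noteq> G z'"
    proof (cases "Re (z $ j) = Re (z' $ j)")
      case True then show ?thesis using im j by (intro exI[of _ "\<lambda>z. Im (z $ j)"]) (auto simp: complex_eq_iff)
    next
      case False then show ?thesis using re by (intro exI[of _ "\<lambda>z. Re (z $ j)"]) auto
    qed
  qed
  then obtain G q where "trig_poly q" "\<forall>x. G (E x) = q x" "\<forall>z\<in>S. \<bar>F z - G z\<bar> < \<eta>" unfolding P_def by blast
  then have "\<bar>f x - q x\<bar> < \<eta>" for x using ES[of x] FE[of x] by (metis (no_types))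
  then show ?thesis using \<open>trig_poly q\<close> that by blast
qed

section \<open>Convergence of the edge energies\<close>

lemma grad_energy_continuous:
  assumes n: "0 < n" and x: "x \<in> lat n"
  shows "continuous_on A (\<lambda>s. grad_energy n u0 i s x)"
proof -
  have y: "torus_shift (1 / real n) i x \<in> lat n" by (rule torus_shift_lattice_next[OF n x])
  have "continuous_on A (\<lambda>s. second_moment n u0 s p)" if "p \<in> lat n \<times> lat n" for p
    unfolding second_moment_def
    by (rule mat_exp_continuous[OF _ that]) (intro finite_cartesian_product finite_lattice n)
  then show ?thesis unfolding grad_energy_def Let_def
    by (intro continuous_intros) (use x y in auto)
qed

text \<open>At the edge and time where the absolute energy attains its maximum B, the renewal
  equation reads B \<le> a + B/2, because the kernel has mass at most 1/2.\<close>

lemma grad_energy_bound: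
  fixes u0 :: "real ^ 'd::finite \<Rightarrow> real"
  assumes n: "2 \<le> n" and T: "0 \<le> T"
    and A: "\<And>i t x. t \<in> {0..T} \<Longrightarrow> x \<in> lat n \<Longrightarrow> (heat_sg n t (disc_grad (1 / real n) i u0) x)\<^sup>2 \<le> a"
    and t: "t \<in> {0..T}" and x: "x \<in> lat n"
  shows "\<bar>grad_energy n u0 i t x\<bar> \<le> 2 * a"
proof -
  let ?E = "UNIV \<times> lat n :: ('d \<times> (real ^ 'd)) set"
  let ?D = "\<lambda>e s. \<bar>grad_energy n u0 (fst e) s (snd e)\<bar>"
  have n0: "0 < n" using n by simp
  have E: "finite ?E" "?E \<noteq> {}" using finite_edges[OF n0] x by auto
  have "\<exists>s\<in>{0..T}. \<forall>r\<in>{0..T}. ?D e r \<le> ?D e s" if "e \<in> ?E" for e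
    by (rule continuous_attains_sup) (use T that in \<open>auto intro!: continuous_intros grad_energy_continuous[OF n0]\<close>)
  then obtain s where s: "\<And>e. e \<in> ?E \<Longrightarrow> s e \<in> {0..T}" "\<And>e r. e \<in> ?E \<Longrightarrow> r \<in> {0..T} \<Longrightarrow> ?D e r \<le> ?D e (s e)" by metis
  obtain e where e: "e \<in> ?E" "\<And>e'. e' \<in> ?E \<Longrightarrow> ?D e' (s e') \<le> ?D e (s e)"
  proof -
    have "Max ((\<lambda>e. ?D e (s e)) ` ?E) \<in> (\<lambda>e. ?D e (s e)) ` ?E" using E by (intro Max_in) auto
    then obtain e where "e \<in> ?E" "Max ((\<lambda>e. ?D e (s e)) ` ?E) = ?D e (s e)" by auto
    then show ?thesis using that[of e] E(1) by (metis (mono_tags, lifting) Max_ge finite_imageI imageI)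
  qed
  define B where "B = ?D e (s e)"
  have le_B: "?D e' r \<le> B" if "e' \<in> ?E" "r \<in> {0..T}" for e' r
    using s(2)[OF that] e(2)[OF that(1)] unfolding B_def by linarith
  have B0: "0 \<le> B" unfolding B_def by simp
  obtain j z where jz: "e = (j, z)" by (cases e)
  have z: "z \<in> lat n" using e jz by simp
  have st: "0 \<le> s e" "s e \<le> T" using s(1)[OF e(1)] by auto
  let ?I = "integral {0..s e} (\<lambda>r. \<Sum>(j', z')\<in>?E. renewal_kernel n j z j' z' (s e - r) * grad_energy n u0 j' r z')"
  have "?I = grad_energy n u0 j (s e) z - (heat_sg n (s e) (disc_grad (1 / real n) j u0) z)\<^sup>2"
    by (rule integral_unique[OF grad_energy_renewal[OF n z st(1)]])
  moreover have "\<bar>?I\<bar> \<le> B / 2"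
  proof (rule renewal_bound_half[OF n z st(1) B0 grad_energy_continuous[OF n0]])
    fix j' :: 'd and z' :: "real ^ 'd" and r assume "z' \<in> lat n" "0 \<le> r" "r \<le> s e"
    then show "\<bar>grad_energy n u0 j' r z'\<bar> \<le> B" using le_B[of "(j', z')" r] st by simp
  qed
  moreover have "0 \<le> (heat_sg n (s e) (disc_grad (1 / real n) j u0) z)\<^sup>2" by simp
  moreover have "(heat_sg n (s e) (disc_grad (1 / real n) j u0) z)\<^sup>2 \<le> a" using A[OF s(1)[OF e(1)] z] .
  moreover have "B = \<bar>grad_energy n u0 j (s e) z\<bar>"
    unfolding B_def using arg_cong[OF jz, of fst] arg_cong[OF jz, of snd] by (simp only: fst_conv snd_conv)
  ultimately have "B \<le> a + B / 2" by linarith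
  then show ?thesis using le_B[of "(i, x)" t] t x by simp
qed

section \<open>Passage to the limit in the renewal equation\<close>

context
  fixes u0 :: "real ^ 'd::finite \<Rightarrow> real" and w Dbar :: "'d \<Rightarrow> real \<Rightarrow> real ^ 'd \<Rightarrow> real"
    and J :: "'d \<Rightarrow> 'd \<Rightarrow> real" and T :: real
  assumes T: "0 < T"
    and J: "\<And>i j. (\<lambda>n. kernel_tail n i j 0) \<longlonglongrightarrow> J i j / 2"
    and w_cont: "\<And>i. continuous_on ({0..T} \<times> UNIV) (\<lambda>(t, x). w i t x)"
    and w_per: "\<And>i t. t \<in> {0..T} \<Longrightarrow> torus_fun (w i t)"
    and w_lim: "\<And>\<eta> i. 0 < \<eta> \<Longrightarrow> \<forall>\<^sub>F n in sequentially. \<forall>t\<in>{0..T}. \<forall>x\<in>lat n.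
        \<bar>heat_sg n t (disc_grad (1 / real n) i u0) x - w i t x\<bar> \<le> \<eta>"
    and D_cont: "\<And>i. continuous_on ({0..T} \<times> UNIV) (\<lambda>(t, x). Dbar i t x)"
    and D_per: "\<And>i t. t \<in> {0..T} \<Longrightarrow> torus_fun (Dbar i t)"
    and D_eq: "\<And>i t x. Dbar i t x = (w i t x)\<^sup>2 + (\<Sum>j\<in>UNIV. J i j / 2 * Dbar j t x)"
begin

lemma w_bounded: "\<exists>B\<ge>0. \<forall>i x. \<forall>t\<in>{0..T}. \<bar>w i t x\<bar> \<le> B"
proof -
  have "\<exists>B\<ge>0. \<forall>t\<in>{0..T}. \<forall>x. \<bar>w i t x\<bar> \<le> B" for i
    using torus_bounded[OF w_cont[of i] w_per] by metis
  then obtain B where B: "\<And>i. 0 \<le> B i" "\<And>i t x. t \<in> {0..T} \<Longrightarrow> \<bar>w i t x\<bar> \<le> B i" by metis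
  have "\<bar>w i t x\<bar> \<le> (\<Sum>i\<in>UNIV. B i)" if "t \<in> {0..T}" for i t x
    using B(2)[OF that, of i x] member_le_sum[of i UNIV B] B(1) by force
  moreover have "0 \<le> (\<Sum>i\<in>UNIV. B i)" using B(1) by (simp add: sum_nonneg)
  ultimately show ?thesis by blast
qed

lemma Dbar_bounded: "\<exists>B\<ge>0. \<forall>i x. \<forall>t\<in>{0..T}. \<bar>Dbar i t x\<bar> \<le> B"
proof -
  have "\<exists>B\<ge>0. \<forall>t\<in>{0..T}. \<forall>x. \<bar>Dbar i t x\<bar> \<le> B" for i
    using torus_bounded[OF D_cont[of i] D_per] by metis
  then obtain B where B: "\<And>i. 0 \<le> B i" "\<And>i t x. t \<in> {0..T} \<Longrightarrow> \<bar>Dbar i t x\<bar> \<le> B i" by metis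
  have "\<bar>Dbar i t x\<bar> \<le> (\<Sum>i\<in>UNIV. B i)" if "t \<in> {0..T}" for i t x
    using B(2)[OF that, of i x] member_le_sum[of i UNIV B] B(1) by force
  moreover have "0 \<le> (\<Sum>i\<in>UNIV. B i)" using B(1) by (simp add: sum_nonneg)
  ultimately show ?thesis by blast
qed

lemma square_diff_le:
  fixes a b B \<eta> :: real
  assumes "\<bar>a - b\<bar> \<le> \<eta>" "\<bar>b\<bar> \<le> B" "\<eta> \<le> 1"
  shows "\<bar>a\<^sup>2 - b\<^sup>2\<bar> \<le> \<eta> * (2 * B + 1)"
proof -
  have "\<bar>a + b\<bar> \<le> 2 * B + 1" using assms by linarith
  then have "\<bar>a - b\<bar> * \<bar>a + b\<bar> \<le> \<eta> * (2 * B + 1)" using assms by (intro mult_mono) auto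
  moreover have "a\<^sup>2 - b\<^sup>2 = (a - b) * (a + b)" by (simp add: power2_eq_square algebra_simps)
  ultimately show ?thesis by (simp add: abs_mult)
qed

lemma heat_square_limit:
  assumes "0 < \<eta>"
  shows "\<forall>\<^sub>F n in sequentially. \<forall>i. \<forall>t\<in>{0..T}. \<forall>x\<in>lat n. \<bar>(heat_sg n t (disc_grad (1 / real n) i u0) x)\<^sup>2 - (w i t x)\<^sup>2\<bar> \<le> \<eta>"
proof -
  obtain B where B: "0 \<le> B" "\<And>i t x. t \<in> {0..T} \<Longrightarrow> \<bar>w i t x\<bar> \<le> B" using w_bounded by blast
  define \<eta>' where "\<eta>' = min 1 (\<eta> / (2 * B + 1))"
  have \<eta>': "0 < \<eta>'" "\<eta>' \<le> 1" "\<eta>' * (2 * B + 1) \<le> \<eta>"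
  proof -
    show "0 < \<eta>'" "\<eta>' \<le> 1" using assms B by (auto simp: \<eta>'_def)
    have "\<eta>' \<le> \<eta> / (2 * B + 1)" by (simp add: \<eta>'_def)
    then show "\<eta>' * (2 * B + 1) \<le> \<eta>" using B(1) by (subst (asm) pos_le_divide_eq) auto
  qed
  have "\<forall>\<^sub>F n in sequentially. \<forall>i\<in>UNIV. \<forall>t\<in>{0..T}. \<forall>x\<in>lat n. \<bar>heat_sg n t (disc_grad (1 / real n) i u0) x - w i t x\<bar> \<le> \<eta>'"
    using w_lim[OF \<eta>'(1)] by (subst eventually_ball_finite_distrib) auto
  then show ?thesis
  proof eventually_elim
    case (elim n)
    show ?case
    proof (intro allI ballI)
      fix i t and x :: "real ^ 'd" assume "t \<in> {0..T}" "x \<in> lat n"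
      then show "\<bar>(heat_sg n t (disc_grad (1 / real n) i u0) x)\<^sup>2 - (w i t x)\<^sup>2\<bar> \<le> \<eta>"
        using square_diff_le[of "heat_sg n t (disc_grad (1 / real n) i u0) x" "w i t x" \<eta>' B] elim B(2)[of t i x] \<eta>' by force
    qed
  qed
qed

lemma grad_energy_eventually_bounded:
  obtains C where "0 \<le> C" "\<forall>\<^sub>F n in sequentially. \<forall>i. \<forall>t\<in>{0..T}. \<forall>x\<in>lat n. \<bar>grad_energy n u0 i t x\<bar> \<le> C"
proof -
  obtain B where B: "0 \<le> B" "\<And>i t x. t \<in> {0..T} \<Longrightarrow> \<bar>w i t x\<bar> \<le> B" using w_bounded by blast
  have "\<forall>\<^sub>F n in sequentially. \<forall>i. \<forall>t\<in>{0..T}. \<forall>x\<in>lat n. \<bar>grad_energy n u0 i t x\<bar> \<le> 2 * (B\<^sup>2 + 1)"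
    using heat_square_limit[OF zero_less_one] eventually_ge_at_top[of 2]
  proof eventually_elim
    case (elim n)
    show ?case
    proof (intro allI ballI, rule grad_energy_bound[OF elim(2) less_imp_le[OF T]])
      fix i t and x :: "real ^ 'd" assume tx: "t \<in> {0..T}" "x \<in> lat n"
      have "(w i t x)\<^sup>2 \<le> B\<^sup>2" using B(2)[OF tx(1), of i x] B(1) by (intro power2_le_iff_abs_le[THEN iffD2])
      moreover have "\<bar>(heat_sg n t (disc_grad (1 / real n) i u0) x)\<^sup>2 - (w i t x)\<^sup>2\<bar> \<le> 1" using elim(1) tx by blast
      ultimately show "(heat_sg n t (disc_grad (1 / real n) i u0) x)\<^sup>2 \<le> B\<^sup>2 + 1" by linarith
    qed
  qed
  then show ?thesis using that[of "2 * (B\<^sup>2 + 1)"] by simp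
qed

lemma inverse_square_eventually:
  assumes "0 < \<eta>" shows "\<forall>\<^sub>F n in sequentially. K / (real n)\<^sup>2 \<le> \<eta>"
proof -
  have "(\<lambda>n. K / (real n)\<^sup>2) \<longlonglongrightarrow> 0"
    by (rule tendsto_divide_0[OF tendsto_const], rule filterlim_at_top_imp_at_infinity)
      (rule filterlim_pow_at_top[OF _ filterlim_real_sequentially], simp)
  then have "\<forall>\<^sub>F n in sequentially. K / (real n)\<^sup>2 < \<eta>" by (rule order_tendstoD(2)[OF _ assms])
  then show ?thesis by (rule eventually_mono) simp
qed

text \<open>Within a window of length of order n^(-2) before t, the error \<open>c\<close> is
  multiplied by the kernel mass 1/2; every other contribution is eventually small. The window has to
  stay inside the times where \<open>c\<close> is valid, which is why the hypothesis starts at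
  \<open>t0 / 2\<close> and the conclusion at \<open>t0\<close>.\<close>

lemma error_contraction:
  assumes \<eta>: "0 < \<eta>" and t0: "0 < t0" and c: "0 \<le> c"
    and half: "\<forall>\<^sub>F n in sequentially. \<forall>i. \<forall>t\<in>{t0 / 2..T}. \<forall>x\<in>lat n. \<bar>grad_energy n u0 i t x - Dbar i t x\<bar> \<le> c"
  shows "\<forall>\<^sub>F n in sequentially. \<forall>i. \<forall>t\<in>{t0..T}. \<forall>x\<in>lat n. \<bar>grad_energy n u0 i t x - Dbar i t x\<bar> \<le> c / 2 + 5 * \<eta>"
proof -
  let ?d = "real CARD('d)"
  obtain C0 where C0: "0 \<le> C0" "\<forall>\<^sub>F n in sequentially. \<forall>i. \<forall>t\<in>{0..T}. \<forall>x\<in>lat n. \<bar>grad_energy n u0 i t x\<bar> \<le> C0"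
    by (rule grad_energy_eventually_bounded)
  obtain B where B: "0 \<le> B" "\<And>i t x. t \<in> {0..T} \<Longrightarrow> \<bar>Dbar i t x\<bar> \<le> B" using Dbar_bounded by blast
  define C where "C = C0 + B"
  have C: "0 \<le> C" using C0 B by (simp add: C_def)
  define P where "P j \<delta> c' \<longleftrightarrow> 0 < \<delta> \<and> 0 \<le> c' \<and> (\<forall>s\<in>{0..T}. \<forall>t\<in>{0..T}. \<bar>s - t\<bar> < \<delta> \<longrightarrow>
    (\<forall>x y. \<bar>Dbar j s x - Dbar j t y\<bar> \<le> \<eta> + c' * (\<Sum>l\<in>UNIV. psi (x $ l - y $ l))))" for j \<delta> c'
  have "\<exists>\<delta> c'. P j \<delta> c'" for j
  proof (rule torus_psi_modulus[OF D_cont[of j] D_per \<eta>])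
    fix \<delta> c' assume "0 < \<delta>" "0 \<le> c'" and "\<And>s t x y. s \<in> {0..T} \<Longrightarrow> t \<in> {0..T} \<Longrightarrow> \<bar>s - t\<bar> < \<delta> \<Longrightarrow>
      \<bar>Dbar j s x - Dbar j t y\<bar> \<le> \<eta> + c' * (\<Sum>l\<in>UNIV. psi (x $ l - y $ l))"
    then show ?thesis unfolding P_def by (intro exI[of _ \<delta>] exI[of _ c'] conjI ballI impI allI)
  qed
  then obtain \<delta>' c'' where P: "\<And>j. P j (\<delta>' j) (c'' j)" by metis
  have mod': "0 < \<delta>' j" "0 \<le> c'' j" for j using P[of j] unfolding P_def by simp_all
  have mod'': "\<bar>Dbar j s x - Dbar j t y\<bar> \<le> \<eta> + c'' j * (\<Sum>l\<in>UNIV. psi (x $ l - y $ l))"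
    if "s \<in> {0..T}" "t \<in> {0..T}" "\<bar>s - t\<bar> < \<delta>' j" for j s t x y
    using P[of j] that unfolding P_def by blast
  define \<delta> where "\<delta> = Min (range \<delta>')"
  define c' where "c' = (\<Sum>j\<in>UNIV. c'' j)"
  have \<delta>: "0 < \<delta>" "\<And>j. \<delta> \<le> \<delta>' j" using mod'(1) by (auto simp: \<delta>_def)
  have c': "0 \<le> c'" "\<And>j. c'' j \<le> c'" using mod'(2) by (auto simp: c'_def intro: sum_nonneg member_le_sum)
  have modulus: "\<bar>Dbar j s x - Dbar j t y\<bar> \<le> \<eta> + c' * (\<Sum>l\<in>UNIV. psi (x $ l - y $ l))"
    if "s \<in> {0..T}" "t \<in> {0..T}" "\<bar>s - t\<bar> < \<delta>" for j s t x y
  proof -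
    have "c'' j * (\<Sum>l\<in>UNIV. psi (x $ l - y $ l)) \<le> c' * (\<Sum>l\<in>UNIV. psi (x $ l - y $ l))"
      by (intro mult_right_mono c' sum_nonneg psi_nonneg)
    then show ?thesis using mod''[OF that(1,2), of j x y] \<delta>(2)[of j] that(3) by linarith
  qed
  \<comment> \<open>The window has length \<open>R / (real n)\<^sup>2\<close>. The tail decay summed
    over all directions is then d / (4 R), and this \<open>R\<close> makes the older contributions
    at most \<eta>. The summand 1 keeps \<open>R\<close> positive when \<open>C\<close> is
    0.\<close>
  define R where "R = C * ?d / (4 * \<eta>) + 1"
  have R: "0 < R" "C * ?d / (4 * R) \<le> \<eta>"
  proof -
    have "0 \<le> C * ?d / (4 * \<eta>)" using C \<eta> by simp
    then show "0 < R" unfolding R_def by linarith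
    have "C * ?d = 4 * \<eta> * (R - 1)" using \<eta> by (simp add: R_def)
    also have "\<dots> \<le> 4 * \<eta> * R" using \<eta> by simp
    finally show "C * ?d / (4 * R) \<le> \<eta>" using \<open>0 < R\<close> by (simp add: field_simps)
  qed
  \<comment> \<open>The accuracy is shared out in advance: two sources of mass error, the distance
    from the limit mass and the tail beyond age t, times d directions, times the bound
    \<open>B\<close> on the limit energies. Using \<open>B + 1\<close> avoids division by
    zero.\<close>
  have "\<forall>\<^sub>F n in sequentially. \<forall>i\<in>UNIV. \<forall>j\<in>UNIV. \<bar>kernel_tail n i j 0 - J i j / 2\<bar> \<le> \<eta> / (2 * (B + 1) * ?d)"
  proof -
    have pos: "0 < \<eta> / (2 * (B + 1) * ?d)" using \<eta> B by simp
    have "\<forall>\<^sub>F n in sequentially. \<bar>kernel_tail n i j 0 - J i j / 2\<bar> \<le> \<eta> / (2 * (B + 1) * ?d)" for i j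
      by (rule eventually_mono[OF tendstoD[OF J[of i j] pos]]) (simp add: dist_real_def)
    then show ?thesis by (simp add: eventually_all_finite)
  qed
  moreover have "0 < \<eta> / (2 * (B + 1) * ?d)" using \<eta> B by simp
  note inverse_square_eventually[OF this, of "1 / (4 * t0)"]
  moreover have "\<forall>\<^sub>F n in sequentially. R / (real n)\<^sup>2 \<le> min (\<delta> / 2) (t0 / 2)"
    by (rule inverse_square_eventually) (use \<delta> t0 in auto)
  moreover have "\<forall>\<^sub>F n in sequentially. (c' * (R * (?d\<^sup>2 * (200 + 120 * R)))) / (real n)\<^sup>2 \<le> \<eta>"
    by (rule inverse_square_eventually[OF \<eta>])
  moreover note heat_square_limit[OF \<eta>] C0(2) half eventually_ge_at_top[of 2]
  ultimately show ?thesis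
  proof eventually_elim
    case (elim n)
    have n: "2 \<le> n" "0 < n" using elim(8) by auto
    define q where "q = R / (real n)\<^sup>2"
    have q_le: "q \<le> min (\<delta> / 2) (t0 / 2)" unfolding q_def by (rule elim(3))
    have q: "0 < q" "q < \<delta>" "q \<le> t0 / 2" "(real n)\<^sup>2 * q = R"
    proof -
      show "0 < q" using R(1) n(2) by (simp add: q_def)
      have "q \<le> \<delta> / 2" using q_le by (rule order_trans) simp
      then show "q < \<delta>" using \<delta>(1) by linarith
      show "q \<le> t0 / 2" using q_le by (rule order_trans) simp
      show "(real n)\<^sup>2 * q = R" using n(2) by (simp add: q_def)
    qed
    show ?case
    proof (intro allI ballI)
      fix i t and x :: "real ^ 'd" assume t: "t \<in> {t0..T}" and x: "x \<in> lat n"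
      have tT: "t \<in> {0..T}" "0 \<le> t" "0 < t" "t0 \<le> t" using t t0 by auto
      let ?E = "UNIV \<times> lat n :: ('d \<times> (real ^ 'd)) set"
      let ?K = "\<lambda>j z s. renewal_kernel n i x j z (t - s)"
      let ?\<Phi> = "\<lambda>j s z. grad_energy n u0 j s z - Dbar j t x"
      let ?A = "(heat_sg n t (disc_grad (1 / real n) i u0) x)\<^sup>2"
      have rb: "(\<lambda>s. \<Sum>(j, z)\<in>?E. ?K j z s * ?\<Phi> j s z) integrable_on {0..t}"
        "\<bar>integral {0..t} (\<lambda>s. \<Sum>(j, z)\<in>?E. ?K j z s * ?\<Phi> j s z)\<bar>
          \<le> C * (\<Sum>j\<in>UNIV. kernel_tail n i j q) + (c + \<eta>) / 2 + c' * (q * (?d\<^sup>2 * (200 + 120 * ((real n)\<^sup>2 * q))))"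
      proof -
        have cont: "continuous_on {0..t} (\<lambda>s. ?\<Phi> j s z)" if "z \<in> lat n" for j z
          by (intro continuous_intros grad_energy_continuous[OF n(2) that])
        have far: "\<bar>?\<Phi> j s z\<bar> \<le> C" if "z \<in> lat n" "0 \<le> s" "s \<le> t" for j z s
        proof -
          have "\<bar>grad_energy n u0 j s z\<bar> \<le> C0" using elim(6) that t by auto
          then show ?thesis using B(2)[OF tT(1), of j x] unfolding C_def by linarith
        qed
        have near: "\<bar>?\<Phi> j s z\<bar> \<le> (c + \<eta>) + c' * (\<Sum>l\<in>UNIV. psi (z $ l - x $ l))" if "z \<in> lat n" "t - q \<le> s" "s \<le> t" for j z s
        proof -
          have s: "s \<in> {0..T}" "s \<in> {t0 / 2..T}" "\<bar>s - t\<bar> < \<delta>" using that q t t0 by auto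
          have "\<bar>grad_energy n u0 j s z - Dbar j s z\<bar> \<le> c" using elim(7) s(2) that(1) by blast
          then show ?thesis using modulus[OF s(1) tT(1) s(3), of j z x] by linarith
        qed
        have qt: "q \<le> t" using q tT by linarith
        show "(\<lambda>s. \<Sum>(j, z)\<in>?E. ?K j z s * ?\<Phi> j s z) integrable_on {0..t}"
          by (rule renewal_bound(1)[OF n(1) x less_imp_le[OF q(1)] qt C _ c'(1) cont far near]) (use c \<eta> in auto)
        show "\<bar>integral {0..t} (\<lambda>s. \<Sum>(j, z)\<in>?E. ?K j z s * ?\<Phi> j s z)\<bar>
          \<le> C * (\<Sum>j\<in>UNIV. kernel_tail n i j q) + (c + \<eta>) / 2 + c' * (q * (?d\<^sup>2 * (200 + 120 * ((real n)\<^sup>2 * q))))"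
          by (rule renewal_bound(2)[OF n(1) x less_imp_le[OF q(1)] qt C _ c'(1) cont far near]) (use c \<eta> in auto)
      qed
      have tail_q: "C * (\<Sum>j\<in>UNIV. kernel_tail n i j q) \<le> \<eta>"
      proof -
        have "(\<Sum>j\<in>UNIV. kernel_tail n i j q) \<le> (\<Sum>j\<in>(UNIV :: 'd set). 1 / (4 * (real n)\<^sup>2 * q))"
          by (intro sum_mono kernel_tail_decay n q)
        also have "\<dots> = ?d / (4 * R)" using q(4) by (simp add: mult.assoc)
        finally have "C * (\<Sum>j\<in>UNIV. kernel_tail n i j q) \<le> C * (?d / (4 * R))" using C by (intro mult_left_mono)
        then show ?thesis using R(2) by simp
      qed
      have sp: "c' * (q * (?d\<^sup>2 * (200 + 120 * ((real n)\<^sup>2 * q)))) \<le> \<eta>"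
        using elim(4) unfolding q(4) unfolding q_def by (simp add: mult_ac)
      let ?m = "\<lambda>j. kernel_tail n i j 0 - kernel_tail n i j t"
      have hm: "((\<lambda>s. \<Sum>(j, z)\<in>?E. ?K j z s * Dbar j t x) has_integral (\<Sum>j\<in>UNIV. ?m j * Dbar j t x)) {0..t}"
      proof -
        have "((\<lambda>s. \<Sum>j\<in>UNIV. (\<Sum>z\<in>lat n. ?K j z s) * Dbar j t x) has_integral (\<Sum>j\<in>UNIV. (kernel_tail n i j (t - t) - kernel_tail n i j (t - 0)) * Dbar j t x)) {0..t}"
          by (intro has_integral_sum has_integral_mult_left kernel_mass_has_integral[OF n(2) x tT(2)]) auto
        moreover have "(\<Sum>j\<in>UNIV. (\<Sum>z\<in>lat n. ?K j z s) * Dbar j t x) = (\<Sum>(j, z)\<in>?E. ?K j z s * Dbar j t x)" for s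
          unfolding sum_distrib_right sum.cartesian_product ..
        ultimately show ?thesis by (simp only: diff_self diff_zero)
      qed
      have "((\<lambda>s. (\<Sum>(j, z)\<in>?E. ?K j z s * ?\<Phi> j s z) + (\<Sum>(j, z)\<in>?E. ?K j z s * Dbar j t x)) has_integral
          (integral {0..t} (\<lambda>s. \<Sum>(j, z)\<in>?E. ?K j z s * ?\<Phi> j s z) + (\<Sum>j\<in>UNIV. ?m j * Dbar j t x))) {0..t}"
        by (rule has_integral_add[OF integrable_integral[OF rb(1)] hm])
      moreover have "(\<Sum>(j, z)\<in>?E. ?K j z s * ?\<Phi> j s z) + (\<Sum>(j, z)\<in>?E. ?K j z s * Dbar j t x)
          = (\<Sum>(j, z)\<in>?E. ?K j z s * grad_energy n u0 j s z)" for s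
        unfolding sum.distrib[symmetric] split_def by (intro sum.cong refl) (simp add: algebra_simps)
      ultimately have "grad_energy n u0 i t x - ?A
          = integral {0..t} (\<lambda>s. \<Sum>(j, z)\<in>?E. ?K j z s * ?\<Phi> j s z) + (\<Sum>j\<in>UNIV. ?m j * Dbar j t x)"
        using has_integral_unique[OF grad_energy_renewal[OF n(1) x tT(2), of i u0]] by (simp only:)
      then have "grad_energy n u0 i t x - Dbar i t x = (?A - (w i t x)\<^sup>2)
          + integral {0..t} (\<lambda>s. \<Sum>(j, z)\<in>?E. ?K j z s * ?\<Phi> j s z) + (\<Sum>j\<in>UNIV. (?m j - J i j / 2) * Dbar j t x)"
        using D_eq[of i t x] by (simp add: sum_subtractf left_diff_distrib)
      moreover have "\<bar>?A - (w i t x)\<^sup>2\<bar> \<le> \<eta>" using elim(5) tT(1) x by blast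
      moreover have "\<bar>\<Sum>j\<in>UNIV. (?m j - J i j / 2) * Dbar j t x\<bar> \<le> \<eta>"
      proof -
        have "\<bar>\<Sum>j\<in>UNIV. (?m j - J i j / 2) * Dbar j t x\<bar> \<le> (\<Sum>j\<in>(UNIV :: 'd set). \<eta> / ((B + 1) * ?d) * B)"
        proof (rule order_trans[OF sum_abs], rule sum_mono, unfold abs_mult, rule mult_mono)
          fix j
          have "kernel_tail n i j t \<le> 1 / (4 * (real n)\<^sup>2 * t)" by (rule kernel_tail_decay[OF n(2) tT(3)])
          also have "\<dots> \<le> 1 / (4 * (real n)\<^sup>2 * t0)" using n t0 tT by (intro divide_left_mono mult_left_mono) auto
          also have "\<dots> = 1 / (4 * t0) / (real n)\<^sup>2" by simp
          finally have "kernel_tail n i j t \<le> \<eta> / (2 * (B + 1) * ?d)" using elim(2) by linarith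
          moreover have "0 \<le> kernel_tail n i j t" by (rule kernel_tail_nonneg)
          moreover have "\<bar>kernel_tail n i j 0 - J i j / 2\<bar> \<le> \<eta> / (2 * (B + 1) * ?d)" using elim(1) by blast
          moreover have "\<eta> / ((B + 1) * ?d) = \<eta> / (2 * (B + 1) * ?d) + \<eta> / (2 * (B + 1) * ?d)"
            using field_sum_of_halves[of "\<eta> / ((B + 1) * ?d)"] by (simp only: divide_divide_eq_left mult_ac)
          moreover have "\<bar>a - b - c\<bar> \<le> q" if "b \<le> h" "0 \<le> b" "\<bar>a - c\<bar> \<le> h" "q = h + h" for a b c h q :: real
            using that by linarith
          ultimately show "\<bar>?m j - J i j / 2\<bar> \<le> \<eta> / ((B + 1) * ?d)" by blast
          show "\<bar>Dbar j t x\<bar> \<le> B" by (rule B(2)[OF tT(1)])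
        qed (use \<eta> B in auto)
        also have "\<dots> = \<eta> * (B / (B + 1))" by simp
        also have "\<dots> \<le> \<eta> * 1" using \<eta> B by (intro mult_left_mono) auto
        finally show ?thesis by simp
      qed
      \<comment> \<open>Bookkeeping: one \<eta> each for the initial term, the mass error, the tail
        and the spatial moment, and half an \<eta> from the modulus, stay below 5 \<eta>.\<close>
      moreover have "\<bar>X\<bar> \<le> c / 2 + 5 * \<eta>" if "X = a + b + d" "\<bar>a\<bar> \<le> \<eta>" "\<bar>d\<bar> \<le> \<eta>" "\<bar>b\<bar> \<le> p + (c + \<eta>) / 2 + r" "p \<le> \<eta>" "r \<le> \<eta>"
        for X a b d p r :: real
      proof -
        have "c / 2 + \<eta> / 2 = (c + \<eta>) / 2" by (simp add: add_divide_distrib)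
        then show ?thesis using that \<eta> by (intro abs_leI) argo+
      qed
      ultimately show "\<bar>grad_energy n u0 i t x - Dbar i t x\<bar> \<le> c / 2 + 5 * \<eta>"
        using rb(2) tail_q sp by blast
    qed
  qed
qed

text \<open>Iteration of the contraction from the crude bound \<open>C0 + B\<close>. The map c
  \<mapsto> c/2 + 5 \<eta>' has the fixed point 10 \<eta>', and the k-th iterate differs from it by
  a geometric term. The induction runs over all starting times, since each step calls the previous
  one at half the time.\<close>

theorem grad_energy_tendsto:
  assumes \<eta>: "0 < \<eta>" and t0: "0 < t0"
  shows "\<forall>\<^sub>F n in sequentially. \<forall>i. \<forall>t\<in>{t0..T}. \<forall>x\<in>lat n. \<bar>grad_energy n u0 i t x - Dbar i t x\<bar> \<le> \<eta>"
proof -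
  obtain C0 where C0: "0 \<le> C0" "\<forall>\<^sub>F n in sequentially. \<forall>i. \<forall>t\<in>{0..T}. \<forall>x\<in>lat n. \<bar>grad_energy n u0 i t x\<bar> \<le> C0"
    by (rule grad_energy_eventually_bounded)
  obtain B where B: "0 \<le> B" "\<And>i t x. t \<in> {0..T} \<Longrightarrow> \<bar>Dbar i t x\<bar> \<le> B" using Dbar_bounded by blast
  \<comment> \<open>The fixed point 10 \<eta>' is then half of \<eta>; the other half is left for
    the geometric term.\<close>
  define \<eta>' where "\<eta>' = \<eta> / 20"
  have \<eta>': "0 < \<eta>'" using \<eta> by (simp add: \<eta>'_def)
  have iter: "\<forall>\<^sub>F n in sequentially. \<forall>i. \<forall>t\<in>{s..T}. \<forall>x\<in>lat n. \<bar>grad_energy n u0 i t x - Dbar i t x\<bar> \<le> (C0 + B) / 2 ^ k + 10 * \<eta>'"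
    if "0 < s" for k s
    using that
  proof (induction k arbitrary: s)
    case 0
    show ?case using C0(2)
    proof eventually_elim
      case (elim n)
      show ?case
      proof (intro allI ballI)
        fix i t and x :: "real ^ 'd" assume tx: "t \<in> {s..T}" "x \<in> lat n"
        then have t: "t \<in> {0..T}" using 0 by auto
        have "\<bar>grad_energy n u0 i t x\<bar> \<le> C0" using elim t tx by blast
        then show "\<bar>grad_energy n u0 i t x - Dbar i t x\<bar> \<le> (C0 + B) / 2 ^ 0 + 10 * \<eta>'" using B(2)[OF t, of i x] \<eta>' by simp
      qed
    qed
  next
    case (Suc k)
    have "0 \<le> (C0 + B) / 2 ^ k + 10 * \<eta>'" using C0 B \<eta>' by simp
    from error_contraction[OF \<eta>' Suc.prems this Suc.IH[of "s / 2"]] Suc.prems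
    show ?case by (simp add: field_simps)
  qed
  have "(\<lambda>k. (C0 + B) / 2 ^ k) \<longlonglongrightarrow> 0"
    using tendsto_mult_right_zero[OF LIMSEQ_power_zero[of "1/2 :: real"], of "C0 + B"] by (simp add: power_divide)
  then have "\<forall>\<^sub>F k in sequentially. (C0 + B) / 2 ^ k < 10 * \<eta>'" by (rule order_tendstoD(2)) (use \<eta>' in simp)
  then obtain k where k: "(C0 + B) / 2 ^ k < 10 * \<eta>'" using eventually_happens'[OF sequentially_bot] by blast
  have k': "(C0 + B) / 2 ^ k + 10 * \<eta>' \<le> \<eta>" using k unfolding \<eta>'_def by linarith
  show ?thesis using iter[OF t0, of k]
  proof eventually_elim
    case (elim n)
    show ?case
    proof (intro allI ballI)
      fix i t and x :: "real ^ 'd" assume "t \<in> {t0..T}" "x \<in> lat n"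
      then have "\<bar>grad_energy n u0 i t x - Dbar i t x\<bar> \<le> (C0 + B) / 2 ^ k + 10 * \<eta>'" using elim by blast
      then show "\<bar>grad_energy n u0 i t x - Dbar i t x\<bar> \<le> \<eta>" using k' by (rule order_trans)
    qed
  qed
qed

end

section \<open>Gradients of the discrete and continuous heat flows\<close>

lemma square_mult_psi_tendsto: "(\<lambda>n. (real n)\<^sup>2 * psi (k / real n)) \<longlonglongrightarrow> 2 * (pi * k)\<^sup>2"
proof -
  have "((\<lambda>h. sin (pi * k * h) / h) \<longlongrightarrow> pi * k) (at 0)"
  proof -
    have "((\<lambda>h. sin (pi * k * h)) has_real_derivative pi * k) (at 0)" by (auto intro!: derivative_eq_intros)
    then show ?thesis by (simp add: has_field_derivative_iff)
  qed
  moreover have "filterlim (\<lambda>n. 1 / real n) (at 0) sequentially"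
    unfolding filterlim_at using lim_1_over_n eventually_gt_at_top[of "0::nat"] by (auto elim: eventually_mono)
  ultimately have "(\<lambda>n. sin (pi * k * (1 / real n)) / (1 / real n)) \<longlonglongrightarrow> pi * k" by (rule filterlim_compose)
  then have "(\<lambda>n. 2 * (sin (pi * k * (1 / real n)) / (1 / real n))\<^sup>2) \<longlonglongrightarrow> 2 * (pi * k)\<^sup>2" by (intro tendsto_intros)
  then show ?thesis by (simp add: psi_sin power_mult_distrib mult_ac)
qed

lemma exp_minus_diff_le:
  fixes a b :: real assumes "0 \<le> a" "0 \<le> b"
  shows "\<bar>exp (- a) - exp (- b)\<bar> \<le> \<bar>a - b\<bar>"
proof -
  have *: "exp (- x) - exp (- y) \<le> y - x" if "0 \<le> x" "x \<le> y" for x y :: real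
  proof -
    have "exp (- x) - exp (- y) = exp (- x) * (1 - exp (- (y - x)))" by (simp add: right_diff_distrib exp_add[symmetric])
    also have "\<dots> \<le> 1 * (y - x)"
    proof (rule mult_mono)
      show "1 - exp (- (y - x)) \<le> y - x" using exp_ge_add_one_self[of "- (y - x)"] by linarith
    qed (use that in auto)
    finally show ?thesis by simp
  qed
  show ?thesis
  proof (cases "a \<le> b")
    case True then show ?thesis using *[OF assms(1) True] by (simp add: abs_if)
  next
    case False then show ?thesis using *[OF assms(2), of a] by (simp add: abs_if)
  qed
qed

text \<open>The solution of the heat equation started from a trigonometric polynomial.\<close>

context
  fixes N :: nat and c \<theta> :: "nat \<Rightarrow> real" and k :: "nat \<Rightarrow> real ^ 'd::finite"
begin

definition wave_flow :: "real \<Rightarrow> real ^ 'd \<Rightarrow> real" where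
  "wave_flow t x = (\<Sum>m<N. c m * (exp (- (2 * pi\<^sup>2 * (k m \<bullet> k m)) * t) * plane_wave (k m) (\<theta> m) x))"

text \<open>The integral over a segment of length s of the cosine with the i-th frequency. Frequency
  0 is split off, where the quotient would give 0 instead of s.\<close>

definition line_cos :: "nat \<Rightarrow> 'd \<Rightarrow> real \<Rightarrow> real" where
  "line_cos m i s = (if k m $ i = 0 then s else sin (2 * pi * k m $ i * s) / (2 * pi * k m $ i))"

definition line_sin :: "nat \<Rightarrow> 'd \<Rightarrow> real \<Rightarrow> real" where
  "line_sin m i s = (if k m $ i = 0 then 0 else (1 - cos (2 * pi * k m $ i * s)) / (2 * pi * k m $ i))"

text \<open>The integral of \<open>wave_flow\<close> along the segment from \<open>x\<close> to \<open>x + s e\<^sub>i\<close>.\<close>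

definition wave_line :: "'d \<Rightarrow> real \<Rightarrow> real \<Rightarrow> real ^ 'd \<Rightarrow> real" where
  "wave_line i s t x = (\<Sum>m<N. c m * line_cos m i s * (exp (- (2 * pi\<^sup>2 * (k m \<bullet> k m)) * t) * plane_wave (k m) (\<theta> m) x))
     - (\<Sum>m<N. c m * line_sin m i s * (exp (- (2 * pi\<^sup>2 * (k m \<bullet> k m)) * t) * plane_wave (k m) (\<theta> m - pi / 2) x))"

lemma wave_flow_0: "wave_flow 0 x = (\<Sum>m<N. c m * plane_wave (k m) (\<theta> m) x)"
  by (simp add: wave_flow_def)

lemma wave_line_0: "wave_line i 0 t x = 0"
proof -
  have "line_cos m i 0 = 0" "line_sin m i 0 = 0" for m by (simp_all add: line_cos_def line_sin_def)
  then show ?thesis by (simp add: wave_line_def)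
qed

lemma wave_line_derivative:
  "((\<lambda>s. wave_line i s t x) has_real_derivative wave_flow t (x + s *\<^sub>R axis i 1)) (at s)"
proof -
  have c': "(line_cos m i has_real_derivative cos (2 * pi * k m $ i * s)) (at s)" for m
    unfolding line_cos_def by (cases "k m $ i = 0") (auto intro!: derivative_eq_intros)
  have s': "(line_sin m i has_real_derivative sin (2 * pi * k m $ i * s)) (at s)" for m
    unfolding line_sin_def by (cases "k m $ i = 0") (auto intro!: derivative_eq_intros)
  let ?e = "\<lambda>m. exp (- (2 * pi\<^sup>2 * (k m \<bullet> k m)) * t)"
  have "((\<lambda>s. wave_line i s t x) has_real_derivative
     (\<Sum>m<N. c m * cos (2 * pi * k m $ i * s) * (?e m * plane_wave (k m) (\<theta> m) x))
     - (\<Sum>m<N. c m * sin (2 * pi * k m $ i * s) * (?e m * plane_wave (k m) (\<theta> m - pi / 2) x))) (at s)"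
    unfolding wave_line_def
    by (intro DERIV_diff DERIV_sum DERIV_cmult_right DERIV_cmult c' s')
  also have "(\<Sum>m<N. c m * cos (2 * pi * k m $ i * s) * (?e m * plane_wave (k m) (\<theta> m) x))
     - (\<Sum>m<N. c m * sin (2 * pi * k m $ i * s) * (?e m * plane_wave (k m) (\<theta> m - pi / 2) x)) = wave_flow t (x + s *\<^sub>R axis i 1)"
    unfolding wave_flow_def sum_subtractf[symmetric]
  proof (intro sum.cong refl)
    fix m
    let ?a = "2 * pi * (k m \<bullet> x) + \<theta> m" and ?b = "2 * pi * k m $ i * s"
    have 1: "plane_wave (k m) (\<theta> m) (x + s *\<^sub>R axis i 1) = cos ?a * cos ?b - sin ?a * sin ?b"
      unfolding plane_wave_shift cos_add[symmetric] by (simp add: mult_ac)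
    have 2: "plane_wave (k m) (\<theta> m - pi / 2) x = sin ?a"
    proof -
      have "plane_wave (k m) (\<theta> m - pi / 2) x = cos (?a - pi / 2)" by (simp add: plane_wave_def algebra_simps)
      then show ?thesis by (simp add: cos_diff)
    qed
    show "c m * cos ?b * (?e m * plane_wave (k m) (\<theta> m) x) - c m * sin ?b * (?e m * plane_wave (k m) (\<theta> m - pi / 2) x)
      = c m * (?e m * plane_wave (k m) (\<theta> m) (x + s *\<^sub>R axis i 1))"
      unfolding 1 2 plane_wave_def[of "k m" "\<theta> m" x] by (simp add: algebra_simps)
  qed
  finally show ?thesis .
qed

lemma heat_at_wave_line: "heat_at (wave_line i s) t x"
proof -
  have "heat_at (\<lambda>t x. (\<Sum>m<N. c m * line_cos m i s * (exp (- (2 * pi\<^sup>2 * (k m \<bullet> k m)) * t) * plane_wave (k m) (\<theta> m) x))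
     - (\<Sum>m<N. c m * line_sin m i s * (exp (- (2 * pi\<^sup>2 * (k m \<bullet> k m)) * t) * plane_wave (k m) (\<theta> m - pi / 2) x))) t x"
    by (intro heat_at_diff heat_at_sum heat_at_cmult heat_at_plane_wave) auto
  then show ?thesis unfolding wave_line_def[abs_def] .
qed

lemma torus_fun_wave_line:
  assumes k: "\<And>m i. m < N \<Longrightarrow> k m $ i \<in> \<int>"
  shows "torus_fun (wave_line i s t)"
proof -
  have "plane_wave (k m) \<phi> (x + axis j 1) = plane_wave (k m) \<phi> x" if "m < N" for m \<phi> x j
    using torus_fun_plane_wave[OF k[OF that]] unfolding torus_fun_def by blast
  then show ?thesis unfolding torus_fun_def wave_line_def by simp
qed

lemma continuous_wave_line: "continuous_on A (\<lambda>(t, x). wave_line i s t x)"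
  unfolding wave_line_def plane_wave_def split_def by (intro continuous_intros)

lemma continuous_wave_flow: "continuous_on A (\<lambda>(t, x). wave_flow t x)"
  unfolding wave_flow_def plane_wave_def split_def by (intro continuous_intros)

text \<open>Discrete and continuous flow are diagonal in the same finitely many waves, and the
  eigenvalues converge. Since exp is 1-Lipschitz on the negative axis, an eigenvalue error costs at
  most its multiple by \<open>T\<close>, uniformly in time and space.\<close>

lemma heat_sg_wave_flow_limit:
  assumes k: "\<And>m i. m < N \<Longrightarrow> k m $ i \<in> \<int>" and \<eta>: "0 < \<eta>" and T: "0 \<le> T"
  shows "\<forall>\<^sub>F n in sequentially. \<forall>t\<in>{0..T}. \<forall>x\<in>lat n. \<bar>heat_sg n t (wave_flow 0) x - wave_flow t x\<bar> \<le> \<eta>"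
proof -
  define \<epsilon> where "\<epsilon> n m = \<bar>(real n)\<^sup>2 * (\<Sum>i\<in>UNIV. psi (k m $ i / real n)) - 2 * pi\<^sup>2 * (k m \<bullet> k m)\<bar>" for n m
  have "(\<lambda>n. \<epsilon> n m) \<longlonglongrightarrow> 0" for m
  proof -
    have "(\<lambda>n. \<Sum>i\<in>UNIV. (real n)\<^sup>2 * psi (k m $ i / real n)) \<longlonglongrightarrow> (\<Sum>i\<in>UNIV. 2 * (pi * k m $ i)\<^sup>2)"
      by (intro tendsto_sum square_mult_psi_tendsto)
    also have "(\<Sum>i\<in>UNIV. 2 * (pi * k m $ i)\<^sup>2) = 2 * pi\<^sup>2 * (k m \<bullet> k m)"
      by (simp add: inner_vec_def sum_distrib_left power2_eq_square mult_ac)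
    finally have "(\<lambda>n. \<bar>(\<Sum>i\<in>UNIV. (real n)\<^sup>2 * psi (k m $ i / real n)) - 2 * pi\<^sup>2 * (k m \<bullet> k m)\<bar>) \<longlonglongrightarrow> \<bar>2 * pi\<^sup>2 * (k m \<bullet> k m) - 2 * pi\<^sup>2 * (k m \<bullet> k m)\<bar>"
      by (intro tendsto_intros)
    then show ?thesis unfolding \<epsilon>_def by (simp add: sum_distrib_left)
  qed
  then have "(\<lambda>n. \<Sum>m<N. \<bar>c m\<bar> * (\<epsilon> n m * T)) \<longlonglongrightarrow> (\<Sum>m<N. \<bar>c m\<bar> * (0 * T))"
    by (intro tendsto_intros)
  then have "(\<lambda>n. \<Sum>m<N. \<bar>c m\<bar> * (\<epsilon> n m * T)) \<longlonglongrightarrow> 0" by simp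
  then have "\<forall>\<^sub>F n in sequentially. (\<Sum>m<N. \<bar>c m\<bar> * (\<epsilon> n m * T)) < \<eta>" by (rule order_tendstoD(2)[OF _ \<eta>])
  then show ?thesis using eventually_gt_at_top[of 0]
  proof eventually_elim
    case (elim n)
    show ?case
    proof (intro ballI)
      fix t and x :: "real ^ 'd" assume t: "t \<in> {0..T}" and x: "x \<in> lat n"
      let ?a = "\<lambda>m. (real n)\<^sup>2 * (\<Sum>i\<in>UNIV. psi (k m $ i / real n))" and ?b = "\<lambda>m. 2 * pi\<^sup>2 * (k m \<bullet> k m)"
      have "heat_sg n t (wave_flow 0) x = (\<Sum>m<N. c m * heat_sg n t (plane_wave (k m) (\<theta> m)) x)"
        unfolding wave_flow_0[abs_def] by (rule heat_sg_sum[OF elim(2) x]) simp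
      also have "\<dots> = (\<Sum>m<N. c m * (exp (- (?a m) * t) * plane_wave (k m) (\<theta> m) x))"
        by (intro sum.cong refl arg_cong[where f="\<lambda>y. _ * y"] heat_sg_plane_wave[OF elim(2) x k]) auto
      finally have "\<bar>heat_sg n t (wave_flow 0) x - wave_flow t x\<bar>
        = \<bar>\<Sum>m<N. c m * ((exp (- (?a m * t)) - exp (- (?b m * t))) * plane_wave (k m) (\<theta> m) x)\<bar>"
        unfolding wave_flow_def by (simp add: sum_subtractf[symmetric] algebra_simps)
      also have "\<dots> \<le> (\<Sum>m<N. \<bar>c m\<bar> * (\<epsilon> n m * T))"
      proof (rule order_trans[OF sum_abs], rule sum_mono)
        fix m
        have "\<bar>exp (- (?a m * t)) - exp (- (?b m * t))\<bar> \<le> \<bar>?a m * t - ?b m * t\<bar>"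
          using t by (intro exp_minus_diff_le mult_nonneg_nonneg sum_nonneg psi_nonneg) auto
        also have "\<dots> = \<epsilon> n m * t" using t by (simp add: \<epsilon>_def left_diff_distrib[symmetric] abs_mult)
        also have "\<dots> \<le> \<epsilon> n m * T" using t by (intro mult_left_mono) (auto simp: \<epsilon>_def)
        finally have "\<bar>exp (- (?a m * t)) - exp (- (?b m * t))\<bar> * \<bar>plane_wave (k m) (\<theta> m) x\<bar> \<le> \<epsilon> n m * T * 1"
          by (intro mult_mono) (auto simp: plane_wave_def \<epsilon>_def T)
        then show "\<bar>c m * ((exp (- (?a m * t)) - exp (- (?b m * t))) * plane_wave (k m) (\<theta> m) x)\<bar> \<le> \<bar>c m\<bar> * (\<epsilon> n m * T)"
          by (simp add: abs_mult mult_left_mono)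
      qed
      finally show "\<bar>heat_sg n t (wave_flow 0) x - wave_flow t x\<bar> \<le> \<eta>" using elim(1) by linarith
    qed
  qed
qed

end


text \<open>The gradient itself need not be known to solve the heat equation, which would take third
  derivatives. Increments of \<open>u\<close> do solve it, and so do the line integrals of a
  trigonometric flow; if that flow starts within \<eta> of the initial gradient, the difference
  starts below \<open>h * \<eta>\<close>. The maximum principle keeps it there, and division by h
  \<rightarrow> 0 gives the bound for the gradient.\<close>

lemma gradient_approximation:
  fixes u0 :: "real ^ 'd::finite \<Rightarrow> real"
  assumes sol: "heat_solution u0 u" and per: "torus_fun u0" and C2: "C2_fun u0" and \<eta>: "0 < \<eta>" and T: "0 \<le> T"
  obtains N c \<theta> and k :: "nat \<Rightarrow> real ^ 'd" where "\<And>m i. m < N \<Longrightarrow> k m $ i \<in> \<int>"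
    "\<And>t x. t \<in> {0..T} \<Longrightarrow> \<bar>partial_deriv i (u t) x - wave_flow N c \<theta> k t x\<bar> \<le> \<eta>"
proof -
  let ?f = "partial_deriv i u0"
  have u_0: "u 0 = u0" using sol by (auto simp: heat_solution_def)
  have f_cont: "continuous_on UNIV ?f" using C2 by (simp add: C2_fun_def C1_fun_def)
  have f_per: "torus_fun ?f"
  proof -
    have "u0 (x + axis j 1 + s *\<^sub>R axis i 1) = u0 (x + s *\<^sub>R axis i 1)" for x j s
      using per unfolding torus_fun_def by (metis add.assoc add.commute)
    then show ?thesis unfolding torus_fun_def partial_deriv_def by simp
  qed
  obtain q where q: "trig_poly q" "\<And>x. \<bar>?f x - q x\<bar> < \<eta>" using trig_poly_dense[OF f_cont f_per \<eta>] by blast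
  obtain N c k \<theta> where k: "\<And>m i. m < N \<Longrightarrow> k m $ i \<in> \<int>" and q_eq: "q = (\<lambda>x. \<Sum>m<(N::nat). c m * plane_wave (k m) (\<theta> m) x)"
    using q(1) unfolding trig_poly_def by blast
  let ?Q = "wave_flow N c \<theta> k" and ?R = "wave_line N c \<theta> k i"
  have Q0: "\<bar>?f x - ?Q 0 x\<bar> < \<eta>" for x using q(2)[of x] by (simp add: q_eq wave_flow_0)
  have init: "\<bar>u0 (x + h *\<^sub>R axis i 1) - u0 x - ?R h 0 x\<bar> \<le> h * \<eta>" if h: "0 < h" for x h
  proof -
    have "((\<lambda>s. u0 (x + s *\<^sub>R axis i 1) - ?R s 0 x) has_real_derivative ?f (x + s *\<^sub>R axis i 1) - ?Q 0 (x + s *\<^sub>R axis i 1)) (at s)" for s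
      using C2 by (intro DERIV_diff directional_derivative wave_line_derivative) (auto simp: C2_fun_def)
    then obtain z where z: "u0 (x + h *\<^sub>R axis i 1) - ?R h 0 x - (u0 (x + 0 *\<^sub>R axis i 1) - ?R 0 0 x)
      = (h - 0) * (?f (x + z *\<^sub>R axis i 1) - ?Q 0 (x + z *\<^sub>R axis i 1))"
      using MVT2[OF h, of "\<lambda>s. u0 (x + s *\<^sub>R axis i 1) - ?R s 0 x" "\<lambda>s. ?f (x + s *\<^sub>R axis i 1) - ?Q 0 (x + s *\<^sub>R axis i 1)"] by blast
    have "\<bar>(h - 0) * (?f (x + z *\<^sub>R axis i 1) - ?Q 0 (x + z *\<^sub>R axis i 1))\<bar> \<le> h * \<eta>"
      unfolding abs_mult using h less_imp_le[OF Q0] by (intro mult_mono) auto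
    then show ?thesis unfolding z[symmetric] by (simp add: wave_line_0 algebra_simps)
  qed
  have u_cont: "continuous_on ({0..T} \<times> UNIV) (\<lambda>(t, x). u t x)"
    using sol unfolding heat_solution_def by (auto elim: continuous_on_subset)
  have incr: "\<bar>u t (x + h *\<^sub>R axis i 1) - u t x - ?R h t x\<bar> \<le> h * \<eta>" if t: "t \<in> {0..T}" and h: "0 < h" for t x h
  proof -
    define V where "V t x = u t (x + h *\<^sub>R axis i 1) - u t x - ?R h t x" for t x
    have V_at: "heat_at V t x" if "0 < t" for t x
      unfolding V_def[abs_def]
      by (intro heat_at_diff heat_at_shift heat_solution_heat_at[OF sol that] heat_at_wave_line)
    have V_cont: "continuous_on ({0..T} \<times> UNIV) (\<lambda>(t, x). V t x)"
    proof -
      have "continuous_on ({0..T} \<times> UNIV) (\<lambda>p. (\<lambda>(t, x). u t x) (fst p, snd p + h *\<^sub>R axis i 1))"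
        by (rule continuous_on_compose2[OF u_cont]) (auto intro!: continuous_intros)
      then show ?thesis unfolding V_def split_def
        by (intro continuous_on_diff) (use u_cont continuous_wave_line in \<open>auto simp: split_def\<close>)
    qed
    have V_per: "torus_fun (V t)" if "t \<in> {0..T}" for t
    proof -
      have u_per: "u t (y + axis j 1) = u t y" for y j using sol that unfolding heat_solution_def torus_fun_def by auto
      have "?R h t (x + axis j 1) = ?R h t x" for x j 
      proof -
        have "torus_fun (?R h t)" by (rule torus_fun_wave_line) (rule k)
        then show ?thesis unfolding torus_fun_def by blast
      qed
      moreover have "u t (x + axis j 1 + h *\<^sub>R axis i 1) = u t (x + h *\<^sub>R axis i 1)" for x j
        using u_per[of "x + h *\<^sub>R axis i 1" j] by (simp only: ac_simps)
      ultimately show ?thesis unfolding torus_fun_def V_def using u_per by simp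
    qed
    have V0: "\<bar>V 0 x\<bar> \<le> h * \<eta>" for x using init[OF h, of x] by (simp add: V_def u_0)
    have "V t x \<le> h * \<eta>"
      by (rule heat_max_principle[OF V_cont V_per V_at _ t]) (use V0 abs_le_D1 in auto)
    moreover have "(\<lambda>t x. (-1) * V t x) t x \<le> h * \<eta>"
    proof (rule heat_max_principle[OF _ _ _ _ t])
      show "continuous_on ({0..T} \<times> UNIV) (\<lambda>(t, x). - 1 * V t x)"
        using continuous_on_minus[OF V_cont] by (simp add: split_def)
      show "torus_fun (\<lambda>x. - 1 * V t x)" if "t \<in> {0..T}" for t using V_per[OF that] by (simp add: torus_fun_def)
      show "heat_at (\<lambda>t x. - 1 * V t x) t x" if "0 < t" for t x by (rule heat_at_cmult[OF V_at[OF that]])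
      show "- 1 * V 0 x \<le> h * \<eta>" for x using V0[of x] by (simp add: abs_le_iff)
    qed
    ultimately show ?thesis unfolding V_def by (simp add: abs_le_iff)
  qed
  have "\<bar>partial_deriv i (u t) x - ?Q t x\<bar> \<le> \<eta>" if t: "t \<in> {0..T}" for t x
  proof -
    \<comment> \<open>At time 0 the regularity of \<open>u0\<close> steps in, since a solution is
      only assumed smooth at positive times.\<close>
    have C1: "C1_fun (u t)"
      using sol t C2 u_0 unfolding heat_solution_def C2_fun_def by (cases "t = 0") auto
    have "((\<lambda>s. u t (x + s *\<^sub>R axis i 1) - ?R s t x) has_real_derivative partial_deriv i (u t) (x + 0 *\<^sub>R axis i 1) - ?Q t (x + 0 *\<^sub>R axis i 1)) (at 0)"
      by (intro DERIV_diff directional_derivative[OF C1] wave_line_derivative)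
    then have "((\<lambda>h. (u t (x + h *\<^sub>R axis i 1) - ?R h t x - u t x) / h) \<longlongrightarrow> partial_deriv i (u t) x - ?Q t x) (at 0)"
      by (simp add: has_field_derivative_iff wave_line_0)
    then have "((\<lambda>h. \<bar>(u t (x + h *\<^sub>R axis i 1) - ?R h t x - u t x) / h\<bar>) \<longlongrightarrow> \<bar>partial_deriv i (u t) x - ?Q t x\<bar>) (at_right 0)"
      by (intro tendsto_rabs) (rule tendsto_mono[OF at_le], simp_all)
    then show ?thesis
    proof (rule tendsto_upperbound)
      show "\<forall>\<^sub>F h in at_right 0. \<bar>(u t (x + h *\<^sub>R axis i 1) - ?R h t x - u t x) / h\<bar> \<le> \<eta>"
        using eventually_at_right_less[of 0]
      proof eventually_elim
        case (elim h)
        have "\<bar>u t (x + h *\<^sub>R axis i 1) - ?R h t x - u t x\<bar> \<le> h * \<eta>" using incr[OF t elim, of x] by (simp add: algebra_simps)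
        then show ?case using elim by (simp add: field_simps)
      qed
    qed simp
  qed
  then show ?thesis using that k by blast
qed

lemma continuous_on_uniform_approx:
  fixes f :: "'a::metric_space \<Rightarrow> real"
  assumes "\<And>\<eta>. 0 < \<eta> \<Longrightarrow> \<exists>g. continuous_on S g \<and> (\<forall>x\<in>S. \<bar>f x - g x\<bar> \<le> \<eta>)"
  shows "continuous_on S f"
  unfolding continuous_on_iff
proof (intro ballI allI impI)
  fix x e assume x: "x \<in> S" and e: "(0::real) < e"
  obtain g where g: "continuous_on S g" "\<forall>x\<in>S. \<bar>f x - g x\<bar> \<le> e / 4" using assms[of "e / 4"] e by auto
  obtain d where d: "0 < d" "\<forall>y\<in>S. dist y x < d \<longrightarrow> dist (g y) (g x) < e / 4"
    using g(1) x e unfolding continuous_on_iff by (metis divide_pos_pos zero_less_numeral)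
  have "dist (f y) (f x) < e" if "y \<in> S" "dist y x < d" for y
  proof -
    have "\<bar>g y - g x\<bar> < e / 4" using d(2) that by (auto simp: dist_real_def)
    moreover have "\<bar>f y - g y\<bar> \<le> e / 4" "\<bar>f x - g x\<bar> \<le> e / 4" using g(2) that x by auto
    ultimately show ?thesis unfolding dist_real_def using e by linarith
  qed
  then show "\<exists>d>0. \<forall>y\<in>S. dist y x < d \<longrightarrow> dist (f y) (f x) < e" using d(1) by blast
qed

context
  fixes u0 :: "real ^ 'd::finite \<Rightarrow> real" and u :: "real \<Rightarrow> real ^ 'd \<Rightarrow> real" and T :: real
  assumes sol: "heat_solution u0 u" and per: "torus_fun u0" and C2: "C2_fun u0" and T: "0 \<le> T"
begin

text \<open>Joint continuity of the gradient, including time 0, is not part of being a solution; it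
  follows because the gradient is a uniform limit of trigonometric flows.\<close>

lemma gradient_continuous: "continuous_on ({0..T} \<times> UNIV) (\<lambda>(t, x). partial_deriv i (u t) x)"
proof (rule continuous_on_uniform_approx)
  fix \<eta> :: real assume "0 < \<eta>"
  from gradient_approximation[OF sol per C2 this T, of i]
  obtain N c \<theta> and k :: "nat \<Rightarrow> real ^ 'd" where "\<And>t x. t \<in> {0..T} \<Longrightarrow> \<bar>partial_deriv i (u t) x - wave_flow N c \<theta> k t x\<bar> \<le> \<eta>" by metis
  then show "\<exists>g. continuous_on ({0..T} \<times> UNIV) g \<and> (\<forall>p\<in>{0..T} \<times> UNIV. \<bar>(\<lambda>(t, x). partial_deriv i (u t) x) p - g p\<bar> \<le> \<eta>)"
    by (intro exI[of _ "\<lambda>(t, x). wave_flow N c \<theta> k t x"] conjI continuous_wave_flow) auto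
qed

lemma gradient_periodic:
  assumes "0 \<le> t" shows "torus_fun (partial_deriv i (u t))"
proof -
  have u_per: "u t (y + axis j 1) = u t y" for y j using sol assms unfolding heat_solution_def torus_fun_def by auto
  have "u t (x + axis j 1 + s *\<^sub>R axis i 1) = u t (x + s *\<^sub>R axis i 1)" for x j s
    using u_per[of "x + s *\<^sub>R axis i 1" j] by (simp only: ac_simps)
  then show ?thesis unfolding torus_fun_def partial_deriv_def by simp
qed

lemma disc_grad_limit:
  assumes \<eta>: "0 < \<eta>"
  shows "\<forall>\<^sub>F n in sequentially. \<forall>x. \<bar>disc_grad (1 / real n) i u0 x - partial_deriv i u0 x\<bar> \<le> \<eta>"
proof -
  have C1: "C1_fun u0" using C2 by (simp add: C2_fun_def)
  have u_0: "u 0 = u0" using sol by (auto simp: heat_solution_def)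
  have per': "torus_fun (partial_deriv i u0)" using gradient_periodic[of 0 i] by (simp add: u_0)
  have "continuous_on UNIV (partial_deriv i u0)" using C1 by (simp add: C1_fun_def)
  \<comment> \<open>A time interval reduced to one point turns the space-time lemma into one about
    functions of space alone.\<close>
  then have "continuous_on ({0..0} \<times> UNIV) (\<lambda>p. partial_deriv i u0 (snd p))"
    by (rule continuous_on_compose2) (auto intro!: continuous_intros)
  then have "continuous_on ({0..0} \<times> UNIV) (\<lambda>(t::real, x). partial_deriv i u0 x)" by (simp only: split_def)
  from torus_uniformly_continuous[OF this per' \<eta>]
  obtain \<delta> where \<delta>0: "0 < \<delta>" "\<And>(s::real) (t::real) x y. s \<in> {0..0} \<Longrightarrow> t \<in> {0..0} \<Longrightarrow> \<bar>s - t\<bar> < \<delta> \<Longrightarrow> (\<And>l. \<bar>x $ l - y $ l\<bar> < \<delta>)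
    \<Longrightarrow> \<bar>partial_deriv i u0 x - partial_deriv i u0 y\<bar> < \<eta>" by blast
  have \<delta>: "0 < \<delta>" "\<And>x y. (\<And>l. \<bar>x $ l - y $ l\<bar> < \<delta>) \<Longrightarrow> \<bar>partial_deriv i u0 x - partial_deriv i u0 y\<bar> < \<eta>"
    using \<delta>0(1) \<delta>0(2)[of 0 0] by simp_all
  have "\<forall>\<^sub>F n in sequentially. 1 / real n < \<delta>" by (rule order_tendstoD(2)[OF lim_1_over_n \<delta>(1)])
  then show ?thesis using eventually_gt_at_top[of 0]
  proof eventually_elim
    case (elim n)
    show ?case
    proof
      fix x
      have n: "0 < 1 / real n" using elim by simp
      obtain z where z: "0 < z" "z < 1 / real n" "u0 (x + (1 / real n) *\<^sub>R axis i 1) - u0 (x + 0 *\<^sub>R axis i 1) = (1 / real n - 0) * partial_deriv i u0 (x + z *\<^sub>R axis i 1)"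
        using MVT2[OF n, of "\<lambda>s. u0 (x + s *\<^sub>R axis i 1)" "\<lambda>s. partial_deriv i u0 (x + s *\<^sub>R axis i 1)"] directional_derivative[OF C1] by blast
      have "disc_grad (1 / real n) i u0 x = partial_deriv i u0 (x + z *\<^sub>R axis i 1)"
        unfolding disc_grad_def torus_fun_shift[OF per] using z(3) elim(2) by (simp add: field_simps)
      moreover have "\<bar>partial_deriv i u0 (x + z *\<^sub>R axis i 1) - partial_deriv i u0 x\<bar> < \<eta>"
        by (rule \<delta>(2)) (use z elim(1) \<delta>(1) in \<open>auto simp: axis_def\<close>)
      ultimately show "\<bar>disc_grad (1 / real n) i u0 x - partial_deriv i u0 x\<bar> \<le> \<eta>" by simp
    qed
  qed
qed

text \<open>A trigonometric flow stands between the two gradients. Contraction of the discrete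
  semigroup carries the initial error forward on the lattice side, the gradient approximation does
  so on the continuous side, and convergence of eigenvalues links the flows.\<close>

theorem heat_sg_gradient_limit:
  assumes \<eta>: "0 < \<eta>"
  shows "\<forall>\<^sub>F n in sequentially. \<forall>t\<in>{0..T}. \<forall>x\<in>lat n. \<bar>heat_sg n t (disc_grad (1 / real n) i u0) x - partial_deriv i (u t) x\<bar> \<le> \<eta>"
proof -
  have u_0: "u 0 = u0" using sol by (auto simp: heat_solution_def)
  have \<eta>4: "0 < \<eta> / 4" using \<eta> by simp
  from gradient_approximation[OF sol per C2 this T, of i]
  obtain N c \<theta> and k :: "nat \<Rightarrow> real ^ 'd" where k: "\<And>m i. m < N \<Longrightarrow> k m $ i \<in> \<int>"
    and Q: "\<And>t x. t \<in> {0..T} \<Longrightarrow> \<bar>partial_deriv i (u t) x - wave_flow N c \<theta> k t x\<bar> \<le> \<eta> / 4" by metis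
  have "\<forall>\<^sub>F n in sequentially. \<forall>t\<in>{0..T}. \<forall>x\<in>lat n. \<bar>heat_sg n t (wave_flow N c \<theta> k 0) x - wave_flow N c \<theta> k t x\<bar> \<le> \<eta> / 4"
    by (rule heat_sg_wave_flow_limit[OF k \<eta>4 T])
  then show ?thesis using disc_grad_limit[OF \<eta>4, of i] eventually_gt_at_top[of 0]
  proof eventually_elim
    case (elim n)
    show ?case
    proof (intro ballI)
      fix t and x :: "real ^ 'd" assume t: "t \<in> {0..T}" and x: "x \<in> lat n"
      have "\<bar>heat_sg n t (disc_grad (1 / real n) i u0) x - heat_sg n t (wave_flow N c \<theta> k 0) x\<bar> \<le> \<eta> / 2"
      proof (rule heat_sg_contraction[OF elim(3) x])
        fix y
        have "\<bar>disc_grad (1 / real n) i u0 y - partial_deriv i u0 y\<bar> \<le> \<eta> / 4" using elim(2) by blast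
        moreover have "\<bar>partial_deriv i u0 y - wave_flow N c \<theta> k 0 y\<bar> \<le> \<eta> / 4" using Q[of 0 y] T by (simp add: u_0)
        ultimately show "\<bar>disc_grad (1 / real n) i u0 y - wave_flow N c \<theta> k 0 y\<bar> \<le> \<eta> / 2" by linarith
      qed (use t in auto)
      moreover have "\<bar>heat_sg n t (wave_flow N c \<theta> k 0) x - wave_flow N c \<theta> k t x\<bar> \<le> \<eta> / 4" using elim(1) t x by blast
      ultimately show "\<bar>heat_sg n t (disc_grad (1 / real n) i u0) x - partial_deriv i (u t) x\<bar> \<le> \<eta>" using Q[OF t, of x] by linarith
    qed
  qed
qed

end

section \<open>Riemann sums and the constant of the limit\<close>

definition coord_box :: "('d::finite \<Rightarrow> real set) \<Rightarrow> (real ^ 'd) set" where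
  "coord_box B = {x. \<forall>i. x $ i \<in> B i}"

lemma coord_box_measurable:
  assumes "\<And>i. B i \<in> sets borel" shows "coord_box B \<in> sets borel"
proof -
  have [measurable]: "(\<lambda>x. x $ i) \<in> borel_measurable (borel :: (real ^ 'd) measure)" for i
    by (intro borel_measurable_continuous_onI continuous_intros)
  note assms[measurable]
  have "{x \<in> space borel. \<forall>i. x $ i \<in> B i} \<in> sets borel" by measurable
  then show ?thesis by (simp add: coord_box_def)
qed

lemma emeasure_coord_box:
  fixes B :: "'d::finite \<Rightarrow> real set"
  assumes B: "\<And>i. B i \<in> sets borel"
  shows "emeasure lborel (coord_box B) = (\<Prod>i\<in>UNIV. emeasure lborel (B i))"
proof -
  have Basis: "(Basis :: (real ^ 'd) set) = range (\<lambda>i. axis i 1)" by (auto simp: Basis_vec_def)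
  have inj: "inj (\<lambda>i::'d. axis i (1::real))" by (auto simp: inj_on_def axis_eq_axis)
  define ix where "ix = the_inv_into UNIV (\<lambda>i::'d. axis i (1::real))"
  have ix: "ix (axis i 1) = i" for i unfolding ix_def by (rule the_inv_into_f_f[OF inj UNIV_I])
  have "emeasure lborel (coord_box B) = (\<integral>\<^sup>+x. indicator (coord_box B) x \<partial>lborel)"
    using coord_box_measurable[of B] B by simp
  also have "\<dots> = (\<integral>\<^sup>+x. (\<Prod>b\<in>Basis. indicator (B (ix b)) (x \<bullet> b)) \<partial>lborel)"
  proof (rule nn_integral_cong)
    fix x :: "real ^ 'd"
    have "(\<Prod>b\<in>Basis. indicator (B (ix b)) (x \<bullet> b)) = (\<Prod>i\<in>UNIV. indicator (B i) (x $ i) :: ennreal)"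
      unfolding Basis by (simp add: prod.reindex[OF inj] ix inner_axis)
    also have "\<dots> = indicator (coord_box B) x"
    proof (cases "x \<in> coord_box B")
      case False
      then obtain i where "x $ i \<notin> B i" by (auto simp: coord_box_def)
      then have "(\<Prod>i\<in>UNIV. indicator (B i) (x $ i) :: ennreal) = 0"
        by (intro prod_zero) (auto simp: indicator_eq_0_iff)
      then show ?thesis using False by simp
    qed (simp add: coord_box_def)
    finally show "indicator (coord_box B) x = (\<Prod>b\<in>Basis. indicator (B (ix b)) (x \<bullet> b) :: ennreal)" by simp
  qed
  also have "\<dots> = (\<Prod>b\<in>Basis. \<integral>\<^sup>+t. indicator (B (ix b)) t \<partial>lborel)"
    by (rule nn_integral_lborel_prod) (use B in auto)
  also have "\<dots> = (\<Prod>i\<in>UNIV. emeasure lborel (B i))"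
    unfolding Basis using B by (simp add: prod.reindex[OF inj] ix)
  finally show ?thesis .
qed

lemma torus_cell_box: "torus_cell = coord_box (\<lambda>_. {0..<1})"
  by (auto simp: torus_cell_def coord_box_def)

lemma torus_cell_measurable: "torus_cell \<in> sets borel"
  unfolding torus_cell_box by (rule coord_box_measurable) simp

lemma emeasure_torus_cell: "emeasure lborel torus_cell = 1"
  unfolding torus_cell_box by (subst emeasure_coord_box) auto

lemma set_integrable_bounded:
  fixes f :: "'a \<Rightarrow> real"
  assumes "A \<in> sets M" "emeasure M A < \<infinity>" "f \<in> borel_measurable M" "\<And>x. x \<in> A \<Longrightarrow> \<bar>f x\<bar> \<le> B"
  shows "set_integrable M A f"
  unfolding set_integrable_def
proof (rule integrableI_bounded_set[where A = A and B = B])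
  show "AE x in M. x \<in> A \<longrightarrow> norm (indicator A x *\<^sub>R f x) \<le> B" using assms(4) by auto
  show "AE x in M. x \<notin> A \<longrightarrow> indicator A x *\<^sub>R f x = 0" by auto
qed (use assms in auto)

definition lattice_cube :: "nat \<Rightarrow> real ^ 'd::finite \<Rightarrow> (real ^ 'd) set" where
  "lattice_cube n x = coord_box (\<lambda>i. {x $ i..<x $ i + 1 / real n})"

lemma lattice_cube_measurable: "lattice_cube n x \<in> sets borel"
  unfolding lattice_cube_def by (rule coord_box_measurable) simp

lemma emeasure_lattice_cube:
  "0 < n \<Longrightarrow> emeasure lborel (lattice_cube n (x :: real ^ 'd::finite)) = ennreal (1 / real n ^ CARD('d))"
  unfolding lattice_cube_def by (subst emeasure_coord_box) (auto simp: ennreal_power power_one_over)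

lemma torus_cell_cubes:
  assumes n: "0 < n"
  shows "torus_cell = (\<Union>x\<in>lat n. lattice_cube n (x :: real ^ 'd::finite))"
    and "disjoint_family_on (lattice_cube n) (lat n :: (real ^ 'd) set)"
proof -
  \<comment> \<open>The corner of the half-open cube containing a point is determined coordinatewise
    by a floor; existence of that corner gives the covering, its uniqueness the
    disjointness.\<close>
  have fl: "y $ i \<in> {x $ i..<x $ i + 1 / real n} \<longleftrightarrow> x $ i = of_int \<lfloor>real n * y $ i\<rfloor> / real n"
    if "x \<in> lat n" for x y :: "real ^ 'd" and i
  proof -
    obtain k where k: "x $ i = real k / real n" using \<open>x \<in> lat n\<close> torus_lattice_iff[OF n] by blast
    have "y $ i \<in> {x $ i..<x $ i + 1 / real n} \<longleftrightarrow> of_int (int k) \<le> real n * y $ i \<and> real n * y $ i < of_int (int k) + 1"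
      using n by (auto simp: k field_simps)
    also have "\<dots> \<longleftrightarrow> \<lfloor>real n * y $ i\<rfloor> = int k" by (metis floor_eq_iff)
    also have "\<dots> \<longleftrightarrow> real_of_int \<lfloor>real n * y $ i\<rfloor> = real k" by linarith
    also have "\<dots> \<longleftrightarrow> x $ i = of_int \<lfloor>real n * y $ i\<rfloor> / real n" using n by (auto simp: k)
    finally show ?thesis .
  qed
  show "torus_cell = (\<Union>x\<in>lat n. lattice_cube n (x :: real ^ 'd))"
  proof (intro set_eqI iffI)
    fix y :: "real ^ 'd" assume y: "y \<in> torus_cell"
    let ?x = "(\<chi> i. of_int \<lfloor>real n * y $ i\<rfloor> / real n) :: real ^ 'd"
    have "\<exists>k<n. ?x $ i = real k / real n" for i
    proof -
      have y01: "0 \<le> y $ i" "y $ i < 1" using y by (auto simp: torus_cell_def)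
      have "0 \<le> real n * y $ i" "real n * y $ i < real n" using y01 n by auto
      then have "0 \<le> \<lfloor>real n * y $ i\<rfloor>" "\<lfloor>real n * y $ i\<rfloor> < int n" by (auto simp: floor_less_iff)
      then show ?thesis using \<open>0 \<le> real n * y $ i\<close> by (intro exI[of _ "nat \<lfloor>real n * y $ i\<rfloor>"]) (auto simp: nat_less_iff)
    qed
    then have x: "?x \<in> lat n" unfolding torus_lattice_iff[OF n] by blast
    then have "y \<in> lattice_cube n ?x" unfolding lattice_cube_def coord_box_def by (simp only: mem_Collect_eq fl) simp
    with x show "y \<in> (\<Union>x\<in>lat n. lattice_cube n x)" by blast
  next
    fix y :: "real ^ 'd" assume "y \<in> (\<Union>x\<in>lat n. lattice_cube n x)"
    then obtain x :: "real ^ 'd" where x: "x \<in> lat n" "y \<in> lattice_cube n x" by blast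
    have "0 \<le> y $ i \<and> y $ i < 1" for i
    proof -
      obtain k where k: "k < n" "x $ i = real k / real n" using x(1) torus_lattice_iff[OF n] by blast
      have "x $ i \<le> y $ i" "y $ i < x $ i + 1 / real n" using x(2) by (auto simp: lattice_cube_def coord_box_def)
      moreover have "real k / real n + 1 / real n \<le> 1" using k(1) n by (simp add: field_simps)
      moreover have "0 \<le> real k / real n" by simp
      ultimately show ?thesis unfolding k(2) by linarith
    qed
    then show "y \<in> torus_cell" by (simp add: torus_cell_def)
  qed
  show "disjoint_family_on (lattice_cube n) (lat n :: (real ^ 'd) set)"
  proof (unfold disjoint_family_on_def, intro ballI impI equals0I)
    fix x z y :: "real ^ 'd" assume A: "x \<in> lat n" "z \<in> lat n" "x \<noteq> z" "y \<in> lattice_cube n x \<inter> lattice_cube n z"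
    have "x $ i = z $ i" for i
    proof -
      have "y $ i \<in> {x $ i..<x $ i + 1 / real n}" "y $ i \<in> {z $ i..<z $ i + 1 / real n}"
        using A(4) unfolding lattice_cube_def coord_box_def by blast+
      then show ?thesis unfolding fl[OF A(1)] fl[OF A(2)] by simp
    qed
    then show False using A(3) by (simp add: vec_eq_iff)
  qed
qed

lemma riemann_sum_tendsto:
  fixes F :: "real ^ 'd::finite \<Rightarrow> real"
  assumes cont: "continuous_on UNIV F" and per: "torus_fun F"
  shows "(\<lambda>n. (\<Sum>x\<in>lat n. F x) / real n ^ CARD('d)) \<longlonglongrightarrow> (LINT x:torus_cell|lborel. F x)"
proof (rule LIMSEQ_I)
  fix \<eta> :: real assume \<eta>: "0 < \<eta>"
  have c0: "continuous_on ({0..0} \<times> UNIV) (\<lambda>(t::real, x). F x)"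
    unfolding case_prod_unfold by (rule continuous_on_compose2[OF cont]) (auto intro!: continuous_intros)
  obtain B where B: "0 \<le> B" "\<And>(t::real) x. t \<in> {0..0} \<Longrightarrow> \<bar>F x\<bar> \<le> B"
    using torus_bounded[of 0 "\<lambda>_. F", OF c0 per] by blast
  obtain \<delta> where \<delta>: "0 < \<delta>" "\<And>(s::real) t x y. s \<in> {0..0} \<Longrightarrow> t \<in> {0..0} \<Longrightarrow> \<bar>s - t\<bar> < \<delta> \<Longrightarrow> (\<And>l. \<bar>x $ l - y $ l\<bar> < \<delta>) \<Longrightarrow> \<bar>F x - F y\<bar> < \<eta> / 2"
    using torus_uniformly_continuous[of 0 "\<lambda>_. F" "\<eta> / 2", OF c0 per] \<eta> by (metis half_gt_zero)
  have F: "F \<in> borel_measurable lborel" using cont by (simp add: borel_measurable_continuous_onI)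
  obtain N where N: "0 < N" "1 / real N < \<delta>" using \<delta>(1) ex_inverse_of_nat_less[of \<delta>] by (metis inverse_eq_divide)
  have "norm ((\<Sum>x\<in>lat n. F x) / real n ^ CARD('d) - (LINT x:torus_cell|lborel. F x)) < \<eta>" if "N \<le> n" for n
  proof -
    have n: "0 < n" using N \<open>N \<le> n\<close> by simp
    have nd: "1 / real n < \<delta>" using N \<open>N \<le> n\<close> by (smt (verit) frac_le of_nat_0_less_iff of_nat_le_iff)
    have fin: "emeasure lborel (lattice_cube n x) < \<infinity>" for x :: "real ^ 'd" using n by (simp add: emeasure_lattice_cube)
    have int: "set_integrable lborel (lattice_cube n x) F" for x
      using lattice_cube_measurable[of n x] fin F B(2)[of 0] by (intro set_integrable_bounded[where B = B]) auto
    have intc: "set_integrable lborel (lattice_cube n x) (\<lambda>_. c)" for x :: "real ^ 'd" and c :: real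
      using lattice_cube_measurable[of n x] fin by (intro set_integrable_bounded[where B = "\<bar>c\<bar>"]) auto
    have lc: "(LINT y:lattice_cube n x|lborel. c) = c / real n ^ CARD('d)" for x :: "real ^ 'd" and c :: real
      using lattice_cube_measurable[of n x] fin[of x] emeasure_lattice_cube[OF n, of x]
      by (subst set_integral_const) (auto simp: measure_def)
    have "(LINT x:torus_cell|lborel. F x) = (\<Sum>x\<in>lat n. LINT y:lattice_cube n x|lborel. F y)"
      unfolding torus_cell_cubes(1)[OF n]
      by (rule set_integral_finite_Union[OF finite_lattice[OF n] torus_cell_cubes(2)[OF n]])
         (use int lattice_cube_measurable in auto)
    then have "(\<Sum>x\<in>lat n. F x) / real n ^ CARD('d) - (LINT x:torus_cell|lborel. F x)
      = (\<Sum>x\<in>lat n. (LINT y:lattice_cube n x|lborel. F x) - (LINT y:lattice_cube n x|lborel. F y))"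
      by (simp add: lc sum_subtractf sum_divide_distrib)
    also have "\<dots> = (\<Sum>x\<in>lat n. LINT y:lattice_cube n x|lborel. F x - F y)"
      by (intro sum.cong refl set_integral_diff(2)[symmetric] int intc)
    also have "norm \<dots> \<le> (\<Sum>x\<in>(lat n :: (real ^ 'd) set). \<eta> / 2 / real n ^ CARD('d))"
    proof (rule order_trans[OF norm_sum], rule sum_mono)
      fix x :: "real ^ 'd" assume x: "x \<in> lat n"
      have le: "\<bar>F x - F y\<bar> \<le> \<eta> / 2" if y: "y \<in> lattice_cube n x" for y
      proof -
        have "\<bar>x $ l - y $ l\<bar> < \<delta>" for l
        proof -
          have "x $ l \<le> y $ l" "y $ l < x $ l + 1 / real n" using y by (auto simp: lattice_cube_def coord_box_def)
          then show ?thesis using nd by linarith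
        qed
        then show ?thesis using \<delta>(2)[of 0 0 x y] \<delta>(1) by simp
      qed
      have "norm (LINT y:lattice_cube n x|lborel. F x - F y) \<le> (LINT y:lattice_cube n x|lborel. \<eta> / 2)"
        using le by (intro set_integral_norm_bound[THEN order_trans] set_integral_mono set_integrable_norm set_integral_diff(1) int intc) auto
      then show "norm (LINT y:lattice_cube n x|lborel. F x - F y) \<le> \<eta> / 2 / real n ^ CARD('d)" by (simp add: lc)
    qed
    also have "\<dots> = \<eta> / 2" using n by (simp add: card_lattice)
    finally show ?thesis using \<eta> by simp
  qed
  then show "\<exists>N. \<forall>n\<ge>N. norm ((\<Sum>x\<in>lat n. F x) / real n ^ CARD('d) - (LINT x:torus_cell|lborel. F x)) < \<eta>" by blast
qed

section \<open>The mass matrix of the limiting kernel and the constant a\<close>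

lemma psi_continuous: "continuous_on A psi"
  unfolding psi_def by (intro continuous_intros)

lemma psi_component_continuous: "continuous_on A (\<lambda>x :: real ^ 'd::finite. psi (x $ i))"
  unfolding psi_def by (intro continuous_intros)

text \<open>Where the denominator vanishes, the ratio is squeezed between 0 and the numerator factor
  \<psi>_i, which tends to 0. The default value of a division by zero is thus the continuous
  extension.\<close>

lemma freq_ratio_continuous: "continuous_on UNIV (freq_ratio i j :: real ^ 'd::finite \<Rightarrow> real)"
proof (rule continuous_at_imp_continuous_on, rule ballI)
  fix \<kappa> :: "real ^ 'd"
  have c: "isCont (\<lambda>x :: real ^ 'd. psi (x $ l)) \<kappa>" for l
    using psi_component_continuous[of UNIV l] by (simp add: continuous_on_eq_continuous_at)
  show "isCont (freq_ratio i j) \<kappa>"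
  proof (cases "(\<Sum>l\<in>UNIV. psi (\<kappa> $ l)) = 0")
    case False
    then show ?thesis unfolding freq_ratio_def by (intro continuous_divide continuous_mult continuous_sum c) auto
  next
    case True
    have "psi (\<kappa> $ i) = 0" using psi_le_sum[of \<kappa> i] psi_nonneg[of "\<kappa> $ i"] True by simp
    then have "((\<lambda>x. psi (x $ i)) \<longlongrightarrow> 0) (at \<kappa>)" using c[of i] by (simp add: isCont_def)
    then have "((\<lambda>x. freq_ratio i j x) \<longlongrightarrow> 0) (at \<kappa>)"
      by (rule tendsto_sandwich[where f = "\<lambda>_. 0" and h = "\<lambda>x. psi (x $ i)", rotated 3])
         (intro always_eventually allI freq_ratio_nonneg freq_ratio_le tendsto_const)+
    moreover have "freq_ratio i j \<kappa> = 0" using True by (simp add: freq_ratio_def)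
    ultimately show ?thesis by (simp add: isCont_def)
  qed
qed

lemma torus_fun_freq_ratio: "torus_fun (freq_ratio i j :: real ^ 'd::finite \<Rightarrow> real)"
proof -
  have "psi ((x + axis k 1) $ l) = psi (x $ l)" for x :: "real ^ 'd" and k l
    using psi_of_int[of "x $ l" 1] by (cases "l = k") (simp_all add: axis_def)
  then show ?thesis unfolding torus_fun_def freq_ratio_def by (simp del: vector_add_component)
qed

definition mean_ratio :: "'d::finite \<Rightarrow> 'd \<Rightarrow> real" where
  "mean_ratio i j = (LINT x:torus_cell|lborel. freq_ratio i j x)"

lemma kernel_tail_tendsto: "(\<lambda>n. kernel_tail n i j 0) \<longlonglongrightarrow> mean_ratio i (j :: 'd::finite) / 2"
proof -
  have "kernel_tail n i j 0 = (\<Sum>x\<in>lat n. freq_ratio i j x) / real n ^ CARD('d) / 2" for n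
    by (simp add: kernel_tail_def)
  then show ?thesis unfolding mean_ratio_def
    using tendsto_divide[OF riemann_sum_tendsto[OF freq_ratio_continuous torus_fun_freq_ratio] tendsto_const, of 2 i j] by simp
qed

text \<open>Passage to the limit in the lattice identity for the total mass, valid from n = 2
  on.\<close>

lemma sum_mean_ratio: "(\<Sum>j\<in>UNIV. mean_ratio i (j :: 'd::finite)) = 1"
proof -
  have "(\<lambda>n. \<Sum>j\<in>UNIV. kernel_tail n i (j :: 'd) 0) \<longlonglongrightarrow> (\<Sum>j\<in>UNIV. mean_ratio i j / 2)"
    by (intro tendsto_sum kernel_tail_tendsto)
  moreover have "(\<lambda>n. \<Sum>j\<in>UNIV. kernel_tail n i (j :: 'd) 0) \<longlonglongrightarrow> 1 / 2"
    by (rule tendsto_eventually[OF eventually_sequentiallyI[of 2]]) (rule sum_kernel_tail_0)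
  ultimately have "(\<Sum>j\<in>UNIV. mean_ratio i j / 2) = 1 / 2" by (rule LIMSEQ_unique)
  then show ?thesis by (simp add: sum_divide_distrib[symmetric])
qed

lemma mean_ratio_nonneg: "0 \<le> mean_ratio i j"
proof (rule LIMSEQ_le_const[of "\<lambda>n. 2 * kernel_tail n i j 0"])
  show "(\<lambda>n. 2 * kernel_tail n i j 0) \<longlonglongrightarrow> mean_ratio i j"
    using tendsto_mult[OF tendsto_const[of 2] kernel_tail_tendsto[of i j]] by simp
qed (auto intro!: exI[of _ 0] kernel_tail_nonneg)

lemma freq_ratio_integrable: "set_integrable lborel torus_cell (freq_ratio i j)"
proof (rule set_integrable_bounded)
  show "freq_ratio i j \<in> borel_measurable lborel"
    using freq_ratio_continuous[of i j] by (simp add: borel_measurable_continuous_onI)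
  show "\<bar>freq_ratio i j x\<bar> \<le> 2" for x
    using freq_ratio_nonneg[of i j x] freq_ratio_le[of i j x] psi_le_2[of "x $ i"] by linarith
qed (use torus_cell_measurable in \<open>auto simp: emeasure_torus_cell\<close>)

text \<open>Compares off-diagonal and diagonal masses. With the row sums this bounds d J by 1, from
  which the positivity of a follows.\<close>

lemma mean_ratio_am_gm: "2 * mean_ratio i j \<le> mean_ratio i i + mean_ratio j j"
proof -
  have *: "2 * freq_ratio i j x \<le> freq_ratio i i x + freq_ratio j j x" for x
  proof -
    have "2 * (psi (x $ i) * psi (x $ j)) \<le> psi (x $ i) * psi (x $ i) + psi (x $ j) * psi (x $ j)"
      using sum_squares_bound[of "psi (x $ i)" "psi (x $ j)"] by (simp add: power2_eq_square mult.assoc)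
    then have "2 * (psi (x $ i) * psi (x $ j)) / (\<Sum>l\<in>UNIV. psi (x $ l)) \<le>
        (psi (x $ i) * psi (x $ i) + psi (x $ j) * psi (x $ j)) / (\<Sum>l\<in>UNIV. psi (x $ l))"
      by (intro divide_right_mono sum_nonneg psi_nonneg)
    then show ?thesis by (simp add: freq_ratio_def add_divide_distrib)
  qed
  have "(LINT x:torus_cell|lborel. 2 * freq_ratio i j x) \<le> (LINT x:torus_cell|lborel. freq_ratio i i x + freq_ratio j j x)"
    by (intro set_integral_mono set_integral_add(1) set_integrable_mult_right freq_ratio_integrable *)
  then show ?thesis by (simp add: mean_ratio_def set_integral_add(2)[OF freq_ratio_integrable freq_ratio_integrable])
qed

lemma component_borel_measurable: "(\<lambda>x :: real ^ 'd::finite. x $ i) \<in> borel_measurable borel"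
  by (intro borel_measurable_continuous_onI continuous_intros)

lemma card_neq_1_obtains:
  assumes "CARD('d::finite) \<noteq> 1"
  obtains i j :: "'d::finite" where "i \<noteq> j"
proof -
  have "\<exists>i j :: 'd. i \<noteq> j"
  proof (rule ccontr)
    assume "\<nexists>i j :: 'd. i \<noteq> j"
    then have "UNIV = {undefined :: 'd}" by auto
    then show False using assms by (metis card_1_singleton_iff One_nat_def)
  qed
  then show ?thesis using that by blast
qed

text \<open>Bridges two models of the unit cube: \<open>J_const\<close> integrates over a product
  indexed by numbers, the torus is indexed by the type of directions. A product measure is
  determined by boxes, and both sides give a box the product of its side measures.\<close>

lemma distr_lborel_coordinates:
  fixes \<sigma> :: "nat \<Rightarrow> 'd::finite"
  assumes \<sigma>: "bij_betw \<sigma> I UNIV" and I: "finite I"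
  shows "distr lborel (\<Pi>\<^sub>M k\<in>I. lborel) (\<lambda>x :: real ^ 'd. \<lambda>k\<in>I. x $ \<sigma> k) = (\<Pi>\<^sub>M k\<in>I. (lborel :: real measure))" (is "distr _ ?P ?\<phi> = _")
proof -
  interpret product_sigma_finite "\<lambda>_ :: nat. lborel :: real measure" by standard
  have \<phi>: "?\<phi> \<in> measurable lborel ?P" by (rule measurable_restrict) (simp add: component_borel_measurable)
  show ?thesis
  proof (rule PiM_eqI[OF I])
    fix A :: "nat \<Rightarrow> real set" assume A: "\<And>k. k \<in> I \<Longrightarrow> A k \<in> sets lborel"
    define \<tau> where "\<tau> = the_inv_into I \<sigma>"
    have \<tau>: "\<tau> (\<sigma> k) = k" if "k \<in> I" for k
      unfolding \<tau>_def using \<sigma> that by (auto simp: bij_betw_def intro: the_inv_into_f_f)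
    have \<sigma>': "inj_on \<sigma> I" "i \<in> \<sigma> ` I" for i using \<sigma> by (auto simp: bij_betw_def)
    have \<tau>I: "\<tau> i \<in> I" "\<sigma> (\<tau> i) = i" for i
      unfolding \<tau>_def using the_inv_into_into[OF \<sigma>' order_refl, of i] f_the_inv_into_f[OF \<sigma>', of i] by auto
    have "emeasure (distr lborel ?P ?\<phi>) (Pi\<^sub>E I A) = emeasure lborel (?\<phi> -` (Pi\<^sub>E I A) \<inter> space lborel)"
      by (rule emeasure_distr[OF \<phi>]) (use A in \<open>auto intro: sets_PiM_I_finite[OF I]\<close>)
    also have "?\<phi> -` (Pi\<^sub>E I A) \<inter> space lborel = coord_box (\<lambda>i. A (\<tau> i))"
    proof (intro set_eqI iffI)
      fix x assume "x \<in> ?\<phi> -` (Pi\<^sub>E I A) \<inter> space lborel"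
      then have "x $ \<sigma> k \<in> A k" if "k \<in> I" for k using that by auto
      then have "x $ \<sigma> (\<tau> i) \<in> A (\<tau> i)" for i using \<tau>I(1) by blast
      then show "x \<in> coord_box (\<lambda>i. A (\<tau> i))" by (simp add: coord_box_def \<tau>I(2))
    next
      fix x assume "x \<in> coord_box (\<lambda>i. A (\<tau> i))"
      then have x: "x $ i \<in> A (\<tau> i)" for i by (simp add: coord_box_def)
      have "x $ \<sigma> k \<in> A k" if "k \<in> I" for k using x[of "\<sigma> k"] \<tau>[OF that] by simp
      then show "x \<in> ?\<phi> -` (Pi\<^sub>E I A) \<inter> space lborel" by auto
    qed
    also have "emeasure lborel (coord_box (\<lambda>i. A (\<tau> i))) = (\<Prod>i\<in>UNIV. emeasure lborel (A (\<tau> i)))"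
      by (rule emeasure_coord_box) (use A[OF \<tau>I(1)] in simp)
    also have "\<dots> = (\<Prod>k\<in>I. emeasure lborel (A k))"
      by (subst prod.reindex_bij_betw[OF \<sigma>, symmetric]) (simp add: \<tau>)
    finally show "emeasure (distr lborel ?P ?\<phi>) (Pi\<^sub>E I A) = (\<Prod>k\<in>I. emeasure lborel (A k))" .
  qed simp
qed

text \<open>The integral is invariant under relabelling of the coordinates, so the directions may be
  enumerated with \<open>i\<close> first and \<open>j\<close> second.\<close>

lemma mean_ratio_off_diag:
  fixes i j :: "'d::finite"
  assumes ij: "i \<noteq> j"
  shows "mean_ratio i j = J_const CARD('d)"
proof -
  let ?I = "{1..CARD('d)}"
  let ?P = "\<Pi>\<^sub>M k\<in>?I. (lborel :: real measure)"
  have "card {i, j} \<le> CARD('d)" by (rule card_mono) auto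
  then have d: "2 \<le> CARD('d)" using ij by simp
  obtain \<sigma> :: "nat \<Rightarrow> 'd" where \<sigma>: "bij_betw \<sigma> ?I UNIV" "\<sigma> 1 = i" "\<sigma> 2 = j"
  proof -
    obtain \<tau> :: "nat \<Rightarrow> 'd" where \<tau>: "bij_betw \<tau> ?I UNIV"
      using ex_bij_betw_nat_finite_1[of "UNIV :: 'd set"] by auto
    have "(1::nat) \<in> ?I" "(2::nat) \<in> ?I" using d by auto
    then have "\<tau> 1 \<noteq> \<tau> 2" using inj_onD[OF bij_betw_imp_inj_on[OF \<tau>], of 1 2] by auto
    \<comment> \<open>Two transpositions adjust an arbitrary enumeration. The second one exchanges
      the direction at position 2 with \<open>j\<close>, both different from \<open>i\<close>, and
      so leaves position 1 alone.\<close>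
    define \<tau>' where "\<tau>' = Transposition.transpose (\<tau> 1) i \<circ> \<tau>"
    have \<tau>': "bij_betw \<tau>' ?I UNIV" unfolding \<tau>'_def by (rule bij_betw_trans[OF \<tau> bij_transpose])
    have t1: "\<tau>' 1 = i" by (simp add: \<tau>'_def)
    have t2: "\<tau>' 2 \<noteq> i" using \<open>\<tau> 1 \<noteq> \<tau> 2\<close> by (auto simp: \<tau>'_def Transposition.transpose_def)
    show ?thesis
    proof (rule that)
      show "bij_betw (Transposition.transpose (\<tau>' 2) j \<circ> \<tau>') ?I UNIV" by (rule bij_betw_trans[OF \<tau>' bij_transpose])
      show "(Transposition.transpose (\<tau>' 2) j \<circ> \<tau>') 1 = i" using t1 t2 ij by (simp add: Transposition.transpose_def)
      show "(Transposition.transpose (\<tau>' 2) j \<circ> \<tau>') 2 = j" by simp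
    qed
  qed
  let ?\<phi> = "\<lambda>x :: real ^ 'd. \<lambda>k\<in>?I. x $ \<sigma> k"
  let ?F = "\<lambda>x. psi (x 1) * psi (x 2) / (\<Sum>k\<in>?I. psi (x k))"
  let ?G = "\<lambda>x. indicator (\<Pi>\<^sub>E k\<in>?I. {0..<1}) x *\<^sub>R ?F x :: real"
  have \<phi>: "?\<phi> \<in> measurable lborel ?P" by (rule measurable_restrict) (simp add: component_borel_measurable)
  have psi_k: "(\<lambda>x. psi (x k)) \<in> borel_measurable ?P" if "k \<in> ?I" for k
  proof -
    have 1: "(\<lambda>x. x k) \<in> measurable ?P lborel" by (rule measurable_component_singleton[OF that])
    have 2: "psi \<in> borel_measurable lborel" using psi_continuous[of UNIV] by (simp add: borel_measurable_continuous_onI)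
    show ?thesis by (rule measurable_compose[OF 1 2])
  qed
  have "?F \<in> borel_measurable ?P"
    by (intro borel_measurable_divide borel_measurable_times borel_measurable_sum psi_k) (use d in auto)
  moreover have "(\<Pi>\<^sub>E k\<in>?I. {0..<1}) \<in> sets ?P" by (rule sets_PiM_I_finite) auto
  ultimately have G: "?G \<in> borel_measurable ?P" by (intro borel_measurable_scaleR borel_measurable_indicator)
  have "J_const CARD('d) = (LINT x|?P. ?G x)" by (simp add: J_const_def set_lebesgue_integral_def)
  also have "\<dots> = (LINT x|distr lborel ?P ?\<phi>. ?G x)"
    unfolding distr_lborel_coordinates[OF \<sigma>(1) finite_atLeastAtMost] by (rule refl)
  also have "\<dots> = (LINT y|lborel. ?G (?\<phi> y))" by (rule integral_distr[OF \<phi> G])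
  also have "\<dots> = (LINT y|lborel. indicator torus_cell y *\<^sub>R freq_ratio i j y)"
  proof (rule Bochner_Integration.integral_cong[OF refl])
    fix y :: "real ^ 'd"
    have "(\<Sum>k\<in>?I. psi (?\<phi> y k)) = (\<Sum>l\<in>UNIV. psi (y $ l))"
      by (subst sum.reindex_bij_betw[OF \<sigma>(1), symmetric]) simp
    moreover have "?\<phi> y 1 = y $ i" "?\<phi> y 2 = y $ j" using d \<sigma> by auto
    ultimately have "?F (?\<phi> y) = freq_ratio i j y" by (simp only: freq_ratio_def)
    moreover have "?\<phi> y \<in> (\<Pi>\<^sub>E k\<in>?I. {0..<1}) \<longleftrightarrow> y \<in> torus_cell"
    proof -
      have "?\<phi> y \<in> (\<Pi>\<^sub>E k\<in>?I. {0..<1}) \<longleftrightarrow> (\<forall>k\<in>?I. y $ \<sigma> k \<in> {0..<1})" by (auto simp: PiE_iff)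
      also have "\<dots> \<longleftrightarrow> (\<forall>l\<in>\<sigma> ` ?I. y $ l \<in> {0..<1})" by blast
      also have "\<dots> \<longleftrightarrow> y \<in> torus_cell" using \<sigma>(1) by (simp add: bij_betw_def torus_cell_def)
      finally show ?thesis .
    qed
    ultimately show "?G (?\<phi> y) = indicator torus_cell y *\<^sub>R freq_ratio i j y" by (simp only: indicator_def)
  qed
  finally show ?thesis by (simp add: mean_ratio_def set_lebesgue_integral_def)
qed

text \<open>All off-diagonal masses equal J and every row sums to 1, which fixes the diagonal as 1 -
  (d - 1) J. The comparison J \<le> 1 - (d - 1) J then says d J \<le> 1.\<close>

lemma J_const_bounds:
  fixes i j :: "'d::finite"
  assumes ij: "i \<noteq> j"
  shows "0 \<le> J_const CARD('d)" "real CARD('d) * J_const CARD('d) \<le> 1"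
    and "mean_ratio i i = 1 - (real CARD('d) - 1) * J_const CARD('d)"
proof -
  have diag: "mean_ratio k k = 1 - (real CARD('d) - 1) * J_const CARD('d)" for k :: 'd
  proof -
    have "(\<Sum>j\<in>UNIV. mean_ratio k j) = mean_ratio k k + (\<Sum>j\<in>UNIV - {k}. mean_ratio k j)"
      by (simp add: sum.remove)
    also have "(\<Sum>j\<in>UNIV - {k}. mean_ratio k j) = (\<Sum>j\<in>UNIV - {k}. J_const CARD('d))"
      by (intro sum.cong refl mean_ratio_off_diag) auto
    finally show ?thesis using sum_mean_ratio[of k] by (simp add: card_Diff_singleton of_nat_diff Suc_leI)
  qed
  show "0 \<le> J_const CARD('d)" using mean_ratio_nonneg[of i j] mean_ratio_off_diag[OF ij] by simp
  show "mean_ratio i i = 1 - (real CARD('d) - 1) * J_const CARD('d)" by (rule diag)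
  show "real CARD('d) * J_const CARD('d) \<le> 1"
    using mean_ratio_am_gm[of i j] unfolding mean_ratio_off_diag[OF ij] diag by (simp add: algebra_simps)
qed

definition energy_coef :: "'d::finite \<Rightarrow> 'd \<Rightarrow> real" where
  "energy_coef i j = (if i = j then 1 + a_const CARD('d) else (1 - a_const CARD('d)) / (real CARD('d) - 1))"

text \<open>The numerator is (1 - d J) + 2 J with both parts nonnegative, and they cannot vanish
  together. It exceeds neither 1 nor the denominator because d \<ge> 2 and J \<ge> 0.\<close>

lemma a_const_bounds: "a_const CARD('d::finite) \<in> {0<..1}"
proof (cases "CARD('d) = 1")
  case False
  then obtain i j :: 'd where ij: "i \<noteq> j" by (rule card_neq_1_obtains)
  have d: "2 \<le> real CARD('d)"
    using False zero_less_card_finite[where 'a = 'd] by linarith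
  let ?d = "real CARD('d)" and ?J = "J_const CARD('d)"
  note J = J_const_bounds(1,2)[OF ij]
  have dJ: "0 \<le> ?d * ?J" using J(1) by simp
  have "(?d - 2) * ?J = ?d * ?J - 2 * ?J" by (simp add: algebra_simps)
  moreover have "0 < 1 - ?d * ?J + 2 * ?J"
  proof (cases "?J = 0")
    case False
    then show ?thesis using J by linarith
  qed simp
  moreover have "0 \<le> (?d - 2) * ?J" using d J(1) by simp
  ultimately have "0 < 1 - (?d - 2) * ?J" "1 - (?d - 2) * ?J \<le> 1 + ?d * ?J" using dJ J(1) by linarith+
  then show ?thesis using False dJ by (simp add: a_const_def divide_le_eq)
qed (simp add: a_const_def)

text \<open>The coefficients of the limit solve the fixed-point equation of the renewal kernel.\<close>

lemma energy_coef_eq: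
  "energy_coef i j = (if i = j then 1 else 0) + (\<Sum>k\<in>UNIV. mean_ratio i k / 2 * energy_coef k (j :: 'd::finite))"
proof (cases "CARD('d) = 1")
  case True
  then obtain c :: 'd where c: "UNIV = {c}" by (rule card_1_singletonE)
  then have ij: "i = c" "j = c" by auto
  have "mean_ratio c c = 1" using sum_mean_ratio[of c] unfolding c by simp
  then show ?thesis using True by (simp add: ij c energy_coef_def a_const_def)
next
  case False
  then obtain k l :: 'd where kl: "k \<noteq> l" by (rule card_neq_1_obtains)
  have d: "2 \<le> real CARD('d)"
    using False zero_less_card_finite[where 'a = 'd] by linarith
  define d where "d = real CARD('d)"
  define J where "J = J_const CARD('d)"
  define p where "p = 1 + a_const CARD('d)"
  define q where "q = (1 - a_const CARD('d)) / (d - 1)"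
  have d2: "2 \<le> d" using d by (simp add: d_def)
  have J0: "0 \<le> J" using J_const_bounds(1)[OF kl] by (simp add: J_def)
  have den: "1 + d * J \<noteq> 0" "d - 1 \<noteq> 0" using d2 J0 by (auto simp: add_nonneg_eq_0_iff)
  have a: "a_const CARD('d) = (1 - (d - 2) * J) / (1 + d * J)" using False by (simp add: a_const_def d_def J_def)
  \<comment> \<open>The mass matrix is (1 - d J) times the identity plus J times the all-ones
    matrix. Hence the inverse of the identity minus half of it is 2 / (1 + d J) times the identity
    plus J times all-ones; \<open>p\<close> and \<open>q\<close> are its diagonal and off-diagonal
    entries.\<close>
  have p: "p = (2 + 2 * J) / (1 + d * J)" unfolding p_def a using den by (simp add: field_simps)
  have q: "q = 2 * J / (1 + d * J)"
  proof -
    have "1 - a_const CARD('d) = (d - 1) * (2 * J) / (1 + d * J)" unfolding a using den by (simp add: field_simps)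
    then show ?thesis unfolding q_def using den by simp
  qed
  have off: "mean_ratio i k = (if k = i then 1 - (d - 1) * J else J)" for k
  proof (cases "k = i")
    case True
    obtain m :: 'd where "i \<noteq> m" using kl by metis
    then show ?thesis using True J_const_bounds(3)[of i m] by (simp add: d_def J_def)
  next
    case False
    then show ?thesis using mean_ratio_off_diag[of i k] by (simp add: J_def)
  qed
  have coef: "energy_coef k j = q + (if k = j then p - q else 0)" for k
    by (simp add: energy_coef_def p_def q_def d_def)
  have "(\<Sum>k\<in>UNIV. mean_ratio i k / 2 * energy_coef k j)
      = (\<Sum>k\<in>UNIV. mean_ratio i k / 2 * q) + (\<Sum>k\<in>UNIV. if k = j then mean_ratio i k / 2 * (p - q) else 0)"
    unfolding coef sum.distrib[symmetric] by (intro sum.cong refl) (simp add: algebra_simps)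
  also have "\<dots> = q / 2 + mean_ratio i j / 2 * (p - q)"
    using sum_mean_ratio[of i] by (simp add: sum_distrib_right[symmetric] sum_divide_distrib[symmetric])
  finally have S: "(\<Sum>k\<in>UNIV. mean_ratio i k / 2 * energy_coef k j) = q / 2 + mean_ratio i j / 2 * (p - q)" .
  have pq: "p - q = 2 / (1 + d * J)" unfolding p q by (simp add: diff_divide_distrib[symmetric])
  show ?thesis
  proof (cases "i = j")
    case True
    define Z W where "Z = 1 + d * J" and "W = 1 - (d - 1) * J"
    have "2 + 2 * J = Z + J + W" by (simp add: Z_def W_def algebra_simps)
    then have "p = (Z + J + W) / Z" unfolding p Z_def[symmetric] by simp
    also have "\<dots> = 1 + (2 * J / Z / 2 + W / 2 * (2 / Z))"
      using den(1) by (simp add: Z_def[symmetric] add_divide_distrib)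
    finally have "p = 1 + (q / 2 + (1 - (d - 1) * J) / 2 * (p - q))" unfolding pq unfolding q Z_def W_def .
    then show ?thesis unfolding S unfolding off coef using True by simp
  next
    case False
    have "2 * J / Z = 2 * J / Z / 2 + J / 2 * (2 / Z)" for Z :: real by simp
    then have "q = q / 2 + J / 2 * (p - q)" unfolding pq unfolding q .
    then show ?thesis unfolding S unfolding off coef using False by simp
  qed
qed

section \<open>Convergence of the integrated energies\<close>

lemma continuous_on_space_slice:
  assumes "continuous_on (S \<times> UNIV) (\<lambda>(t, x). f t x)" "t \<in> S"
  shows "continuous_on UNIV (f t)"
proof -
  have "continuous_on UNIV (\<lambda>x. (t, x))" by (intro continuous_intros)
  from continuous_on_compose2[OF assms(1) this] show ?thesis using assms(2) by auto
qed

lemma continuous_on_time_slice: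
  assumes "continuous_on (S \<times> UNIV) (\<lambda>(t, x). f t x)"
  shows "continuous_on S (\<lambda>t. f t x)"
proof -
  have "continuous_on S (\<lambda>t. (t, x))" by (intro continuous_intros)
  from continuous_on_compose2[OF assms this] show ?thesis by auto
qed

lemma set_integral_sum:
  fixes f :: "'i \<Rightarrow> 'a \<Rightarrow> real"
  assumes "\<And>j. j \<in> I \<Longrightarrow> set_integrable M A (f j)"
  shows "(LINT x:A|M. \<Sum>j\<in>I. f j x) = (\<Sum>j\<in>I. LINT x:A|M. f j x)"
  using assms unfolding set_lebesgue_integral_def set_integrable_def by (simp only: scaleR_sum_right Bochner_Integration.integral_sum)

lemma torus_integral_continuous:
  fixes f :: "real \<Rightarrow> real ^ 'd::finite \<Rightarrow> real"
  assumes cont: "continuous_on ({0..T} \<times> UNIV) (\<lambda>(t, x). f t x)" and per: "\<And>t. t \<in> {0..T} \<Longrightarrow> torus_fun (f t)"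
  shows "continuous_on {0..T} (\<lambda>t. LINT x:torus_cell|lborel. f t x)"
    and "\<And>t. t \<in> {0..T} \<Longrightarrow> set_integrable lborel torus_cell (f t)"
proof -
  obtain B where B: "\<And>t x. t \<in> {0..T} \<Longrightarrow> \<bar>f t x\<bar> \<le> B" using torus_bounded[OF cont per] by blast
  show int: "set_integrable lborel torus_cell (f t)" if t: "t \<in> {0..T}" for t
  proof (rule set_integrable_bounded)
    have "continuous_on UNIV (f t)" by (rule continuous_on_space_slice[OF cont t])
    then show "f t \<in> borel_measurable lborel" by (simp add: borel_measurable_continuous_onI)
  qed (use torus_cell_measurable B[OF t] in \<open>auto simp: emeasure_torus_cell\<close>)
  show "continuous_on {0..T} (\<lambda>t. LINT x:torus_cell|lborel. f t x)"
    unfolding continuous_on_iff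
  proof (intro ballI allI impI)
    fix t \<eta> :: real assume t: "t \<in> {0..T}" and \<eta>: "0 < \<eta>"
    then have \<eta>2: "0 < \<eta> / 2" by simp
    obtain \<delta> where \<delta>: "0 < \<delta>" "\<And>s t x y. s \<in> {0..T} \<Longrightarrow> t \<in> {0..T} \<Longrightarrow> \<bar>s - t\<bar> < \<delta> \<Longrightarrow> (\<And>l. \<bar>x $ l - y $ l\<bar> < \<delta>) \<Longrightarrow> \<bar>f s x - f t y\<bar> < \<eta> / 2"
      using torus_uniformly_continuous[OF cont per \<eta>2] by blast
    have "dist (LINT x:torus_cell|lborel. f s x) (LINT x:torus_cell|lborel. f t x) < \<eta>" if s: "s \<in> {0..T}" "dist s t < \<delta>" for s
    proof -
      have c: "set_integrable lborel torus_cell (\<lambda>_ :: real ^ 'd. \<eta> / 2)"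
        by (rule set_integrable_bounded[where B = "\<eta> / 2"]) (use torus_cell_measurable \<eta> in \<open>auto simp: emeasure_torus_cell\<close>)
      have le: "norm (f s x - f t x) \<le> \<eta> / 2" for x
        using \<delta>(2)[OF s(1) t, of x x] s(2) \<delta>(1) by (simp add: dist_real_def)
      have "norm (LINT x:torus_cell|lborel. f s x - f t x) \<le> (LINT x:torus_cell|lborel. norm (f s x - f t x))"
        by (intro set_integral_norm_bound set_integral_diff(1) int s t)
      also have "\<dots> \<le> (LINT x:(torus_cell :: (real ^ 'd) set)|lborel. \<eta> / 2)"
        by (intro set_integral_mono set_integrable_norm set_integral_diff(1) int s t c le)
      also have "\<dots> = \<eta> / 2"
        using torus_cell_measurable emeasure_torus_cell[where 'a = 'd] by (subst set_integral_const) (auto simp: measure_def)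
      finally show ?thesis
        using \<eta> by (simp add: dist_real_def set_integral_diff(2)[OF int[OF s(1)] int[OF t]])
    qed
    then show "\<exists>d>0. \<forall>s\<in>{0..T}. dist s t < d \<longrightarrow> dist (LINT x:torus_cell|lborel. f s x) (LINT x:torus_cell|lborel. f t x) < \<eta>"
      using \<delta>(1) by blast
  qed
qed

context
  fixes u0 :: "real ^ 'd::finite \<Rightarrow> real" and u :: "real \<Rightarrow> real ^ 'd \<Rightarrow> real"
    and g :: "'d \<Rightarrow> real \<Rightarrow> real ^ 'd \<Rightarrow> real" and T :: real
  assumes sol: "heat_solution u0 u" and per: "torus_fun u0" and C2: "C2_fun u0" and T: "0 < T"
    and g_cont: "\<And>i. continuous_on ({0..} \<times> UNIV) (\<lambda>(s, x). g i s x)"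
    and g_per: "\<And>i s. 0 \<le> s \<Longrightarrow> torus_fun (g i s)"
begin

definition limit_energy :: "'d \<Rightarrow> real \<Rightarrow> real ^ 'd \<Rightarrow> real" where
  "limit_energy i t x = (\<Sum>j\<in>UNIV. energy_coef i j * (partial_deriv j (u t) x)\<^sup>2)"

lemma gradient_continuous': "continuous_on ({0..T} \<times> UNIV) (\<lambda>(t, x). partial_deriv j (u t) x)"
  by (rule gradient_continuous[OF sol per C2 less_imp_le[OF T]])

lemma gradient_periodic': "0 \<le> t \<Longrightarrow> torus_fun (partial_deriv j (u t))"
  by (rule gradient_periodic[OF sol per C2 less_imp_le[OF T]])

lemma limit_energy_continuous: "continuous_on ({0..T} \<times> UNIV) (\<lambda>(t, x). limit_energy i t x)"
  using gradient_continuous' unfolding limit_energy_def case_prod_unfold by (intro continuous_intros)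

lemma limit_energy_periodic: "0 \<le> t \<Longrightarrow> torus_fun (limit_energy i t)"
  using gradient_periodic'[of t] unfolding torus_fun_def limit_energy_def by simp

lemma limit_energy_eq:
  "limit_energy i t x = (partial_deriv i (u t) x)\<^sup>2 + (\<Sum>j\<in>UNIV. mean_ratio i j / 2 * limit_energy j t x)"
proof -
  let ?p = "\<lambda>j. (partial_deriv j (u t) x)\<^sup>2"
  have "limit_energy i t x = (\<Sum>j\<in>UNIV. (if i = j then ?p j else 0) + (\<Sum>k\<in>UNIV. mean_ratio i k / 2 * (energy_coef k j * ?p j)))"
    unfolding limit_energy_def
  proof (rule sum.cong[OF refl])
    fix j
    show "energy_coef i j * ?p j = (if i = j then ?p j else 0) + (\<Sum>k\<in>UNIV. mean_ratio i k / 2 * (energy_coef k j * ?p j))"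
      by (subst energy_coef_eq) (simp add: distrib_right sum_distrib_right mult.assoc)
  qed
  also have "\<dots> = ?p i + (\<Sum>j\<in>UNIV. \<Sum>k\<in>UNIV. mean_ratio i k / 2 * (energy_coef k j * ?p j))"
    by (simp add: sum.distrib)
  also have "(\<Sum>j\<in>UNIV. \<Sum>k\<in>UNIV. mean_ratio i k / 2 * (energy_coef k j * ?p j)) = (\<Sum>k\<in>UNIV. mean_ratio i k / 2 * limit_energy k t x)"
    unfolding limit_energy_def by (subst sum.swap) (simp only: sum_distrib_left)
  finally show ?thesis .
qed

lemmas hypotheses = T kernel_tail_tendsto gradient_continuous' gradient_periodic'
  heat_sg_gradient_limit[OF sol per C2 less_imp_le[OF T]] limit_energy_continuous limit_energy_periodic limit_energy_eq

lemma g_continuous: "continuous_on ({0..T} \<times> UNIV) (\<lambda>(s, x). g i s x)"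
  by (rule continuous_on_subset[OF g_cont]) auto

lemma grad_energy_bounded:
  obtains C where "0 \<le> C" "\<forall>\<^sub>F n in sequentially. \<forall>i. \<forall>t\<in>{0..T}. \<forall>x\<in>lat n. \<bar>grad_energy n u0 i t x\<bar> \<le> C"
  by (rule grad_energy_eventually_bounded[where w = "\<lambda>i t. partial_deriv i (u t)" and Dbar = limit_energy and J = mean_ratio and T = T and ?u0.0 = u0])
     (rule hypotheses | assumption | simp)+

lemma grad_energy_limit:
  assumes "0 < \<eta>" "0 < t0"
  shows "\<forall>\<^sub>F n in sequentially. \<forall>i. \<forall>t\<in>{t0..T}. \<forall>x\<in>lat n. \<bar>grad_energy n u0 i t x - limit_energy i t x\<bar> \<le> \<eta>"
  by (rule grad_energy_tendsto[where w = "\<lambda>i t. partial_deriv i (u t)" and Dbar = limit_energy and J = mean_ratio and T = T and ?u0.0 = u0])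
     (rule hypotheses assms | simp)+

lemma g_bounded: "\<exists>G\<ge>0. \<forall>t\<in>{0..T}. \<forall>x. \<bar>g i t x\<bar> \<le> G"
proof -
  obtain G where "0 \<le> G" "\<And>t x. t \<in> {0..T} \<Longrightarrow> \<bar>g i t x\<bar> \<le> G"
    using torus_bounded[OF g_continuous[of i]] g_per by auto
  then show ?thesis by blast
qed

lemma lattice_mean_le:
  assumes n: "0 < n" and le: "\<And>x. x \<in> lat n \<Longrightarrow> \<bar>F x\<bar> \<le> (c :: real)"
  shows "\<bar>(1 / real n) ^ CARD('d) * (\<Sum>x\<in>lat n. F (x :: real ^ 'd))\<bar> \<le> c"
proof -
  have "\<bar>\<Sum>x\<in>lat n. F (x :: real ^ 'd)\<bar> \<le> (\<Sum>x\<in>(lat n :: (real ^ 'd) set). c)"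
    by (rule order_trans[OF sum_abs sum_mono]) (rule le)
  also have "\<dots> = real n ^ CARD('d) * c" using n by (simp add: card_lattice)
  finally have "(1 / real n) ^ CARD('d) * \<bar>\<Sum>x\<in>lat n. F (x :: real ^ 'd)\<bar> \<le> (1 / real n) ^ CARD('d) * (real n ^ CARD('d) * c)"
    by (rule mult_left_mono) simp
  also have "\<dots> = c" using n by (simp add: power_one_over)
  finally show ?thesis by (simp add: abs_mult)
qed

lemma energy_mean_pointwise:
  assumes s: "0 < s" "s \<le> T"
  shows "(\<lambda>n. (1 / real n) ^ CARD('d) * (\<Sum>x\<in>lat n. grad_energy n u0 i s x * g i s x))
    \<longlonglongrightarrow> (LINT x:torus_cell|lborel. limit_energy i s x * g i s x)"
proof -
  obtain G where G: "0 \<le> G" "\<And>x. \<bar>g i s x\<bar> \<le> G" using g_bounded[of i] s by auto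
  let ?A = "\<lambda>n. (1 / real n) ^ CARD('d) * (\<Sum>x\<in>lat n. grad_energy n u0 i s x * g i s x)"
  let ?R = "\<lambda>n. (1 / real n) ^ CARD('d) * (\<Sum>x\<in>lat n. limit_energy i s x * g i s x)"
  have sT: "s \<in> {0..T}" using s by simp
  note continuous_on_space_slice[OF limit_energy_continuous[of i] sT]
  moreover note continuous_on_space_slice[OF g_continuous[of i] sT]
  moreover have "torus_fun (\<lambda>x. limit_energy i s x * g i s x)"
    using limit_energy_periodic[of s i] g_per[of s i] s by (simp add: torus_fun_def)
  ultimately have R: "?R \<longlonglongrightarrow> (LINT x:torus_cell|lborel. limit_energy i s x * g i s x)"
    using riemann_sum_tendsto[of "\<lambda>x. limit_energy i s x * g i s x"] by (simp add: continuous_on_mult power_one_over)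
  have "(\<lambda>n. ?A n - ?R n) \<longlonglongrightarrow> 0"
  proof (rule LIMSEQ_I)
    fix r :: real assume r: "0 < r"
    define \<eta> where "\<eta> = r / (2 * (G + 1))"
    have \<eta>: "0 < \<eta>" using r G(1) by (simp add: \<eta>_def)
    have \<eta>G: "\<eta> * G < r"
    proof -
      have "\<eta> * (2 * (G + 1)) = r" using G(1) by (simp add: \<eta>_def)
      moreover have "\<eta> * G < \<eta> * (2 * (G + 1))" using \<eta> G(1) by (intro mult_strict_left_mono) auto
      ultimately show ?thesis by simp
    qed
    have "\<forall>\<^sub>F n in sequentially. norm (?A n - ?R n - 0) < r"
      using grad_energy_limit[OF \<eta> s(1)] eventually_gt_at_top[of 0]
    proof eventually_elim
      case (elim n)
      have "?A n - ?R n = (1 / real n) ^ CARD('d) * (\<Sum>x\<in>lat n. (grad_energy n u0 i s x - limit_energy i s x) * g i s x)"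
        by (simp add: right_diff_distrib[symmetric] sum_subtractf[symmetric] left_diff_distrib[symmetric])
      also have "\<bar>\<dots>\<bar> \<le> \<eta> * G"
      proof (rule lattice_mean_le[OF elim(2)])
        fix x :: "real ^ 'd" assume "x \<in> lat n"
        then have "\<bar>grad_energy n u0 i s x - limit_energy i s x\<bar> \<le> \<eta>" using elim(1) s by simp
        then show "\<bar>(grad_energy n u0 i s x - limit_energy i s x) * g i s x\<bar> \<le> \<eta> * G"
          unfolding abs_mult by (intro mult_mono G(2)) (use \<eta> in auto)
      qed
      finally show ?case using \<eta>G by simp
    qed
    then show "\<exists>no. \<forall>n\<ge>no. norm (?A n - ?R n - 0) < r" by (simp add: eventually_sequentially)
  qed
  from tendsto_add[OF this R] show ?thesis by simp
qed

text \<open>Dominated convergence in time. The energies converge only at positive times, so the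
  single point 0 is discarded, and the a priori bound on the energies provides the majorant.\<close>

lemma energy_integral_tendsto:
  "(\<lambda>n. LINT s:{0..T}|lborel. (1 / real n) ^ CARD('d) * (\<Sum>x\<in>lat n. grad_energy n u0 i s x * g i s x))
    \<longlonglongrightarrow> (LINT s:{0..T}|lborel. LINT x:torus_cell|lborel. limit_energy i s x * g i s x)"
proof -
  let ?A = "\<lambda>n s. (1 / real n) ^ CARD('d) * (\<Sum>x\<in>lat n. grad_energy n u0 i s x * g i s x)"
  let ?L = "\<lambda>s. LINT x:torus_cell|lborel. limit_energy i s x * g i s x"
  obtain G where G: "0 \<le> G" "\<And>s x. s \<in> {0..T} \<Longrightarrow> \<bar>g i s x\<bar> \<le> G" using g_bounded[of i] by auto
  obtain C where C: "0 \<le> C" "\<forall>\<^sub>F n in sequentially. \<forall>i. \<forall>t\<in>{0..T}. \<forall>x\<in>lat n. \<bar>grad_energy n u0 i t x\<bar> \<le> C"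
    by (rule grad_energy_bounded)
  obtain N where N: "\<And>n i t x. N \<le> n \<Longrightarrow> t \<in> {0..T} \<Longrightarrow> x \<in> lat n \<Longrightarrow> \<bar>grad_energy n u0 i t x\<bar> \<le> C"
    using C(2) unfolding eventually_sequentially by blast
  have gc: "continuous_on {0..T} (\<lambda>s. g i s x)" for x
    by (rule continuous_on_time_slice[OF g_continuous])
  have Ac: "continuous_on {0..T} (?A n)" if "0 < n" for n
    by (intro continuous_intros gc grad_energy_continuous that)
  have Lc: "continuous_on {0..T} ?L"
  proof (rule torus_integral_continuous(1))
    show "continuous_on ({0..T} \<times> UNIV) (\<lambda>(t, x). limit_energy i t x * g i t x)"
      using limit_energy_continuous[of i] g_continuous[of i] unfolding case_prod_unfold by (rule continuous_on_mult)
    show "torus_fun (\<lambda>x. limit_energy i t x * g i t x)" if "t \<in> {0..T}" for t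
      using limit_energy_periodic[of t i] g_per[of t i] that by (simp add: torus_fun_def)
  qed
  \<comment> \<open>The index is moved beyond \<open>N\<close>, so that the bound \<open>C\<close>
    holds for every term; \<open>Suc\<close> also excludes the degenerate lattice n = 0.\<close>
  have "(\<lambda>n. LINT s:{0..T}|lborel. ?A (n + Suc N) s) \<longlonglongrightarrow> (LINT s:{0..T}|lborel. ?L s)"
    unfolding set_lebesgue_integral_def[of lborel "{0..T}"]
  proof (rule integral_dominated_convergence[where w = "\<lambda>s. indicator {0..T} s *\<^sub>R (C * G)"])
    show "(\<lambda>s. indicator {0..T} s *\<^sub>R ?L s) \<in> borel_measurable lborel"
      using borel_measurable_continuous_on_indicator[OF _ Lc] by simp
    show "(\<lambda>s. indicator {0..T} s *\<^sub>R ?A (n + Suc N) s) \<in> borel_measurable lborel" for n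
      using borel_measurable_continuous_on_indicator[OF _ Ac[of "n + Suc N"]] by simp
    show "integrable lborel (\<lambda>s. indicator {0..T} s *\<^sub>R (C * G))"
      using borel_integrable_atLeastAtMost'[of 0 T "\<lambda>_. C * G"] unfolding set_integrable_def by simp
    show "AE s in lborel. (\<lambda>n. indicator {0..T} s *\<^sub>R ?A (n + Suc N) s) \<longlonglongrightarrow> indicator {0..T} s *\<^sub>R ?L s"
      using AE_lborel_singleton[of "0 :: real"]
    proof eventually_elim
      case (elim s)
      show ?case
      proof (cases "s \<in> {0..T}")
        case True
        then have s: "0 < s" "s \<le> T" using elim by auto
        show ?thesis by (intro tendsto_scaleR tendsto_const LIMSEQ_ignore_initial_segment energy_mean_pointwise s)
      qed simp
    qed
    show "AE s in lborel. norm (indicator {0..T} s *\<^sub>R ?A (n + Suc N) s) \<le> indicator {0..T} s *\<^sub>R (C * G)" for n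
    proof (intro AE_I2)
      fix s :: real
      show "norm (indicator {0..T} s *\<^sub>R ?A (n + Suc N) s) \<le> indicator {0..T} s *\<^sub>R (C * G)"
      proof (cases "s \<in> {0..T}")
        case True
        have "\<bar>?A (n + Suc N) s\<bar> \<le> C * G"
        proof (rule lattice_mean_le)
          fix x :: "real ^ 'd" assume "x \<in> lat (n + Suc N)"
          then show "\<bar>grad_energy (n + Suc N) u0 i s x * g i s x\<bar> \<le> C * G"
            unfolding abs_mult by (intro mult_mono G(2) N True) (use C(1) in auto)
        qed simp
        then show ?thesis using True by simp
      qed simp
    qed
  qed
  then show ?thesis by (rule LIMSEQ_offset)
qed

lemma Gamma_lim_eq:
  "Gamma_lim g u T = (\<Sum>i\<in>UNIV. LINT s:{0..T}|lborel. LINT x:torus_cell|lborel. limit_energy i s x * g i s x)"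
proof -
  have I: "(LINT s:{0..T}|lborel. LINT x:torus_cell|lborel. limit_energy i s x * g i s x)
      = (\<Sum>j\<in>UNIV. energy_coef i j * (LINT s:{0..T}|lborel. LINT x:torus_cell|lborel. (partial_deriv j (u s) x)\<^sup>2 * g i s x))" for i
  proof -
    have c: "continuous_on ({0..T} \<times> UNIV) (\<lambda>(t, x). (partial_deriv j (u t) x)\<^sup>2 * g i t x)" for j
      using gradient_continuous'[of j] g_continuous[of i] unfolding case_prod_unfold by (intro continuous_on_mult continuous_on_power)
    have p: "torus_fun (\<lambda>x. (partial_deriv j (u t) x)\<^sup>2 * g i t x)" if "t \<in> {0..T}" for j t
      using gradient_periodic'[of t j] g_per[of t i] that by (simp add: torus_fun_def)
    note tc = torus_integral_continuous(1)[OF c p] torus_integral_continuous(2)[OF c p]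
    have "(LINT s:{0..T}|lborel. LINT x:torus_cell|lborel. limit_energy i s x * g i s x)
      = (LINT s:{0..T}|lborel. \<Sum>j\<in>UNIV. energy_coef i j * (LINT x:torus_cell|lborel. (partial_deriv j (u s) x)\<^sup>2 * g i s x))"
    proof (rule set_lebesgue_integral_cong)
      show "\<forall>s. s \<in> {0..T} \<longrightarrow> (LINT x:torus_cell|lborel. limit_energy i s x * g i s x)
        = (\<Sum>j\<in>UNIV. energy_coef i j * (LINT x:torus_cell|lborel. (partial_deriv j (u s) x)\<^sup>2 * g i s x))"
      proof (intro allI impI)
        fix s assume s: "s \<in> {0..T}"
        have "(LINT x:torus_cell|lborel. limit_energy i s x * g i s x)
          = (LINT x:torus_cell|lborel. \<Sum>j\<in>UNIV. energy_coef i j * ((partial_deriv j (u s) x)\<^sup>2 * g i s x))"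
          by (simp add: limit_energy_def sum_distrib_right mult.assoc)
        also have "\<dots> = (\<Sum>j\<in>UNIV. LINT x:torus_cell|lborel. energy_coef i j * ((partial_deriv j (u s) x)\<^sup>2 * g i s x))"
          by (rule set_integral_sum) (use tc(2) s in auto)
        finally show "(LINT x:torus_cell|lborel. limit_energy i s x * g i s x)
          = (\<Sum>j\<in>UNIV. energy_coef i j * (LINT x:torus_cell|lborel. (partial_deriv j (u s) x)\<^sup>2 * g i s x))" by simp
      qed
    qed simp
    also have "\<dots> = (\<Sum>j\<in>UNIV. LINT s:{0..T}|lborel. energy_coef i j * (LINT x:torus_cell|lborel. (partial_deriv j (u s) x)\<^sup>2 * g i s x))"
      by (rule set_integral_sum) (use borel_integrable_atLeastAtMost'[OF tc(1)] in auto)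
    finally show ?thesis by simp
  qed
  show ?thesis unfolding I Gamma_lim_def energy_coef_def by (rule refl)
qed

end

theorem theorem4:
  fixes M :: "'w measure"
    and N :: "real \<Rightarrow> 'd::finite \<Rightarrow> real ^ 'd \<Rightarrow> real \<Rightarrow> 'w \<Rightarrow> nat"
    and U :: "real \<Rightarrow> real \<Rightarrow> real ^ 'd \<Rightarrow> 'w \<Rightarrow> real"
    and g :: "'d \<Rightarrow> real \<Rightarrow> real ^ 'd \<Rightarrow> real"
    and u0 :: "real ^ 'd \<Rightarrow> real"
    and u :: "real \<Rightarrow> real ^ 'd \<Rightarrow> real"
  assumes "prob_space M"
    and "\<And>\<epsilon>. \<epsilon> \<in> mesh_sizes \<Longrightarrow> iid_poisson_clocks M \<epsilon> (N \<epsilon>)"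
    and "\<And>\<epsilon>. \<epsilon> \<in> mesh_sizes \<Longrightarrow> averaging_process M \<epsilon> (N \<epsilon>) u0 (U \<epsilon>)"
    and "\<And>i. continuous_on ({0..} \<times> UNIV) (\<lambda>(s, x). g i s x)"
    and "\<And>i s. 0 \<le> s \<Longrightarrow> torus_fun (g i s)"
    and "torus_fun u0" and "C2_fun u0"
    and "heat_solution u0 u"
  shows "a_const CARD('d) \<in> {0<..1} \<and>
    (\<forall>t>0. ((\<lambda>\<epsilon>. LINT \<omega>|M. Gamma_eps \<epsilon> g (\<lambda>s x. U \<epsilon> s x \<omega>) t) \<longlongrightarrow> Gamma_lim g u t)
              (at 0 within mesh_sizes))"
proof (intro conjI allI impI a_const_bounds)
  fix t :: real assume t: "0 < t"
  let ?A = "\<lambda>n. \<Sum>i\<in>UNIV. LINT s:{0..t}|lborel. (1 / real n) ^ CARD('d) * (\<Sum>x\<in>lat n. grad_energy n u0 i s x * g i s x)"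
  let ?E = "\<lambda>\<epsilon>. LINT \<omega>|M. Gamma_eps \<epsilon> g (\<lambda>s x. U \<epsilon> s x \<omega>) t"
  have mesh: "\<exists>n. 0 < n \<and> \<epsilon> = 1 / real n" if "\<epsilon> \<in> mesh_sizes" for \<epsilon>
  proof -
    from that obtain n where n: "1 / \<epsilon> = real n" "0 < \<epsilon>" unfolding mesh_sizes_def Nats_def by auto
    have "real n \<noteq> 0" unfolding n(1)[symmetric] using n(2) by simp
    moreover have "\<epsilon> = 1 / real n" unfolding n(1)[symmetric] by simp
    ultimately show ?thesis by auto
  qed
  have E: "?E (1 / real n) = ?A n" if mem: "1 / real n \<in> mesh_sizes" and n: "0 < n" for n
  proof -
    \<comment> \<open>A bound on the finite lattice suffices, and it may depend on n: it only
      secures integrability and does not enter the value of the expectation.\<close>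
    have "bounded (u0 ` lat n)" by (intro finite_imp_bounded finite_imageI finite_lattice n)
    then obtain B where B: "\<And>y. y \<in> lat n \<Longrightarrow> \<bar>u0 y\<bar> \<le> B" unfolding bounded_iff by auto
    show ?thesis
      by (rule expectation_Gamma_eps[OF assms(1) n assms(2)[OF mem] assms(3)[OF mem] B assms(4) less_imp_le[OF t]])
  qed
  have lim: "?A \<longlonglongrightarrow> Gamma_lim g u t"
  proof -
    have eq: "Gamma_lim g u t = (\<Sum>i\<in>UNIV. LINT s:{0..t}|lborel. LINT x:torus_cell|lborel. limit_energy u i s x * g i s x)"
      by (rule Gamma_lim_eq[OF assms(8,6,7) t assms(4,5)])
    show ?thesis unfolding eq
      by (intro tendsto_sum energy_integral_tendsto[OF assms(8,6,7) t assms(4,5)])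
  qed
  show "(?E \<longlongrightarrow> Gamma_lim g u t) (at 0 within mesh_sizes)"
    unfolding Lim_within
  proof (intro allI impI)
    fix r :: real assume "0 < r"
    then obtain K where K: "\<And>n. K \<le> n \<Longrightarrow> dist (?A n) (Gamma_lim g u t) < r"
      using lim unfolding lim_sequentially by blast
    have "dist (?E \<epsilon>) (Gamma_lim g u t) < r" if \<epsilon>: "\<epsilon> \<in> mesh_sizes" "dist \<epsilon> 0 < 1 / real (Suc K)" for \<epsilon>
    proof -
      obtain n where n: "0 < n" "\<epsilon> = 1 / real n" using mesh[OF \<epsilon>(1)] by blast
      have "1 / real n < 1 / real (Suc K)" using \<epsilon>(2) n by (simp add: dist_real_def)
      then have "real (Suc K) < real n" using n(1) by (simp add: divide_less_eq less_divide_eq field_simps del: of_nat_Suc)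
      then have "K \<le> n" by linarith
      then show ?thesis using K[of n] E[of n] \<epsilon>(1) n by simp
    qed
    then show "\<exists>d>0. \<forall>\<epsilon>\<in>mesh_sizes. 0 < dist \<epsilon> 0 \<and> dist \<epsilon> 0 < d \<longrightarrow> dist (?E \<epsilon>) (Gamma_lim g u t) < r"
      by (intro exI[of _ "1 / real (Suc K)"]) auto
  qed
qed

end
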